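(* Let $d\ge1$, $\Omega=[0,1]^d$, $k\in\mathbb{Z}_{\ge0}$ and $m\ge0$ with $m<k+\frac12$. Suppose that $$s>(d+1)\left(k-m+\tfrac12\right)+m+\tfrac12 .$$ Then there is a constant $C>0$ depending only on $s,k,m,d$ such that for every $f\in\mathcal{B}^s(\Omega)$ and every integer $n\ge2$, $$\inf_{f_n\in \Sigma^k_{n}}\|f - f_n\|_{H^m(\Omega)} \le C\,\|f\|_{\mathcal{B}^s(\Omega)}\,n^{m-(k+1)}\log(n).$$
   Context: The Fourier transform is $\hat g(\xi)=\int_{\mathbb{R}^d} g(x)e^{-2\pi \mathrm{i}\,\xi\cdot x}\,dx$, and $|\cdot|$ is the Euclidean norm. For $s\ge 0$, the spectral Barron space is $$\mathcal{B}^s(\Omega)=\Big\{f:\Omega\to\mathbb{C}:\ \|f\|_{\mathcal{B}^s(\Omega)}:=\inf_{f_e|_\Omega=f}\int_{\mathbb{R}^d}(1+|\xi|)^s|\hat f_e(\xi)|\,d\xi<\infty\Big\},$$ where the infimum is over extensions $f_e\in L^1(\mathbb{R}^d)$ of $f$. The activation function is $\sigma_k(x)=[\max(0,x)]^k$, with the convention $0^0=0$, so that $\sigma_0$ is the Heaviside function ($0$ for $x\le0$, $1$ for $x>0$). Set $$\Sigma^k_n=\Big\{\sum_{i=1}^n a_i\sigma_k(\omega_i\cdot x+b_i):\ \omega_i\in S^{d-1},\ b_i\in\mathbb{R},\ a_i\in\mathbb{C}\Big\},$$ where $S^{d-1}$ is the unit sphere in $\mathbb{R}^d$. $H^m(\Omega)$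 is the usual $L^2$-based Sobolev space of order $m$ (the fractional, Sobolev–Slobodeckij, space if $m$ is not an integer), with $H^0=L^2$; the norm is $+\infty$ for functions not in $H^m(\Omega)$. Functions are identified when equal almost everywhere. *)

theory Defs
  imports "HOL-Analysis.Analysis"
begin

definition fourier :: "(real^'n \<Rightarrow> complex) \<Rightarrow> real^'n \<Rightarrow> complex" where
  "fourier g \<xi> = (LINT x|lebesgue. g x * exp (- (2 * of_real pi * \<i> * of_real (\<xi> \<bullet> x))))"

text \<open>Functions on \<open>\<Omega>\<close> are represented by functions on the whole space; their values outside
  \<open>\<Omega>\<close> (and on null sets) are irrelevant in all definitions below.\<close>

definition extensions :: "(real^'n) set \<Rightarrow> (real^'n \<Rightarrow> complex) \<Rightarrow> (real^'n \<Rightarrow> complex) set" where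
  "extensions \<Omega> f = {fe. integrable lebesgue fe \<and> (AE x in lebesgue_on \<Omega>. fe x = f x)}"

text \<open>The infimum is taken in the extended nonnegative reals, so it is \<open>top\<close> if there is
  no extension at all.\<close>

definition barron_norm :: "real \<Rightarrow> (real^'n) set \<Rightarrow> (real^'n \<Rightarrow> complex) \<Rightarrow> ennreal" where
  "barron_norm s \<Omega> f =
     (INF fe\<in>extensions \<Omega> f. \<integral>\<^sup>+\<xi>. ennreal ((1 + norm \<xi>) powr s * norm (fourier fe \<xi>)) \<partial>lebesgue)"

definition barron_space :: "real \<Rightarrow> (real^'n) set \<Rightarrow> (real^'n \<Rightarrow> complex) set" where
  "barron_space s \<Omega> = {f. barron_norm s \<Omega> f < top}"

text \<open>The case distinction implements the convention \<open>0\<^sup>0 = 0\<close>; in the library \<open>0 ^ 0 = 1\<close>.\<close>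

definition relu_pow :: "nat \<Rightarrow> real \<Rightarrow> real" where
  "relu_pow k x = (if k = 0 \<and> max 0 x = 0 then 0 else (max 0 x) ^ k)"

definition shallow_nets :: "nat \<Rightarrow> nat \<Rightarrow> (real^'n \<Rightarrow> complex) set" where
  "shallow_nets k n =
     {\<lambda>x. \<Sum>i<n. a i * of_real (relu_pow k (\<omega> i \<bullet> x + b i)) | a \<omega> b.
        \<forall>i<n. \<omega> i \<in> sphere 0 1}"

definition partial_deriv :: "'n \<Rightarrow> (real^'n \<Rightarrow> real) \<Rightarrow> real^'n \<Rightarrow> real" where
  "partial_deriv i \<phi> x = frechet_derivative \<phi> (at x) (axis i 1)"

definition partial_derivs :: "'n list \<Rightarrow> (real^'n \<Rightarrow> real) \<Rightarrow> real^'n \<Rightarrow> real" where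
  "partial_derivs is \<phi> = foldr partial_deriv is \<phi>"

definition test_functions :: "(real^'n) set \<Rightarrow> (real^'n \<Rightarrow> real) set" where
  "test_functions U =
     {\<phi>. (\<forall>is x. partial_derivs is \<phi> differentiable (at x)) \<and>
         (\<exists>K. compact K \<and> K \<subseteq> U \<and> (\<forall>x. x \<notin> K \<longrightarrow> \<phi> x = 0))}"

definition locally_integrable :: "(real^'n) set \<Rightarrow> (real^'n \<Rightarrow> complex) \<Rightarrow> bool" where
  "locally_integrable U u \<longleftrightarrow> (\<forall>K. compact K \<and> K \<subseteq> U \<longrightarrow> integrable (lebesgue_on K) u)"

definition mi_order :: "('n::finite \<Rightarrow> nat) \<Rightarrow> nat" where
  "mi_order \<alpha> = (\<Sum>i\<in>UNIV. \<alpha> i)"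

text \<open>A list \<open>is\<close> in which each \<open>i\<close> occurs \<open>\<alpha> i\<close> times is an order of carrying out
  \<open>\<partial>\<^sup>\<alpha>\<close>; all these orders give the same result on a smooth function.\<close>

definition weak_derivative ::
  "(real^'n) set \<Rightarrow> ('n \<Rightarrow> nat) \<Rightarrow> (real^'n \<Rightarrow> complex) \<Rightarrow> (real^'n \<Rightarrow> complex) \<Rightarrow> bool" where
  "weak_derivative U \<alpha> u g \<longleftrightarrow>
     locally_integrable U u \<and> locally_integrable U g \<and>
     (\<forall>\<phi>\<in>test_functions U. \<forall>is. (\<forall>i. count_list is i = \<alpha> i) \<longrightarrow>
        (LINT x|lebesgue_on U. u x * of_real (partial_derivs is \<phi> x)) =
        (-1) ^ mi_order \<alpha> * (LINT x|lebesgue_on U. g x * of_real (\<phi> x)))"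

definition weak_derivative_families ::
  "nat \<Rightarrow> (real^'n) set \<Rightarrow> (real^'n \<Rightarrow> complex) \<Rightarrow> (('n \<Rightarrow> nat) \<Rightarrow> real^'n \<Rightarrow> complex) set" where
  "weak_derivative_families j \<Omega> f =
     {D. \<forall>\<alpha>. mi_order \<alpha> \<le> j \<longrightarrow> weak_derivative (interior \<Omega>) \<alpha> f (D \<alpha>)}"

definition L2_norm_sq :: "(real^'n) set \<Rightarrow> (real^'n \<Rightarrow> complex) \<Rightarrow> ennreal" where
  "L2_norm_sq \<Omega> g = (\<integral>\<^sup>+x. ennreal ((norm (g x))\<^sup>2) \<partial>lebesgue_on \<Omega>)"

definition slobodeckij_sq :: "real \<Rightarrow> (real^'n) set \<Rightarrow> (real^'n \<Rightarrow> complex) \<Rightarrow> ennreal" where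
  "slobodeckij_sq \<theta> \<Omega> g =
     (\<integral>\<^sup>+x. \<integral>\<^sup>+y. ennreal ((norm (g x - g y))\<^sup>2 / norm (x - y) powr (real CARD('n) + 2 * \<theta>))
        \<partial>lebesgue_on \<Omega> \<partial>lebesgue_on \<Omega>)"

definition ennreal_sqrt :: "ennreal \<Rightarrow> ennreal" where
  "ennreal_sqrt x = (if x = top then top else ennreal (sqrt (enn2real x)))"

text \<open>Weak derivatives on the interior of \<open>\<Omega>\<close> are unique almost everywhere there. Hence, if the
  boundary of \<open>\<Omega>\<close> is a null set, all members of \<open>weak_derivative_families\<close> yield the same value,
  and the infimum merely stands for that value, or for \<open>top\<close> if some weak derivative of order
  at most \<open>\<lfloor>m\<rfloor>\<close> does not exist.\<close>

definition sobolev_norm :: "real \<Rightarrow> (real^'n) set \<Rightarrow> (real^'n \<Rightarrow> complex) \<Rightarrow> ennreal" where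
  "sobolev_norm m \<Omega> f =
     (let j = nat \<lfloor>m\<rfloor>; \<theta> = frac m in
      INF D\<in>weak_derivative_families j \<Omega> f.
        ennreal_sqrt
          ((\<Sum>\<alpha> | mi_order \<alpha> \<le> j. L2_norm_sq \<Omega> (D \<alpha>)) +
           (if \<theta> = 0 then 0 else \<Sum>\<alpha> | mi_order \<alpha> = j. slobodeckij_sq \<theta> \<Omega> (D \<alpha>))))"

lemma finite_mi_order_le: "finite {\<alpha> :: 'n::finite \<Rightarrow> nat. mi_order \<alpha> \<le> j}"
proof (rule finite_subset)
  have "\<alpha> i \<le> j" if "mi_order \<alpha> \<le> j" for \<alpha> :: "'n \<Rightarrow> nat" and i
    using member_le_sum[of i UNIV \<alpha>] that unfolding mi_order_def by simp
  then show "{\<alpha> :: 'n \<Rightarrow> nat. mi_order \<alpha> \<le> j} \<subseteq> (UNIV \<rightarrow>\<^sub>E {..j})"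
    by (simp add: PiE_def subset_iff)
  show "finite ((UNIV :: 'n set) \<rightarrow>\<^sub>E {..j})"
    by (simp add: finite_PiE)
qed

end

theory Submission
  imports Defs "HOL-Probability.Probability"
begin

text \<open>On the unit cube, a Barron function is an absolutely convergent Fourier series with frequencies
  \<open>\<xi>\<close> in the lattice \<open>(1/2)\<int>\<^sup>d\<close>: Fourier inversion writes it as a superposition of exponentials, and each
  exponential is expanded coordinatewise over the lattice with rapidly decaying coefficients. Each
  term is a ridge function, hence an integral over the bias \<open>b\<close> of neurons with direction \<open>\<xi> / \<bar>\<xi>\<bar>\<close> and a
  bounded density. For one direction, cut the range of \<open>b\<close> into cells of length \<open>h\<close>. Inside a cell, replacing
  each neuron by its Lagrange interpolant leaves a remainder supported on a slab of width \<open>h\<close>, so its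
  squared \<open>H\<^sup>m\<close> norm is of order \<open>h powr (2 * (k - m) + 1)\<close>; one sample of the remainder per cell makes the
  errors of different cells uncorrelated. With \<open>q = k + 1 - m\<close>, one direction of mass \<open>A\<close> approximated with \<open>N\<close>
  neurons thus contributes \<open>A\<^sup>2 * N powr (-2 * q)\<close> to the squared error. The condition on \<open>s\<close> permits to
  distribute the \<open>n\<close> neurons over the lattice directions with weights \<open>(1 + \<bar>\<xi>\<bar>) powr (- e)\<close> for some \<open>e > d\<close>, which
  are summable. This yields the rate \<open>n powr (- q)\<close> even without the logarithm. Random choices are
  replaced by greedy ones.\<close>

section \<open>Truncated powers and smooth steps\<close>

text \<open>The requirement on \<open>s\<close> is a budget. The neuron density for a frequency
  \<xi> is a derivative of order k + 1, so its bound A grows like (1 + |\<xi>|)^(k+1). If direction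
  \<xi> carries the weight \<kappa> = (1 + |\<xi>|)^(-e), the squared error closes as soon as the
  sum of A \<kappa>^(1/2 - q) is finite, which costs k + 1 + e (q - 1/2) orders of the Barron
  weight; the hypothesis leaves room for an e > d. The exponent 1/2 - q is the one at which the
  infinitely many directions too light for a cell of their own can be sampled together at the plain
  Monte Carlo rate. Passing to a lattice is what makes stratification possible: it acts on the bias
  alone and needs a discrete set of directions. The bound m < k + 1/2 reflects that derivatives of
  order k of a neuron jump across a hyperplane, and a jump has finite Slobodeckij energy of order
  \<theta> only for \<theta> < 1/2. All estimates concern families of formal derivatives through
  squares of values and differences; that these are weak derivatives is a separate matter, settled
  by difference quotients because truncated powers need not be smooth.\<close>

lemma relu_pow_eq: "relu_pow k t = (if 0 < t then t ^ k else 0)"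
  by (auto simp: relu_pow_def max_def)

lemma relu_pow_measurable [measurable]: "relu_pow k \<in> borel_measurable borel"
proof -
  have "relu_pow k = (\<lambda>t. if 0 < t then t ^ k else 0)"
    by (auto simp: relu_pow_eq)
  then show ?thesis by simp
qed

text \<open>At the kink the difference quotient is at most \<open>\<bar>y\<bar> ^ k\<close> in
  modulus, which tends to 0 only for \<open>k\<close> at least 1; for \<open>k = 0\<close> the point
  0 has to be excluded.\<close>

lemma relu_pow_has_derivative:
  assumes "1 \<le> k \<or> t \<noteq> 0"
  shows "(relu_pow (Suc k) has_real_derivative (real (Suc k) * relu_pow k t)) (at t)"
proof -
  consider "t < 0" | "t > 0" | "t = 0" by linarith
  then show ?thesis
  proof cases
    case 1
    have "((\<lambda>_::real. 0::real) has_real_derivative 0) (at t)" by simp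
    then have "(relu_pow (Suc k) has_real_derivative 0) (at t)"
      using 1 by (rule_tac has_field_derivative_transform_within_open[where S="{..<0}"])
        (auto simp: relu_pow_eq)
    with 1 show ?thesis by (simp add: relu_pow_eq)
  next
    case 2
    have "((\<lambda>s::real. s ^ Suc k) has_real_derivative real (Suc k) * t ^ k) (at t)"
      using DERIV_pow[of "Suc k" t] by simp
    then have "(relu_pow (Suc k) has_real_derivative real (Suc k) * t ^ k) (at t)"
      using 2 by (rule_tac has_field_derivative_transform_within_open[where S="{0<..}"])
        (auto simp: relu_pow_eq)
    with 2 show ?thesis by (simp add: relu_pow_eq)
  next
    case 3
    with assms have k: "k \<ge> 1" by simp
    have "((\<lambda>y. relu_pow (Suc k) y / y) \<longlongrightarrow> 0) (at 0)"
    proof (rule Lim_null_comparison)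
      show "\<forall>\<^sub>F y in at 0. norm (relu_pow (Suc k) y / y) \<le> \<bar>y\<bar> ^ k"
        by (auto simp: relu_pow_eq eventually_at_filter)
      show "((\<lambda>y::real. \<bar>y\<bar> ^ k) \<longlongrightarrow> 0) (at 0)"
        using k by (auto intro!: tendsto_eq_intros)
    qed
    with 3 show ?thesis by (simp add: has_field_derivative_iff relu_pow_eq)
  qed
qed

lemma continuous_on_relu_pow: "continuous_on S (relu_pow (Suc k))"
proof -
  have "relu_pow (Suc k) = (\<lambda>t. max 0 t ^ Suc k)"
    by (auto simp: relu_pow_eq max_def)
  then show ?thesis by (auto intro!: continuous_intros)
qed

text \<open>The \<open>m\<close>-fold backward difference of \<open>t\<^sub>+\<^sup>p / p!\<close>; for \<open>p = m\<close> it is the distribution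
  function of a B-spline.\<close>
fun bspline :: "nat \<Rightarrow> nat \<Rightarrow> real \<Rightarrow> real" where
  "bspline 0 p t = relu_pow p t / fact p"
| "bspline (Suc m) p t = bspline m p t - bspline m p (t - 1)"

lemma bspline_nonpos: "t \<le> 0 \<Longrightarrow> bspline m p t = 0"
  by (induction m arbitrary: t) (auto simp: relu_pow_eq)

text \<open>The exponent drops from \<open>p + 2\<close> to \<open>p + 1\<close> and never to 0,
  because \<open>relu_pow 1\<close> has no derivative at its kink.\<close>

lemma bspline_has_derivative:
  "(bspline m (Suc (Suc p)) has_real_derivative bspline m (Suc p) t) (at t)"
proof (induction m arbitrary: t)
  case 0
  have "((\<lambda>t. relu_pow (Suc (Suc p)) t / fact (Suc (Suc p))) has_real_derivative
      (real (Suc (Suc p)) * relu_pow (Suc p) t) / fact (Suc (Suc p))) (at t)"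
    by (intro DERIV_cdivide relu_pow_has_derivative) simp
  also have "real (Suc (Suc p)) * relu_pow (Suc p) t / fact (Suc (Suc p)) = bspline 0 (Suc p) t"
    by (simp add: field_simps del: of_nat_Suc)
  also have "(\<lambda>t. relu_pow (Suc (Suc p)) t / fact (Suc (Suc p))) = bspline 0 (Suc (Suc p))"
    by (simp add: fun_eq_iff)
  finally show ?case .
next
  case (Suc m)
  have "((\<lambda>t. bspline m (Suc (Suc p)) (t - 1)) has_real_derivative bspline m (Suc p) (t - 1)) (at t)"
    using DERIV_shift[of "bspline m (Suc (Suc p))" "bspline m (Suc p) (t - 1)" t "-1"] Suc[of "t - 1"]
    by simp
  from DERIV_diff[OF Suc[of t] this] show ?case by simp
qed

lemma bspline_continuous: "continuous_on S (bspline m (Suc p))"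
proof (induction m arbitrary: S)
  case 0
  show ?case by (auto intro!: continuous_intros continuous_on_relu_pow)
next
  case (Suc m)
  have "continuous_on S (\<lambda>t. bspline m (Suc p) (t - 1))"
    by (rule continuous_on_compose2[OF Suc[of UNIV]]) (auto intro!: continuous_intros)
  then show ?case by (auto intro!: continuous_intros Suc)
qed

text \<open>This is \<open>bspline\<close> without the truncation: a polynomial, with which
  \<open>bspline m p\<close> agrees to the right of its last knot \<open>m\<close>.\<close>

fun pow_diff :: "nat \<Rightarrow> nat \<Rightarrow> real \<Rightarrow> real" where
  "pow_diff 0 p t = t ^ p / fact p"
| "pow_diff (Suc m) p t = pow_diff m p t - pow_diff m p (t - 1)"

lemma pow_diff_has_derivative:
  "(pow_diff m (Suc p) has_real_derivative pow_diff m p t) (at t)"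
proof (induction m arbitrary: t)
  case 0
  have "((\<lambda>t::real. t ^ Suc p) has_real_derivative (real (Suc p) * t ^ p)) (at t)"
    using DERIV_pow[of "Suc p" t] by simp
  from DERIV_cdivide[OF this, of "fact (Suc p)"]
  have "((\<lambda>t::real. t ^ Suc p / fact (Suc p)) has_real_derivative (real (Suc p) * t ^ p) / fact (Suc p)) (at t)" .
  also have "(real (Suc p) * t ^ p) / fact (Suc p) = pow_diff 0 p t"
    by (simp add: field_simps del: of_nat_Suc)
  also have "(\<lambda>t::real. t ^ Suc p / fact (Suc p)) = pow_diff 0 (Suc p)"
    by (simp add: fun_eq_iff)
  finally show ?case .
next
  case (Suc m)
  have "((\<lambda>t. pow_diff m (Suc p) (t - 1)) has_real_derivative pow_diff m p (t - 1)) (at t)"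
    using DERIV_shift[of "pow_diff m (Suc p)" "pow_diff m p (t - 1)" t "-1"] Suc[of "t - 1"]
    by simp
  from DERIV_diff[OF Suc[of t] this] show ?case by simp
qed

text \<open>Each backward difference lowers the degree by one, so \<open>m\<close> of them
  annihilate the powers below \<open>m\<close> and turn t^m / m! into 1.\<close>

lemma pow_diff_le: "p \<le> m \<Longrightarrow> pow_diff m p t = (if p = m then 1 else 0)"
proof (induction m arbitrary: p t)
  case 0
  then show ?case by simp
next
  case (Suc m)
  show ?case
  proof (cases "p = Suc m")
    case True
    \<comment> \<open>In the top case the inner difference has derivative 1 by the induction
      hypothesis, hence is t plus a constant, and its difference over one unit is 1.\<close>
    have "((\<lambda>t. pow_diff m p t - t) has_real_derivative pow_diff m m s - 1) (at s)" for s
      using pow_diff_has_derivative[of m m s] True by (auto intro!: derivative_eq_intros)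
    then have "((\<lambda>t. pow_diff m p t - t) has_real_derivative 0) (at s)" for s
      using Suc.IH[of m] by simp
    then have "pow_diff m p t - t = pow_diff m p (t - 1) - (t - 1)"
      by (intro DERIV_const_ratio_const2[THEN trans] DERIV_isconst_all) auto
    with True show ?thesis by simp
  next
    case False
    with Suc show ?thesis by auto
  qed
qed

lemma bspline_eq_pow_diff: "real m < t \<Longrightarrow> bspline m p t = pow_diff m p t"
  by (induction m arbitrary: t) (auto simp: relu_pow_eq)

text \<open>Strictly to the right of \<open>m\<close> the polynomial formula applies; the value at
  \<open>m\<close> itself follows by continuity, for which the exponent must be at least 1.\<close>

lemma bspline_ge:
  assumes "real m \<le> t" "Suc p \<le> m"
  shows "bspline m (Suc p) t = (if Suc p = m then 1 else 0)"
proof (rule tendsto_unique[of "at_right t"])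
  have "isCont (bspline m (Suc p)) t"
    using bspline_continuous[of UNIV m p] by (simp add: continuous_on_eq_continuous_at)
  then show "(bspline m (Suc p) \<longlongrightarrow> bspline m (Suc p) t) (at_right t)"
    by (simp add: isCont_def filterlim_at_split)
  have "eventually (\<lambda>s. bspline m (Suc p) s = (if Suc p = m then 1 else 0)) (at_right t)"
    using assms by (auto simp: eventually_at_right_field bspline_eq_pow_diff pow_diff_le intro!: exI[of _ "t + 1"])
  then show "(bspline m (Suc p) \<longlongrightarrow> (if Suc p = m then 1 else 0)) (at_right t)"
    by (rule tendsto_eventually)
qed simp

text \<open>Only \<open>N\<close> derivatives are ever used, so a piecewise polynomial step
  suffices: the integral of a B-spline of degree \<open>N\<close>. Its derivatives are the same
  differences with smaller exponents.\<close>

lemma smooth_step_exists: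
  obtains M :: real and \<eta> :: "nat \<Rightarrow> real \<Rightarrow> real" and B :: real where
    "M > 0" "\<And>l t. l < N \<Longrightarrow> (\<eta> l has_real_derivative \<eta> (Suc l) t) (at t)"
    "\<And>l. l \<le> N \<Longrightarrow> continuous_on UNIV (\<eta> l)"
    "\<And>l t. t \<le> 0 \<Longrightarrow> \<eta> l t = 0"
    "\<And>l t. l \<le> N \<Longrightarrow> M \<le> t \<Longrightarrow> \<eta> l t = (if l = 0 then 1 else 0)"
    "\<And>l t. l \<le> N \<Longrightarrow> \<bar>\<eta> l t\<bar> \<le> B"
proof -
  define \<eta> where "\<eta> l = bspline (Suc N) (Suc N - l)" for l
  have der: "(\<eta> l has_real_derivative \<eta> (Suc l) t) (at t)" if "l < N" for l t
    using bspline_has_derivative[of "Suc N" "N - Suc l" t] that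
    by (simp add: \<eta>_def Suc_diff_le Suc_diff_Suc)
  have cont: "continuous_on S (\<eta> l)" if "l \<le> N" for l S
    using bspline_continuous[of S "Suc N" "N - l"] that by (simp add: \<eta>_def Suc_diff_le)
  have neg: "\<eta> l t = 0" if "t \<le> 0" for l t
    using that by (auto simp: \<eta>_def simp del: bspline.simps intro: bspline_nonpos)
  have ge: "\<eta> l t = (if l = 0 then 1 else 0)" if "l \<le> N" "real (Suc N) \<le> t" for l t
    using bspline_ge[of "Suc N" t "N - l"] that by (auto simp: \<eta>_def Suc_diff_le simp del: bspline.simps)
  have "\<exists>B. \<forall>t. \<bar>\<eta> l t\<bar> \<le> B" if "l \<le> N" for l
  proof -
    have "compact (\<eta> l ` {0..real (Suc N)})"
      by (intro compact_continuous_image cont that) auto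
    then obtain B where B: "\<And>t. t \<in> {0..real (Suc N)} \<Longrightarrow> \<bar>\<eta> l t\<bar> \<le> B"
      by (meson compact_imp_bounded bounded_real imageI)
    have "\<bar>\<eta> l t\<bar> \<le> max 1 B" for t
    proof -
      consider "t \<le> 0" | "real (Suc N) \<le> t" | "t \<in> {0..real (Suc N)}" by fastforce
      then show ?thesis using neg[of t l] ge[OF that, of t] B[of t] by cases auto
    qed
    then show ?thesis by blast
  qed
  then obtain B where B: "\<And>l t. l \<le> N \<Longrightarrow> \<bar>\<eta> l t\<bar> \<le> B l" by metis
  have "\<bar>\<eta> l t\<bar> \<le> (\<Sum>l\<le>N. B l)" if "l \<le> N" for l t
  proof -
    have "B i \<ge> 0" if "i \<le> N" for i using B[OF that, of 0] by linarith
    then have "B l \<le> (\<Sum>l\<le>N. B l)" using that by (intro member_le_sum) auto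
    with B[OF that, of t] show ?thesis by linarith
  qed
  then show ?thesis
    using that[of "real (Suc N)" \<eta> "\<Sum>l\<le>N. B l"] der cont neg ge by auto
qed

section \<open>Ridge functions as superpositions of neurons\<close>

text \<open>For \<open>E t = exp (\<mu> t)\<close>, the \<open>i\<close>-th derivative of \<open>g 0 * E\<close> is \<open>(exp_shift \<mu> ^^ i) g 0 * E\<close>
  whenever \<open>g (Suc l)\<close> is the derivative of \<open>g l\<close>.\<close>
definition exp_shift :: "complex \<Rightarrow> (nat \<Rightarrow> real \<Rightarrow> complex) \<Rightarrow> nat \<Rightarrow> real \<Rightarrow> complex" where
  "exp_shift \<mu> g l t = g (Suc l) t + \<mu> * g l t"

text \<open>All four properties go through one induction, since each shift needs the functions of
  index \<open>l\<close> and \<open>l + 1\<close>; the budget \<open>l + i \<le> N\<close> keeps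
  both available. A shift costs one derivative and a factor \<open>1 + norm \<mu>\<close> in the
  bound.\<close>

lemma exp_shift_iterate:
  fixes g :: "nat \<Rightarrow> real \<Rightarrow> complex"
  assumes "\<And>l t. l < N \<Longrightarrow> (g l has_vector_derivative g (Suc l) t) (at t)"
    and "\<And>l. l \<le> N \<Longrightarrow> continuous_on UNIV (g l)"
    and "\<And>l t. l \<le> N \<Longrightarrow> t \<le> a \<Longrightarrow> g l t = 0"
    and "\<And>l t. l \<le> N \<Longrightarrow> norm (g l t) \<le> B"
  shows "l + i < N \<Longrightarrow>
      ((exp_shift \<mu> ^^ i) g l has_vector_derivative (exp_shift \<mu> ^^ i) g (Suc l) t) (at t)"
    and "l + i \<le> N \<Longrightarrow> continuous_on UNIV ((exp_shift \<mu> ^^ i) g l)"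
    and "l + i \<le> N \<Longrightarrow> t \<le> a \<Longrightarrow> (exp_shift \<mu> ^^ i) g l t = 0"
    and "l + i \<le> N \<Longrightarrow> norm ((exp_shift \<mu> ^^ i) g l t) \<le> (1 + norm \<mu>) ^ i * B"
proof (induction i arbitrary: l t)
  case 0
  { case 1 then show ?case using assms by simp }
  { case 2 then show ?case using assms by simp }
  { case 3 then show ?case using assms by simp }
  { case 4 then show ?case using assms by simp }
next
  case (Suc i)
  let ?h = "(exp_shift \<mu> ^^ i) g"
  have eq: "(exp_shift \<mu> ^^ Suc i) g l = (\<lambda>t. ?h (Suc l) t + \<mu> * ?h l t)" for l
    by (simp add: exp_shift_def fun_eq_iff)
  { case 1
    then show ?case unfolding eq
      by (intro has_vector_derivative_add has_vector_derivative_mult_right Suc.IH(1)) auto }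
  { case 2
    then show ?case unfolding eq by (intro continuous_intros Suc.IH(2)) auto }
  { case 3
    then show ?case unfolding eq using Suc.IH(3)[of "Suc l" t] Suc.IH(3)[of l t] by simp }
  { case 4
    have "norm (?h (Suc l) t + \<mu> * ?h l t) \<le> norm (?h (Suc l) t) + norm \<mu> * norm (?h l t)"
      by (metis norm_triangle_ineq norm_mult)
    also have "\<dots> \<le> (1 + norm \<mu>) ^ i * B + norm \<mu> * ((1 + norm \<mu>) ^ i * B)"
      using 4 by (intro add_mono mult_left_mono Suc.IH(4)) auto
    finally show ?case unfolding eq by (simp add: algebra_simps) }
qed

text \<open>Multiply the exponential by a smooth step that vanishes left of \<open>a\<close> and is
  1 on [-R, R]. Taylor's formula at \<open>a\<close> then has no polynomial part, and its integral
  remainder is a superposition of truncated powers of t - b, with density the derivative of order k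
  + 1 divided by k!. Each derivative costs a factor of order \<open>1 + \<tau>\<close>, while
  \<open>L\<close> and \<open>C\<close> do not depend on \<tau>.\<close>

lemma ridge_representation:
  fixes R :: real
  assumes "R > 0"
  obtains L C :: real where "L \<ge> R" "C > 0"
    "\<And>\<tau>. \<tau> \<ge> 0 \<Longrightarrow> \<exists>\<rho>\<in>borel_measurable borel.
       (\<forall>b. norm (\<rho> b) \<le> C * (1 + \<tau>) ^ Suc k) \<and> (\<forall>b. \<bar>b\<bar> > L \<longrightarrow> \<rho> b = 0) \<and>
       (\<forall>t. \<bar>t\<bar> \<le> R \<longrightarrow> (LINT b|lborel. \<rho> b * complex_of_real (relu_pow k (t - b))) =
          exp (2 * of_real pi * \<i> * of_real (\<tau> * t)))"
proof -
  obtain M \<eta> B where M: "M > 0"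
    and der: "\<And>l t. l < Suc k \<Longrightarrow> (\<eta> l has_real_derivative \<eta> (Suc l) t) (at t)"
    and cont: "\<And>l. l \<le> Suc k \<Longrightarrow> continuous_on UNIV (\<eta> l)"
    and neg: "\<And>l t. t \<le> 0 \<Longrightarrow> \<eta> l t = 0"
    and ge: "\<And>l t. l \<le> Suc k \<Longrightarrow> M \<le> t \<Longrightarrow> \<eta> l t = (if l = 0 then 1 else 0)"
    and bnd: "\<And>l t. l \<le> Suc k \<Longrightarrow> \<bar>\<eta> l t\<bar> \<le> B"
    using smooth_step_exists[of "Suc k"] by blast
  \<comment> \<open>The step rises over [a, a + M] = [-R - M, -R], so it equals 1 on
    [-R, R].\<close>
  define a where "a = - R - M"
  have B: "B \<ge> 1" using bnd[of 0 M] ge[of 0 M] by simp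
  define g where "g l t = complex_of_real (\<eta> l (t - a))" for l t
  have g_der: "(g l has_vector_derivative g (Suc l) t) (at t)" if "l < Suc k" for l t
  proof -
    have "((\<lambda>t. \<eta> l (t - a)) has_real_derivative \<eta> (Suc l) (t - a)) (at t)"
      using DERIV_shift[of "\<eta> l" "\<eta> (Suc l) (t - a)" t "-a"] der[OF that, of "t - a"] by simp
    then show ?thesis unfolding g_def
      by (intro has_vector_derivative_of_real) (simp add: has_real_derivative_iff_has_vector_derivative)
  qed
  have g_cont: "continuous_on UNIV (g l)" if "l \<le> Suc k" for l
    unfolding g_def
    by (intro continuous_intros continuous_on_compose2[OF cont[OF that]]) auto
  have g_neg: "g l t = 0" if "t \<le> a" for l t using that neg by (simp add: g_def)
  have g_bnd: "norm (g l t) \<le> B" if "l \<le> Suc k" for l t using bnd[OF that] by (simp add: g_def)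
  note it = exp_shift_iterate[of "Suc k" g a B, OF g_der g_cont g_neg g_bnd]
  define C where "C = (1 + 2 * pi) ^ Suc k * B / fact k"
  show ?thesis
  proof (rule that[of "R + M" C])
    show "R + M \<ge> R" using M by simp
    show "C > 0" using B add_pos_pos[OF zero_less_one, of "2 * pi"]
      by (auto simp: C_def intro!: divide_pos_pos mult_pos_pos zero_less_power)
    fix \<tau> :: real assume \<tau>: "\<tau> \<ge> 0"
    define \<mu> where "\<mu> = 2 * of_real pi * \<i> * complex_of_real \<tau>"
    have norm_\<mu>: "norm \<mu> = 2 * pi * \<tau>" using \<tau> by (simp add: \<mu>_def norm_mult)
    define D where "D i t = (exp_shift \<mu> ^^ i) g 0 t * exp (\<mu> * of_real t)" for i t
    have D_cont: "continuous_on S (D i)" if "i \<le> Suc k" for i S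
      unfolding D_def using continuous_on_subset[OF it(2)[of 0 i \<mu>]] that
      by (intro continuous_intros) auto
    have E_der: "((\<lambda>t. exp (\<mu> * of_real t)) has_vector_derivative \<mu> * exp (\<mu> * of_real t)) (at t)" for t
    proof -
      have "((\<lambda>z. exp (\<mu> * z)) has_field_derivative exp (\<mu> * of_real t) * \<mu>) (at (of_real t))"
        by (auto intro!: derivative_eq_intros)
      from has_vector_derivative_real_field[OF this] show ?thesis by (simp add: mult.commute)
    qed
    have D_der: "(D i has_vector_derivative D (Suc i) t) (at t)" if "i < Suc k" for i t
      unfolding D_def
      using has_vector_derivative_mult[OF it(1)[of 0 i \<mu> t] E_der[of t]] that
      by (simp add: exp_shift_def algebra_simps)
    have E_norm: "norm (exp (\<mu> * of_real t)) = 1" for t by (simp add: \<mu>_def)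
    \<comment> \<open>Biases beyond \<open>R\<close> do not act on arguments
      \<open>t \<le> R\<close>, so the density may be cut off there, which makes its support
      compact.\<close>
    define \<rho> where "\<rho> b = indicator {a..R} b * (D (Suc k) b / fact k)" for b
    have [measurable]: "D (Suc k) \<in> borel_measurable borel"
      using D_cont by (intro borel_measurable_continuous_onI) auto
    have 1: "\<rho> \<in> borel_measurable borel" unfolding \<rho>_def by measurable
    have 2: "norm (\<rho> b) \<le> C * (1 + \<tau>) ^ Suc k" for b
    proof -
      have "norm (D (Suc k) b) \<le> (1 + norm \<mu>) ^ Suc k * B"
        using it(4)[of 0 "Suc k" \<mu> b] by (simp add: D_def norm_mult E_norm del: funpow.simps norm_exp_eq_Re)
      also have "\<dots> \<le> ((1 + 2 * pi) * (1 + \<tau>)) ^ Suc k * B"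
        using B \<tau> pi_gt_zero by (intro mult_right_mono power_mono) (auto simp: norm_\<mu> algebra_simps)
      finally have "norm (D (Suc k) b) / fact k \<le> ((1 + 2 * pi) * (1 + \<tau>)) ^ Suc k * B / fact k"
        by (rule divide_right_mono) simp
      then have "norm (D (Suc k) b) / fact k \<le> C * (1 + \<tau>) ^ Suc k"
        by (simp add: C_def power_mult_distrib mult_ac del: power_Suc)
      moreover have "norm (\<rho> b) \<le> norm (D (Suc k) b) / fact k"
        by (auto simp: \<rho>_def norm_mult norm_divide indicator_def)
      ultimately show ?thesis by linarith
    qed
    have 3: "\<rho> b = 0" if "\<bar>b\<bar> > R + M" for b
      using that assms M by (auto simp: \<rho>_def a_def indicator_def)
    have 4: "(LINT b|lborel. \<rho> b * complex_of_real (relu_pow k (t - b))) =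
        exp (2 * of_real pi * \<i> * of_real (\<tau> * t))" if t: "\<bar>t\<bar> \<le> R" for t
    proof -
      have at: "a \<le> t" using t M by (simp add: a_def)
      let ?i = "\<lambda>b. ((t - b) ^ k / fact k) *\<^sub>R D (Suc k) b"
      have i_int: "set_integrable lborel {a..t} ?i"
        by (intro borel_integrable_atLeastAtMost' continuous_intros D_cont) auto
      have "D 0 t = (\<Sum>i<Suc k. ((t - a) ^ i / fact i) *\<^sub>R D i a) + integral {a..t} (\<lambda>b. ((t - b) ^ (Suc k - 1) / fact (Suc k - 1)) *\<^sub>R D (Suc k) b)"
        by (rule Taylor_integral) (use D_der at in \<open>auto intro: has_vector_derivative_at_within\<close>)
      also have "(\<Sum>i<Suc k. ((t - a) ^ i / fact i) *\<^sub>R D i a) = 0"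
        using it(3)[of 0 _ a \<mu>] by (intro sum.neutral) (auto simp: D_def)
      also have "integral {a..t} (\<lambda>b. ((t - b) ^ (Suc k - 1) / fact (Suc k - 1)) *\<^sub>R D (Suc k) b) = (LINT b:{a..t}|lborel. ?i b)"
        using set_borel_integral_eq_integral(2)[OF i_int] by simp
      also have "\<dots> = (LINT b|lborel. \<rho> b * complex_of_real (relu_pow k (t - b)))"
        unfolding set_lebesgue_integral_def
      proof (rule integral_cong_AE)
        \<comment> \<open>For \<open>k = 0\<close> the integrands differ at \<open>b = t\<close>:
          there (t - b)^0 is 1 but \<open>relu_pow 0 0\<close> is 0. A single point has measure
          zero.\<close>
        have "AE b in lborel. b \<noteq> t" by (rule AE_lborel_singleton)
        then show "AE b in lborel. indicator {a..t} b *\<^sub>R ?i b = \<rho> b * complex_of_real (relu_pow k (t - b))"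
          by eventually_elim (use t in \<open>auto simp: \<rho>_def indicator_def relu_pow_eq scaleR_conv_of_real\<close>)
      qed (use 1 in \<open>measurable\<close>)
      also have "D 0 t = exp (2 * of_real pi * \<i> * of_real (\<tau> * t))"
        using ge[of 0 "t - a"] t by (simp add: D_def g_def a_def \<mu>_def mult.assoc)
      finally show ?thesis by simp
    qed
    show "\<exists>\<rho>\<in>borel_measurable borel.
       (\<forall>b. norm (\<rho> b) \<le> C * (1 + \<tau>) ^ Suc k) \<and> (\<forall>b. \<bar>b\<bar> > R + M \<longrightarrow> \<rho> b = 0) \<and>
       (\<forall>t. \<bar>t\<bar> \<le> R \<longrightarrow> (LINT b|lborel. \<rho> b * complex_of_real (relu_pow k (t - b))) =
          exp (2 * of_real pi * \<i> * of_real (\<tau> * t)))"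
      using 1 2 3 4 by blast
  qed
qed

section \<open>Fourier series of cut-off exponentials\<close>

text \<open>The character of index \<open>l\<close> and period 2, centred at \<open>x0\<close>:
  every character is then 1 at \<open>x0\<close>, and the Fourier partial sum at \<open>x0\<close>
  is the plain sum of the coefficients.\<close>

definition circ :: "real \<Rightarrow> int \<Rightarrow> real \<Rightarrow> complex" where
  "circ x0 l x = exp (of_real pi * \<i> * of_int l * of_real (x - x0))"

lemma circ_continuous [continuous_intros]: "continuous_on S (circ x0 l)"
  unfolding circ_def by (intro continuous_intros)

lemma circ_mult: "circ x0 l x * circ x0 m x = circ x0 (l + m) x"
  by (simp add: circ_def exp_add[symmetric] algebra_simps)

lemma cnj_circ: "cnj (circ x0 l x) = circ x0 (- l) x"
  by (simp add: circ_def exp_cnj)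

lemma integral_circ: "((circ x0 l) has_integral (if l = 0 then 2 else 0)) {a..a + 2}"
proof (cases "l = 0")
  case True
  have "((\<lambda>x::real. 1::complex) has_integral 2) {a..a+2}"
    using has_integral_const_real[of "1::complex" a "a + 2"] by (simp add: scaleR_conv_of_real)
  with True show ?thesis by (simp add: fun_eq_iff circ_def[abs_def])
next
  case False
  let ?c = "of_real pi * \<i> * of_int l :: complex"
  have c: "?c \<noteq> 0" using False by simp
  have der: "((\<lambda>x. circ x0 l x / ?c) has_vector_derivative circ x0 l x) (at x within {a..a+2})" for x
  proof -
    have "((\<lambda>z. exp (?c * (z - of_real x0)) / ?c) has_field_derivative exp (?c * (of_real x - of_real x0)))
        (at (of_real x))"
      using c by (auto intro!: derivative_eq_intros)
    from has_vector_derivative_real_field[OF this] show ?thesis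
      by (auto simp: circ_def has_vector_derivative_at_within)
  qed
  have "circ x0 l (a + 2) = circ x0 l a * exp (2 * of_real pi * \<i> * of_int l)"
  proof -
    have "of_real pi * \<i> * of_int l * of_real (a + 2 - x0) =
        of_real pi * \<i> * of_int l * of_real (a - x0) + 2 * of_real pi * \<i> * of_int l"
      by (simp add: algebra_simps)
    then show ?thesis unfolding circ_def by (simp only: exp_add)
  qed
  also have "exp (2 * of_real pi * \<i> * of_int l) = (1::complex)"
    by (simp add: exp_eq_1)
  finally have "circ x0 l (a + 2) = circ x0 l a" by simp
  with fundamental_theorem_of_calculus[of a "a + 2" "\<lambda>x. circ x0 l x / ?c" "circ x0 l", OF _ der]
  show ?thesis using False by simp
qed

text \<open>The residual after projecting on the characters in \<open>L\<close> is orthogonal to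
  them, so its squared norm is that of \<open>v\<close> minus twice the sum. The factor 2 is the
  length of the period and is given up at the end.\<close>

lemma bessel_inequality:
  fixes v :: "real \<Rightarrow> complex" and x0 :: real
  assumes v: "continuous_on {a..a + 2} v" and L: "finite L"
  defines "w \<equiv> \<lambda>l. integral {a..a + 2} (\<lambda>x. v x * circ x0 (- l) x) / 2"
  shows "(\<Sum>l\<in>L. (norm (w l))\<^sup>2) \<le> integral {a..a + 2} (\<lambda>x. (norm (v x))\<^sup>2)"
proof -
  let ?I = "\<lambda>f. integral {a..a+2} f"
  note [continuous_intros] = v
  have int: "continuous_on {a..a+2} f \<Longrightarrow> f integrable_on {a..a+2}" for f :: "real \<Rightarrow> complex"
    by (rule integrable_continuous_interval)
  have isum: "?I (\<lambda>x. \<Sum>l\<in>L. c l * g l x) = (\<Sum>l\<in>L. c l * ?I (g l))"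
    if "\<And>l. continuous_on {a..a+2} (g l)" for c and g :: "int \<Rightarrow> real \<Rightarrow> complex"
    using L that by (subst integral_sum) (auto intro!: int continuous_intros)
  have iv: "?I (\<lambda>x. v x * circ x0 (- l) x) = 2 * w l" for l by (simp add: w_def)
  define r where "r x = v x - (\<Sum>l\<in>L. w l * circ x0 l x)" for x
  have r_cont [continuous_intros]: "continuous_on {a..a+2} r"
    unfolding r_def by (intro continuous_intros)
  have orth: "?I (\<lambda>x. r x * circ x0 (- l) x) = 0" if "l \<in> L" for l
  proof -
    have "?I (\<lambda>x. r x * circ x0 (- l) x) =
       ?I (\<lambda>x. v x * circ x0 (- l) x - (\<Sum>m\<in>L. w m * circ x0 (m - l) x))"
      by (intro integral_cong) (simp add: r_def algebra_simps sum_distrib_left circ_mult)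
    also have "\<dots> = ?I (\<lambda>x. v x * circ x0 (- l) x) - (\<Sum>m\<in>L. w m * ?I (circ x0 (m - l)))"
      by (subst integral_diff) (auto intro!: int continuous_intros simp: isum[of "\<lambda>m. circ x0 (m - l)" w, OF circ_continuous])
    also have "(\<Sum>m\<in>L. w m * ?I (circ x0 (m - l))) = (\<Sum>m\<in>L. if m = l then 2 * w l else 0)"
      by (intro sum.cong) (auto simp: integral_unique[OF integral_circ])
    also have "\<dots> = 2 * w l" using L that by simp
    finally show ?thesis by (simp add: iv)
  qed
  have "?I (\<lambda>x. r x * cnj (r x)) = ?I (\<lambda>x. r x * cnj (v x) - (\<Sum>l\<in>L. cnj (w l) * (r x * circ x0 (- l) x)))"
  proof (intro integral_cong)
    fix x
    have "cnj (r x) = cnj (v x) - (\<Sum>l\<in>L. cnj (w l) * circ x0 (- l) x)"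
      by (simp add: r_def cnj_circ)
    then show "r x * cnj (r x) = r x * cnj (v x) - (\<Sum>l\<in>L. cnj (w l) * (r x * circ x0 (- l) x))"
      by (simp add: right_diff_distrib sum_distrib_left mult_ac)
  qed
  also have "\<dots> = ?I (\<lambda>x. r x * cnj (v x)) - (\<Sum>l\<in>L. cnj (w l) * ?I (\<lambda>x. r x * circ x0 (- l) x))"
    by (subst integral_diff) (auto intro!: int continuous_intros
        simp: isum[of "\<lambda>l x. r x * circ x0 (- l) x" "\<lambda>l. cnj (w l)", OF continuous_on_mult[OF r_cont circ_continuous]])
  also have "\<dots> = ?I (\<lambda>x. r x * cnj (v x))" using orth by simp
  also have "\<dots> = ?I (\<lambda>x. v x * cnj (v x) - (\<Sum>l\<in>L. w l * cnj (v x * circ x0 (- l) x)))"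
    by (intro integral_cong) (simp add: r_def algebra_simps sum_distrib_left cnj_circ)
  also have "\<dots> = ?I (\<lambda>x. v x * cnj (v x)) - ?I (\<lambda>x. \<Sum>l\<in>L. w l * cnj (v x * circ x0 (- l) x))"
    by (rule integral_diff) (auto intro!: int continuous_intros)
  also have "?I (\<lambda>x. \<Sum>l\<in>L. w l * cnj (v x * circ x0 (- l) x)) = (\<Sum>l\<in>L. w l * ?I (\<lambda>x. cnj (v x * circ x0 (- l) x)))"
    by (rule isum) (intro continuous_intros)
  also have "(\<Sum>l\<in>L. w l * ?I (\<lambda>x. cnj (v x * circ x0 (- l) x))) = (\<Sum>l\<in>L. w l * cnj (2 * w l))"
    by (simp only: Henstock_Kurzweil_Integration.integral_cnj[symmetric] iv)
  finally have eq: "?I (\<lambda>x. r x * cnj (r x)) = ?I (\<lambda>x. v x * cnj (v x)) - (\<Sum>l\<in>L. w l * cnj (2 * w l))" .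
  have re: "?I (\<lambda>x. f x * cnj (f x)) = of_real (?I (\<lambda>x. (norm (f x))\<^sup>2))" if "continuous_on {a..a+2} f" for f :: "real \<Rightarrow> complex"
    unfolding complex_norm_square[symmetric] using that
    by (intro integral_unique has_integral_of_real integrable_integral)
      (auto intro!: integrable_continuous_interval continuous_intros)
  have "w l * cnj (2 * w l) = of_real (2 * (norm (w l))\<^sup>2)" for l
  proof -
    have "w l * cnj (2 * w l) = 2 * (w l * cnj (w l))" by simp
    also have "\<dots> = 2 * of_real ((norm (w l))\<^sup>2)" by (simp only: complex_norm_square)
    finally show ?thesis by simp
  qed
  then have "(\<Sum>l\<in>L. w l * cnj (2 * w l)) = of_real (2 * (\<Sum>l\<in>L. (norm (w l))\<^sup>2))"
    by (simp only: sum_distrib_left of_real_sum)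
  with eq have "complex_of_real (?I (\<lambda>x. (norm (r x))\<^sup>2)) = of_real (?I (\<lambda>x. (norm (v x))\<^sup>2) - 2 * (\<Sum>l\<in>L. (norm (w l))\<^sup>2))"
    by (simp only: re[OF v] re[OF r_cont] of_real_diff)
  then have "?I (\<lambda>x. (norm (r x))\<^sup>2) = ?I (\<lambda>x. (norm (v x))\<^sup>2) - 2 * (\<Sum>l\<in>L. (norm (w l))\<^sup>2)"
    by (simp only: of_real_eq_iff)
  moreover have "?I (\<lambda>x. (norm (r x))\<^sup>2) \<ge> 0" by (intro integral_nonneg) (auto intro!: integrable_continuous_interval continuous_intros)
  moreover have "(\<Sum>l\<in>L. (norm (w l))\<^sup>2) \<ge> 0" by (intro sum_nonneg) auto
  ultimately show ?thesis by linarith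
qed

lemma exp_cmult_has_vector_derivative:
  "((\<lambda>x. exp (c * complex_of_real x)) has_vector_derivative c * exp (c * of_real x)) (at x)"
proof -
  have "((\<lambda>z. exp (c * z)) has_field_derivative exp (c * of_real x) * c) (at (of_real x))"
    by (auto intro!: derivative_eq_intros)
  from has_vector_derivative_real_field[OF this] show ?thesis by (simp add: mult.commute)
qed

text \<open>Chernoff's proof: dividing by \<open>circ x0 1 - 1\<close> turns the partial sums into telescoping sums.\<close>
lemma fourier_series_tendsto:
  fixes u :: "real \<Rightarrow> complex"
  assumes u: "continuous_on {a..a + 2} u" and x0: "a < x0" "x0 < a + 2"
    and du: "(u has_vector_derivative u') (at x0)"
  shows "(\<lambda>N. \<Sum>l=-int N..int N. integral {a..a + 2} (\<lambda>x. u x * circ x0 (- l) x) / 2) \<longlonglongrightarrow> u x0"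
proof -
  define z where "z x = circ x0 1 x - 1" for x
  have z_eq: "z x = exp (of_real pi * \<i> * of_real (x - x0)) - 1" for x by (simp add: z_def circ_def)
  have z0: "z x \<noteq> 0" if "x \<in> {a..a+2}" "x \<noteq> x0" for x
  proof
    assume "z x = 0"
    then have "exp (of_real pi * \<i> * of_real (x - x0)) = 1" by (simp add: z_eq)
    then obtain n :: int where "pi * (x - x0) = of_int (2 * n) * pi"
      by (auto simp: exp_eq_1)
    then have n: "x - x0 = 2 * of_int n" by (simp add: mult.commute)
    then have "\<bar>2 * real_of_int n\<bar> < 2" using that x0 by auto
    then have "n = 0" by auto
    with n that show False by simp
  qed
  have z_cont [continuous_intros]: "continuous_on S z" for S unfolding z_def by (intro continuous_intros)
  \<comment> \<open>The value at \<open>x0\<close> is the limit of the quotient, since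
    \<open>u'\<close> and \<open>of_real pi * \<i>\<close> are the derivatives of numerator and
    denominator. This makes \<open>v\<close> continuous on the whole interval, so that Bessel's
    inequality applies to it.\<close>
  define v where "v x = (if x = x0 then u' / (of_real pi * \<i>) else (u x - u x0) / z x)" for x
  have dz: "(z has_vector_derivative of_real pi * \<i>) (at x0)"
  proof -
    have "((\<lambda>y. exp (of_real pi * \<i> * (y - of_real x0)) - 1) has_field_derivative of_real pi * \<i>) (at (of_real x0))"
      by (auto intro!: derivative_eq_intros)
    from has_vector_derivative_real_field[OF this] show ?thesis by (simp add: z_eq[abs_def])
  qed
  have z_x0: "z x0 = 0" by (simp add: z_eq)
  have lim: "(v \<longlongrightarrow> v x0) (at x0)"
  proof -
    have quot: "((\<lambda>x. (f x - f x0) /\<^sub>R (x - x0)) \<longlongrightarrow> f') (at x0)"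
      if "(f has_vector_derivative f') (at x0)" for f :: "real \<Rightarrow> complex" and f'
    proof -
      have "((\<lambda>h. (f (x0 + h) - f x0 - h *\<^sub>R f') /\<^sub>R \<bar>h\<bar>) \<longlongrightarrow> 0) (at 0)"
        using that by (rule_tac tendsto_norm_zero_cancel) (simp add: has_vector_derivative_def has_derivative_at divide_inverse mult.commute)
      then have "((\<lambda>h. norm ((f (x0 + h) - f x0 - h *\<^sub>R f') /\<^sub>R \<bar>h\<bar>)) \<longlongrightarrow> 0) (at 0)"
        by (rule tendsto_norm_zero)
      moreover have "\<forall>\<^sub>F h in at 0. norm ((f (x0 + h) - f x0 - h *\<^sub>R f') /\<^sub>R \<bar>h\<bar>) = norm ((f (x0 + h) - f x0) /\<^sub>R h - f')"
      proof -
        have "norm ((f (x0 + h) - f x0 - h *\<^sub>R f') /\<^sub>R \<bar>h\<bar>) = norm ((f (x0 + h) - f x0) /\<^sub>R h - f')" if "h \<noteq> 0" for h :: real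
        proof -
          have "(f (x0 + h) - f x0) /\<^sub>R h - f' = (f (x0 + h) - f x0 - h *\<^sub>R f') /\<^sub>R h"
            using that by (simp add: scaleR_diff_right)
          then show ?thesis by simp
        qed
        then show ?thesis by (auto simp: eventually_at_filter)
      qed
      ultimately have "((\<lambda>h. norm ((f (x0 + h) - f x0) /\<^sub>R h - f')) \<longlongrightarrow> 0) (at 0)"
        by (rule Lim_transform_eventually)
      then have "((\<lambda>h. (f (x0 + h) - f x0) /\<^sub>R h) \<longlongrightarrow> f') (at 0)"
        by (simp add: tendsto_norm_zero_iff LIM_zero_iff)
      then show ?thesis by (subst LIM_offset_zero_iff[of x0]) auto
    qed
    have 1: "((\<lambda>x. (u x - u x0) /\<^sub>R (x - x0)) \<longlongrightarrow> u') (at x0)"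
      by (rule quot[OF du])
    have 2: "((\<lambda>x. (z x - z x0) /\<^sub>R (x - x0)) \<longlongrightarrow> of_real pi * \<i>) (at x0)"
      by (rule quot[OF dz])
    have "((\<lambda>x. ((u x - u x0) /\<^sub>R (x - x0)) / ((z x - z x0) /\<^sub>R (x - x0))) \<longlongrightarrow> u' / (of_real pi * \<i>)) (at x0)"
      by (intro tendsto_divide 1 2) auto
    moreover have "\<forall>\<^sub>F x in at x0. ((u x - u x0) /\<^sub>R (x - x0)) / ((z x - z x0) /\<^sub>R (x - x0)) = v x"
      by (auto simp: eventually_at_filter v_def z_x0 scaleR_conv_of_real divide_simps)
    ultimately have "(v \<longlongrightarrow> u' / (of_real pi * \<i>)) (at x0)"
      using Lim_transform_eventually by blast
    then show ?thesis by (simp add: v_def)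
  qed
  have v_cont: "continuous_on {a..a+2} v"
    unfolding continuous_on_eq_continuous_within
  proof
    fix x assume x: "x \<in> {a..a+2}"
    show "continuous (at x within {a..a+2}) v"
    proof (cases "x = x0")
      case True
      then show ?thesis using tendsto_within_subset[OF lim, of "{a..a+2}"] by (simp add: continuous_within)
    next
      case False
      have "continuous_on ({a..a+2} - {x0}) (\<lambda>x. (u x - u x0) / z x)"
        by (intro continuous_intros continuous_on_subset[OF u]) (auto simp: z0)
      then have "continuous_on ({a..a+2} - {x0}) v"
        by (rule continuous_on_eq) (auto simp: v_def)
      then have "continuous (at x within ({a..a+2} - {x0})) v"
        using x False by (auto simp: continuous_on_eq_continuous_within)
      moreover have "at x within ({a..a+2} - {x0}) = at x within {a..a+2}"
        using False by (intro at_within_nhd[of x "- {x0}"]) auto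
      ultimately show ?thesis by (simp add: continuous_within)
    qed
  qed
  have uv: "u x = u x0 + z x * v x" if "x \<in> {a..a+2}" for x
    using z0[OF that] z_x0 by (auto simp: v_def)
  define w where "w l = integral {a..a + 2} (\<lambda>x. v x * circ x0 (- l) x) / 2" for l :: int
  \<comment> \<open>Square-summability along every injective enumeration gives decay of the
    coefficients in both directions of the index.\<close>
  have "summable (\<lambda>n. (norm (w (h n)))\<^sup>2)" if h: "inj h" for h :: "nat \<Rightarrow> int"
  proof (rule bounded_imp_summable)
    fix n
    have "(\<Sum>k\<le>n. (norm (w (h k)))\<^sup>2) = (\<Sum>l\<in>h ` {..n}. (norm (w l))\<^sup>2)"
      using h by (subst sum.reindex) (auto intro: inj_on_subset)
    also have "\<dots> \<le> integral {a..a + 2} (\<lambda>x. (norm (v x))\<^sup>2)"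
      unfolding w_def by (rule bessel_inequality[OF v_cont]) auto
    finally show "(\<Sum>k\<le>n. (norm (w (h k)))\<^sup>2) \<le> integral {a..a + 2} (\<lambda>x. (norm (v x))\<^sup>2)" .
  qed auto
  then have w0: "(\<lambda>n. w (h n)) \<longlonglongrightarrow> 0" if "inj h" for h :: "nat \<Rightarrow> int"
    using that summable_LIMSEQ_zero[of "\<lambda>n. (norm (w (h n)))\<^sup>2"] by (simp add: tendsto_norm_zero_iff)
  \<comment> \<open>Since u = u(x0) + z v and \<open>z\<close> is a difference of two adjacent
    characters, multiplication by \<open>z\<close> turns the coefficients of \<open>v\<close> into
    differences of neighbours.\<close>
  have coef: "integral {a..a + 2} (\<lambda>x. u x * circ x0 (- l) x) / 2 = (if l = 0 then u x0 else 0) + (w (l - 1) - w l)" for l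
  proof -
    have int: "continuous_on {a..a+2} f \<Longrightarrow> f integrable_on {a..a+2}" for f :: "real \<Rightarrow> complex"
      by (rule integrable_continuous_interval)
    have "integral {a..a + 2} (\<lambda>x. u x * circ x0 (- l) x) =
        integral {a..a + 2} (\<lambda>x. u x0 * circ x0 (- l) x + (v x * circ x0 (- (l - 1)) x - v x * circ x0 (- l) x))"
    proof (intro integral_cong)
      fix x assume x: "x \<in> {a..a+2}"
      have "z x * circ x0 (- l) x = circ x0 (- (l - 1)) x - circ x0 (- l) x"
        by (simp add: z_def left_diff_distrib circ_mult algebra_simps)
      moreover have "u x * circ x0 (- l) x = u x0 * circ x0 (- l) x + v x * (z x * circ x0 (- l) x)"
        using uv[OF x] by (simp add: distrib_right mult.left_commute mult.assoc)
      ultimately show "u x * circ x0 (- l) x = u x0 * circ x0 (- l) x + (v x * circ x0 (- (l - 1)) x - v x * circ x0 (- l) x)"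
        by (simp only: right_diff_distrib)
    qed
    also have "\<dots> = integral {a..a+2} (\<lambda>x. u x0 * circ x0 (- l) x) + integral {a..a+2} (\<lambda>x. v x * circ x0 (- (l - 1)) x - v x * circ x0 (- l) x)"
      by (rule Henstock_Kurzweil_Integration.integral_add) (auto intro!: int continuous_intros v_cont)
    also have "integral {a..a+2} (\<lambda>x. v x * circ x0 (- (l - 1)) x - v x * circ x0 (- l) x) =
        integral {a..a+2} (\<lambda>x. v x * circ x0 (- (l - 1)) x) - integral {a..a+2} (\<lambda>x. v x * circ x0 (- l) x)"
      by (rule Henstock_Kurzweil_Integration.integral_diff) (auto intro!: int continuous_intros v_cont)
    also have "integral {a..a+2} (\<lambda>x. u x0 * circ x0 (- l) x) = u x0 * (if l = 0 then 2 else 0)"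
      using integral_unique[OF integral_circ[of x0 "- l" a]] by simp
    finally show ?thesis by (simp add: w_def add_divide_distrib diff_divide_distrib)
  qed
  have tele: "(\<Sum>l=-int N..int N. w (l - 1) - w l) = w (- int N - 1) - w (int N)" for N
  proof (induction N)
    case (Suc N)
    have "{-int (Suc N)..int (Suc N)} = insert (- int N - 1) (insert (int N + 1) {-int N..int N})" by auto
    then show ?case using Suc by (simp add: add.commute)
  qed simp
  have "(\<lambda>N. u x0 + (w (- int N - 1) - w (int N))) \<longlonglongrightarrow> u x0 + (0 - 0)"
    by (intro tendsto_intros w0) (auto simp: inj_def)
  moreover have "(\<Sum>l=-int N..int N. integral {a..a + 2} (\<lambda>x. u x * circ x0 (- l) x) / 2) = u x0 + (w (- int N - 1) - w (int N))" for N
    unfolding coef sum.distrib tele by simp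
  ultimately show ?thesis by simp
qed

section \<open>Summability over shifted half-integer lattices\<close>

lemma integrable_count_int_inverse_square:
  "integrable (count_space UNIV) (\<lambda>j::int. 1 / (1 + \<bar>real_of_int j\<bar>)\<^sup>2)"
proof -
  let ?g = "\<lambda>j::int. 1 / (1 + \<bar>real_of_int j\<bar>)\<^sup>2"
  have "summable (\<lambda>n. 1 / (1 + real n)\<^sup>2)"
    using summable_Suc_iff[THEN iffD2, OF inverse_power_summable[of 2, where 'a=real]] by (simp add: inverse_eq_divide)
  then have nat: "Infinite_Set_Sum.abs_summable_on (\<lambda>n::nat. 1 / (1 + real n)\<^sup>2) UNIV"
    by (simp add: abs_summable_on_nat_iff')
  have 1: "Infinite_Set_Sum.abs_summable_on ?g (range int)"
    by (subst Infinite_Set_Sum.abs_summable_on_reindex_iff[symmetric]) (use nat in auto)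
  have 2: "Infinite_Set_Sum.abs_summable_on ?g (range (\<lambda>n. - int n))"
    by (subst Infinite_Set_Sum.abs_summable_on_reindex_iff[symmetric]) (use nat in \<open>auto simp: inj_def\<close>)
  have "j \<in> range int \<union> range (\<lambda>n. - int n)" for j :: int
    by (cases j rule: int_cases2) auto
  then have "(UNIV::int set) = range int \<union> range (\<lambda>n. - int n)" by blast
  with Infinite_Set_Sum.abs_summable_on_union[OF 1 2] show ?thesis
    by (simp add: Infinite_Set_Sum.abs_summable_on_def)
qed

text \<open>Reindexing by the integer part of \<open>2 * t\<close> reduces every shift to
  \<open>t = 0\<close> up to the factor 4, so that the bound is uniform in \<open>t\<close>.\<close>

lemma int_shifted_inverse_square:
  obtains S where "S > 0"
    "\<And>t::real. integrable (count_space UNIV) (\<lambda>l::int. 1 / (1 + \<bar>t - of_int l / 2\<bar>)\<^sup>2)"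
    "\<And>t::real. (LINT l|count_space UNIV. 1 / (1 + \<bar>t - of_int (l::int) / 2\<bar>)\<^sup>2) \<le> S"
proof -
  define S where "S = (LINT j|count_space UNIV. 4 * (1 / (1 + \<bar>real_of_int j\<bar>)\<^sup>2))"
  have sum4: "integrable (count_space UNIV) (\<lambda>j::int. 4 * (1 / (1 + \<bar>real_of_int j\<bar>)\<^sup>2))"
    by (intro integrable_mult_right integrable_count_int_inverse_square)
  have S_nn: "S \<ge> 0" unfolding S_def by (intro integral_nonneg_AE) auto
  have bnd: "1 / (1 + \<bar>t - of_int (j + \<lfloor>2 * t\<rfloor>) / 2\<bar>)\<^sup>2 \<le> 4 * (1 / (1 + \<bar>real_of_int j\<bar>)\<^sup>2)" for t :: real and j :: int
  proof -
    have "\<bar>2 * t - of_int \<lfloor>2 * t\<rfloor>\<bar> \<le> 1" by linarith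
    then have "(1 + \<bar>real_of_int j\<bar>) / 2 \<le> 1 + \<bar>t - of_int (j + \<lfloor>2 * t\<rfloor>) / 2\<bar>"
    proof -
      define y where "y = t - (real_of_int j + real_of_int \<lfloor>2 * t\<rfloor>) / 2"
      assume "\<bar>2 * t - of_int \<lfloor>2 * t\<rfloor>\<bar> \<le> 1"
      moreover have "2 * t - of_int \<lfloor>2 * t\<rfloor> = 2 * y + real_of_int j" by (simp add: y_def field_simps)
      ultimately have "\<bar>2 * y + real_of_int j\<bar> \<le> 1" by simp
      then have "\<bar>real_of_int j\<bar> \<le> 1 + 2 * \<bar>y\<bar>" by (simp only: abs_le_iff) linarith
      then have "(1 + \<bar>real_of_int j\<bar>) / 2 \<le> 1 + \<bar>y\<bar>" by simp
      then show ?thesis by (simp add: y_def)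
    qed
    then have "((1 + \<bar>real_of_int j\<bar>) / 2)\<^sup>2 \<le> (1 + \<bar>t - of_int (j + \<lfloor>2 * t\<rfloor>) / 2\<bar>)\<^sup>2"
      by (intro power_mono) auto
    then have "1 / (1 + \<bar>t - of_int (j + \<lfloor>2 * t\<rfloor>) / 2\<bar>)\<^sup>2 \<le> 1 / ((1 + \<bar>real_of_int j\<bar>) / 2)\<^sup>2"
      by (intro divide_left_mono mult_pos_pos zero_less_power) (auto intro: add_pos_nonneg)
    then show ?thesis by (simp add: power_divide)
  qed
  have bij: "bij_betw (\<lambda>j. j + \<lfloor>2 * t\<rfloor>) UNIV (UNIV :: int set)" for t :: real
    by (rule bij_betwI[of _ _ _ "\<lambda>j. j - \<lfloor>2 * t\<rfloor>"]) auto
  have sh: "integrable (count_space UNIV) (\<lambda>j::int. 1 / (1 + \<bar>t - of_int (j + \<lfloor>2 * t\<rfloor>) / 2\<bar>)\<^sup>2)" for t :: real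
  proof (rule Bochner_Integration.integrable_bound[OF sum4])
    show "AE j in count_space UNIV. norm (1 / (1 + \<bar>t - of_int (j + \<lfloor>2 * t\<rfloor>) / 2\<bar>)\<^sup>2) \<le> norm (4 * (1 / (1 + \<bar>real_of_int j\<bar>)\<^sup>2))"
    proof (rule AE_I2)
      fix j :: int
      have "(0::real) \<le> 1 / (1 + \<bar>t - of_int (j + \<lfloor>2 * t\<rfloor>) / 2\<bar>)\<^sup>2"
        by (intro divide_nonneg_nonneg) auto
      then show "norm (1 / (1 + \<bar>t - of_int (j + \<lfloor>2 * t\<rfloor>) / 2\<bar>)\<^sup>2) \<le> norm (4 * (1 / (1 + \<bar>real_of_int j\<bar>)\<^sup>2))"
        unfolding real_norm_def by (rule order_trans[OF eq_refl[OF abs_of_nonneg] order_trans[OF bnd abs_ge_self]])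
    qed
  qed simp
  show ?thesis
  proof (rule that[of "S + 1"])
    show "integrable (count_space UNIV) (\<lambda>l::int. 1 / (1 + \<bar>t - of_int l / 2\<bar>)\<^sup>2)" for t :: real
      by (rule iffD1[OF Infinite_Set_Sum.abs_summable_on_reindex_bij_betw[OF bij[of t],
            unfolded Infinite_Set_Sum.abs_summable_on_def] sh])
    show "(LINT l|count_space UNIV. 1 / (1 + \<bar>t - of_int (l::int) / 2\<bar>)\<^sup>2) \<le> S + 1" for t :: real
    proof -
      have "(LINT l|count_space UNIV. 1 / (1 + \<bar>t - of_int (l::int) / 2\<bar>)\<^sup>2) =
          (LINT j|count_space UNIV. 1 / (1 + \<bar>t - of_int (j + \<lfloor>2 * t\<rfloor>) / 2\<bar>)\<^sup>2)"
        by (rule infsetsum_reindex_bij_betw[OF bij, symmetric, unfolded infsetsum_def])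
      also have "\<dots> \<le> S" unfolding S_def by (rule integral_mono[OF sh sum4 bnd])
      finally show ?thesis by simp
    qed
  qed (use S_nn in simp)
qed

text \<open>Multiply the exponential by a cut-off that is 1 on [0, 1] and supported in [-1/2, 3/2],
  and expand over period 2; the room for the cut-off is the reason for half-integer frequencies. The
  coefficient is the Fourier integral of the cut-off at \<open>t - l / 2\<close>, and
  \<open>N\<close> integrations by parts give its decay of order \<open>N\<close>.\<close>

lemma exp_lattice_expansion:
  assumes "N \<ge> 2"
  obtains C :: real and c :: "int \<Rightarrow> real \<Rightarrow> complex" where "C > 0"
    "\<And>l. c l \<in> borel_measurable borel"
    "\<And>l t. norm (c l t) \<le> C / (1 + \<bar>t - of_int l / 2\<bar>) ^ N"
    "\<And>t x. 0 \<le> x \<Longrightarrow> x \<le> 1 \<Longrightarrow>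
      (LINT l|count_space UNIV. c l t * exp (of_real pi * \<i> * of_int l * of_real x)) =
      exp (2 * of_real pi * \<i> * of_real (t * x))"
proof -
  obtain M \<eta> B where M: "M > 0"
    and der: "\<And>l t. l < N \<Longrightarrow> (\<eta> l has_real_derivative \<eta> (Suc l) t) (at t)"
    and cont: "\<And>l. l \<le> N \<Longrightarrow> continuous_on UNIV (\<eta> l)"
    and neg: "\<And>l t. t \<le> 0 \<Longrightarrow> \<eta> l t = 0"
    and ge: "\<And>l t. l \<le> N \<Longrightarrow> M \<le> t \<Longrightarrow> \<eta> l t = (if l = 0 then 1 else 0)"
    and bnd: "\<And>l t. l \<le> N \<Longrightarrow> \<bar>\<eta> l t\<bar> \<le> B"
    using smooth_step_exists[of N] by blast
  \<comment> \<open>The first step rises on [-1/2, 0], the second one cancels it on [1, 3/2]; (2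
    M)^l is the chain-rule factor of the \<open>l\<close>-th derivative.\<close>
  define \<phi> where "\<phi> l x = (2 * M) ^ l * (\<eta> l (2 * M * x + M) - \<eta> l (2 * M * x - 2 * M))" for l x
  have \<phi>_der: "(\<phi> l has_real_derivative \<phi> (Suc l) x) (at x)" if "l < N" for l x
  proof -
    have d: "((\<lambda>x. \<eta> l (2 * M * x + b)) has_real_derivative \<eta> (Suc l) (2 * M * x + b) * (2 * M)) (at x)" for b
      by (rule DERIV_chain'[OF _ der[OF that]]) (auto intro!: derivative_eq_intros)
    show ?thesis unfolding \<phi>_def
      using DERIV_cmult[OF DERIV_diff[OF d[of M] d[of "-2 * M"]], of "(2 * M) ^ l"]
      by (simp add: algebra_simps)
  qed
  have \<phi>_cont: "continuous_on S (\<phi> l)" if "l \<le> N" for l S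
    unfolding \<phi>_def by (intro continuous_intros continuous_on_compose2[OF cont[OF that]]) auto
  have \<phi>_left: "\<phi> l (-1/2) = 0" for l using neg M by (simp add: \<phi>_def)
  have \<phi>_right: "\<phi> l (3/2) = 0" if "l \<le> N" for l using ge[OF that] M by (simp add: \<phi>_def)
  have \<phi>_1: "\<phi> 0 x = 1" if "0 \<le> x" "x \<le> 1" for x
    using that M ge[of 0 "2 * M * x + M"] neg[of "2 * M * x - 2 * M" 0] by (simp add: \<phi>_def)
  define B' where "B' = (\<Sum>l\<le>N. (2 * M) ^ l) * (2 * B)"
  have B: "B \<ge> 0" using bnd[of 0 0] by simp
  have \<phi>_bnd: "\<bar>\<phi> l x\<bar> \<le> B'" if "l \<le> N" for l x
  proof -
    have "(2 * M) ^ l \<le> (\<Sum>l\<le>N. (2 * M) ^ l)" using that M by (intro member_le_sum) auto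
    moreover have "\<bar>\<eta> l (2 * M * x + M) - \<eta> l (2 * M * x - 2 * M)\<bar> \<le> 2 * B"
      using bnd[OF that, of "2 * M * x + M"] bnd[OF that, of "2 * M * x - 2 * M"] by linarith
    ultimately show ?thesis unfolding \<phi>_def B'_def using M B
      by (auto simp: abs_mult intro!: mult_mono sum_nonneg)
  qed
  have B': "B' \<ge> 0" using \<phi>_bnd[of 0 0] by simp
  define I where "I l t = integral {-1/2..3/2} (\<lambda>x. of_real (\<phi> l x) * exp (2 * of_real pi * \<i> * of_real (t * x)))" for l t
  have f_int: "(\<lambda>x. of_real (\<phi> l x) * exp (2 * of_real pi * \<i> * of_real (t * x))) integrable_on {-1/2..3/2}"
    if "l \<le> N" for l t
    by (intro integrable_continuous_interval continuous_intros \<phi>_cont that)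
  have I_bnd: "norm (I l t) \<le> 2 * B'" if "l \<le> N" for l t
  proof -
    have "norm (I l t) \<le> B' * (3/2 - (-1/2))" unfolding I_def
      by (rule integral_bound)
        (use \<phi>_bnd[OF that] in \<open>auto intro!: continuous_intros \<phi>_cont that simp: norm_mult\<close>)
    then show ?thesis by simp
  qed
  have parts: "I (Suc l) t = - (2 * of_real pi * \<i> * of_real t) * I l t" if l: "l < N" for l t
  proof -
    let ?e = "\<lambda>x. exp (2 * of_real pi * \<i> * of_real (t * x))" and ?c = "2 * of_real pi * \<i> * of_real t"
    have eqv: "2 * of_real pi * \<i> * complex_of_real (t * x) = ?c * of_real x" for x
      by (simp add: mult.assoc)
    have e: "(?e has_vector_derivative ?c * ?e x) (at x)" for x
      unfolding eqv by (rule exp_cmult_has_vector_derivative)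
    have p: "((\<lambda>x. complex_of_real (\<phi> l x)) has_vector_derivative of_real (\<phi> (Suc l) x)) (at x)" for x
      by (rule has_vector_derivative_of_real) (use \<phi>_der[OF l, of x] in \<open>simp add: has_real_derivative_iff_has_vector_derivative\<close>)
    have "((\<lambda>x. of_real (\<phi> l x) * (?c * ?e x) + of_real (\<phi> (Suc l) x) * ?e x) has_integral
        (of_real (\<phi> l (3/2)) * ?e (3/2) - of_real (\<phi> l (-1/2)) * ?e (-1/2))) {-1/2..3/2}"
      by (rule fundamental_theorem_of_calculus)
        (simp, rule has_vector_derivative_at_within, rule has_vector_derivative_mult[OF p e])
    then have "((\<lambda>x. ?c * (of_real (\<phi> l x) * ?e x) + of_real (\<phi> (Suc l) x) * ?e x) has_integral 0) {-1/2..3/2}"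
      using \<phi>_left \<phi>_right l by (simp add: mult_ac)
    moreover have "((\<lambda>x. ?c * (of_real (\<phi> l x) * ?e x) + of_real (\<phi> (Suc l) x) * ?e x) has_integral ?c * I l t + I (Suc l) t) {-1/2..3/2}"
      unfolding I_def using l by (intro has_integral_add has_integral_mult_right integrable_integral f_int) auto
    ultimately have "?c * I l t + I (Suc l) t = 0" using has_integral_unique by blast
    then show ?thesis by (simp add: add_eq_0_iff)
  qed
  have I_pow: "norm (I l t) = (2 * pi * \<bar>t\<bar>) ^ l * norm (I 0 t)" if "l \<le> N" for l t
    using that by (induction l) (simp_all add: parts norm_mult)
  \<comment> \<open>For small \<open>t\<close> the trivial bound suffices; otherwise
    \<open>N\<close> integrations by parts gain (2 pi |t|)^N, which dominates (1 + |t|)^N up to the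
    factor 2^N.\<close>
  have decay: "norm (I 0 t) \<le> 2 ^ N * 2 * B' / (1 + \<bar>t\<bar>) ^ N" for t
  proof -
    have pos: "(1 + \<bar>t\<bar>) ^ N > 0" by (intro zero_less_power) auto
    have "(1 + \<bar>t\<bar>) ^ N * norm (I 0 t) \<le> 2 ^ N * (2 * B')"
    proof (cases "\<bar>t\<bar> \<le> 1")
      case True
      then have "(1 + \<bar>t\<bar>) ^ N \<le> 2 ^ N" by (intro power_mono) auto
      then show ?thesis using I_bnd[of 0 t] by (intro mult_mono) auto
    next
      case False
      have "1 + \<bar>t\<bar> \<le> 2 * (2 * pi * \<bar>t\<bar>)"
      proof -
        have "1 * \<bar>t\<bar> \<le> pi * \<bar>t\<bar>" using pi_gt3 by (intro mult_right_mono) auto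
        with False show ?thesis by simp
      qed
      then have "(1 + \<bar>t\<bar>) ^ N \<le> (2 * (2 * pi * \<bar>t\<bar>)) ^ N" by (intro power_mono) auto
      then have "(1 + \<bar>t\<bar>) ^ N * norm (I 0 t) \<le> (2 * (2 * pi * \<bar>t\<bar>)) ^ N * norm (I 0 t)"
        by (intro mult_right_mono) auto
      also have "\<dots> = 2 ^ N * norm (I N t)" 
        unfolding I_pow[OF order_refl] power_mult_distrib[of 2 "2 * pi * \<bar>t\<bar>"] by (simp only: mult.assoc)
      also have "\<dots> \<le> 2 ^ N * (2 * B')" using I_bnd[of N t] by (intro mult_left_mono) auto
      finally show ?thesis .
    qed
    then show ?thesis using pos by (simp add: pos_le_divide_eq mult_ac)
  qed
  have I_meas: "I 0 \<in> borel_measurable borel"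
  proof -
    have [measurable]: "\<phi> 0 \<in> borel_measurable borel"
      using \<phi>_cont[of 0 UNIV] by (intro borel_measurable_continuous_onI) auto
    have "I 0 t = (LINT x|lborel. indicator {-1/2..3/2} x *\<^sub>R (of_real (\<phi> 0 x) * exp (2 * of_real pi * \<i> * of_real (t * x))))" for t
      unfolding I_def set_lebesgue_integral_def[symmetric]
      by (rule set_borel_integral_eq_integral(2)[symmetric])
        (intro borel_integrable_atLeastAtMost' continuous_intros \<phi>_cont, simp)
    then have "I 0 = (\<lambda>t. LINT x|lborel. indicator {-1/2..3/2} x *\<^sub>R (of_real (\<phi> 0 x) * exp (2 * of_real pi * \<i> * of_real (t * x))))" by blast
    also have "\<dots> \<in> borel_measurable borel"
      by measurable
    finally show ?thesis .
  qed
  define c where "c l t = I 0 (t - of_int l / 2) / 2" for l :: int and t :: real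
  have c_bnd: "norm (c l t) \<le> (2 ^ N * B' + 1) / (1 + \<bar>t - of_int l / 2\<bar>) ^ N" for l t
  proof -
    have "norm (c l t) \<le> (2 ^ N * 2 * B' / (1 + \<bar>t - of_int l / 2\<bar>) ^ N) / 2"
      unfolding c_def using decay[of "t - of_int l / 2"] by (simp add: norm_divide mult_ac)
    also have "\<dots> = (2 ^ N * B') / (1 + \<bar>t - of_int l / 2\<bar>) ^ N" by simp
    also have "\<dots> \<le> (2 ^ N * B' + 1) / (1 + \<bar>t - of_int l / 2\<bar>) ^ N"
      by (intro divide_right_mono) auto
    finally show ?thesis .
  qed
  show ?thesis
  proof (rule that[of "2 ^ N * B' + 1" c])
    show "2 ^ N * B' + 1 > 0" using B' by (intro add_nonneg_pos) auto
    show "c l \<in> borel_measurable borel" for l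
      unfolding c_def using I_meas by measurable
    show "norm (c l t) \<le> (2 ^ N * B' + 1) / (1 + \<bar>t - of_int l / 2\<bar>) ^ N" for l t by (rule c_bnd)
    fix t x0 :: real assume x0: "0 \<le> x0" "x0 \<le> 1"
    let ?f = "\<lambda>l. c l t * exp (of_real pi * \<i> * of_int l * of_real x0)"
    let ?u = "\<lambda>x. of_real (\<phi> 0 x) * exp (2 * of_real pi * \<i> * of_real (t * x))"
    obtain S where S: "\<And>t::real. integrable (count_space UNIV) (\<lambda>l::int. 1 / (1 + \<bar>t - of_int l / 2\<bar>)\<^sup>2)"
      using int_shifted_inverse_square by metis
    have f_sum: "integrable (count_space UNIV) ?f"
    proof (rule Bochner_Integration.integrable_bound[OF integrable_mult_right[OF S[of t], of "2 ^ N * B' + 1"]])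
      have "norm (?f l) \<le> norm ((2 ^ N * B' + 1) * (1 / (1 + \<bar>t - of_int l / 2\<bar>)\<^sup>2))" for l
      proof -
        have "norm (?f l) = norm (c l t)" by (simp add: norm_mult)
        also have "\<dots> \<le> (2 ^ N * B' + 1) / (1 + \<bar>t - of_int l / 2\<bar>) ^ N" by (rule c_bnd)
        also have "\<dots> \<le> (2 ^ N * B' + 1) / (1 + \<bar>t - of_int l / 2\<bar>) ^ 2"
          using assms B' by (intro divide_left_mono power_increasing mult_pos_pos zero_less_power) (auto intro: add_pos_nonneg)
        finally show ?thesis using B' by simp
      qed
      then show "AE l in count_space UNIV. norm (?f l) \<le> norm ((2 ^ N * B' + 1) * (1 / (1 + \<bar>t - of_int l / 2\<bar>)\<^sup>2))"
        by simp
    qed simp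
    have "(?u has_vector_derivative of_real (\<phi> 0 x0) * (2 * of_real pi * \<i> * of_real t * exp (2 * of_real pi * \<i> * of_real (t * x0))) +
       of_real (\<phi> (Suc 0) x0) * exp (2 * of_real pi * \<i> * of_real (t * x0))) (at x0)"
    proof (rule has_vector_derivative_mult)
      show "((\<lambda>x. complex_of_real (\<phi> 0 x)) has_vector_derivative of_real (\<phi> (Suc 0) x0)) (at x0)"
        by (rule has_vector_derivative_of_real) (use \<phi>_der[of 0 x0] assms in \<open>simp add: has_real_derivative_iff_has_vector_derivative\<close>)
      have eqv: "2 * of_real pi * \<i> * complex_of_real (t * x) = 2 * of_real pi * \<i> * of_real t * of_real x" for x
        by (simp add: mult.assoc)
      show "((\<lambda>x. exp (2 * of_real pi * \<i> * of_real (t * x))) has_vector_derivative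
        2 * of_real pi * \<i> * of_real t * exp (2 * of_real pi * \<i> * of_real (t * x0))) (at x0)"
        unfolding eqv by (rule exp_cmult_has_vector_derivative)
    qed
    then have "(\<lambda>N. \<Sum>l=-int N..int N. integral {-1/2..-1/2 + 2} (\<lambda>x. ?u x * circ x0 (- l) x) / 2) \<longlonglongrightarrow> ?u x0"
      using x0 by (intro fourier_series_tendsto) (auto intro!: continuous_intros \<phi>_cont)
    moreover have "integral {-1/2..-1/2 + 2} (\<lambda>x. ?u x * circ x0 (- l) x) / 2 = ?f l" for l
    proof -
      have "integral {-1/2..3/2} (\<lambda>x. ?u x * circ x0 (- l) x) =
        integral {-1/2..3/2} (\<lambda>x. (of_real (\<phi> 0 x) * exp (2 * of_real pi * \<i> * of_real ((t - of_int l / 2) * x))) * exp (of_real pi * \<i> * of_int l * of_real x0))"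
      proof (intro integral_cong)
        fix x :: real
        have "2 * of_real pi * \<i> * of_real (t * x) + of_real pi * \<i> * of_int (- l) * of_real (x - x0) =
            2 * of_real pi * \<i> * complex_of_real ((t - of_int l / 2) * x) + of_real pi * \<i> * of_int l * of_real x0"
          by (simp add: field_simps)
        then have "exp (2 * of_real pi * \<i> * of_real (t * x)) * circ x0 (- l) x =
            exp (2 * of_real pi * \<i> * complex_of_real ((t - of_int l / 2) * x)) * exp (of_real pi * \<i> * of_int l * of_real x0)"
          unfolding circ_def exp_add[symmetric] by (rule arg_cong)
        then show "?u x * circ x0 (- l) x = (of_real (\<phi> 0 x) * exp (2 * of_real pi * \<i> * of_real ((t - of_int l / 2) * x))) * exp (of_real pi * \<i> * of_int l * of_real x0)"
          by (simp only: mult.assoc)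
      qed
      also have "\<dots> = I 0 (t - of_int l / 2) * exp (of_real pi * \<i> * of_int l * of_real x0)"
        unfolding I_def by simp
      finally show ?thesis by (simp add: c_def)
    qed
    ultimately have lim1: "(\<lambda>N. \<Sum>l=-int N..int N. ?f l) \<longlonglongrightarrow> ?u x0" by simp
    \<comment> \<open>The symmetric partial sums have the right limit by pointwise convergence of
      the Fourier series; absolute summability identifies this limit with the unordered sum.\<close>
    have "(\<lambda>N. LINT l|count_space UNIV. indicator {-int N..int N} l *\<^sub>R ?f l) \<longlonglongrightarrow> (LINT l|count_space UNIV. ?f l)"
    proof (rule integral_dominated_convergence[where w="\<lambda>l. norm (?f l)"])
      show "AE l in count_space UNIV. (\<lambda>N. indicator {-int N..int N} l *\<^sub>R ?f l) \<longlonglongrightarrow> ?f l"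
      proof (rule AE_I2)
        fix l :: int
        have "\<forall>\<^sub>F N in sequentially. indicator {-int N..int N} l *\<^sub>R ?f l = ?f l"
          using eventually_ge_at_top[of "nat \<bar>l\<bar>"] by eventually_elim (auto simp: indicator_def)
        then show "(\<lambda>N. indicator {-int N..int N} l *\<^sub>R ?f l) \<longlonglongrightarrow> ?f l" by (rule tendsto_eventually)
      qed
      show "integrable (count_space UNIV) (\<lambda>l. norm (?f l))"
        using f_sum by (rule integrable_norm)
    qed (auto simp: indicator_def)
    moreover have "(LINT l|count_space UNIV. indicator {-int N..int N} l *\<^sub>R ?f l) = (\<Sum>l=-int N..int N. ?f l)" for N
    proof -
      have "finite {l. indicator {-int N..int N} l *\<^sub>R ?f l \<noteq> 0}"
        by (rule finite_subset[of _ "{-int N..int N}"]) (auto simp: indicator_def)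
      then have "(LINT l|count_space UNIV. indicator {-int N..int N} l *\<^sub>R ?f l) =
          (\<Sum>l | indicator {-int N..int N} l *\<^sub>R ?f l \<noteq> 0. indicator {-int N..int N} l *\<^sub>R ?f l)"
        by (subst lebesgue_integral_count_space_finite_support) auto
      also have "\<dots> = (\<Sum>l=-int N..int N. ?f l)"
        by (rule sum.mono_neutral_cong_left) (auto simp: indicator_def)
      finally show ?thesis .
    qed
    ultimately have "(\<lambda>N. \<Sum>l=-int N..int N. ?f l) \<longlonglongrightarrow> (LINT l|count_space UNIV. ?f l)"
      by simp
    from LIMSEQ_unique[OF this lim1] show "(LINT l|count_space UNIV. ?f l) = exp (2 * of_real pi * \<i> * of_real (t * x0))"
      using \<phi>_1[OF x0] by simp
  qed
qed

section \<open>Localised neurons\<close>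

text \<open>Equally spaced points of [0, 1); the denominator \<open>k + 1\<close> also covers
  \<open>k = 0\<close>.\<close>

definition lnode :: "nat \<Rightarrow> nat \<Rightarrow> real" where "lnode k r = real r / real (Suc k)"

definition lagr :: "nat \<Rightarrow> nat \<Rightarrow> real \<Rightarrow> real" where
  "lagr k r y = (\<Prod>s\<in>{..k} - {r}. (y - lnode k s) / (lnode k r - lnode k s))"

lemma lnode_bounds: "r \<le> k \<Longrightarrow> 0 \<le> lnode k r \<and> lnode k r \<le> 1"
  by (auto simp: lnode_def)

lemma lnode_inj: "lnode k r = lnode k s \<longleftrightarrow> r = s"
  by (simp add: lnode_def del: of_nat_Suc)

text \<open>Interpolant and polynomial have degree at most \<open>k\<close> and agree at
  \<open>k + 1\<close> distinct nodes.\<close>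

lemma lagrange_interpolation_exact:
  assumes "degree p \<le> k"
  shows "(\<Sum>r\<le>k. lagr k r y * poly p (lnode k r)) = poly p y"
proof -
  define l where "l r = (\<Prod>s\<in>{..k} - {r}. smult (1 / (lnode k r - lnode k s)) [:- lnode k s, 1:])" for r
  have l: "poly (l r) y = lagr k r y" for r y
    by (simp add: l_def lagr_def poly_prod diff_divide_distrib)
  have deg_l: "degree (l r) \<le> k" if "r \<le> k" for r
  proof -
    have "degree (l r) \<le> (\<Sum>s\<in>{..k} - {r}. degree (smult (1 / (lnode k r - lnode k s)) [:- lnode k s, 1:]))"
      using degree_prod_sum_le[of "{..k} - {r}" "\<lambda>s. smult (1 / (lnode k r - lnode k s)) [:- lnode k s, 1:]"]
      by (simp add: l_def o_def)
    also have "\<dots> \<le> (\<Sum>s\<in>{..k} - {r}. 1)" by (intro sum_mono) (simp add: degree_smult_le order_trans)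
    also have "\<dots> = k" using that by simp
    finally show ?thesis .
  qed
  define q where "q = (\<Sum>r\<le>k. smult (poly p (lnode k r)) (l r))"
  have "degree q \<le> k" unfolding q_def
    by (intro degree_sum_le) (auto intro: order_trans[OF degree_smult_le] deg_l)
  moreover have "poly q (lnode k t) = poly p (lnode k t)" if "t \<le> k" for t
  proof -
    have "lagr k r (lnode k t) = (if r = t then 1 else 0)" for r
    proof (cases "r = t")
      case True
      then show ?thesis by (auto simp: lagr_def lnode_inj intro!: prod.neutral)
    next
      case False
      then show ?thesis using that by (auto simp: lagr_def intro!: prod_zero bexI[of _ t])
    qed
    then have "poly q (lnode k t) = (\<Sum>r\<le>k. if r = t then poly p (lnode k r) else 0)"
      unfolding q_def poly_sum by (intro sum.cong) (auto simp: l)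
    then show ?thesis using that by simp
  qed
  moreover have "card (lnode k ` {..k}) = Suc k"
    by (subst card_image) (auto simp: inj_on_def lnode_inj)
  ultimately have "q = p"
    by (intro poly_eqI_degree[of "lnode k ` {..k}"]) (use assms in auto)
  then have "poly q y = poly p y" by simp
  then show ?thesis by (simp add: q_def poly_sum l mult.commute)
qed

lemma continuous_on_lagr: "continuous_on S (lagr k r)"
  unfolding lagr_def by (auto intro!: continuous_intros simp: lnode_inj)

lemma lagr_measurable [measurable]: "lagr k r \<in> borel_measurable borel"
  by (rule borel_measurable_continuous_onI[OF continuous_on_lagr])

lemma lagr_bounded:
  obtains B where "B \<ge> 0" "\<And>r y. r \<le> k \<Longrightarrow> 0 \<le> y \<Longrightarrow> y \<le> 1 \<Longrightarrow> \<bar>lagr k r y\<bar> \<le> B"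
proof -
  have "\<exists>B. \<forall>y\<in>{0..1}. \<bar>lagr k r y\<bar> \<le> B" for r
  proof -
    have "compact (lagr k r ` {0..1})" by (intro compact_continuous_image continuous_on_lagr) auto
    then show ?thesis by (meson compact_imp_bounded bounded_real imageI)
  qed
  then obtain B where B: "\<And>r y. y \<in> {0..1} \<Longrightarrow> \<bar>lagr k r y\<bar> \<le> B r" by metis
  have "0 \<le> B r" for r using B[of 0 r] by auto
  then have "\<bar>lagr k r y\<bar> \<le> (\<Sum>r\<le>k. B r)" if "r \<le> k" "0 \<le> y" "y \<le> 1" for r y
    using that B[of y r] member_le_sum[of r "{..k}" B] by auto
  with \<open>\<And>r. 0 \<le> B r\<close> show ?thesis by (intro that[of "\<Sum>r\<le>k. B r"]) (auto intro: sum_nonneg)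
qed

text \<open>The neuron with bias \<open>b\<close> in the cell \<open>[\<beta>, \<beta> + h]\<close> minus its interpolation by neurons with
  biases at the nodes of the cell. Since the interpolation is exact for polynomials of degree
  at most \<open>k\<close>, the difference vanishes on both sides of the cell.\<close>
definition kern :: "nat \<Rightarrow> nat \<Rightarrow> real \<Rightarrow> real \<Rightarrow> real \<Rightarrow> real \<Rightarrow> real" where
  "kern k i \<beta> h b t =
     relu_pow i (t - b) - (\<Sum>r\<le>k. lagr k r ((b - \<beta>) / h) * relu_pow i (t - (\<beta> + h * lnode k r)))"

text \<open>Factor the difference of the powers of the positive parts; taking positive parts does
  not increase distances.\<close>

lemma relu_pow_Lipschitz:
  assumes "\<bar>s\<bar> \<le> H" "\<bar>t\<bar> \<le> H"
  shows "\<bar>relu_pow (Suc j) s - relu_pow (Suc j) t\<bar> \<le> real (Suc j) * H ^ j * \<bar>s - t\<bar>"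
proof -
  have eq: "relu_pow (Suc j) s = max 0 s ^ Suc j" for s by (auto simp: relu_pow_eq max_def)
  let ?s = "max 0 s" and ?t = "max 0 t"
  have "?s ^ Suc j - ?t ^ Suc j = (?s - ?t) * (\<Sum>p<Suc j. ?t ^ (j - p) * ?s ^ p)"
    using power_diff_sumr2[of ?s "Suc j" ?t] unfolding diff_Suc_Suc .
  then have "\<bar>?s ^ Suc j - ?t ^ Suc j\<bar> = \<bar>?s - ?t\<bar> * \<bar>\<Sum>p<Suc j. ?t ^ (j - p) * ?s ^ p\<bar>"
    by (simp only: abs_mult)
  also have "\<dots> \<le> \<bar>s - t\<bar> * (\<Sum>p<Suc j. H ^ (j - p) * H ^ p)"
    using assms by (intro mult_mono order_trans[OF sum_abs] sum_mono)
      (auto simp: abs_mult power_abs intro!: mult_mono power_mono sum_nonneg mult_nonneg_nonneg)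
  also have "(\<Sum>p<Suc j. H ^ (j - p) * H ^ p) = (\<Sum>p<Suc j. H ^ j)"
    by (intro sum.cong) (auto simp flip: power_add)
  finally show ?thesis by (simp add: eq algebra_simps)
qed

context
  fixes k i :: nat and \<beta> h b :: real
  assumes ik: "i \<le> k" and h: "h > 0" and b: "\<beta> \<le> b" "b \<le> \<beta> + h"
begin

lemma cell_node_bounds: "r \<le> k \<Longrightarrow> \<beta> \<le> \<beta> + h * lnode k r \<and> \<beta> + h * lnode k r \<le> \<beta> + h"
  using lnode_bounds[of r k] h by (auto simp: mult_le_cancel_left1)

lemma kern_left: "t \<le> \<beta> \<Longrightarrow> kern k i \<beta> h b t = 0"
  using b cell_node_bounds by (auto simp: kern_def relu_pow_eq intro!: sum.neutral) fastforce

text \<open>For \<open>i = 0\<close> the right end point of the cell is excluded: a neuron with bias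
  \<open>t\<close> contributes 0 at \<open>t\<close> instead of the polynomial value 1.\<close>

lemma kern_right:
  assumes "t > \<beta> + h \<or> t = \<beta> + h \<and> i \<ge> 1"
  shows "kern k i \<beta> h b t = 0"
proof -
  have pow: "relu_pow i (t - c) = (t - c) ^ i" if "c \<le> \<beta> + h" for c
    using that assms by (auto simp: relu_pow_eq power_0_left)
  \<comment> \<open>Right of the cell the truncation is inactive, and (t - b)^i is a polynomial of
    degree at most k in the rescaled bias \<open>(b - \<beta>) / h\<close>; interpolation in that
    variable is exact.\<close>
  define p where "p = [:t - \<beta>, - h:] ^ i"
  have "degree p \<le> k"
    using degree_power_le[of "[:t - \<beta>, - h:]" i] h ik by (simp add: p_def)
  have poly_p: "poly p y = (t - (\<beta> + h * y)) ^ i" for y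
    by (simp add: p_def poly_power algebra_simps)
  have "\<beta> + h * ((b - \<beta>) / h) = b" using h by simp
  with lagrange_interpolation_exact[OF \<open>degree p \<le> k\<close>, of "(b - \<beta>) / h"]
  have "(\<Sum>r\<le>k. lagr k r ((b - \<beta>) / h) * (t - (\<beta> + h * lnode k r)) ^ i) = (t - b) ^ i"
    by (simp only: poly_p)
  then show ?thesis using b cell_node_bounds by (simp add: kern_def pow)
qed

lemma kern_outside: "t < \<beta> \<or> \<beta> + h < t \<Longrightarrow> kern k i \<beta> h b t = 0"
  using kern_left kern_right by auto

text \<open>Inside the cell all truncated powers are at most h^i, and the Lagrange weights are
  bounded independently of \<open>h\<close>.\<close>

lemma kern_bound:
  assumes B: "B \<ge> 0" "\<And>r y. r \<le> k \<Longrightarrow> 0 \<le> y \<Longrightarrow> y \<le> 1 \<Longrightarrow> \<bar>lagr k r y\<bar> \<le> B"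
  shows "\<bar>kern k i \<beta> h b t\<bar> \<le> (1 + real (Suc k) * B) * h ^ i"
proof (cases "\<beta> \<le> t \<and> t \<le> \<beta> + h")
  case False
  then show ?thesis using kern_outside[of t] B h by (auto simp del: of_nat_Suc)
next
  case True
  have 1: "\<bar>relu_pow i (t - c)\<bar> \<le> h ^ i" if "\<beta> \<le> c" for c
    using that True h by (auto simp: relu_pow_eq power_abs[symmetric] intro!: power_mono)
  have y: "0 \<le> (b - \<beta>) / h" "(b - \<beta>) / h \<le> 1" using b h by auto
  have "\<bar>\<Sum>r\<le>k. lagr k r ((b - \<beta>) / h) * relu_pow i (t - (\<beta> + h * lnode k r))\<bar> \<le> (\<Sum>r\<le>k. B * h ^ i)"
    using cell_node_bounds B(2)[OF _ y] B(1)
    by (intro order_trans[OF sum_abs] sum_mono) (auto simp: abs_mult intro!: mult_mono 1)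
  also have "\<dots> = real (Suc k) * B * h ^ i" by simp
  finally have "\<bar>kern k i \<beta> h b t\<bar> \<le> h ^ i + real (Suc k) * B * h ^ i"
    using 1[OF b(1)] unfolding kern_def by linarith
  then show ?thesis by (simp add: algebra_simps)
qed

text \<open>For positive exponent the kernel also vanishes at both ends of the cell, so clamping the
  argument to the cell changes nothing. Inside it all arguments of the truncated powers are at most
  \<open>h\<close> in modulus, which gives the factor h^j.\<close>

lemma kern_Lipschitz:
  assumes B: "B \<ge> 0" "\<And>r y. r \<le> k \<Longrightarrow> 0 \<le> y \<Longrightarrow> y \<le> 1 \<Longrightarrow> \<bar>lagr k r y\<bar> \<le> B" and i: "i = Suc j"
  shows "\<bar>kern k i \<beta> h b s - kern k i \<beta> h b t\<bar> \<le> real i * (1 + real (Suc k) * B) * h ^ j * \<bar>s - t\<bar>"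
proof -
  define cl where "cl t = min (\<beta> + h) (max \<beta> t)" for t
  have cl: "kern k i \<beta> h b t = kern k i \<beta> h b (cl t)" for t
    using kern_outside[of t] kern_left[of \<beta>] kern_right[of "\<beta> + h"] i h
    by (cases "t < \<beta>"; cases "t > \<beta> + h") (auto simp: cl_def)
  have cl_in: "\<beta> \<le> cl t" "cl t \<le> \<beta> + h" for t using h by (auto simp: cl_def)
  have 1: "\<bar>relu_pow i (cl s - c) - relu_pow i (cl t - c)\<bar> \<le> real i * h ^ j * \<bar>cl s - cl t\<bar>" if "\<beta> \<le> c" "c \<le> \<beta> + h" for c
    using relu_pow_Lipschitz[of "cl s - c" h "cl t - c" j] cl_in[of s] cl_in[of t] that i by auto
  let ?M = "real i * h ^ j * \<bar>cl s - cl t\<bar>"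
  have y: "0 \<le> (b - \<beta>) / h" "(b - \<beta>) / h \<le> 1" using b h by auto
  have "kern k i \<beta> h b (cl s) - kern k i \<beta> h b (cl t) =
     (relu_pow i (cl s - b) - relu_pow i (cl t - b)) -
     (\<Sum>r\<le>k. lagr k r ((b - \<beta>) / h) * (relu_pow i (cl s - (\<beta> + h * lnode k r)) - relu_pow i (cl t - (\<beta> + h * lnode k r))))"
    by (simp add: kern_def right_diff_distrib sum_subtractf)
  moreover have "\<bar>\<Sum>r\<le>k. lagr k r ((b - \<beta>) / h) * (relu_pow i (cl s - (\<beta> + h * lnode k r)) - relu_pow i (cl t - (\<beta> + h * lnode k r)))\<bar>
     \<le> (\<Sum>r\<le>k. B * ?M)"
    using cell_node_bounds B(2)[OF _ y] B(1)
    by (intro order_trans[OF sum_abs] sum_mono) (auto simp only: abs_mult atMost_iff intro!: mult_mono 1)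
  moreover have "(\<Sum>r\<le>k. B * ?M) = real (Suc k) * B * ?M" by simp
  ultimately have "\<bar>kern k i \<beta> h b (cl s) - kern k i \<beta> h b (cl t)\<bar> \<le> ?M + real (Suc k) * B * ?M"
    using 1[OF b] by linarith
  also have "\<dots> = real i * (1 + real (Suc k) * B) * h ^ j * \<bar>cl s - cl t\<bar>" by (simp add: algebra_simps)
  also have "\<dots> \<le> real i * (1 + real (Suc k) * B) * h ^ j * \<bar>s - t\<bar>"
  proof (rule mult_left_mono)
    show "\<bar>cl s - cl t\<bar> \<le> \<bar>s - t\<bar>" unfolding cl_def by linarith
    show "0 \<le> real i * (1 + real (Suc k) * B) * h ^ j"
      using B(1) h by (intro mult_nonneg_nonneg) (simp_all del: of_nat_Suc)
  qed
  finally show ?thesis by (simp only: cl[of s] cl[of t])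
qed

end

lemma relu_pow_0_eq: "(p < s \<longleftrightarrow> p < t) \<Longrightarrow> relu_pow 0 (s - p) = relu_pow 0 (t - p)"
  by (auto simp: relu_pow_eq)

text \<open>With exponent 0 every summand is a multiple of a Heaviside function, so the kernel can
  change its value only across \<open>b\<close> or a node.\<close>

lemma kern_0_jump:
  assumes "kern k 0 \<beta> h b s \<noteq> kern k 0 \<beta> h b t"
  shows "\<exists>p\<in>insert b ((\<lambda>r. \<beta> + h * lnode k r) ` {..k}). min s t \<le> p \<and> p \<le> max s t"
proof (rule ccontr)
  assume "\<not> ?thesis"
  then have n: "p < s \<longleftrightarrow> p < t" if "p \<in> insert b ((\<lambda>r. \<beta> + h * lnode k r) ` {..k})" for p
    using that by (auto simp: min_def max_def not_le split: if_splits)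
  have "kern k 0 \<beta> h b s = kern k 0 \<beta> h b t"
    unfolding kern_def by (intro arg_cong2[of _ _ _ _ "(-)"] sum.cong refl arg_cong2[of _ _ _ _ "(*)"] relu_pow_0_eq n) auto
  with assms show False by simp
qed

lemma kern_measurable [measurable]:
  "kern k i \<beta> h b \<in> borel_measurable borel"
  unfolding kern_def by measurable

section \<open>Slabs and singular weights\<close>

lemma norm_le_sqrt_card_cube:
  fixes x :: "real^'n::finite"
  assumes "x \<in> cbox 0 1"
  shows "norm x \<le> real CARD('n)"
proof -
  have "norm x \<le> (\<Sum>i\<in>UNIV. \<bar>x $ i\<bar>)" by (rule norm_le_l1_cart)
  also have "\<dots> \<le> (\<Sum>i\<in>(UNIV::'n set). 1)"
    using assms by (intro sum_mono) (auto simp: mem_box_cart)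
  finally show ?thesis by simp
qed

lemma emeasure_unit_cube: "emeasure lborel (cbox 0 1 :: (real^'n::finite) set) = 1"
proof -
  have "emeasure lborel (cbox 0 1 :: (real^'n) set) = ennreal (measure lborel (cbox 0 1 :: (real^'n) set))"
    by (rule emeasure_eq_ennreal_measure) (use emeasure_lborel_cbox_finite[of "0::real^'n" 1] in auto)
  also have "measure lborel (cbox 0 1 :: (real^'n) set) = 1"
    by (subst content_cbox_cart) (auto simp: interval_ne_empty_cart)
  finally show ?thesis by simp
qed

text \<open>Many disjoint translates of a thin slab fit into a bounded box.\<close>
lemma emeasure_cube_thin_slab:
  fixes \<omega> :: "real^'n::finite"
  assumes \<omega>: "\<omega> \<in> sphere 0 1" and h: "0 < h" "h < 1"
  shows "emeasure lborel {x \<in> cbox 0 1. a \<le> \<omega> \<bullet> x \<and> \<omega> \<bullet> x \<le> a + h}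
     \<le> ennreal ((1 + 8 * real CARD('n)) ^ CARD('n) * h)"
proof -
  let ?D = "real CARD('n)"
  have D: "?D \<ge> 1" by (simp add: Suc_leI)
  define S where "S = {x \<in> cbox 0 1. a \<le> \<omega> \<bullet> x \<and> \<omega> \<bullet> x \<le> a + h}"
  have "S = cbox 0 1 \<inter> {x. \<omega> \<bullet> x \<ge> a} \<inter> {x. \<omega> \<bullet> x \<le> a + h}" by (auto simp: S_def)
  then have S [measurable]: "S \<in> sets borel"
    by (auto intro!: borel_closed closed_Int closed_halfspace_ge closed_halfspace_le)
  have "\<exists>i. \<bar>\<omega> $ i\<bar> \<ge> 1 / ?D"
  proof (rule ccontr)
    assume "\<not> ?thesis"
    then have "(\<Sum>i\<in>UNIV. \<bar>\<omega> $ i\<bar>) < (\<Sum>i\<in>(UNIV::'n set). 1 / ?D)"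
      by (intro sum_strict_mono) (auto simp: not_le)
    with norm_le_l1_cart[of \<omega>] \<omega> show False by simp
  qed
  then obtain i where i: "\<bar>\<omega> $ i\<bar> \<ge> 1 / ?D" by blast
  \<comment> \<open>Some coordinate of the unit vector is at least 1/d in modulus; moving along it
    by 2 h d changes \<open>\<omega> \<bullet> x\<close> by at least 2 h, so that the translated
    slabs are disjoint.\<close>
  define v :: "real^'n" where "v = axis i (2 * h * ?D * sgn (\<omega> $ i))"
  have "\<omega> \<bullet> v = 2 * h * ?D * \<bar>\<omega> $ i\<bar>"
    by (simp add: v_def inner_axis abs_sgn mult_ac)
  moreover have "2 * h * ?D * (1 / ?D) \<le> 2 * h * ?D * \<bar>\<omega> $ i\<bar>"
    using h by (intro mult_left_mono i) auto
  ultimately have wv: "\<omega> \<bullet> v \<ge> 2 * h" by simp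
  \<comment> \<open>About 1/h translates are used; their total displacement is at most 4 d, so they
    lie in a box whose size does not depend on \<open>h\<close>.\<close>
  define L where "L = nat \<lceil>1 / h\<rceil>"
  have L: "1 / h \<le> real L" "real L \<le> 2 / h"
  proof -
    have "1 / h > 1" using h by simp
    then have "real L = of_int \<lceil>1 / h\<rceil>" unfolding L_def by simp
    moreover have "of_int \<lceil>1 / h\<rceil> \<le> 1 / h + 1" "1 / h \<le> of_int \<lceil>1 / h\<rceil>" by linarith+
    moreover have "2 / h = 1 / h + 1 / h" by simp
    ultimately show "1 / h \<le> real L" "real L \<le> 2 / h" using \<open>1 / h > 1\<close> by linarith+
  qed
  define F where "F l = {x. x - real l *\<^sub>R v \<in> S}" for l :: nat
  have F_meas: "F l \<in> sets borel" for l
  proof -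
    have "F l = (\<lambda>x. x - real l *\<^sub>R v) -` S \<inter> space borel" by (auto simp: F_def)
    also have "\<dots> \<in> sets borel" by (rule measurable_sets[OF _ S]) measurable
    finally show ?thesis .
  qed
  have F_em: "emeasure lborel (F l) = emeasure lborel S" for l
  proof -
    have "emeasure lborel (F l) = emeasure (distr lborel borel ((+) (real l *\<^sub>R v))) (F l)"
      by (simp add: lborel_distr_plus)
    also have "\<dots> = emeasure lborel S"
      using F_meas[of l] by (subst emeasure_distr) (auto simp: F_def intro!: arg_cong[of _ _ "emeasure lborel"])
    finally show ?thesis .
  qed
  have less: "F l \<inter> F l' = {}" if "l < l'" for l l'
  proof (rule ccontr)
    assume "F l \<inter> F l' \<noteq> {}"
    then obtain x where x: "x - real l *\<^sub>R v \<in> S" "x - real l' *\<^sub>R v \<in> S" by (auto simp: F_def)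
    then have 1: "\<omega> \<bullet> x - real l * (\<omega> \<bullet> v) \<le> a + h" "a \<le> \<omega> \<bullet> x - real l' * (\<omega> \<bullet> v)"
      by (auto simp: S_def inner_diff_right)
    have "(real l' - real l) * (\<omega> \<bullet> v) \<ge> 1 * (2 * h)" using that wv h by (intro mult_mono) auto
    with 1 h show False by (simp add: algebra_simps)
  qed
  have disj: "disjoint_family_on F {..<L}"
    unfolding disjoint_family_on_def using less by (metis inf_commute nat_neq_iff)
  have sub: "F l \<subseteq> cbox (\<chi> i. - (4 * ?D)) (\<chi> i. 1 + 4 * ?D)" if "l < L" for l
  proof
    fix x assume "x \<in> F l"
    then have x: "x - real l *\<^sub>R v \<in> cbox 0 1" by (auto simp: F_def S_def)
    have vb: "\<bar>real l * v $ j\<bar> \<le> 4 * ?D" for j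
    proof -
      have "\<bar>v $ j\<bar> \<le> 2 * h * ?D" using h by (auto simp: v_def axis_def abs_mult sgn_if)
      then have "\<bar>real l * v $ j\<bar> \<le> real L * (2 * h * ?D)" using that unfolding abs_mult by (intro mult_mono) auto
      also have "\<dots> \<le> 2 / h * (2 * h * ?D)" using h by (intro mult_right_mono L) auto
      finally show ?thesis using h by simp
    qed
    show "x \<in> cbox (\<chi> i. - (4 * ?D)) (\<chi> i. 1 + 4 * ?D)"
      unfolding mem_box_cart
    proof
      fix j
      have "0 \<le> x $ j - real l * v $ j" "x $ j - real l * v $ j \<le> 1" using x by (auto simp: mem_box_cart)
      with vb[of j] show "(\<chi> i. - (4 * ?D)) $ j \<le> x $ j \<and> x $ j \<le> (\<chi> i. 1 + 4 * ?D) $ j" by simp linarith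
    qed
  qed
  have "real L * emeasure lborel S = (\<Sum>l<L. emeasure lborel (F l))" by (simp add: F_em ennreal_of_nat_eq_real_of_nat)
  also have "\<dots> = emeasure lborel (\<Union>l<L. F l)"
    by (rule sum_emeasure) (use F_meas disj in auto)
  also have "\<dots> \<le> emeasure lborel (cbox (\<chi> i. - (4 * ?D)) (\<chi> i. 1 + 4 * ?D) :: (real^'n) set)"
    using sub by (intro emeasure_mono) auto
  also have "\<dots> = ennreal (measure lborel (cbox (\<chi> i. - (4 * ?D)) (\<chi> i. 1 + 4 * ?D) :: (real^'n) set))"
    by (rule emeasure_eq_ennreal_measure)
      (use emeasure_lborel_cbox_finite[of "\<chi> i. - (4 * ?D) :: real^'n" "\<chi> i. 1 + 4 * ?D"] in auto)
  also have "measure lborel (cbox (\<chi> i. - (4 * ?D)) (\<chi> i. 1 + 4 * ?D) :: (real^'n) set) = (1 + 8 * ?D) ^ CARD('n)"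
    by (subst content_cbox_cart) (auto simp: interval_ne_empty_cart add.commute)
  finally have "ennreal (real L) * emeasure lborel S \<le> ennreal ((1 + 8 * ?D) ^ CARD('n))" .
  moreover have fin: "emeasure lborel S = ennreal (measure lborel S)"
  proof (rule emeasure_eq_ennreal_measure)
    have "emeasure lborel S \<le> emeasure lborel (cbox 0 1 :: (real^'n) set)"
      by (intro emeasure_mono) (auto simp: S_def)
    then show "emeasure lborel S \<noteq> top" by (auto simp: emeasure_unit_cube top_unique)
  qed
  ultimately have "real L * measure lborel S \<le> (1 + 8 * ?D) ^ CARD('n)"
    by (simp add: ennreal_mult[symmetric])
  moreover have "1 / h * measure lborel S \<le> real L * measure lborel S" by (intro mult_right_mono L) auto
  ultimately have "1 / h * measure lborel S \<le> (1 + 8 * ?D) ^ CARD('n)" by linarith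
  then have "measure lborel S \<le> (1 + 8 * ?D) ^ CARD('n) * h" using h by (simp add: pos_divide_le_eq)
  then show ?thesis unfolding S_def[symmetric] fin by (rule ennreal_leI)
qed

text \<open>Slabs thicker than 1 are bounded by the cube; the degenerate slab \<open>h = 0\<close>
  is contained in arbitrarily thin ones.\<close>

lemma emeasure_cube_slab:
  obtains C :: real where "C > 0"
    "\<And>(\<omega>::real^'n::finite) a h. \<omega> \<in> sphere 0 1 \<Longrightarrow> h \<ge> 0 \<Longrightarrow>
       emeasure lborel {x \<in> cbox 0 1. a \<le> \<omega> \<bullet> x \<and> \<omega> \<bullet> x \<le> a + h} \<le> ennreal (C * h)"
proof -
  define C where "C = (1 + 8 * real CARD('n)) ^ CARD('n)"
  have C: "C \<ge> 1" unfolding C_def by (intro one_le_power) auto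
  show ?thesis
  proof (rule that[of C])
    show "C > 0" using C by simp
    fix \<omega> :: "real^'n" and a h :: real assume \<omega>: "\<omega> \<in> sphere 0 1" and h: "h \<ge> 0"
    let ?S = "\<lambda>h. {x \<in> cbox 0 1. a \<le> \<omega> \<bullet> x \<and> \<omega> \<bullet> x \<le> a + h}"
    have sets: "?S h \<in> sets lborel" for h
    proof -
      have "?S h = cbox 0 1 \<inter> {x. \<omega> \<bullet> x \<ge> a} \<inter> {x. \<omega> \<bullet> x \<le> a + h}" by auto
      then show ?thesis by (auto intro!: borel_closed closed_Int closed_halfspace_ge closed_halfspace_le)
    qed
    consider "h \<ge> 1" | "0 < h" "h < 1" | "h = 0" using h by linarith
    then show "emeasure lborel (?S h) \<le> ennreal (C * h)"
    proof cases
      case 1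
      have "emeasure lborel (?S h) \<le> emeasure lborel (cbox 0 1 :: (real^'n) set)" by (intro emeasure_mono) auto
      also have "\<dots> \<le> ennreal (C * h)" using mult_mono[OF C 1] C 1 by (simp add: emeasure_unit_cube)
      finally show ?thesis .
    next
      case 2
      then show ?thesis using emeasure_cube_thin_slab[OF \<omega>, of h a] by (simp add: C_def)
    next
      case 3
      show ?thesis
      proof (rule ennreal_le_epsilon)
        fix e :: real assume e: "e > 0"
        define e' where "e' = min (e / C) (1 / 2)"
        have e': "0 < e'" "e' < 1" "C * e' \<le> e" using e C by (auto simp: e'_def min_def field_simps)
        have "emeasure lborel (?S h) \<le> emeasure lborel (?S e')"
          using 3 e' by (intro emeasure_mono sets) auto
        also have "\<dots> \<le> ennreal (C * e')" using emeasure_cube_thin_slab[OF \<omega> e'(1,2), of a] by (simp add: C_def)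
        also have "\<dots> \<le> ennreal e" using e' by (intro ennreal_leI)
        finally show "emeasure lborel (?S h) \<le> ennreal (C * h) + ennreal e" using 3 by simp
      qed
    qed
  qed
qed

section \<open>Scaling of the truncated singular weight\<close>

lemma emeasure_cball_le:
  obtains V :: real where "V > 0" "\<And>r. r \<ge> 0 \<Longrightarrow> emeasure lborel (cball (0::real^'n::finite) r) \<le> ennreal (V * r ^ CARD('n))"
proof -
  have "emeasure lborel (cball (0::real^'n) r) = ennreal (unit_ball_vol (real CARD('n)) * r ^ CARD('n))" if "r \<ge> 0" for r
    using emeasure_cball[OF that, of "0::real^'n"] by simp
  moreover have "unit_ball_vol (real CARD('n)) > 0" by (rule unit_ball_vol_pos) simp
  ultimately show ?thesis using that[of "unit_ball_vol (real CARD('n))"] by simp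
qed

lemma ennreal_suminf_geometric_le:
  fixes c q :: real
  assumes "c \<ge> 0" "0 \<le> q" "q < 1"
  shows "(\<Sum>i. ennreal (c * q ^ i)) = ennreal (c / (1 - q))"
proof -
  have "(\<lambda>i. c * q ^ i) sums (c * (1 / (1 - q)))"
    using assms by (intro sums_mult geometric_sums) auto
  then show ?thesis using assms by (subst suminf_ennreal2) (auto simp: sums_iff)
qed

lemma dyadic_floor:
  fixes x :: real assumes "x \<ge> 1"
  obtains i :: nat where "2 ^ i \<le> x" "x < 2 ^ Suc i"
proof -
  define i where "i = nat \<lfloor>log 2 x\<rfloor>"
  have "0 \<le> log 2 x" using assms by simp
  then have "real i \<le> log 2 x" "log 2 x < real (Suc i)" unfolding i_def by linarith+
  then have "2 powr real i \<le> x" "x < 2 powr real (Suc i)"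
    using assms by (simp_all add: le_log_iff log_less_iff)
  then show ?thesis using that[of i] by (simp add: powr_realpow del: of_nat_Suc)
qed

text \<open>Proved by summing over dyadic shells.\<close>
lemma singular_weight_integral:
  fixes \<theta> :: real and \<gamma> :: nat
  assumes th: "0 < \<theta>" "2 * \<theta> < real \<gamma>"
  obtains C :: real where "C > 0"
    "\<And>h. h > 0 \<Longrightarrow>
      (\<integral>\<^sup>+z. ennreal (min 1 ((norm z / h) ^ \<gamma>) / norm z powr (real CARD('n::finite) + 2 * \<theta>)) \<partial>(lborel :: (real^'n) measure))
        \<le> ennreal (C * h powr (- (2 * \<theta>)))"
proof -
  let ?n = "CARD('n)"
  define a where "a = real ?n + 2 * \<theta>"
  have a: "a > 0" using th by (simp add: a_def)
  obtain V :: real where V: "V > 0" "\<And>r. r \<ge> 0 \<Longrightarrow> emeasure lborel (cball (0::real^'n) r) \<le> ennreal (V * r ^ ?n)"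
    using emeasure_cball_le[where 'n='n] by blast
  \<comment> \<open>Ratios of the two geometric series: the outer shells sum up because \<theta> is
    positive, the inner ones because 2 \<theta> < \<gamma>.\<close>
  define q1 where "q1 = 2 powr (- (2 * \<theta>))"
  define q2 where "q2 = 2 powr (- (real \<gamma> - 2 * \<theta>))"
  have q: "0 < q1" "q1 < 1" "0 < q2" "q2 < 1"
    using th by (auto simp: q1_def q2_def powr_less_one)
  define c1 where "c1 = V * 2 ^ ?n"
  define c2 where "c2 = V * 2 powr a"
  define C where "C = c1 / (1 - q1) + c2 / (1 - q2)"
  have c: "c1 > 0" "c2 > 0" using V by (auto simp: c1_def c2_def)
  show ?thesis
  proof (rule that[of C])
    show "C > 0" using c q by (auto simp: C_def intro!: add_pos_pos divide_pos_pos)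
    fix h :: real assume h: "h > 0"
    define f :: "real^'n \<Rightarrow> real" where "f z = min 1 ((norm z / h) ^ \<gamma>) / norm z powr a" for z
    \<comment> \<open>Upper bounds for the integrand on the shells 2^i h \<le> |z| < 2^(i+1) h and h
      / 2^(i+1) \<le> |z| \<le> h / 2^i; each bound is then spread over the full ball containing its
      shell.\<close>
    define d1 where "d1 i = (2 ^ i * h) powr (- a)" for i :: nat
    define d2 where "d2 i = (1 / 2 ^ i) ^ \<gamma> * (h / 2 ^ Suc i) powr (- a)" for i :: nat
    have d_nn: "d1 i \<ge> 0" "d2 i \<ge> 0" for i by (auto simp: d1_def d2_def)
    define g1 where "g1 i z = ennreal (d1 i) * indicator (cball 0 (2 ^ Suc i * h)) z" for i and z :: "real^'n"
    define g2 where "g2 i z = ennreal (d2 i) * indicator (cball 0 (h / 2 ^ i)) z" for i and z :: "real^'n"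
    have [measurable]: "g1 i \<in> borel_measurable borel" "g2 i \<in> borel_measurable borel" for i
      unfolding g1_def g2_def
      by (intro borel_measurable_times_ennreal borel_measurable_const borel_measurable_indicator borel_closed closed_cball)+
    have "ennreal (f z) \<le> (\<Sum>i. g1 i z) + (\<Sum>i. g2 i z)" for z
    proof (cases "z = 0")
      case True
      then show ?thesis by (simp add: f_def)
    next
      case False
      then have nz: "norm z > 0" by simp
      show ?thesis
      proof (cases "norm z \<ge> h")
        case True
        then have "norm z / h \<ge> 1" using h by simp
        then obtain i where i: "2 ^ i \<le> norm z / h" "norm z / h < 2 ^ Suc i" using dyadic_floor by blast
        have "f z \<le> 1 / norm z powr a" unfolding f_def by (intro divide_right_mono) auto
        also have "\<dots> = norm z powr (- a)" by (rule powr_minus_divide[symmetric])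
        also have "\<dots> \<le> d1 i" unfolding d1_def using i h a by (intro powr_mono2') (auto simp: field_simps)
        finally have "ennreal (f z) \<le> g1 i z" using i h by (auto simp: g1_def field_simps intro: ennreal_leI)
        also have "\<dots> \<le> (\<Sum>i. g1 i z)" using sum_le_suminf[of "\<lambda>i. g1 i z" "{i}"] by simp
        also have "\<dots> \<le> (\<Sum>i. g1 i z) + (\<Sum>i. g2 i z)" by simp
        finally show ?thesis .
      next
        case False
        then have "h / norm z \<ge> 1" using nz by simp
        then obtain i where i: "2 ^ i \<le> h / norm z" "h / norm z < 2 ^ Suc i" using dyadic_floor by blast
        have z1: "norm z \<le> h / 2 ^ i" "h / 2 ^ Suc i \<le> norm z"
          using i nz h by (simp_all add: field_simps)
        have "norm z / h \<le> 1 / 2 ^ i" using z1(1) h by (simp add: field_simps)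
        then have "(norm z / h) ^ \<gamma> \<le> (1 / 2 ^ i) ^ \<gamma>" using h by (intro power_mono) auto
        then have "f z \<le> (1 / 2 ^ i) ^ \<gamma> / norm z powr a" unfolding f_def by (intro divide_right_mono) auto
        also have "\<dots> = (1 / 2 ^ i) ^ \<gamma> * norm z powr (- a)" by (simp add: powr_minus_divide)
        also have "\<dots> \<le> d2 i" unfolding d2_def using z1 h a by (intro mult_left_mono powr_mono2') auto
        finally have "ennreal (f z) \<le> g2 i z" using z1 by (auto simp: g2_def intro: ennreal_leI)
        also have "\<dots> \<le> (\<Sum>i. g2 i z)" using sum_le_suminf[of "\<lambda>i. g2 i z" "{i}"] by simp
        also have "\<dots> \<le> (\<Sum>i. g1 i z) + (\<Sum>i. g2 i z)" by simp
        finally show ?thesis .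
      qed
    qed
    then have "(\<integral>\<^sup>+z. ennreal (f z) \<partial>lborel) \<le> (\<integral>\<^sup>+z. (\<Sum>i. g1 i z) + (\<Sum>i. g2 i z) \<partial>lborel)"
      by (intro nn_integral_mono) auto
    also have "\<dots> = (\<integral>\<^sup>+z. (\<Sum>i. g1 i z) \<partial>lborel) + (\<integral>\<^sup>+z. (\<Sum>i. g2 i z) \<partial>lborel)"
      by (rule nn_integral_add) measurable
    also have "(\<integral>\<^sup>+z. (\<Sum>i. g1 i z) \<partial>lborel) = (\<Sum>i. \<integral>\<^sup>+z. g1 i z \<partial>lborel)"
      by (rule nn_integral_suminf) measurable
    also have "(\<integral>\<^sup>+z. (\<Sum>i. g2 i z) \<partial>lborel) = (\<Sum>i. \<integral>\<^sup>+z. g2 i z \<partial>lborel)"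
      by (rule nn_integral_suminf) measurable
    also have "(\<Sum>i. \<integral>\<^sup>+z. g1 i z \<partial>lborel) + (\<Sum>i. \<integral>\<^sup>+z. g2 i z \<partial>lborel)
        \<le> (\<Sum>i. ennreal (c1 * h powr (- (2 * \<theta>)) * q1 ^ i)) + (\<Sum>i. ennreal (c2 * h powr (- (2 * \<theta>)) * q2 ^ i))"
    proof (intro add_mono suminf_le)
      fix i :: nat
      have p2: "2 powr (real i) = 2 ^ i" by (simp add: powr_realpow)
      have "(\<integral>\<^sup>+z. g1 i z \<partial>lborel) \<le> ennreal (d1 i) * ennreal (V * (2 ^ Suc i * h) ^ ?n)"
        unfolding g1_def using h V(2)[of "2 ^ Suc i * h"]
        by (subst nn_integral_cmult_indicator) (auto intro!: mult_left_mono)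
      also have "\<dots> = ennreal (d1 i * (V * (2 ^ Suc i * h) ^ ?n))"
        using d_nn V h by (subst ennreal_mult) auto
      also have "d1 i * (V * (2 ^ Suc i * h) ^ ?n) = c1 * ((2 ^ i * h) powr (- a) * (2 ^ i * h) ^ ?n)"
        by (simp add: d1_def c1_def power_mult_distrib mult_ac)
      also have "(2 ^ i * h) powr (- a) * (2 ^ i * h) ^ ?n = (2 ^ i * h) powr (- (2 * \<theta>))"
        using h by (simp add: a_def powr_realpow[symmetric] powr_add[symmetric])
      also have "\<dots> = h powr (- (2 * \<theta>)) * q1 ^ i"
        using h by (simp add: q1_def powr_mult p2[symmetric] powr_powr powr_realpow[symmetric] mult_ac)
      finally show "(\<integral>\<^sup>+z. g1 i z \<partial>lborel) \<le> ennreal (c1 * h powr (- (2 * \<theta>)) * q1 ^ i)" by (simp add: mult_ac)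
      have "(\<integral>\<^sup>+z. g2 i z \<partial>lborel) \<le> ennreal (d2 i) * ennreal (V * (h / 2 ^ i) ^ ?n)"
        unfolding g2_def using h V(2)[of "h / 2 ^ i"]
        by (subst nn_integral_cmult_indicator) (auto intro!: mult_left_mono)
      also have "\<dots> = ennreal (d2 i * (V * (h / 2 ^ i) ^ ?n))"
        using d_nn V h by (subst ennreal_mult) auto
      also have "(h / 2 ^ Suc i) powr (- a) = 2 powr a * (h / 2 ^ i) powr (- a)"
        using h by (simp add: powr_divide powr_mult powr_minus field_simps)
      then have "d2 i * (V * (h / 2 ^ i) ^ ?n) = c2 * ((1 / 2 ^ i) ^ \<gamma> * ((h / 2 ^ i) powr (- a) * (h / 2 ^ i) ^ ?n))"
        by (simp add: d2_def c2_def)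
      also have "(h / 2 ^ i) powr (- a) * (h / 2 ^ i) ^ ?n = (h / 2 ^ i) powr (- (2 * \<theta>))"
        using h by (simp add: a_def powr_realpow[symmetric] powr_add[symmetric])
      also have "(1 / 2 ^ i) ^ \<gamma> * (h / 2 ^ i) powr (- (2 * \<theta>)) = h powr (- (2 * \<theta>)) * q2 ^ i"
      proof -
        have "(1 / 2 ^ i) ^ \<gamma> = 2 powr (- (real i * real \<gamma>))"
          by (simp add: power_divide powr_minus_divide powr_realpow[symmetric] powr_powr p2[symmetric])
        moreover have "(h / 2 ^ i) powr (- (2 * \<theta>)) = h powr (- (2 * \<theta>)) * 2 powr (real i * (2 * \<theta>))"
          using h by (simp add: powr_divide p2[symmetric] powr_powr powr_minus field_simps)
        moreover have "q2 ^ i = 2 powr (- (real i * real \<gamma>) + real i * (2 * \<theta>))"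
          using q by (simp add: q2_def powr_realpow[symmetric] powr_powr algebra_simps)
        ultimately show ?thesis by (simp only: powr_add mult_ac)
      qed
      finally show "(\<integral>\<^sup>+z. g2 i z \<partial>lborel) \<le> ennreal (c2 * h powr (- (2 * \<theta>)) * q2 ^ i)" by (simp add: mult_ac)
    qed auto
    also have "\<dots> = ennreal (c1 * h powr (- (2 * \<theta>)) / (1 - q1)) + ennreal (c2 * h powr (- (2 * \<theta>)) / (1 - q2))"
      using c q h by (subst (1 2) ennreal_suminf_geometric_le) auto
    also have "\<dots> = ennreal (c1 * h powr (- (2 * \<theta>)) / (1 - q1) + c2 * h powr (- (2 * \<theta>)) / (1 - q2))"
      using c q h by (intro ennreal_plus[symmetric]) auto
    also have "c1 * h powr (- (2 * \<theta>)) / (1 - q1) + c2 * h powr (- (2 * \<theta>)) / (1 - q2) = C * h powr (- (2 * \<theta>))"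
      by (simp add: C_def algebra_simps)
    finally show "(\<integral>\<^sup>+z. ennreal (min 1 ((norm z / h) ^ \<gamma>) / norm z powr (real ?n + 2 * \<theta>)) \<partial>(lborel :: (real^'n) measure))
        \<le> ennreal (C * h powr (- (2 * \<theta>)))"
      by (simp add: f_def a_def)
  qed
qed

section \<open>Sobolev energies of ridge functions\<close>

lemma nn_integral_lebesgue_on_borel:
  fixes f :: "real^'n \<Rightarrow> ennreal"
  assumes "f \<in> borel_measurable borel"
  shows "(\<integral>\<^sup>+x. f x \<partial>lebesgue_on (cbox a b)) = (\<integral>\<^sup>+x. f x * indicator (cbox a b) x \<partial>lborel)"
proof -
  have "(\<integral>\<^sup>+x. f x \<partial>lebesgue_on (cbox a b)) = (\<integral>\<^sup>+x. f x * indicator (cbox a b) x \<partial>lebesgue)"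
    by (subst nn_integral_restrict_space) auto
  also have "\<dots> = (\<integral>\<^sup>+x. f x * indicator (cbox a b) x \<partial>lborel)"
    by (rule nn_integral_completion)
  finally show ?thesis .
qed

lemma L2_norm_sq_borel:
  fixes g :: "real^'n \<Rightarrow> complex"
  assumes [measurable]: "g \<in> borel_measurable borel"
  shows "L2_norm_sq (cbox 0 1) g = (\<integral>\<^sup>+x. ennreal ((norm (g x))\<^sup>2) * indicator (cbox 0 1) x \<partial>lborel)"
  unfolding L2_norm_sq_def by (rule nn_integral_lebesgue_on_borel) measurable

lemma slobodeckij_sq_borel:
  fixes g :: "real^'n \<Rightarrow> complex"
  assumes [measurable]: "g \<in> borel_measurable borel"
  shows "slobodeckij_sq \<theta> (cbox 0 1) g =
    (\<integral>\<^sup>+x. \<integral>\<^sup>+y. ennreal ((norm (g x - g y))\<^sup>2 / norm (x - y) powr (real CARD('n) + 2 * \<theta>)) * indicator (cbox 0 1) y \<partial>lborel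
       * indicator (cbox 0 1) x \<partial>lborel)"
proof -
  have 1: "(\<integral>\<^sup>+y. ennreal ((norm (g x - g y))\<^sup>2 / norm (x - y) powr (real CARD('n) + 2 * \<theta>)) \<partial>lebesgue_on (cbox 0 1)) =
     (\<integral>\<^sup>+y. ennreal ((norm (g x - g y))\<^sup>2 / norm (x - y) powr (real CARD('n) + 2 * \<theta>)) * indicator (cbox 0 1) y \<partial>lborel)" for x
    by (rule nn_integral_lebesgue_on_borel) measurable
  show ?thesis unfolding slobodeckij_sq_def 1
    by (rule nn_integral_lebesgue_on_borel) measurable
qed

lemma nn_integral_lborel_shift:
  fixes f :: "real^'n \<Rightarrow> ennreal"
  assumes [measurable]: "f \<in> borel_measurable borel"
  shows "(\<integral>\<^sup>+y. f y \<partial>lborel) = (\<integral>\<^sup>+z. f (x + z) \<partial>lborel)"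
proof -
  have "(\<integral>\<^sup>+y. f y \<partial>lborel) = (\<integral>\<^sup>+y. f y \<partial>distr lborel borel ((+) x))"
    by (simp add: lborel_distr_plus)
  also have "\<dots> = (\<integral>\<^sup>+z. f (x + z) \<partial>lborel)"
    by (subst nn_integral_distr) auto
  finally show ?thesis .
qed

text \<open>Substituting y = x + z and exchanging the integrals isolates the weight |z|^(-(d + 2
  \<theta>)); what remains is the integral over x of the squared difference by a fixed
  shift.\<close>

lemma slobodeckij_sq_le:
  fixes u :: "real^'n \<Rightarrow> complex" and \<gamma> :: nat
  assumes u [measurable]: "u \<in> borel_measurable borel" and "B \<ge> 0" "h > 0"
    and inner: "\<And>z. (\<integral>\<^sup>+x. ennreal ((norm (u x - u (x + z)))\<^sup>2) * indicator (cbox 0 1) x * indicator (cbox 0 1) (x + z) \<partial>lborel)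
       \<le> ennreal (B * min 1 ((norm z / h) ^ \<gamma>))"
    and W: "(\<integral>\<^sup>+z. ennreal (min 1 ((norm z / h) ^ \<gamma>) / norm z powr (real CARD('n) + 2 * \<theta>)) \<partial>(lborel :: (real^'n) measure))
        \<le> ennreal W"
  shows "slobodeckij_sq \<theta> (cbox 0 1) u \<le> ennreal (B * W)"
proof -
  let ?a = "real CARD('n) + 2 * \<theta>"
  let ?\<Omega> = "cbox 0 1 :: (real^'n) set"
  have "slobodeckij_sq \<theta> ?\<Omega> u =
    (\<integral>\<^sup>+x. \<integral>\<^sup>+z. ennreal (1 / norm z powr ?a) * (ennreal ((norm (u x - u (x + z)))\<^sup>2) * indicator ?\<Omega> x * indicator ?\<Omega> (x + z)) \<partial>lborel \<partial>lborel)"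
    unfolding slobodeckij_sq_borel[OF u]
  proof (intro nn_integral_cong)
    fix x :: "real^'n"
    have "(\<integral>\<^sup>+y. ennreal ((norm (u x - u y))\<^sup>2 / norm (x - y) powr ?a) * indicator ?\<Omega> y \<partial>lborel) * indicator ?\<Omega> x =
       (\<integral>\<^sup>+y. (ennreal ((norm (u x - u y))\<^sup>2 / norm (x - y) powr ?a) * indicator ?\<Omega> y) * indicator ?\<Omega> x \<partial>lborel)"
      by (subst nn_integral_multc) auto
    also have "\<dots> = (\<integral>\<^sup>+z. (ennreal ((norm (u x - u (x + z)))\<^sup>2 / norm (x - (x + z)) powr ?a) * indicator ?\<Omega> (x + z)) * indicator ?\<Omega> x \<partial>lborel)"
      by (rule nn_integral_lborel_shift) measurable
    also have "\<dots> = (\<integral>\<^sup>+z. ennreal (1 / norm z powr ?a) * (ennreal ((norm (u x - u (x + z)))\<^sup>2) * indicator ?\<Omega> x * indicator ?\<Omega> (x + z)) \<partial>lborel)"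
      by (intro nn_integral_cong) (auto simp: ennreal_mult[symmetric] indicator_def)
    finally show "(\<integral>\<^sup>+y. ennreal ((norm (u x - u y))\<^sup>2 / norm (x - y) powr ?a) * indicator ?\<Omega> y \<partial>lborel) * indicator ?\<Omega> x = \<dots>" .
  qed
  also have "\<dots> = (\<integral>\<^sup>+z. \<integral>\<^sup>+x. ennreal (1 / norm z powr ?a) * (ennreal ((norm (u x - u (x + z)))\<^sup>2) * indicator ?\<Omega> x * indicator ?\<Omega> (x + z)) \<partial>lborel \<partial>lborel)"
    by (rule lborel_pair.Fubini'[symmetric]) measurable
  also have "\<dots> = (\<integral>\<^sup>+z. ennreal (1 / norm z powr ?a) * (\<integral>\<^sup>+x. ennreal ((norm (u x - u (x + z)))\<^sup>2) * indicator ?\<Omega> x * indicator ?\<Omega> (x + z) \<partial>lborel) \<partial>lborel)"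
    by (intro nn_integral_cong nn_integral_cmult) measurable
  also have "\<dots> \<le> (\<integral>\<^sup>+z. ennreal (1 / norm z powr ?a) * ennreal (B * min 1 ((norm z / h) ^ \<gamma>)) \<partial>(lborel :: (real^'n) measure))"
    by (intro nn_integral_mono mult_left_mono inner) auto
  also have "\<dots> = (\<integral>\<^sup>+z. ennreal B * ennreal (min 1 ((norm z / h) ^ \<gamma>) / norm z powr ?a) \<partial>(lborel :: (real^'n) measure))"
    using \<open>B \<ge> 0\<close> \<open>h > 0\<close> by (intro nn_integral_cong) (simp add: ennreal_mult[symmetric])
  also have "\<dots> = ennreal B * (\<integral>\<^sup>+z. ennreal (min 1 ((norm z / h) ^ \<gamma>) / norm z powr ?a) \<partial>(lborel :: (real^'n) measure))"
    by (rule nn_integral_cmult) measurable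
  also have "\<dots> \<le> ennreal B * ennreal W"
    by (intro mult_left_mono W) auto
  also have "\<dots> = ennreal (B * W)" using \<open>B \<ge> 0\<close> by (simp add: ennreal_mult')
  finally show ?thesis .
qed

section \<open>Differences of ridge functions under translation\<close>

lemma difference_integral_le:
  fixes u :: "real^'n \<Rightarrow> complex"
  assumes T: "T \<in> sets borel" "emeasure lborel T \<le> ennreal \<mu>" and "\<delta> \<ge> 0"
    and d: "\<And>x. x \<in> cbox 0 1 \<Longrightarrow> x + z \<in> cbox 0 1 \<Longrightarrow> norm (u x - u (x + z)) \<le> \<delta>"
      "\<And>x. x \<in> cbox 0 1 \<Longrightarrow> x + z \<in> cbox 0 1 \<Longrightarrow> u x \<noteq> u (x + z) \<Longrightarrow> x \<in> T"
  shows "(\<integral>\<^sup>+x. ennreal ((norm (u x - u (x + z)))\<^sup>2) * indicator (cbox 0 1) x * indicator (cbox 0 1) (x + z) \<partial>lborel)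
       \<le> ennreal (\<delta>\<^sup>2 * \<mu>)"
proof -
  have "(\<integral>\<^sup>+x. ennreal ((norm (u x - u (x + z)))\<^sup>2) * indicator (cbox 0 1) x * indicator (cbox 0 1) (x + z) \<partial>lborel)
      \<le> (\<integral>\<^sup>+x. ennreal (\<delta>\<^sup>2) * indicator T x \<partial>lborel)"
  proof (intro nn_integral_mono)
    fix x :: "real^'n"
    show "ennreal ((norm (u x - u (x + z)))\<^sup>2) * indicator (cbox 0 1) x * indicator (cbox 0 1) (x + z) \<le> ennreal (\<delta>\<^sup>2) * indicator T x"
    proof (cases "x \<in> cbox 0 1 \<and> x + z \<in> cbox 0 1 \<and> u x \<noteq> u (x + z)")
      case True
      then show ?thesis using d(1)[of x] d(2)[of x] by (auto intro!: ennreal_leI power_mono)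
    qed (auto simp: indicator_def)
  qed
  also have "\<dots> = ennreal (\<delta>\<^sup>2) * emeasure lborel T"
    using T by (subst nn_integral_cmult_indicator) auto
  also have "\<dots> \<le> ennreal (\<delta>\<^sup>2) * ennreal \<mu>" by (intro mult_left_mono T) auto
  also have "\<dots> = ennreal (\<delta>\<^sup>2 * \<mu>)" by (simp add: ennreal_mult')
  finally show ?thesis .
qed

lemma emeasure_Un_le:
  assumes "A \<in> sets M" "B \<in> sets M" "emeasure M A \<le> ennreal a" "emeasure M B \<le> ennreal b" "a \<ge> 0" "b \<ge> 0"
  shows "emeasure M (A \<union> B) \<le> ennreal (a + b)"
  using emeasure_subadditive[OF assms(1,2)] add_mono[OF assms(3,4)] assms(5,6)
  by (simp add: ennreal_plus[symmetric] del: ennreal_plus)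

definition slab :: "real^'n \<Rightarrow> real \<Rightarrow> real \<Rightarrow> (real^'n) set" where
  "slab \<omega> a h = {x \<in> cbox 0 1. a \<le> \<omega> \<bullet> x \<and> \<omega> \<bullet> x \<le> a + h}"

lemma slab_borel [measurable]: "slab \<omega> a h \<in> sets borel"
proof -
  have "slab \<omega> a h = cbox 0 1 \<inter> {x. \<omega> \<bullet> x \<ge> a} \<inter> {x. \<omega> \<bullet> x \<le> a + h}" by (auto simp: slab_def)
  then show ?thesis by (auto intro!: borel_closed closed_Int closed_halfspace_ge closed_halfspace_le)
qed

context
  fixes Cs :: real and \<omega> :: "real^'n"
  assumes Cs: "Cs > 0" and w: "\<omega> \<in> sphere 0 1"
    and slab: "\<And>a h. h \<ge> 0 \<Longrightarrow> emeasure lborel (slab \<omega> a h) \<le> ennreal (Cs * h)"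
begin

lemma inner_le_norm: "\<bar>\<omega> \<bullet> z\<bar> \<le> norm z"
  using Cauchy_Schwarz_ineq2[of \<omega> z] w by simp

text \<open>Two moduli of continuity: a Lipschitz profile gives (|z| / h)^2, a step profile only |z|
  / h, because near a jump its difference is of full size. In both cases the difference lives where
  x or x + z lies in a slab of measure of order h, which settles large shifts.\<close>

lemma ridge_difference_compact_support_le:
  assumes h: "h > 0" and "A \<ge> 0" and K: "\<And>t. \<bar>K t\<bar> \<le> A" "\<And>t. t < \<beta> \<or> \<beta> + h < t \<Longrightarrow> K t = 0"
    and \<gamma>: "(\<gamma> = 2 \<and> (\<forall>s t. \<bar>K s - K t\<bar> \<le> A / h * \<bar>s - t\<bar>)) \<or>
        (\<gamma> = 1 \<and> finite P \<and> (\<forall>s t. K s \<noteq> K t \<longrightarrow> (\<exists>p\<in>P. min s t \<le> p \<and> p \<le> max s t)))"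
  shows "(\<integral>\<^sup>+x. ennreal ((norm (complex_of_real (K (\<omega> \<bullet> x)) - of_real (K (\<omega> \<bullet> (x + z)))))\<^sup>2)
        * indicator (cbox 0 1) x * indicator (cbox 0 1) (x + z) \<partial>lborel)
       \<le> ennreal (8 * (1 + real (card P)) * Cs * A\<^sup>2 * h * min 1 ((norm z / h) ^ \<gamma>))"
proof -
  let ?u = "\<lambda>x. complex_of_real (K (\<omega> \<bullet> x))"
  have nd: "norm (?u x - ?u (x + z)) = \<bar>K (\<omega> \<bullet> x) - K (\<omega> \<bullet> x + \<omega> \<bullet> z)\<bar>" for x
    by (simp add: inner_add_right flip: of_real_diff)
  have two: "\<bar>K s - K t\<bar> \<le> 2 * A" for s t using K(1)[of s] K(1)[of t] by linarith
  define T1 where "T1 = slab \<omega> \<beta> h \<union> slab \<omega> (\<beta> - \<omega> \<bullet> z) h"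
  have T1: "T1 \<in> sets borel" "emeasure lborel T1 \<le> ennreal (2 * Cs * h)"
    using emeasure_Un_le[of "slab \<omega> \<beta> h" lborel "slab \<omega> (\<beta> - \<omega> \<bullet> z) h" "Cs * h" "Cs * h"] slab h Cs
    by (auto simp: T1_def mult.assoc intro: less_imp_le)
  have inT1: "x \<in> T1" if "x \<in> cbox 0 1" "?u x \<noteq> ?u (x + z)" for x
  proof (rule ccontr)
    assume "x \<notin> T1"
    then have "K (\<omega> \<bullet> x) = 0" "K (\<omega> \<bullet> x + \<omega> \<bullet> z) = 0"
      using that(1) by (auto simp: T1_def slab_def intro!: K(2))
    with that(2) show False by (simp add: inner_add_right)
  qed
  from \<gamma> show ?thesis
  proof
    assume g: "\<gamma> = 2 \<and> (\<forall>s t. \<bar>K s - K t\<bar> \<le> A / h * \<bar>s - t\<bar>)"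
    define \<mu> where "\<mu> = min 1 (norm z / h)"
    have mu: "0 \<le> \<mu>" "\<mu>\<^sup>2 = min 1 ((norm z / h) ^ 2)"
    proof -
      show "0 \<le> \<mu>" using h by (simp add: \<mu>_def)
      show "\<mu>\<^sup>2 = min 1 ((norm z / h) ^ 2)"
      proof (cases "norm z / h \<le> 1")
        case True
        then have "(norm z / h) ^ 2 \<le> 1" using h by (intro power_le_one) auto
        with True show ?thesis by (simp add: \<mu>_def)
      next
        case False
        then have "(norm z / h) ^ 2 \<ge> 1" by (intro one_le_power) auto
        with False show ?thesis by (simp add: \<mu>_def)
      qed
    qed
    have "norm (?u x - ?u (x + z)) \<le> 2 * A * \<mu>" for x
    proof -
      have "\<bar>K (\<omega> \<bullet> x) - K (\<omega> \<bullet> x + \<omega> \<bullet> z)\<bar> \<le> A / h * \<bar>\<omega> \<bullet> x - (\<omega> \<bullet> x + \<omega> \<bullet> z)\<bar>" using g by blast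
      also have "\<dots> \<le> A / h * norm z" using inner_le_norm[of z] h \<open>A \<ge> 0\<close> by (intro mult_left_mono) auto
      also have "\<dots> \<le> 2 * A * (norm z / h)" using h \<open>A \<ge> 0\<close> by (simp add: field_simps)
      finally have "\<bar>K (\<omega> \<bullet> x) - K (\<omega> \<bullet> x + \<omega> \<bullet> z)\<bar> \<le> 2 * A * (norm z / h)" .
      with two[of "\<omega> \<bullet> x" "\<omega> \<bullet> x + \<omega> \<bullet> z"] show ?thesis unfolding nd \<mu>_def by (simp add: min_def)
    qed
    from difference_integral_le[OF T1, of "2 * A * \<mu>" z ?u, OF _ this inT1]
    have "(\<integral>\<^sup>+x. ennreal ((norm (?u x - ?u (x + z)))\<^sup>2) * indicator (cbox 0 1) x * indicator (cbox 0 1) (x + z) \<partial>lborel)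
        \<le> ennreal ((2 * A * \<mu>)\<^sup>2 * (2 * Cs * h))" using mu \<open>A \<ge> 0\<close> by auto
    also have "(2 * A * \<mu>)\<^sup>2 * (2 * Cs * h) = 8 * Cs * A\<^sup>2 * h * min 1 ((norm z / h) ^ 2)"
      by (simp add: power_mult_distrib mu(2)[symmetric])
    also have "ennreal \<dots> \<le> ennreal (8 * (1 + real (card P)) * Cs * A\<^sup>2 * h * min 1 ((norm z / h) ^ 2))"
      using Cs h by (intro ennreal_leI mult_right_mono) (auto simp: algebra_simps)
    finally show ?thesis using g by simp
  next
    assume g: "\<gamma> = 1 \<and> finite P \<and> (\<forall>s t. K s \<noteq> K t \<longrightarrow> (\<exists>p\<in>P. min s t \<le> p \<and> p \<le> max s t))"
    have bound: "norm (?u x - ?u (x + z)) \<le> 2 * A" for x unfolding nd by (rule two)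
    show ?thesis
    proof (cases "norm z / h \<le> 1")
      case False
      from difference_integral_le[OF T1, of "2 * A" z ?u, OF _ bound inT1] \<open>A \<ge> 0\<close>
      have "(\<integral>\<^sup>+x. ennreal ((norm (?u x - ?u (x + z)))\<^sup>2) * indicator (cbox 0 1) x * indicator (cbox 0 1) (x + z) \<partial>lborel)
        \<le> ennreal ((2 * A)\<^sup>2 * (2 * Cs * h))" by auto
      also have "\<dots> \<le> ennreal (8 * (1 + real (card P)) * Cs * A\<^sup>2 * h)"
        using Cs h by (intro ennreal_leI) (auto simp: power_mult_distrib algebra_simps)
      finally show ?thesis using False g by simp
    next
      case True
      \<comment> \<open>A change of value requires a jump point between
        \<open>\<omega> \<bullet> x\<close> and \<open>\<omega> \<bullet> (x + z)\<close>, which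
        puts x into a slab of width \<open>2 * norm z\<close> around that point.\<close>
      define T2 where "T2 = (\<Union>p\<in>P. slab \<omega> (p - norm z) (2 * norm z))"
      have T2b: "T2 \<in> sets borel" using g unfolding T2_def by (intro sets.finite_UN) auto
      have "emeasure lborel T2 \<le> (\<Sum>p\<in>P. emeasure lborel (slab \<omega> (p - norm z) (2 * norm z)))"
        unfolding T2_def using g by (intro emeasure_subadditive_finite) auto
      also have "\<dots> \<le> (\<Sum>p\<in>P. ennreal (Cs * (2 * norm z)))" by (intro sum_mono slab) auto
      also have "\<dots> = ennreal (real (card P) * (Cs * (2 * norm z)))"
        using Cs by (subst sum_ennreal) auto
      finally have T2e: "emeasure lborel T2 \<le> ennreal (real (card P) * (Cs * (2 * norm z)))" .
      have inT2: "x \<in> T2" if x: "x \<in> cbox 0 1" "?u x \<noteq> ?u (x + z)" for x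
      proof -
        have "K (\<omega> \<bullet> x) \<noteq> K (\<omega> \<bullet> x + \<omega> \<bullet> z)" using x by (simp add: inner_add_right)
        then obtain p where p: "p \<in> P" "min (\<omega> \<bullet> x) (\<omega> \<bullet> x + \<omega> \<bullet> z) \<le> p" "p \<le> max (\<omega> \<bullet> x) (\<omega> \<bullet> x + \<omega> \<bullet> z)"
          using g by blast
        then have "p - norm z \<le> \<omega> \<bullet> x \<and> \<omega> \<bullet> x \<le> p + norm z" using inner_le_norm[of z] by linarith
        with p x show ?thesis by (auto simp: T2_def slab_def)
      qed
      from difference_integral_le[OF T2b T2e, of "2 * A" z ?u, OF _ bound inT2] \<open>A \<ge> 0\<close>
      have "(\<integral>\<^sup>+x. ennreal ((norm (?u x - ?u (x + z)))\<^sup>2) * indicator (cbox 0 1) x * indicator (cbox 0 1) (x + z) \<partial>lborel)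
        \<le> ennreal ((2 * A)\<^sup>2 * (real (card P) * (Cs * (2 * norm z))))" by auto
      also have "(2 * A)\<^sup>2 * (real (card P) * (Cs * (2 * norm z))) = 8 * real (card P) * Cs * A\<^sup>2 * norm z"
        by (simp add: power_mult_distrib)
      also have "ennreal \<dots> \<le> ennreal (8 * (1 + real (card P)) * Cs * A\<^sup>2 * norm z)"
        using Cs by (intro ennreal_leI mult_right_mono) (auto simp: algebra_simps)
      also have "8 * (1 + real (card P)) * Cs * A\<^sup>2 * norm z = 8 * (1 + real (card P)) * Cs * A\<^sup>2 * h * (norm z / h)"
        using h by simp
      finally show ?thesis using True g by simp
    qed
  qed
qed

text \<open>The counterpart for a whole neuron, whose support is not small: the cube replaces the
  slab, the length scale is 1, and a single jump point \<open>p\<close> remains. The division by 1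
  matches the form of \<open>slobodeckij_sq_le\<close> with \<open>h = 1\<close>.\<close>

lemma ridge_difference_le:
  assumes "A \<ge> 0" and K: "\<And>t. \<bar>t\<bar> \<le> real CARD('n) \<Longrightarrow> \<bar>K t\<bar> \<le> A"
    and \<gamma>: "(\<gamma> = 2 \<and> (\<forall>s t. \<bar>s\<bar> \<le> real CARD('n) \<longrightarrow> \<bar>t\<bar> \<le> real CARD('n) \<longrightarrow> \<bar>K s - K t\<bar> \<le> A * \<bar>s - t\<bar>)) \<or>
        (\<gamma> = 1 \<and> (\<forall>s t. K s \<noteq> K t \<longrightarrow> min s t \<le> p \<and> p \<le> max s t))"
  shows "(\<integral>\<^sup>+x. ennreal ((norm (complex_of_real (K (\<omega> \<bullet> x)) - of_real (K (\<omega> \<bullet> (x + z)))))\<^sup>2)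
        * indicator (cbox 0 1) x * indicator (cbox 0 1) (x + z) \<partial>lborel)
       \<le> ennreal (8 * (1 + Cs) * A\<^sup>2 * min 1 ((norm z / 1) ^ \<gamma>))"
proof -
  let ?u = "\<lambda>x. complex_of_real (K (\<omega> \<bullet> x))"
  have nd: "norm (?u x - ?u (x + z)) = \<bar>K (\<omega> \<bullet> x) - K (\<omega> \<bullet> (x + z))\<bar>" for x
    by (simp flip: of_real_diff)
  have rng: "\<bar>\<omega> \<bullet> x\<bar> \<le> real CARD('n)" if "x \<in> cbox 0 1" for x
    using inner_le_norm[of x] norm_le_sqrt_card_cube[OF that] by linarith
  have bound: "norm (?u x - ?u (x + z)) \<le> 2 * A" if "x \<in> cbox 0 1" "x + z \<in> cbox 0 1" for x
    unfolding nd using K[OF rng[OF that(1)]] K[OF rng[OF that(2)]] by linarith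
  have em1: "emeasure lborel (cbox 0 1 :: (real^'n) set) \<le> ennreal 1"
    by (simp add: emeasure_unit_cube)
  from \<gamma> show ?thesis
  proof
    assume g: "\<gamma> = 2 \<and> (\<forall>s t. \<bar>s\<bar> \<le> real CARD('n) \<longrightarrow> \<bar>t\<bar> \<le> real CARD('n) \<longrightarrow> \<bar>K s - K t\<bar> \<le> A * \<bar>s - t\<bar>)"
    define \<mu> where "\<mu> = min 1 (norm z)"
    have mu: "0 \<le> \<mu>" "\<mu>\<^sup>2 = min 1 ((norm z / 1) ^ 2)"
      using power_le_one[of "norm z" 2] one_le_power[of "norm z" 2] by (auto simp: \<mu>_def min_def)
    have d: "norm (?u x - ?u (x + z)) \<le> 2 * A * \<mu>" if x: "x \<in> cbox 0 1" "x + z \<in> cbox 0 1" for x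
    proof -
      have "\<bar>K (\<omega> \<bullet> x) - K (\<omega> \<bullet> (x + z))\<bar> \<le> A * \<bar>\<omega> \<bullet> x - \<omega> \<bullet> (x + z)\<bar>" using g rng x by blast
      also have "\<dots> \<le> A * norm z" using inner_le_norm[of z] \<open>A \<ge> 0\<close> by (intro mult_left_mono) (auto simp: inner_add_right)
      also have "\<dots> \<le> 2 * A * norm z" using \<open>A \<ge> 0\<close> by (intro mult_right_mono) auto
      finally show ?thesis using bound[OF x] unfolding nd \<mu>_def by (simp add: min_def)
    qed
    have "(\<integral>\<^sup>+x. ennreal ((norm (?u x - ?u (x + z)))\<^sup>2) * indicator (cbox 0 1) x * indicator (cbox 0 1) (x + z) \<partial>lborel)
        \<le> ennreal ((2 * A * \<mu>)\<^sup>2 * 1)"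
      by (rule difference_integral_le[OF _ em1]) (use d mu \<open>A \<ge> 0\<close> in auto)
    also have "(2 * A * \<mu>)\<^sup>2 * 1 = 4 * A\<^sup>2 * min 1 ((norm z / 1) ^ 2)"
      unfolding mu(2)[symmetric] by (simp add: power_mult_distrib)
    also have "ennreal \<dots> \<le> ennreal (8 * (1 + Cs) * A\<^sup>2 * min 1 ((norm z / 1) ^ 2))"
      using Cs by (intro ennreal_leI mult_right_mono) (auto simp: algebra_simps)
    finally show ?thesis using g by simp
  next
    assume g: "\<gamma> = 1 \<and> (\<forall>s t. K s \<noteq> K t \<longrightarrow> min s t \<le> p \<and> p \<le> max s t)"
    show ?thesis
    proof (cases "norm z \<le> 1")
      case False
      have "(\<integral>\<^sup>+x. ennreal ((norm (?u x - ?u (x + z)))\<^sup>2) * indicator (cbox 0 1) x * indicator (cbox 0 1) (x + z) \<partial>lborel)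
        \<le> ennreal ((2 * A)\<^sup>2 * 1)"
        by (rule difference_integral_le[OF _ em1]) (use bound \<open>A \<ge> 0\<close> in auto)
      also have "\<dots> \<le> ennreal (8 * (1 + Cs) * A\<^sup>2)"
        using Cs by (intro ennreal_leI) (auto simp: power_mult_distrib algebra_simps)
      finally show ?thesis using False g by simp
    next
      case True
      have "(\<integral>\<^sup>+x. ennreal ((norm (?u x - ?u (x + z)))\<^sup>2) * indicator (cbox 0 1) x * indicator (cbox 0 1) (x + z) \<partial>lborel)
        \<le> ennreal ((2 * A)\<^sup>2 * (Cs * (2 * norm z)))"
      proof (rule difference_integral_le[where T="slab \<omega> (p - norm z) (2 * norm z)"])
        show "x \<in> slab \<omega> (p - norm z) (2 * norm z)" if x: "x \<in> cbox 0 1" "?u x \<noteq> ?u (x + z)" for x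
        proof -
          have "K (\<omega> \<bullet> x) \<noteq> K (\<omega> \<bullet> x + \<omega> \<bullet> z)" using x by (simp add: inner_add_right)
          then have "min (\<omega> \<bullet> x) (\<omega> \<bullet> x + \<omega> \<bullet> z) \<le> p" "p \<le> max (\<omega> \<bullet> x) (\<omega> \<bullet> x + \<omega> \<bullet> z)"
            using g by blast+
          then have "p - norm z \<le> \<omega> \<bullet> x \<and> \<omega> \<bullet> x \<le> p + norm z" using inner_le_norm[of z] by linarith
          with x show ?thesis by (auto simp: slab_def)
        qed
      qed (use bound slab \<open>A \<ge> 0\<close> in auto)
      also have "(2 * A)\<^sup>2 * (Cs * (2 * norm z)) = 8 * Cs * A\<^sup>2 * norm z"
        by (simp add: power_mult_distrib)
      also have "ennreal \<dots> \<le> ennreal (8 * (1 + Cs) * A\<^sup>2 * norm z)"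
        using Cs by (intro ennreal_leI mult_right_mono) (auto simp: algebra_simps)
      finally show ?thesis using True g by simp
    qed
  qed
qed

end

text \<open>The squared Sobolev norm with an arbitrary family \<open>D\<close> in place of the weak
  derivatives. It makes sense for formal derivatives and depends only on squares of values and of
  differences, so second-moment arguments apply to it.\<close>

definition energy :: "real \<Rightarrow> (('n::finite \<Rightarrow> nat) \<Rightarrow> real^'n \<Rightarrow> complex) \<Rightarrow> ennreal" where
  "energy m D = (\<Sum>\<alpha> | mi_order \<alpha> \<le> nat \<lfloor>m\<rfloor>. L2_norm_sq (cbox 0 1) (D \<alpha>)) +
     (if frac m = 0 then 0 else \<Sum>\<alpha> | mi_order \<alpha> = nat \<lfloor>m\<rfloor>. slobodeckij_sq (frac m) (cbox 0 1) (D \<alpha>))"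

text \<open>The factor that the chain rule produces in the derivative of index \<alpha> of the
  neuron of power \<open>k\<close> and direction \<omega>. For orders above \<open>k\<close> the
  truncated subtraction keeps it bounded, so that estimates hold for all \<alpha>.\<close>

definition dcoef :: "nat \<Rightarrow> real^'n \<Rightarrow> ('n \<Rightarrow> nat) \<Rightarrow> real" where
  "dcoef k \<omega> \<alpha> = (\<Prod>i\<in>UNIV. (\<omega> $ i) ^ \<alpha> i) * (fact k / fact (k - mi_order \<alpha>))"

lemma abs_dcoef_le:
  fixes \<omega> :: "real^'n"
  assumes "\<omega> \<in> sphere 0 1"
  shows "\<bar>dcoef k \<omega> \<alpha>\<bar> \<le> fact k"
proof -
  have "\<bar>\<Prod>i\<in>UNIV. (\<omega> $ i) ^ \<alpha> i\<bar> = (\<Prod>i\<in>UNIV. \<bar>\<omega> $ i\<bar> ^ \<alpha> i)"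
    by (simp add: abs_prod power_abs)
  also have "\<dots> \<le> 1"
    using assms component_le_norm_cart[of \<omega>] by (intro prod_le_1) (auto intro!: power_le_one)
  finally have 1: "\<bar>\<Prod>i\<in>UNIV. (\<omega> $ i) ^ \<alpha> i\<bar> \<le> 1" .
  have "(fact k / fact (k - mi_order \<alpha>) :: real) \<le> fact k / 1"
    by (intro divide_left_mono) auto
  then have "\<bar>\<Prod>i\<in>UNIV. (\<omega> $ i) ^ \<alpha> i\<bar> * (fact k / fact (k - mi_order \<alpha>)) \<le> 1 * fact k"
    using 1 by (intro mult_mono) auto
  then show ?thesis by (simp add: dcoef_def abs_mult)
qed

section \<open>Energies of localised remainders and of single neurons\<close>

lemma energy_bound:
  assumes "\<And>\<alpha>. mi_order \<alpha> \<le> nat \<lfloor>m\<rfloor> \<Longrightarrow> L2_norm_sq (cbox 0 1) (D \<alpha>) \<le> ennreal a"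
    and "\<And>\<alpha>. frac m \<noteq> 0 \<Longrightarrow> mi_order \<alpha> = nat \<lfloor>m\<rfloor> \<Longrightarrow> slobodeckij_sq (frac m) (cbox 0 1) (D \<alpha>) \<le> ennreal b"
    and "a \<ge> 0" "b \<ge> 0"
  shows "energy m (D :: ('n::finite \<Rightarrow> nat) \<Rightarrow> real^'n \<Rightarrow> complex) \<le>
     ennreal (real (card {\<alpha> :: 'n \<Rightarrow> nat. mi_order \<alpha> \<le> nat \<lfloor>m\<rfloor>}) * (a + b))"
proof -
  let ?S = "{\<alpha> :: 'n \<Rightarrow> nat. mi_order \<alpha> \<le> nat \<lfloor>m\<rfloor>}" and ?T = "{\<alpha> :: 'n \<Rightarrow> nat. mi_order \<alpha> = nat \<lfloor>m\<rfloor>}"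
  have "(\<Sum>\<alpha>\<in>?S. L2_norm_sq (cbox 0 1) (D \<alpha>)) \<le> (\<Sum>\<alpha>\<in>?S. ennreal a)"
    by (intro sum_mono assms) auto
  also have "\<dots> = ennreal (real (card ?S) * a)" using assms by (subst sum_ennreal) auto
  finally have 1: "(\<Sum>\<alpha>\<in>?S. L2_norm_sq (cbox 0 1) (D \<alpha>)) \<le> ennreal (real (card ?S) * a)" .
  have "(if frac m = 0 then 0 else \<Sum>\<alpha>\<in>?T. slobodeckij_sq (frac m) (cbox 0 1) (D \<alpha>)) \<le> (\<Sum>\<alpha>\<in>?T. ennreal b)"
  proof (cases "frac m = 0")
    case True
    then show ?thesis by simp
  next
    case False
    then show ?thesis by (simp only: if_False) (rule sum_mono, rule assms(2), auto)
  qed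
  also have "\<dots> = ennreal (real (card ?T) * b)" using assms by (subst sum_ennreal) auto
  also have "\<dots> \<le> ennreal (real (card ?S) * b)"
    using assms by (intro ennreal_leI mult_right_mono) (auto intro!: card_mono finite_mi_order_le)
  finally have 2: "(if frac m = 0 then 0 else \<Sum>\<alpha>\<in>?T. slobodeckij_sq (frac m) (cbox 0 1) (D \<alpha>)) \<le> ennreal (real (card ?S) * b)" .
  show ?thesis unfolding energy_def using add_mono[OF 1 2] assms
    by (simp add: ennreal_plus[symmetric] distrib_left del: ennreal_plus)
qed

lemma ridge_L2_le:
  fixes \<omega> :: "real^'n"
  assumes K [measurable]: "K \<in> borel_measurable borel"
    and T: "T \<in> sets borel" "emeasure lborel T \<le> ennreal \<mu>" and "A \<ge> 0"
    and "\<And>x. x \<in> cbox 0 1 \<Longrightarrow> \<bar>K (\<omega> \<bullet> x)\<bar> \<le> A" "\<And>x. x \<in> cbox 0 1 \<Longrightarrow> K (\<omega> \<bullet> x) \<noteq> 0 \<Longrightarrow> x \<in> T"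
  shows "L2_norm_sq (cbox 0 1) (\<lambda>x. complex_of_real (K (\<omega> \<bullet> x))) \<le> ennreal (A\<^sup>2 * \<mu>)"
proof -
  have "L2_norm_sq (cbox 0 1) (\<lambda>x. complex_of_real (K (\<omega> \<bullet> x))) =
    (\<integral>\<^sup>+x. ennreal ((norm (complex_of_real (K (\<omega> \<bullet> x))))\<^sup>2) * indicator (cbox 0 1) x \<partial>lborel)"
    by (rule L2_norm_sq_borel) measurable
  also have "\<dots> \<le> (\<integral>\<^sup>+x. ennreal (A\<^sup>2) * indicator T x \<partial>lborel)"
  proof (intro nn_integral_mono)
    fix x :: "real^'n"
    show "ennreal ((norm (complex_of_real (K (\<omega> \<bullet> x))))\<^sup>2) * indicator (cbox 0 1) x \<le> ennreal (A\<^sup>2) * indicator T x"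
    proof (cases "x \<in> cbox 0 1 \<and> K (\<omega> \<bullet> x) \<noteq> 0")
      case True
      then have "\<bar>K (\<omega> \<bullet> x)\<bar>\<^sup>2 \<le> A\<^sup>2" using assms by (intro power_mono) auto
      with True show ?thesis using assms by (auto intro!: ennreal_leI)
    qed (auto simp: indicator_def)
  qed
  also have "\<dots> = ennreal (A\<^sup>2) * emeasure lborel T"
    using T by (subst nn_integral_cmult_indicator) auto
  also have "\<dots> \<le> ennreal (A\<^sup>2) * ennreal \<mu>" by (intro mult_left_mono T) auto
  also have "\<dots> = ennreal (A\<^sup>2 * \<mu>)" by (simp add: ennreal_mult')
  finally show ?thesis .
qed

text \<open>Splitting m = j + \<theta> into integer and fractional part. If j = k, the derivatives
  of top order are step functions, and m < k + 1/2 becomes 2 \<theta> < 1, which gives them finite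
  Slobodeckij energy.\<close>

lemma sobolev_order_facts:
  assumes "0 \<le> m" "m < real k + 1/2"
  shows "nat \<lfloor>m\<rfloor> \<le> k" "m = real (nat \<lfloor>m\<rfloor>) + frac m"
    "nat \<lfloor>m\<rfloor> = k \<Longrightarrow> 2 * frac m < 1" "2 * frac m < 2"
proof -
  obtain j \<theta> where j: "j = nat \<lfloor>m\<rfloor>" and \<theta>: "\<theta> = frac m" by blast
  have "real j = of_int \<lfloor>m\<rfloor>" unfolding j using assms(1) by (subst of_nat_nat) auto
  then have e: "m = real j + \<theta>" by (simp add: \<theta> frac_def)
  have t: "0 \<le> \<theta>" "\<theta> < 1" by (simp_all add: \<theta> frac_lt_1)
  have "real j < real (Suc k)" using e t assms(2) by simp
  then have "j \<le> k" by simp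
  moreover have "j = k \<Longrightarrow> 2 * \<theta> < 1" using e assms(2) by simp
  ultimately show "nat \<lfloor>m\<rfloor> \<le> k" "m = real (nat \<lfloor>m\<rfloor>) + frac m"
    "nat \<lfloor>m\<rfloor> = k \<Longrightarrow> 2 * frac m < 1" "2 * frac m < 2"
    using e t unfolding j \<theta> by simp_all
qed

text \<open>A derivative of order j of the remainder has size h^(k - j) on a slab of measure of
  order h, and the fractional part costs a further h^(-2 \<theta>); with j + \<theta> = m the
  exponents of the squares add up to 2 (k - m) + 1. Lower orders have larger exponents, whence the
  upper bound \<open>H\<close> on \<open>h\<close>.\<close>

lemma kern_energy_bound:
  fixes m H :: real
  assumes m: "0 \<le> m" "m < real k + 1/2" and H: "H \<ge> 1"
  obtains C :: real where "C > 0"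
    "\<And>(\<omega>::real^'n::finite) \<beta> h b. \<omega> \<in> sphere 0 1 \<Longrightarrow> 0 < h \<Longrightarrow> h \<le> H \<Longrightarrow> \<beta> \<le> b \<Longrightarrow> b \<le> \<beta> + h \<Longrightarrow>
      energy m (\<lambda>\<alpha> x. of_real (dcoef k \<omega> \<alpha> * kern k (k - mi_order \<alpha>) \<beta> h b (\<omega> \<bullet> x)))
        \<le> ennreal (C * h powr (2 * (real k - m) + 1))"
proof -
  let ?j = "nat \<lfloor>m\<rfloor>" and ?\<theta> = "frac m"
  note jk = sobolev_order_facts[OF m]
  obtain B where B: "B \<ge> 0" "\<And>r y. r \<le> k \<Longrightarrow> 0 \<le> y \<Longrightarrow> y \<le> 1 \<Longrightarrow> \<bar>lagr k r y\<bar> \<le> B"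
    using lagr_bounded by blast
  obtain Cs where Cs: "Cs > 0" and slab0: "\<And>(\<omega>::real^'n) a h. \<omega> \<in> sphere 0 1 \<Longrightarrow> h \<ge> 0 \<Longrightarrow>
       emeasure lborel {x \<in> cbox 0 1. a \<le> \<omega> \<bullet> x \<and> \<omega> \<bullet> x \<le> a + h} \<le> ennreal (Cs * h)"
    using emeasure_cube_slab by blast
  have slab: "\<omega> \<in> sphere 0 1 \<Longrightarrow> h \<ge> 0 \<Longrightarrow> emeasure lborel (slab \<omega> a h) \<le> ennreal (Cs * h)" for \<omega> :: "real^'n" and a h
    unfolding slab_def by (rule slab0)
  \<comment> \<open>Order in the shift of the squared and integrated difference of a top-order
    derivative: 1 for step functions, 2 for Lipschitz functions.\<close>
  define \<gamma> :: nat where "\<gamma> = (if ?j = k then 1 else 2)"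
  have \<gamma>: "2 * ?\<theta> < real \<gamma>" using jk(3,4) by (auto simp: \<gamma>_def)
  have "\<exists>W>0. ?\<theta> \<noteq> 0 \<longrightarrow> (\<forall>h>0. (\<integral>\<^sup>+z. ennreal (min 1 ((norm z / h) ^ \<gamma>) / norm z powr (real CARD('n) + 2 * ?\<theta>)) \<partial>(lborel :: (real^'n) measure))
        \<le> ennreal (W * h powr (- (2 * ?\<theta>))))"
  proof (cases "?\<theta> = 0")
    case False
    then have "0 < ?\<theta>" using frac_ge_0[of m] by linarith
    obtain W where W: "W > 0" "\<And>h. h > 0 \<Longrightarrow> (\<integral>\<^sup>+z. ennreal (min 1 ((norm z / h) ^ \<gamma>) / norm z powr (real CARD('n) + 2 * ?\<theta>)) \<partial>(lborel :: (real^'n) measure))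
        \<le> ennreal (W * h powr (- (2 * ?\<theta>)))"
      by (rule singular_weight_integral[OF \<open>0 < ?\<theta>\<close> \<gamma>, where 'n='n]) (rule that, assumption+)
    then show ?thesis by (intro exI[of _ W]) simp
  qed (auto intro: exI[of _ 1])
  then obtain W where W: "W > 0" "?\<theta> \<noteq> 0 \<Longrightarrow> h > 0 \<Longrightarrow> (\<integral>\<^sup>+z. ennreal (min 1 ((norm z / h) ^ \<gamma>) / norm z powr (real CARD('n) + 2 * ?\<theta>)) \<partial>(lborel :: (real^'n) measure))
        \<le> ennreal (W * h powr (- (2 * ?\<theta>)))" for h by blast
  define A where "A = fact k * real (Suc k) * (1 + real (Suc k) * B)"
  have A: "A > 0" using B(1) by (auto simp: A_def intro!: mult_pos_pos add_pos_nonneg)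
  \<comment> \<open>The factor \<open>H powr (2 * m)\<close> absorbs the surplus power
    \<open>2 * (m - mi_order \<alpha>)\<close> of \<open>h\<close> in the lower orders.\<close>
  define C1 where "C1 = A\<^sup>2 * Cs * H powr (2 * m)"
  define C2 where "C2 = 8 * (1 + real (Suc (Suc k))) * Cs * A\<^sup>2 * W"
  have C12: "C1 > 0" "C2 > 0" using A Cs W(1) H by (auto simp: C1_def C2_def intro!: mult_pos_pos)
  define C where "C = real (card {\<alpha> :: 'n \<Rightarrow> nat. mi_order \<alpha> \<le> ?j}) * (C1 + C2)"
  show ?thesis
  proof (rule that[of "C + 1"])
    show "C + 1 > 0" using C12 by (auto simp: C_def intro!: add_nonneg_pos)
    fix \<omega> :: "real^'n" and \<beta> h b :: real
    assume \<omega>: "\<omega> \<in> sphere 0 1" and h: "0 < h" "h \<le> H" and b: "\<beta> \<le> b" "b \<le> \<beta> + h"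
    define e where "e = 2 * (real k - m) + 1"
    define K where "K \<alpha> t = dcoef k \<omega> \<alpha> * kern k (k - mi_order \<alpha>) \<beta> h b t" for \<alpha> t
    have [measurable]: "K \<alpha> \<in> borel_measurable borel" for \<alpha> unfolding K_def by measurable
    note kb = kern_bound[OF diff_le_self h(1) b B] and ko = kern_outside[OF diff_le_self h(1) b]
      and kl = kern_Lipschitz[OF diff_le_self h(1) b B]
    have K_le: "\<bar>K \<alpha> t\<bar> \<le> A * h ^ (k - mi_order \<alpha>)" for \<alpha> t
    proof -
      have "\<bar>K \<alpha> t\<bar> \<le> fact k * ((1 + real (Suc k) * B) * h ^ (k - mi_order \<alpha>))"
        unfolding K_def abs_mult by (intro mult_mono abs_dcoef_le[OF \<omega>] kb) auto
      also have "\<dots> \<le> A * h ^ (k - mi_order \<alpha>)"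
      proof -
        have "fact k * 1 * (1 + real (Suc k) * B) \<le> A" unfolding A_def using B(1) by (intro mult_right_mono mult_left_mono) auto
        then show ?thesis using h by (simp only: mult.assoc[symmetric] mult_1_right) (intro mult_right_mono, auto)
      qed
      finally show ?thesis .
    qed
    have K_out: "K \<alpha> t = 0" if "t < \<beta> \<or> \<beta> + h < t" for \<alpha> t using ko[OF that] by (simp add: K_def)
    have K_Lip: "\<bar>K \<alpha> s - K \<alpha> t\<bar> \<le> A * h ^ (k - mi_order \<alpha>) / h * \<bar>s - t\<bar>" if "k - mi_order \<alpha> = Suc i" for \<alpha> s t i
    proof -
      have "\<bar>K \<alpha> s - K \<alpha> t\<bar> = \<bar>dcoef k \<omega> \<alpha>\<bar> * \<bar>kern k (k - mi_order \<alpha>) \<beta> h b s - kern k (k - mi_order \<alpha>) \<beta> h b t\<bar>"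
        by (simp add: K_def right_diff_distrib[symmetric] abs_mult)
      also have "\<dots> \<le> fact k * (real (k - mi_order \<alpha>) * (1 + real (Suc k) * B) * h ^ i * \<bar>s - t\<bar>)"
        by (intro mult_mono abs_dcoef_le[OF \<omega>] kl that) auto
      also have "\<dots> = fact k * real (k - mi_order \<alpha>) * (1 + real (Suc k) * B) * (h ^ i * \<bar>s - t\<bar>)"
        by (simp only: mult.assoc)
      also have "\<dots> \<le> A * (h ^ i * \<bar>s - t\<bar>)"
        unfolding A_def using B(1) h by (intro mult_right_mono mult_left_mono) auto
      also have "A * (h ^ i * \<bar>s - t\<bar>) = A * h ^ (k - mi_order \<alpha>) / h * \<bar>s - t\<bar>"
        using h by (simp add: that)
      finally show ?thesis .
    qed
    have L2: "L2_norm_sq (cbox 0 1) (\<lambda>x. complex_of_real (K \<alpha> (\<omega> \<bullet> x))) \<le> ennreal (C1 * h powr e)"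
      if \<alpha>: "mi_order \<alpha> \<le> ?j" for \<alpha>
    proof -
      have "L2_norm_sq (cbox 0 1) (\<lambda>x. complex_of_real (K \<alpha> (\<omega> \<bullet> x))) \<le> ennreal ((A * h ^ (k - mi_order \<alpha>))\<^sup>2 * (Cs * h))"
      proof (rule ridge_L2_le[OF _ slab_borel slab[OF \<omega>, of h \<beta>]])
        show "x \<in> slab \<omega> \<beta> h" if "x \<in> cbox 0 1" "K \<alpha> (\<omega> \<bullet> x) \<noteq> 0" for x
          using that K_out[of "\<omega> \<bullet> x" \<alpha>] by (force simp: slab_def not_less)
      qed (use h A K_le in auto)
      also have "(A * h ^ (k - mi_order \<alpha>))\<^sup>2 * (Cs * h) = A\<^sup>2 * Cs * (h ^ (2 * (k - mi_order \<alpha>)) * h)"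
        by (simp add: power_mult_distrib power_mult[symmetric] mult_ac)
      also have "h ^ (2 * (k - mi_order \<alpha>)) * h = h powr (real (2 * (k - mi_order \<alpha>)) + 1)"
        using h by (simp add: powr_add powr_realpow[symmetric])
      also have "real (2 * (k - mi_order \<alpha>)) + 1 = e + 2 * (m - real (mi_order \<alpha>))"
        using \<alpha> jk(1) by (simp add: e_def of_nat_diff)
      also have "h powr \<dots> = h powr e * h powr (2 * (m - real (mi_order \<alpha>)))" by (rule powr_add)
      also have "ennreal (A\<^sup>2 * Cs * (h powr e * h powr (2 * (m - real (mi_order \<alpha>))))) \<le> ennreal (C1 * h powr e)"
      proof (rule ennreal_leI)
        have "h powr (2 * (m - real (mi_order \<alpha>))) \<le> H powr (2 * m)"
        proof -
        have "real (mi_order \<alpha>) \<le> m" using \<alpha> jk(2) frac_ge_0[of m] by linarith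
        then have "h powr (2 * (m - real (mi_order \<alpha>))) \<le> H powr (2 * (m - real (mi_order \<alpha>)))"
          using h by (intro powr_mono2) auto
        also have "\<dots> \<le> H powr (2 * m)" using H by (intro powr_mono) auto
        finally show ?thesis .
      qed
        then have "A\<^sup>2 * Cs * (h powr e * h powr (2 * (m - real (mi_order \<alpha>)))) \<le> A\<^sup>2 * Cs * (h powr e * H powr (2 * m))"
          using A Cs by (intro mult_left_mono) auto
        then show "A\<^sup>2 * Cs * (h powr e * h powr (2 * (m - real (mi_order \<alpha>)))) \<le> C1 * h powr e"
          by (simp add: C1_def mult_ac)
      qed
      finally show ?thesis .
    qed
    have Sl: "slobodeckij_sq ?\<theta> (cbox 0 1) (\<lambda>x. complex_of_real (K \<alpha> (\<omega> \<bullet> x))) \<le> ennreal (C2 * h powr e)"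
      if \<theta>: "?\<theta> \<noteq> 0" and \<alpha>: "mi_order \<alpha> = ?j" for \<alpha>
    proof -
      \<comment> \<open>Possible jump points of the top-order derivative: the bias and the k + 1
        nodes, hence the count k + 2 in \<open>C2\<close>.\<close>
      define P where "P = insert b ((\<lambda>r. \<beta> + h * lnode k r) ` {..k})"
      have P: "finite P" "card P \<le> Suc (Suc k)"
        using card_insert_le_m1[of "Suc (Suc k)" "(\<lambda>r. \<beta> + h * lnode k r) ` {..k}" b] card_image_le[of "{..k}" "\<lambda>r. \<beta> + h * lnode k r"]
        by (auto simp: P_def)
      let ?A = "A * h ^ (k - ?j)"
      have alt: "(\<gamma> = 2 \<and> (\<forall>s t. \<bar>K \<alpha> s - K \<alpha> t\<bar> \<le> ?A / h * \<bar>s - t\<bar>)) \<or>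
        (\<gamma> = 1 \<and> finite P \<and> (\<forall>s t. K \<alpha> s \<noteq> K \<alpha> t \<longrightarrow> (\<exists>p\<in>P. min s t \<le> p \<and> p \<le> max s t)))"
      proof (cases "?j = k")
        case True
        have "\<exists>p\<in>P. min s t \<le> p \<and> p \<le> max s t" if "K \<alpha> s \<noteq> K \<alpha> t" for s t
          unfolding P_def by (rule kern_0_jump) (use that True \<alpha> in \<open>auto simp: K_def\<close>)
        then show ?thesis using True P by (simp add: \<gamma>_def)
      next
        case False
        then obtain i where "k - mi_order \<alpha> = Suc i" using jk(1) \<alpha> by (metis diff_is_0_eq le_antisym not0_implies_Suc)
        then show ?thesis using K_Lip[of \<alpha> i] False \<alpha> by (simp add: \<gamma>_def)
      qed
      have "slobodeckij_sq ?\<theta> (cbox 0 1) (\<lambda>x. complex_of_real (K \<alpha> (\<omega> \<bullet> x)))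
          \<le> ennreal (8 * (1 + real (card P)) * Cs * ?A\<^sup>2 * h * (W * h powr (- (2 * ?\<theta>))))"
      proof (rule slobodeckij_sq_le[OF _ _ h(1) _ W(2)[OF \<theta> h(1)]])
        show "(\<integral>\<^sup>+x. ennreal ((norm (complex_of_real (K \<alpha> (\<omega> \<bullet> x)) - of_real (K \<alpha> (\<omega> \<bullet> (x + z)))))\<^sup>2)
            * indicator (cbox 0 1) x * indicator (cbox 0 1) (x + z) \<partial>lborel)
          \<le> ennreal (8 * (1 + real (card P)) * Cs * ?A\<^sup>2 * h * min 1 ((norm z / h) ^ \<gamma>))" for z
          by (rule ridge_difference_compact_support_le[OF Cs \<omega> slab[OF \<omega>] h(1) _ _ K_out alt])
            (use K_le[of \<alpha>] \<alpha> A h in auto)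
      qed (use Cs h in auto)
      also have "\<dots> \<le> ennreal (C2 * h powr e)"
      proof (rule ennreal_leI)
        have "h ^ (2 * (k - ?j)) * h * h powr (- (2 * ?\<theta>)) = h powr (real (2 * (k - ?j)) + 1 + - (2 * ?\<theta>))"
          unfolding powr_add using h by (simp add: powr_realpow[symmetric])
        also have "real (2 * (k - ?j)) + 1 + - (2 * ?\<theta>) = e"
          using jk(1,2) by (simp add: e_def of_nat_diff)
        finally have he: "h ^ (2 * (k - ?j)) * h * h powr (- (2 * ?\<theta>)) = h powr e" .
        have "8 * (1 + real (card P)) * Cs * ?A\<^sup>2 * h * (W * h powr (- (2 * ?\<theta>))) =
          (1 + real (card P)) * (8 * Cs * A\<^sup>2 * W * (h ^ (2 * (k - ?j)) * h * h powr (- (2 * ?\<theta>))))"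
          by (simp add: power_mult_distrib power_mult[symmetric] mult_ac)
        also have "\<dots> \<le> (1 + real (Suc (Suc k))) * (8 * Cs * A\<^sup>2 * W * (h ^ (2 * (k - ?j)) * h * h powr (- (2 * ?\<theta>))))"
          using P(2) Cs W(1) h by (intro mult_right_mono add_left_mono of_nat_mono) auto
        also have "\<dots> = C2 * h powr e" unfolding he C2_def by (simp only: mult_ac)
        finally show "8 * (1 + real (card P)) * Cs * ?A\<^sup>2 * h * (W * h powr (- (2 * ?\<theta>))) \<le> C2 * h powr e" .
      qed
      finally show ?thesis .
    qed
    have "energy m (\<lambda>\<alpha> x. of_real (K \<alpha> (\<omega> \<bullet> x))) \<le> ennreal (real (card {\<alpha> :: 'n \<Rightarrow> nat. mi_order \<alpha> \<le> ?j}) * (C1 * h powr e + C2 * h powr e))"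
      by (rule energy_bound) (use L2 Sl C12 in auto)
    also have "\<dots> \<le> ennreal ((C + 1) * h powr e)"
      by (intro ennreal_leI) (simp add: C_def algebra_simps)
    finally show "energy m (\<lambda>\<alpha> x. of_real (dcoef k \<omega> \<alpha> * kern k (k - mi_order \<alpha>) \<beta> h b (\<omega> \<bullet> x)))
        \<le> ennreal ((C + 1) * h powr (2 * (real k - m) + 1))" unfolding K_def e_def .
  qed
qed

text \<open>Bare neurons are not small, only bounded uniformly over the biases in [-L, L]; this is
  what plain sampling of the light directions relies on.\<close>

lemma neuron_energy_bound:
  fixes m L :: real
  assumes m: "0 \<le> m" "m < real k + 1/2" and L: "L \<ge> 0"
  obtains C :: real where "C > 0"
    "\<And>(\<omega>::real^'n::finite) b. \<omega> \<in> sphere 0 1 \<Longrightarrow> \<bar>b\<bar> \<le> L \<Longrightarrow>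
      energy m (\<lambda>\<alpha> x. of_real (dcoef k \<omega> \<alpha> * relu_pow (k - mi_order \<alpha>) (\<omega> \<bullet> x - b))) \<le> ennreal C"
proof -
  let ?j = "nat \<lfloor>m\<rfloor>" and ?\<theta> = "frac m" and ?d = "real CARD('n)"
  note jk = sobolev_order_facts[OF m]
  obtain Cs where Cs: "Cs > 0" and slab0: "\<And>(\<omega>::real^'n) a h. \<omega> \<in> sphere 0 1 \<Longrightarrow> h \<ge> 0 \<Longrightarrow>
       emeasure lborel {x \<in> cbox 0 1. a \<le> \<omega> \<bullet> x \<and> \<omega> \<bullet> x \<le> a + h} \<le> ennreal (Cs * h)"
    using emeasure_cube_slab by blast
  have slab: "\<omega> \<in> sphere 0 1 \<Longrightarrow> h \<ge> 0 \<Longrightarrow> emeasure lborel (slab \<omega> a h) \<le> ennreal (Cs * h)" for \<omega> :: "real^'n" and a h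
    unfolding slab_def by (rule slab0)
  define \<gamma> :: nat where "\<gamma> = (if ?j = k then 1 else 2)"
  have \<gamma>: "2 * ?\<theta> < real \<gamma>" using jk(3,4) by (auto simp: \<gamma>_def)
  have "\<exists>W>0. ?\<theta> \<noteq> 0 \<longrightarrow> (\<integral>\<^sup>+z. ennreal (min 1 ((norm z / 1) ^ \<gamma>) / norm z powr (real CARD('n) + 2 * ?\<theta>)) \<partial>(lborel :: (real^'n) measure))
        \<le> ennreal W"
  proof (cases "?\<theta> = 0")
    case False
    then have "0 < ?\<theta>" using frac_ge_0[of m] by linarith
    obtain W where W: "W > 0" "\<And>h. h > 0 \<Longrightarrow> (\<integral>\<^sup>+z. ennreal (min 1 ((norm z / h) ^ \<gamma>) / norm z powr (real CARD('n) + 2 * ?\<theta>)) \<partial>(lborel :: (real^'n) measure))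
        \<le> ennreal (W * h powr (- (2 * ?\<theta>)))"
      by (rule singular_weight_integral[OF \<open>0 < ?\<theta>\<close> \<gamma>, where 'n='n]) (rule that, assumption+)
    from W(1) W(2)[of 1] show ?thesis by (intro exI[of _ W]) simp
  qed (auto intro: exI[of _ 1])
  then obtain W where W: "W > 0" "?\<theta> \<noteq> 0 \<Longrightarrow> (\<integral>\<^sup>+z. ennreal (min 1 ((norm z / 1) ^ \<gamma>) / norm z powr (real CARD('n) + 2 * ?\<theta>)) \<partial>(lborel :: (real^'n) measure))
        \<le> ennreal W" by blast
  \<comment> \<open>On the cube \<open>\<omega> \<bullet> x\<close> is at most d in modulus, so
    \<open>D\<close> bounds the arguments of all truncated powers; being at least 1, it lets its
    \<open>k\<close>-th power dominate the lower ones.\<close>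
  define D where "D = 1 + ?d + L"
  have D: "D \<ge> 1" using L by (simp add: D_def)
  define A where "A = fact k * real (Suc k) * D ^ k"
  have A: "A > 0" using D by (auto simp: A_def)
  define C where "C = real (card {\<alpha> :: 'n \<Rightarrow> nat. mi_order \<alpha> \<le> ?j}) * (A\<^sup>2 * 1 + 8 * (1 + Cs) * A\<^sup>2 * W)"
  show ?thesis
  proof (rule that[of "C + 1"])
    show "C + 1 > 0" using A Cs W(1) by (auto simp: C_def intro!: add_nonneg_pos)
    fix \<omega> :: "real^'n" and b :: real
    assume \<omega>: "\<omega> \<in> sphere 0 1" and b: "\<bar>b\<bar> \<le> L"
    define K where "K \<alpha> t = dcoef k \<omega> \<alpha> * relu_pow (k - mi_order \<alpha>) (t - b)" for \<alpha> t
    have [measurable]: "K \<alpha> \<in> borel_measurable borel" for \<alpha> unfolding K_def by measurable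
    have Dp: "D ^ i \<le> D ^ k" if "i \<le> k" for i using D that by (intro power_increasing)
    have rng: "\<bar>t - b\<bar> \<le> D" if "\<bar>t\<bar> \<le> ?d" for t using that b by (simp add: D_def)
    have K_le: "\<bar>K \<alpha> t\<bar> \<le> A" if t: "\<bar>t\<bar> \<le> ?d" for \<alpha> t
    proof -
      have "\<bar>relu_pow (k - mi_order \<alpha>) (t - b)\<bar> \<le> D ^ (k - mi_order \<alpha>)"
        using rng[OF t] D by (auto simp: relu_pow_eq power_abs[symmetric] intro!: power_mono)
      also have "\<dots> \<le> D ^ k" by (rule Dp) simp
      finally have "\<bar>K \<alpha> t\<bar> \<le> fact k * D ^ k"
        unfolding K_def abs_mult by (intro mult_mono abs_dcoef_le[OF \<omega>]) auto
      also have "\<dots> \<le> A" unfolding A_def using D by (intro mult_right_mono) auto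
      finally show ?thesis .
    qed
    have K_Lip: "\<bar>K \<alpha> s - K \<alpha> t\<bar> \<le> A * \<bar>s - t\<bar>" if "k - mi_order \<alpha> = Suc i" "\<bar>s\<bar> \<le> ?d" "\<bar>t\<bar> \<le> ?d" for \<alpha> s t i
    proof -
      have i: "Suc i \<le> k" using that(1) by linarith
      have "\<bar>K \<alpha> s - K \<alpha> t\<bar> = \<bar>dcoef k \<omega> \<alpha>\<bar> * \<bar>relu_pow (Suc i) (s - b) - relu_pow (Suc i) (t - b)\<bar>"
        by (simp add: K_def that(1) right_diff_distrib[symmetric] abs_mult)
      also have "\<dots> \<le> fact k * (real (Suc i) * D ^ i * \<bar>(s - b) - (t - b)\<bar>)"
        by (intro mult_mono abs_dcoef_le[OF \<omega>] relu_pow_Lipschitz rng that) auto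
      also have "\<dots> \<le> fact k * (real (Suc k) * D ^ k * \<bar>s - t\<bar>)"
        using D i Dp[of i] by (intro mult_left_mono mult_right_mono mult_mono) auto
      finally show ?thesis by (simp add: A_def mult.assoc)
    qed
    have in_rng: "\<bar>\<omega> \<bullet> x\<bar> \<le> ?d" if "x \<in> cbox 0 1" for x
      using Cauchy_Schwarz_ineq2[of \<omega> x] \<omega> norm_le_sqrt_card_cube[OF that] by simp
    have L2: "L2_norm_sq (cbox 0 1) (\<lambda>x. complex_of_real (K \<alpha> (\<omega> \<bullet> x))) \<le> ennreal (A\<^sup>2 * 1)" for \<alpha>
    proof (rule ridge_L2_le[where T="cbox 0 1"])
      show "emeasure lborel (cbox 0 1 :: (real^'n) set) \<le> ennreal 1" by (simp only: emeasure_unit_cube ennreal_1)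
      show "\<bar>K \<alpha> (\<omega> \<bullet> x)\<bar> \<le> A" if "x \<in> cbox 0 1" for x using K_le in_rng that by blast
    qed (use A in \<open>simp_all\<close>)
    have Sl: "slobodeckij_sq ?\<theta> (cbox 0 1) (\<lambda>x. complex_of_real (K \<alpha> (\<omega> \<bullet> x))) \<le> ennreal (8 * (1 + Cs) * A\<^sup>2 * W)"
      if \<theta>: "?\<theta> \<noteq> 0" and \<alpha>: "mi_order \<alpha> = ?j" for \<alpha>
    proof (rule slobodeckij_sq_le[OF _ _ _ _ W(2)[OF \<theta>]])
      have alt: "(\<gamma> = 2 \<and> (\<forall>s t. \<bar>s\<bar> \<le> ?d \<longrightarrow> \<bar>t\<bar> \<le> ?d \<longrightarrow> \<bar>K \<alpha> s - K \<alpha> t\<bar> \<le> A * \<bar>s - t\<bar>)) \<or>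
        (\<gamma> = 1 \<and> (\<forall>s t. K \<alpha> s \<noteq> K \<alpha> t \<longrightarrow> min s t \<le> b \<and> b \<le> max s t))"
      proof (cases "?j = k")
        case True
        have "min s t \<le> b \<and> b \<le> max s t" if "K \<alpha> s \<noteq> K \<alpha> t" for s t
        proof (rule ccontr)
          assume "\<not> ?thesis"
          then have "b < s \<longleftrightarrow> b < t" by (auto simp: min_def max_def split: if_splits)
          from relu_pow_0_eq[OF this] that show False by (simp add: K_def True \<alpha>)
        qed
        then show ?thesis using True by (simp add: \<gamma>_def)
      next
        case False
        then obtain i where "k - mi_order \<alpha> = Suc i" using jk(1) \<alpha> by (metis diff_is_0_eq le_antisym not0_implies_Suc)
        then show ?thesis using K_Lip[of \<alpha> i] False by (simp add: \<gamma>_def)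
      qed
      show "(\<integral>\<^sup>+x. ennreal ((norm (complex_of_real (K \<alpha> (\<omega> \<bullet> x)) - of_real (K \<alpha> (\<omega> \<bullet> (x + z)))))\<^sup>2)
            * indicator (cbox 0 1) x * indicator (cbox 0 1) (x + z) \<partial>lborel)
          \<le> ennreal (8 * (1 + Cs) * A\<^sup>2 * min 1 ((norm z / 1) ^ \<gamma>))" for z
        by (rule ridge_difference_le[OF Cs \<omega> slab[OF \<omega>] _ _ alt]) (use K_le A in auto)
    qed (use Cs in auto)
    have "energy m (\<lambda>\<alpha> x. of_real (K \<alpha> (\<omega> \<bullet> x))) \<le> ennreal C"
      unfolding C_def by (rule energy_bound) (use L2 Sl A Cs W(1) in auto)
    also have "\<dots> \<le> ennreal (C + 1)" by (intro ennreal_leI) simp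
    finally show "energy m (\<lambda>\<alpha> x. of_real (dcoef k \<omega> \<alpha> * relu_pow (k - mi_order \<alpha>) (\<omega> \<bullet> x - b))) \<le> ennreal (C + 1)"
      unfolding K_def .
  qed
qed

section \<open>Greedy derandomisation of stratified sampling\<close>

lemma (in prob_space) exists_le_nn_integral:
  assumes g [measurable]: "g \<in> borel_measurable M"
  shows "\<exists>x\<in>space M. g x \<le> (\<integral>\<^sup>+x. g x \<partial>M)"
proof (rule ccontr)
  let ?c = "\<integral>\<^sup>+x. g x \<partial>M"
  assume "\<not> ?thesis"
  then have gt: "\<And>x. x \<in> space M \<Longrightarrow> ?c < g x" by (auto simp: not_le)
  obtain x0 where "x0 \<in> space M" using not_empty by blast
  \<comment> \<open>Strict excess at a single point already makes the mean finite, which legitimises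
    the subtraction below.\<close>
  then have fin: "?c \<noteq> top" using gt[of x0] by auto
  have "(\<integral>\<^sup>+x. g x - ?c \<partial>M) = ?c - (\<integral>\<^sup>+x. ?c \<partial>M)"
    using fin gt by (intro nn_integral_diff) (auto simp: emeasure_space_1 intro: less_imp_le)
  also have "\<dots> = 0" using fin by (simp add: emeasure_space_1)
  finally have "AE x in M. g x - ?c = 0" by (subst (asm) nn_integral_0_iff_AE) auto
  then have "AE x in M. False"
  proof (rule AE_mp)
    show "AE x in M. g x - ?c = 0 \<longrightarrow> False"
      using diff_gr0_ennreal[OF gt] by (intro AE_I2) force
  qed
  then show False by simp
qed

text \<open>\<open>expectation X - X x\<close> is centred, so its cross term with \<open>S\<close>
  has mean zero and the mean square is |S|^2 plus the variance. Boundedness of \<open>X\<close>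
  supplies the integrability.\<close>

lemma (in prob_space) second_moment_step:
  fixes X :: "'a \<Rightarrow> complex" and S :: complex
  assumes X [measurable]: "X \<in> borel_measurable M" and B: "\<And>x. x \<in> space M \<Longrightarrow> norm (X x) \<le> B"
  shows "(\<integral>\<^sup>+x. ennreal ((norm (S + expectation X - X x))\<^sup>2) \<partial>M)
     \<le> ennreal ((norm S)\<^sup>2) + (\<integral>\<^sup>+x. ennreal ((norm (X x))\<^sup>2) \<partial>M)"
proof -
  define c where "c = S + expectation X"
  have intX: "integrable M X" using B by (intro integrable_const_bound[of _ B]) auto
  have intX2: "integrable M (\<lambda>x. (norm (X x))\<^sup>2)"
    using B by (intro integrable_const_bound[of _ "B\<^sup>2"]) (auto intro!: power_mono)
  have sq: "(norm (c - y))\<^sup>2 = (norm c)\<^sup>2 - 2 * Re (cnj c * y) + (norm y)\<^sup>2" for c y :: complex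
    unfolding cmod_power2 by (simp add: power2_eq_square algebra_simps)
  have int3: "integrable M (\<lambda>x. (norm (c - X x))\<^sup>2)"
    unfolding sq using intX intX2 by (intro Bochner_Integration.integrable_add Bochner_Integration.integrable_diff) auto
  have "expectation (\<lambda>x. (norm (c - X x))\<^sup>2) = (norm c)\<^sup>2 - 2 * Re (cnj c * expectation X) + expectation (\<lambda>x. (norm (X x))\<^sup>2)"
    unfolding sq using intX intX2
    by (subst Bochner_Integration.integral_add Bochner_Integration.integral_diff; (intro Bochner_Integration.integrable_diff)?)+
      (auto simp: prob_space)
  also have "\<dots> = (norm (c - expectation X))\<^sup>2 - (norm (expectation X))\<^sup>2 + expectation (\<lambda>x. (norm (X x))\<^sup>2)"
    by (simp add: sq)
  also have "\<dots> \<le> (norm S)\<^sup>2 + expectation (\<lambda>x. (norm (X x))\<^sup>2)" by (simp add: c_def)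
  finally have le: "expectation (\<lambda>x. (norm (c - X x))\<^sup>2) \<le> (norm S)\<^sup>2 + expectation (\<lambda>x. (norm (X x))\<^sup>2)" .
  have "(\<integral>\<^sup>+x. ennreal ((norm (c - X x))\<^sup>2) \<partial>M) = ennreal (expectation (\<lambda>x. (norm (c - X x))\<^sup>2))"
    by (rule nn_integral_eq_integral[OF int3]) auto
  also have "\<dots> \<le> ennreal ((norm S)\<^sup>2 + expectation (\<lambda>x. (norm (X x))\<^sup>2))" using le by (rule ennreal_leI)
  also have "\<dots> = ennreal ((norm S)\<^sup>2) + ennreal (expectation (\<lambda>x. (norm (X x))\<^sup>2))"
    by (intro ennreal_plus) auto
  also have "ennreal (expectation (\<lambda>x. (norm (X x))\<^sup>2)) = (\<integral>\<^sup>+x. ennreal ((norm (X x))\<^sup>2) \<partial>M)"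
    by (rule nn_integral_eq_integral[OF intX2, symmetric]) auto
  finally show ?thesis by (simp add: c_def)
qed

text \<open>Joint measurability in the parameter and the point is what allows the energy of a random
  family to be averaged.\<close>

lemma energy_measurable:
  fixes X :: "('n::finite \<Rightarrow> nat) \<Rightarrow> 'p \<Rightarrow> real^'n \<Rightarrow> complex"
  assumes [measurable]: "\<And>\<alpha>. case_prod (X \<alpha>) \<in> borel_measurable (P \<Otimes>\<^sub>M borel)"
  shows "(\<lambda>\<theta>. L2_norm_sq (cbox 0 1) (X \<alpha> \<theta>)) \<in> borel_measurable P"
    "(\<lambda>\<theta>. slobodeckij_sq s (cbox 0 1) (X \<alpha> \<theta>)) \<in> borel_measurable P"
    "(\<lambda>\<theta>. energy m (\<lambda>\<alpha>. X \<alpha> \<theta>)) \<in> borel_measurable P"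
proof -
  have b: "X \<alpha> \<theta> \<in> borel_measurable borel" if "\<theta> \<in> space P" for \<alpha> \<theta>
    using that by measurable
  show 1: "(\<lambda>\<theta>. L2_norm_sq (cbox 0 1) (X \<alpha> \<theta>)) \<in> borel_measurable P" for \<alpha>
  proof (subst measurable_cong)
    show "L2_norm_sq (cbox 0 1) (X \<alpha> \<theta>) = (\<integral>\<^sup>+x. ennreal ((norm (X \<alpha> \<theta> x))\<^sup>2) * indicator (cbox 0 1) x \<partial>lborel)"
      if "\<theta> \<in> space P" for \<theta> by (rule L2_norm_sq_borel[OF b[OF that]])
  qed measurable
  show 2: "(\<lambda>\<theta>. slobodeckij_sq s (cbox 0 1) (X \<alpha> \<theta>)) \<in> borel_measurable P" for \<alpha> s
  proof (subst measurable_cong)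
    show "slobodeckij_sq s (cbox 0 1) (X \<alpha> \<theta>) = (\<integral>\<^sup>+x. \<integral>\<^sup>+y. ennreal ((norm (X \<alpha> \<theta> x - X \<alpha> \<theta> y))\<^sup>2 / norm (x - y) powr (real CARD('n) + 2 * s)) * indicator (cbox 0 1) y \<partial>lborel
       * indicator (cbox 0 1) x \<partial>lborel)"
      if "\<theta> \<in> space P" for \<theta> by (rule slobodeckij_sq_borel[OF b[OF that]])
  qed measurable
  show "(\<lambda>\<theta>. energy m (\<lambda>\<alpha>. X \<alpha> \<theta>)) \<in> borel_measurable P"
    unfolding energy_def using 1 2 by measurable
qed

context prob_space
begin

text \<open>The energy is an integral of squared values and squared differences. By Tonelli the
  pointwise second-moment bound passes to the mean of the energy, and some parameter does at least
  as well as the mean. Independence is replaced by order: the accumulated error \<open>S\<close> is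
  fixed before the next draw.\<close>

lemma energy_step:
  fixes X :: "('n::finite \<Rightarrow> nat) \<Rightarrow> 'a \<Rightarrow> real^'n \<Rightarrow> complex" and S :: "('n \<Rightarrow> nat) \<Rightarrow> real^'n \<Rightarrow> complex"
  assumes X [measurable]: "\<And>\<alpha>. case_prod (X \<alpha>) \<in> borel_measurable (M \<Otimes>\<^sub>M borel)"
    and S [measurable]: "\<And>\<alpha>. S \<alpha> \<in> borel_measurable borel"
    and B: "\<And>\<alpha> \<theta> x. \<theta> \<in> space M \<Longrightarrow> norm (X \<alpha> \<theta> x) \<le> B \<alpha> x"
  defines "E \<equiv> \<lambda>\<alpha> x. expectation (\<lambda>\<theta>. X \<alpha> \<theta> x)"
  shows "\<exists>\<theta>\<in>space M. energy m (\<lambda>\<alpha> x. S \<alpha> x + E \<alpha> x - X \<alpha> \<theta> x) \<le> energy m S + (\<integral>\<^sup>+\<theta>. energy m (\<lambda>\<alpha>. X \<alpha> \<theta>) \<partial>M)"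
proof -
  interpret pair_sigma_finite M "lborel :: (real^'n) measure" ..
  have pm: "borel_measurable (M \<Otimes>\<^sub>M (lborel :: (real^'n) measure)) = borel_measurable (M \<Otimes>\<^sub>M borel)"
    by (rule measurable_cong_sets) (auto intro: sets_pair_measure_cong)
  have X' [measurable]: "(\<lambda>(x, \<theta>). X \<alpha> \<theta> x) \<in> borel_measurable (borel \<Otimes>\<^sub>M M)" for \<alpha>
  proof -
    have "(\<lambda>p. case_prod (X \<alpha>) (case p of (x, \<theta>) \<Rightarrow> (\<theta>, x))) \<in> borel_measurable (borel \<Otimes>\<^sub>M M)"
      by (rule measurable_compose[OF measurable_pair_swap' X])
    then show ?thesis by (simp add: case_prod_beta')
  qed
  have E [measurable]: "E \<alpha> \<in> borel_measurable borel" for \<alpha>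
    unfolding E_def by measurable
  have Xs [measurable]: "(\<lambda>\<theta>. X \<alpha> \<theta> x) \<in> borel_measurable M" for \<alpha> x by measurable
  have Xb: "X \<alpha> \<theta> \<in> borel_measurable borel" if "\<theta> \<in> space M" for \<alpha> \<theta>
    using that by measurable
  define Y where "Y \<alpha> \<theta> x = S \<alpha> x + E \<alpha> x - X \<alpha> \<theta> x" for \<alpha> \<theta> x
  have Y [measurable]: "case_prod (Y \<alpha>) \<in> borel_measurable (M \<Otimes>\<^sub>M borel)" for \<alpha>
    unfolding Y_def by measurable
  have Yb: "Y \<alpha> \<theta> \<in> borel_measurable borel" if "\<theta> \<in> space M" for \<alpha> \<theta>
    using that by measurable
  have L2: "(\<integral>\<^sup>+\<theta>. L2_norm_sq (cbox 0 1) (Y \<alpha> \<theta>) \<partial>M) \<le> L2_norm_sq (cbox 0 1) (S \<alpha>) + (\<integral>\<^sup>+\<theta>. L2_norm_sq (cbox 0 1) (X \<alpha> \<theta>) \<partial>M)" for \<alpha>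
  proof -
    have sw: "(\<integral>\<^sup>+\<theta>. L2_norm_sq (cbox 0 1) (Z \<theta>) \<partial>M) = (\<integral>\<^sup>+x. (\<integral>\<^sup>+\<theta>. ennreal ((norm (Z \<theta> x))\<^sup>2) \<partial>M) * indicator (cbox 0 1) x \<partial>lborel)"
      if Z [measurable]: "case_prod Z \<in> borel_measurable (M \<Otimes>\<^sub>M borel)" for Z :: "'a \<Rightarrow> real^'n \<Rightarrow> complex"
    proof -
      have Zb: "Z \<theta> \<in> borel_measurable borel" if "\<theta> \<in> space M" for \<theta> using that by measurable
      have "(\<integral>\<^sup>+\<theta>. L2_norm_sq (cbox 0 1) (Z \<theta>) \<partial>M) = (\<integral>\<^sup>+\<theta>. \<integral>\<^sup>+x. ennreal ((norm (Z \<theta> x))\<^sup>2) * indicator (cbox 0 1) x \<partial>lborel \<partial>M)"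
        by (intro nn_integral_cong L2_norm_sq_borel Zb)
      also have "\<dots> = (\<integral>\<^sup>+x. \<integral>\<^sup>+\<theta>. ennreal ((norm (Z \<theta> x))\<^sup>2) * indicator (cbox 0 1) x \<partial>M \<partial>lborel)"
        by (rule Fubini'[symmetric]) (unfold pm, measurable)
      also have "\<dots> = (\<integral>\<^sup>+x. (\<integral>\<^sup>+\<theta>. ennreal ((norm (Z \<theta> x))\<^sup>2) \<partial>M) * indicator (cbox 0 1) x \<partial>lborel)"
        by (intro nn_integral_cong nn_integral_multc) measurable
      finally show ?thesis .
    qed
    have "(\<integral>\<^sup>+\<theta>. L2_norm_sq (cbox 0 1) (Y \<alpha> \<theta>) \<partial>M) = (\<integral>\<^sup>+x. (\<integral>\<^sup>+\<theta>. ennreal ((norm (Y \<alpha> \<theta> x))\<^sup>2) \<partial>M) * indicator (cbox 0 1) x \<partial>lborel)"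
      by (rule sw) measurable
    also have "\<dots> \<le> (\<integral>\<^sup>+x. (ennreal ((norm (S \<alpha> x))\<^sup>2) + (\<integral>\<^sup>+\<theta>. ennreal ((norm (X \<alpha> \<theta> x))\<^sup>2) \<partial>M)) * indicator (cbox 0 1) x \<partial>lborel)"
      unfolding Y_def E_def by (intro nn_integral_mono mult_right_mono second_moment_step[OF Xs B]) auto
    also have "\<dots> = (\<integral>\<^sup>+x. ennreal ((norm (S \<alpha> x))\<^sup>2) * indicator (cbox 0 1) x + (\<integral>\<^sup>+\<theta>. ennreal ((norm (X \<alpha> \<theta> x))\<^sup>2) \<partial>M) * indicator (cbox 0 1) x \<partial>lborel)"
      by (simp add: distrib_right)
    also have "\<dots> = (\<integral>\<^sup>+x. ennreal ((norm (S \<alpha> x))\<^sup>2) * indicator (cbox 0 1) x \<partial>lborel) + (\<integral>\<^sup>+x. (\<integral>\<^sup>+\<theta>. ennreal ((norm (X \<alpha> \<theta> x))\<^sup>2) \<partial>M) * indicator (cbox 0 1) x \<partial>lborel)"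
      by (rule nn_integral_add) measurable
    also have "\<dots> = L2_norm_sq (cbox 0 1) (S \<alpha>) + (\<integral>\<^sup>+\<theta>. L2_norm_sq (cbox 0 1) (X \<alpha> \<theta>) \<partial>M)"
      by (simp only: sw[OF X] L2_norm_sq_borel[OF S])
    finally show ?thesis .
  qed
  have Sl: "(\<integral>\<^sup>+\<theta>. slobodeckij_sq s (cbox 0 1) (Y \<alpha> \<theta>) \<partial>M) \<le> slobodeckij_sq s (cbox 0 1) (S \<alpha>) + (\<integral>\<^sup>+\<theta>. slobodeckij_sq s (cbox 0 1) (X \<alpha> \<theta>) \<partial>M)" for \<alpha> s
  proof -
    define w where "w x y = ennreal (1 / norm (x - y) powr (real CARD('n) + 2 * s)) * indicator (cbox 0 1) y * indicator (cbox 0 1) x" for x y :: "real^'n"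
    have w [measurable]: "(\<lambda>(x, y). w x y) \<in> borel_measurable (borel \<Otimes>\<^sub>M borel)" unfolding w_def by measurable
    have wb: "(\<integral>\<^sup>+y. ennreal ((norm (g x - g y))\<^sup>2 / norm (x - y) powr (real CARD('n) + 2 * s)) * indicator (cbox 0 1) y \<partial>lborel) * indicator (cbox 0 1) x
        = (\<integral>\<^sup>+y. ennreal ((norm (g x - g y))\<^sup>2) * w x y \<partial>lborel)"
      if [measurable]: "g \<in> borel_measurable borel" for g :: "real^'n \<Rightarrow> complex" and x
      by (subst nn_integral_multc[symmetric], measurable, intro nn_integral_cong)
        (auto simp: w_def ennreal_mult[symmetric] indicator_def)
    have sb: "slobodeckij_sq s (cbox 0 1) g = (\<integral>\<^sup>+x. \<integral>\<^sup>+y. ennreal ((norm (g x - g y))\<^sup>2) * w x y \<partial>lborel \<partial>lborel)"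
      if "g \<in> borel_measurable borel" for g :: "real^'n \<Rightarrow> complex"
      unfolding slobodeckij_sq_borel[OF that] wb[OF that] ..
    have sw: "(\<integral>\<^sup>+\<theta>. slobodeckij_sq s (cbox 0 1) (Z \<theta>) \<partial>M) = (\<integral>\<^sup>+x. \<integral>\<^sup>+y. (\<integral>\<^sup>+\<theta>. ennreal ((norm (Z \<theta> x - Z \<theta> y))\<^sup>2) \<partial>M) * w x y \<partial>lborel \<partial>lborel)"
      if Z [measurable]: "case_prod Z \<in> borel_measurable (M \<Otimes>\<^sub>M borel)" for Z :: "'a \<Rightarrow> real^'n \<Rightarrow> complex"
    proof -
      have Zb: "Z \<theta> \<in> borel_measurable borel" if "\<theta> \<in> space M" for \<theta> using that by measurable
      have "(\<integral>\<^sup>+\<theta>. slobodeckij_sq s (cbox 0 1) (Z \<theta>) \<partial>M) = (\<integral>\<^sup>+\<theta>. \<integral>\<^sup>+x. \<integral>\<^sup>+y. ennreal ((norm (Z \<theta> x - Z \<theta> y))\<^sup>2) * w x y \<partial>lborel \<partial>lborel \<partial>M)"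
        by (intro nn_integral_cong sb Zb)
      also have "\<dots> = (\<integral>\<^sup>+x. \<integral>\<^sup>+\<theta>. \<integral>\<^sup>+y. ennreal ((norm (Z \<theta> x - Z \<theta> y))\<^sup>2) * w x y \<partial>lborel \<partial>M \<partial>lborel)"
        by (rule Fubini'[symmetric]) (unfold pm, measurable)
      also have "\<dots> = (\<integral>\<^sup>+x. \<integral>\<^sup>+y. \<integral>\<^sup>+\<theta>. ennreal ((norm (Z \<theta> x - Z \<theta> y))\<^sup>2) * w x y \<partial>M \<partial>lborel \<partial>lborel)"
        by (intro nn_integral_cong Fubini'[symmetric]) (unfold pm, measurable)
      also have "\<dots> = (\<integral>\<^sup>+x. \<integral>\<^sup>+y. (\<integral>\<^sup>+\<theta>. ennreal ((norm (Z \<theta> x - Z \<theta> y))\<^sup>2) \<partial>M) * w x y \<partial>lborel \<partial>lborel)"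
        by (intro nn_integral_cong nn_integral_multc) measurable
      finally show ?thesis .
    qed
    \<comment> \<open>Differences between two points have the same structure as the values: a fixed
      part plus an expectation minus a sample.\<close>
    have Yd: "Y \<alpha> \<theta> x - Y \<alpha> \<theta> y = (S \<alpha> x - S \<alpha> y) + expectation (\<lambda>\<theta>. X \<alpha> \<theta> x - X \<alpha> \<theta> y) - (X \<alpha> \<theta> x - X \<alpha> \<theta> y)" for \<theta> x y
    proof -
      have "integrable M (\<lambda>\<theta>. X \<alpha> \<theta> x)" for x using B by (intro integrable_const_bound[of _ "B \<alpha> x"]) auto
      then show ?thesis by (simp add: Y_def E_def)
    qed
    have "(\<integral>\<^sup>+\<theta>. slobodeckij_sq s (cbox 0 1) (Y \<alpha> \<theta>) \<partial>M) = (\<integral>\<^sup>+x. \<integral>\<^sup>+y. (\<integral>\<^sup>+\<theta>. ennreal ((norm (Y \<alpha> \<theta> x - Y \<alpha> \<theta> y))\<^sup>2) \<partial>M) * w x y \<partial>lborel \<partial>lborel)"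
      by (rule sw) measurable
    also have "\<dots> \<le> (\<integral>\<^sup>+x. \<integral>\<^sup>+y. (ennreal ((norm (S \<alpha> x - S \<alpha> y))\<^sup>2) + (\<integral>\<^sup>+\<theta>. ennreal ((norm (X \<alpha> \<theta> x - X \<alpha> \<theta> y))\<^sup>2) \<partial>M)) * w x y \<partial>lborel \<partial>lborel)"
      unfolding Yd
    proof (intro nn_integral_mono mult_right_mono)
      fix x y
      show "(\<integral>\<^sup>+\<theta>. ennreal ((norm ((S \<alpha> x - S \<alpha> y) + expectation (\<lambda>\<theta>. X \<alpha> \<theta> x - X \<alpha> \<theta> y) - (X \<alpha> \<theta> x - X \<alpha> \<theta> y)))\<^sup>2) \<partial>M)
        \<le> ennreal ((norm (S \<alpha> x - S \<alpha> y))\<^sup>2) + (\<integral>\<^sup>+\<theta>. ennreal ((norm (X \<alpha> \<theta> x - X \<alpha> \<theta> y))\<^sup>2) \<partial>M)"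
        by (rule second_moment_step[where B="B \<alpha> x + B \<alpha> y"])
          (auto intro: order_trans[OF norm_triangle_ineq4] add_mono B)
    qed auto
    also have "\<dots> = (\<integral>\<^sup>+x. \<integral>\<^sup>+y. ennreal ((norm (S \<alpha> x - S \<alpha> y))\<^sup>2) * w x y + (\<integral>\<^sup>+\<theta>. ennreal ((norm (X \<alpha> \<theta> x - X \<alpha> \<theta> y))\<^sup>2) \<partial>M) * w x y \<partial>lborel \<partial>lborel)"
      by (simp add: distrib_right)
    also have "\<dots> = (\<integral>\<^sup>+x. (\<integral>\<^sup>+y. ennreal ((norm (S \<alpha> x - S \<alpha> y))\<^sup>2) * w x y \<partial>lborel) + (\<integral>\<^sup>+y. (\<integral>\<^sup>+\<theta>. ennreal ((norm (X \<alpha> \<theta> x - X \<alpha> \<theta> y))\<^sup>2) \<partial>M) * w x y \<partial>lborel) \<partial>lborel)"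
      by (intro nn_integral_cong nn_integral_add) measurable
    also have "\<dots> = (\<integral>\<^sup>+x. \<integral>\<^sup>+y. ennreal ((norm (S \<alpha> x - S \<alpha> y))\<^sup>2) * w x y \<partial>lborel \<partial>lborel) + (\<integral>\<^sup>+x. \<integral>\<^sup>+y. (\<integral>\<^sup>+\<theta>. ennreal ((norm (X \<alpha> \<theta> x - X \<alpha> \<theta> y))\<^sup>2) \<partial>M) * w x y \<partial>lborel \<partial>lborel)"
      by (rule nn_integral_add) measurable
    also have "\<dots> = slobodeckij_sq s (cbox 0 1) (S \<alpha>) + (\<integral>\<^sup>+\<theta>. slobodeckij_sq s (cbox 0 1) (X \<alpha> \<theta>) \<partial>M)"
      by (simp only: sw[OF X] sb[OF S])
    finally show ?thesis .
  qed
  let ?A = "{\<alpha> :: 'n \<Rightarrow> nat. mi_order \<alpha> \<le> nat \<lfloor>m\<rfloor>}" and ?T = "{\<alpha> :: 'n \<Rightarrow> nat. mi_order \<alpha> = nat \<lfloor>m\<rfloor>}"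
  have expand: "(\<integral>\<^sup>+\<theta>. energy m (\<lambda>\<alpha>. Z \<alpha> \<theta>) \<partial>M) = (\<Sum>\<alpha>\<in>?A. \<integral>\<^sup>+\<theta>. L2_norm_sq (cbox 0 1) (Z \<alpha> \<theta>) \<partial>M) +
     (if frac m = 0 then 0 else \<Sum>\<alpha>\<in>?T. \<integral>\<^sup>+\<theta>. slobodeckij_sq (frac m) (cbox 0 1) (Z \<alpha> \<theta>) \<partial>M)"
    if Z: "\<And>\<alpha>. case_prod (Z \<alpha>) \<in> borel_measurable (M \<Otimes>\<^sub>M borel)" for Z :: "('n \<Rightarrow> nat) \<Rightarrow> 'a \<Rightarrow> real^'n \<Rightarrow> complex"
  proof -
    note em [measurable] = energy_measurable[OF Z]
    show ?thesis unfolding energy_def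
      by (subst nn_integral_add) (auto simp: nn_integral_sum)
  qed
  have "(\<integral>\<^sup>+\<theta>. energy m (\<lambda>\<alpha>. Y \<alpha> \<theta>) \<partial>M) \<le>
     (\<Sum>\<alpha>\<in>?A. L2_norm_sq (cbox 0 1) (S \<alpha>) + (\<integral>\<^sup>+\<theta>. L2_norm_sq (cbox 0 1) (X \<alpha> \<theta>) \<partial>M)) +
     (if frac m = 0 then 0 else \<Sum>\<alpha>\<in>?T. slobodeckij_sq (frac m) (cbox 0 1) (S \<alpha>) + (\<integral>\<^sup>+\<theta>. slobodeckij_sq (frac m) (cbox 0 1) (X \<alpha> \<theta>) \<partial>M))"
    unfolding expand[OF Y] by (cases "frac m = 0") (auto intro!: add_mono sum_mono L2 Sl)
  also have "\<dots> = energy m S + (\<integral>\<^sup>+\<theta>. energy m (\<lambda>\<alpha>. X \<alpha> \<theta>) \<partial>M)"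
    unfolding expand[OF X] unfolding energy_def by (simp add: sum.distrib add_ac)
  finally have le: "(\<integral>\<^sup>+\<theta>. energy m (\<lambda>\<alpha>. Y \<alpha> \<theta>) \<partial>M) \<le> energy m S + (\<integral>\<^sup>+\<theta>. energy m (\<lambda>\<alpha>. X \<alpha> \<theta>) \<partial>M)" .
  obtain \<theta> where "\<theta> \<in> space M" "energy m (\<lambda>\<alpha>. Y \<alpha> \<theta>) \<le> (\<integral>\<^sup>+\<theta>. energy m (\<lambda>\<alpha>. Y \<alpha> \<theta>) \<partial>M)"
    using exists_le_nn_integral[OF energy_measurable(3)[of Y M m, OF Y]] by blast
  with le show ?thesis unfolding Y_def by (meson order_trans)
qed

end

section \<open>Networks with their formal derivatives\<close>

definition neuron :: "nat \<Rightarrow> real^'n::finite \<Rightarrow> real \<Rightarrow> ('n \<Rightarrow> nat) \<Rightarrow> real^'n \<Rightarrow> real" where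
  "neuron k \<omega> b \<alpha> x = dcoef k \<omega> \<alpha> * relu_pow (k - mi_order \<alpha>) (\<omega> \<bullet> x - b)"

text \<open>A network together with its formal derivatives of all orders.\<close>
inductive is_net :: "nat \<Rightarrow> nat \<Rightarrow> (('n::finite \<Rightarrow> nat) \<Rightarrow> real^'n \<Rightarrow> complex) \<Rightarrow> bool" for k where
  zero: "is_net k N (\<lambda>\<alpha> x. 0)"
| add: "is_net k N u \<Longrightarrow> \<omega> \<in> sphere 0 1 \<Longrightarrow>
    is_net k (Suc N) (\<lambda>\<alpha> x. u \<alpha> x + a * of_real (neuron k \<omega> b \<alpha> x))"

definition nets :: "nat \<Rightarrow> nat \<Rightarrow> (('n::finite \<Rightarrow> nat) \<Rightarrow> real^'n \<Rightarrow> complex) set" where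
  "nets k N = {u. is_net k N u}"

lemma nets_zero: "(\<lambda>\<alpha> x. 0) \<in> nets k N"
  by (simp add: nets_def is_net.zero)

lemma nets_add: "u \<in> nets k N \<Longrightarrow> \<omega> \<in> sphere 0 1 \<Longrightarrow>
    (\<lambda>\<alpha> x. u \<alpha> x + a * of_real (neuron k \<omega> b \<alpha> x)) \<in> nets k (Suc N)"
  unfolding nets_def by (simp add: is_net.add)

lemma nets_induct [consumes 1, case_names zero add]:
  assumes "u \<in> nets k N" "\<And>N. Q N (\<lambda>\<alpha> x. 0)"
    "\<And>u N \<omega> a b. u \<in> nets k N \<Longrightarrow> \<omega> \<in> sphere 0 1 \<Longrightarrow> Q N u \<Longrightarrow>
       Q (Suc N) (\<lambda>\<alpha> x. u \<alpha> x + a * of_real (neuron k \<omega> b \<alpha> x))"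
  shows "Q N u"
  using assms(1) unfolding nets_def mem_Collect_eq
  by (induction rule: is_net.induct) (auto intro: assms(2,3) simp: nets_def)

lemma neuron_measurable [measurable]: "neuron k \<omega> b \<alpha> \<in> borel_measurable borel"
  unfolding neuron_def by measurable

lemma nets_measurable: "u \<in> nets k N \<Longrightarrow> u \<alpha> \<in> borel_measurable borel"
  by (induction rule: nets_induct) simp_all

text \<open>The zero rule of \<open>is_net\<close> holds for every \<open>N\<close>, so
  \<open>N\<close> only bounds the number of neurons from above.\<close>

lemma nets_Suc: "u \<in> nets k N \<Longrightarrow> u \<in> nets k (Suc N)"
proof (induction rule: nets_induct)
  case (add u N \<omega> a b)
  show ?case by (rule nets_add[OF add.IH add.hyps(2)])
qed (rule nets_zero)

lemma nets_mono: "N \<le> M \<Longrightarrow> u \<in> nets k N \<Longrightarrow> u \<in> nets k M"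
  by (induction M rule: dec_induct) (auto intro: nets_Suc)

lemma nets_plus:
  assumes "v \<in> nets k M" "u \<in> nets k N"
  shows "(\<lambda>\<alpha> x. u \<alpha> x + v \<alpha> x) \<in> nets k (N + M)"
  using assms
proof (induction rule: nets_induct)
  case (zero M)
  then show ?case by (auto intro: nets_mono[of N "N + M"])
next
  case (add v M \<omega> a b)
  from nets_add[OF add.IH[OF add.prems] add.hyps(2), of a b] show ?case by (simp add: add.assoc)
qed

lemma nets_single: "\<omega> \<in> sphere 0 1 \<Longrightarrow> (\<lambda>\<alpha> x. a * of_real (neuron k \<omega> b \<alpha> x)) \<in> nets k 1"
  using nets_add[OF nets_zero[of k 0], of \<omega> a b] by simp

lemma nets_sum:
  assumes "finite I" "\<And>i. i \<in> I \<Longrightarrow> u i \<in> nets k (N i)"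
  shows "(\<lambda>\<alpha> x. \<Sum>i\<in>I. u i \<alpha> x) \<in> nets k (\<Sum>i\<in>I. N i)"
  using assms
proof (induction rule: finite_induct)
  case (insert i I)
  then show ?case using nets_plus[of "\<lambda>\<alpha> x. \<Sum>i\<in>I. u i \<alpha> x" k "\<Sum>i\<in>I. N i" "u i" "N i"] by simp
qed (simp add: nets_zero)

lemma sphere_nonempty: "\<exists>\<omega> :: real^'n::finite. \<omega> \<in> sphere 0 1"
  using norm_axis_1 by (metis dist_0_norm mem_sphere)

text \<open>The component of index 0 is the network itself. Members of \<open>shallow_nets\<close>
  have exactly \<open>N\<close> summands with unit directions; missing ones are filled with
  coefficient 0 and an arbitrary unit vector.\<close>

lemma nets_shallow:
  assumes "u \<in> nets k N"
  shows "u (\<lambda>_. 0) \<in> shallow_nets k N"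
  using assms
proof (induction rule: nets_induct)
  case (zero N)
  obtain \<omega> :: "real^'a" where "\<omega> \<in> sphere 0 1" using sphere_nonempty by blast
  then show ?case unfolding shallow_nets_def
    by (intro CollectI exI[of _ "\<lambda>_. 0"] exI[of _ "\<lambda>_. \<omega>"]) auto
next
  case (add u N \<omega> a b)
  then obtain a' \<omega>' b' where u: "u (\<lambda>_. 0) = (\<lambda>x. \<Sum>i<N. a' i * of_real (relu_pow k (\<omega>' i \<bullet> x + b' i)))"
    "\<forall>i<N. \<omega>' i \<in> sphere 0 1" by (auto simp: shallow_nets_def)
  have n: "neuron k \<omega> b (\<lambda>_. 0) x = relu_pow k (\<omega> \<bullet> x + (- b))" for x
    by (simp add: neuron_def dcoef_def mi_order_def)
  show ?case unfolding shallow_nets_def n u(1) using u(2) add.hyps(2)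
    by (intro CollectI exI[of _ "a'(N := a)"] exI[of _ "\<omega>'(N := \<omega>)"] exI[of _ "b'(N := - b)"])
      (auto simp: less_Suc_eq)
qed

text \<open>The quantifier over all \<open>S\<close> makes the notion additive: the errors committed so far play the
  role of \<open>S\<close> when the next part of the target is approximated.\<close>
definition good :: "nat \<Rightarrow> real \<Rightarrow> nat \<Rightarrow> (('n::finite \<Rightarrow> nat) \<Rightarrow> real^'n \<Rightarrow> complex) \<Rightarrow> real \<Rightarrow> bool" where
  "good k m N Y \<delta> \<longleftrightarrow> \<delta> \<ge> 0 \<and> (\<forall>\<alpha>. Y \<alpha> \<in> borel_measurable borel) \<and>
     (\<forall>S. (\<forall>\<alpha>. S \<alpha> \<in> borel_measurable borel) \<longrightarrow>
        (\<exists>v\<in>nets k N. energy m (\<lambda>\<alpha> x. S \<alpha> x + Y \<alpha> x - v \<alpha> x) \<le> energy m S + ennreal \<delta>))"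

lemma goodD:
  assumes "good k m N Y \<delta>" "\<And>\<alpha>. S \<alpha> \<in> borel_measurable borel"
  obtains v where "v \<in> nets k N" "energy m (\<lambda>\<alpha> x. S \<alpha> x + Y \<alpha> x - v \<alpha> x) \<le> energy m S + ennreal \<delta>"
  using assms unfolding good_def by blast

lemma good_zero: "good k m N (\<lambda>\<alpha> x. 0) 0"
  unfolding good_def by (auto intro!: bexI[OF _ nets_zero])

lemma good_mono: "good k m N Y \<delta> \<Longrightarrow> N \<le> M \<Longrightarrow> \<delta> \<le> \<delta>' \<Longrightarrow> good k m M Y \<delta>'"
  unfolding good_def
  by (meson add_left_mono dual_order.trans ennreal_leI nets_mono)

lemma good_plus:
  assumes 1: "good k m N Y \<delta>" and 2: "good k m N' Y' \<delta>'"
  shows "good k m (N + N') (\<lambda>\<alpha> x. Y \<alpha> x + Y' \<alpha> x) (\<delta> + \<delta>')"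
  unfolding good_def
proof (intro conjI allI impI)
  have d: "\<delta> \<ge> 0" "\<delta>' \<ge> 0" and [measurable]: "\<And>\<alpha>. Y \<alpha> \<in> borel_measurable borel" "\<And>\<alpha>. Y' \<alpha> \<in> borel_measurable borel"
    using 1 2 by (auto simp: good_def)
  show "\<delta> + \<delta>' \<ge> 0" using d by simp
  show "(\<lambda>x. Y \<alpha> x + Y' \<alpha> x) \<in> borel_measurable borel" for \<alpha> by measurable
  fix S :: "('a \<Rightarrow> nat) \<Rightarrow> real^'a \<Rightarrow> complex" assume S: "\<forall>\<alpha>. S \<alpha> \<in> borel_measurable borel"
  then obtain v where v: "v \<in> nets k N" "energy m (\<lambda>\<alpha> x. S \<alpha> x + Y \<alpha> x - v \<alpha> x) \<le> energy m S + ennreal \<delta>"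
    using goodD[OF 1, of S] by blast
  let ?S = "\<lambda>\<alpha> x. S \<alpha> x + Y \<alpha> x - v \<alpha> x"
  have [measurable]: "\<And>\<alpha>. v \<alpha> \<in> borel_measurable borel" by (rule nets_measurable[OF v(1)])
  have [measurable]: "\<And>\<alpha>. S \<alpha> \<in> borel_measurable borel" using S by blast
  have "?S \<alpha> \<in> borel_measurable borel" for \<alpha> by measurable
  then obtain v' where v': "v' \<in> nets k N'" "energy m (\<lambda>\<alpha> x. ?S \<alpha> x + Y' \<alpha> x - v' \<alpha> x) \<le> energy m ?S + ennreal \<delta>'"
    using goodD[OF 2, of ?S] by blast
  have net: "(\<lambda>\<alpha> x. v \<alpha> x + v' \<alpha> x) \<in> nets k (N + N')" by (rule nets_plus[OF v'(1) v(1)])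
  have le: "energy m (\<lambda>\<alpha> x. S \<alpha> x + (Y \<alpha> x + Y' \<alpha> x) - (v \<alpha> x + v' \<alpha> x)) \<le> energy m S + ennreal (\<delta> + \<delta>')"
  proof -
    have "(\<lambda>\<alpha> x. S \<alpha> x + (Y \<alpha> x + Y' \<alpha> x) - (v \<alpha> x + v' \<alpha> x)) = (\<lambda>\<alpha> x. ?S \<alpha> x + Y' \<alpha> x - v' \<alpha> x)"
      by (simp add: fun_eq_iff)
    then have "energy m (\<lambda>\<alpha> x. S \<alpha> x + (Y \<alpha> x + Y' \<alpha> x) - (v \<alpha> x + v' \<alpha> x)) \<le> energy m ?S + ennreal \<delta>'"
      using v'(2) by simp
    also have "\<dots> \<le> (energy m S + ennreal \<delta>) + ennreal \<delta>'" by (intro add_right_mono v)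
    also have "\<dots> = energy m S + ennreal (\<delta> + \<delta>')" using d by (simp add: add.assoc)
    finally show ?thesis .
  qed
  show "\<exists>v\<in>nets k (N + N'). energy m (\<lambda>\<alpha> x. S \<alpha> x + (Y \<alpha> x + Y' \<alpha> x) - v \<alpha> x) \<le> energy m S + ennreal (\<delta> + \<delta>')"
    by (rule bexI[where x="\<lambda>\<alpha> x. v \<alpha> x + v' \<alpha> x"]) (rule le, rule net)
qed

lemma good_sum:
  assumes "finite I" "\<And>i. i \<in> I \<Longrightarrow> good k m (N i) (Y i) (\<delta> i)"
  shows "good k m (\<Sum>i\<in>I. N i) (\<lambda>\<alpha> x. \<Sum>i\<in>I. Y i \<alpha> x) (\<Sum>i\<in>I. \<delta> i)"
  using assms
proof (induction rule: finite_induct)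
  case (insert i I)
  then show ?case
    using good_plus[of k m "N i" "Y i" "\<delta> i" "\<Sum>i\<in>I. N i" "\<lambda>\<alpha> x. \<Sum>i\<in>I. Y i \<alpha> x" "\<Sum>i\<in>I. \<delta> i"] by simp
qed (simp add: good_zero)

text \<open>The network consists of the sample \<open>X \<alpha> \<theta>\<close> and of the
  deterministic part, \<open>Y\<close> minus the mean of \<open>X\<close>. What it leaves of S + Y
  is \<open>S\<close> plus mean minus sample, the situation of \<open>energy_step\<close>.\<close>

lemma good_random:
  fixes X :: "('n::finite \<Rightarrow> nat) \<Rightarrow> 'a \<Rightarrow> real^'n \<Rightarrow> complex"
  assumes P: "prob_space P"
    and X [measurable]: "\<And>\<alpha>. case_prod (X \<alpha>) \<in> borel_measurable (P \<Otimes>\<^sub>M borel)"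
    and B: "\<And>\<alpha> \<theta> x. \<theta> \<in> space P \<Longrightarrow> norm (X \<alpha> \<theta> x) \<le> B \<alpha> x"
    and Y: "\<And>\<alpha>. Y \<alpha> \<in> borel_measurable borel"
    and net: "\<And>\<theta>. \<theta> \<in> space P \<Longrightarrow> (\<lambda>\<alpha> x. X \<alpha> \<theta> x + (Y \<alpha> x - (LINT \<theta>|P. X \<alpha> \<theta> x))) \<in> nets k N"
    and E: "\<And>\<theta>. \<theta> \<in> space P \<Longrightarrow> energy m (\<lambda>\<alpha>. X \<alpha> \<theta>) \<le> ennreal \<delta>" and \<delta>: "\<delta> \<ge> 0"
  shows "good k m N Y \<delta>"
  unfolding good_def
proof (intro conjI allI impI \<delta> Y)
  interpret prob_space P by (rule P)
  fix S :: "('n \<Rightarrow> nat) \<Rightarrow> real^'n \<Rightarrow> complex" assume "\<forall>\<alpha>. S \<alpha> \<in> borel_measurable borel"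
  then obtain \<theta> where \<theta>: "\<theta> \<in> space P"
    "energy m (\<lambda>\<alpha> x. S \<alpha> x + (LINT \<theta>|P. X \<alpha> \<theta> x) - X \<alpha> \<theta> x) \<le> energy m S + (\<integral>\<^sup>+\<theta>. energy m (\<lambda>\<alpha>. X \<alpha> \<theta>) \<partial>P)"
    using energy_step[of X S B m, OF X _ B] by blast
  note \<theta>(2)
  also have "energy m S + (\<integral>\<^sup>+\<theta>. energy m (\<lambda>\<alpha>. X \<alpha> \<theta>) \<partial>P) \<le> energy m S + (\<integral>\<^sup>+\<theta>. ennreal \<delta> \<partial>P)"
    by (intro add_left_mono nn_integral_mono E)
  also have "(\<integral>\<^sup>+\<theta>. ennreal \<delta> \<partial>P) = ennreal \<delta>" by (simp add: emeasure_space_1)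
  finally have le: "energy m (\<lambda>\<alpha> x. S \<alpha> x + (LINT \<theta>|P. X \<alpha> \<theta> x) - X \<alpha> \<theta> x) \<le> energy m S + ennreal \<delta>" .
  show "\<exists>v\<in>nets k N. energy m (\<lambda>\<alpha> x. S \<alpha> x + Y \<alpha> x - v \<alpha> x) \<le> energy m S + ennreal \<delta>"
  proof (rule bexI[OF _ net[OF \<theta>(1)]])
    show "energy m (\<lambda>\<alpha> x. S \<alpha> x + Y \<alpha> x - (X \<alpha> \<theta> x + (Y \<alpha> x - (LINT \<theta>|P. X \<alpha> \<theta> x)))) \<le> energy m S + ennreal \<delta>"
      using le by (simp add: algebra_simps)
  qed
qed

lemma energy_cmult:
  assumes [measurable]: "\<And>\<alpha>. D \<alpha> \<in> borel_measurable borel"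
  shows "energy m (\<lambda>\<alpha> x. c * D \<alpha> x) = ennreal ((norm c)\<^sup>2) * energy m D"
proof -
  have 1: "L2_norm_sq (cbox 0 1) (\<lambda>x. c * D \<alpha> x) = ennreal ((norm c)\<^sup>2) * L2_norm_sq (cbox 0 1) (D \<alpha>)" for \<alpha>
  proof -
    have "L2_norm_sq (cbox 0 1) (\<lambda>x. c * D \<alpha> x) = (\<integral>\<^sup>+x. ennreal ((norm c)\<^sup>2) * (ennreal ((norm (D \<alpha> x))\<^sup>2) * indicator (cbox 0 1) x) \<partial>lborel)"
      by (subst L2_norm_sq_borel, measurable)
        (simp add: norm_mult power_mult_distrib ennreal_mult mult.assoc)
    also have "\<dots> = ennreal ((norm c)\<^sup>2) * L2_norm_sq (cbox 0 1) (D \<alpha>)"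
      by (subst L2_norm_sq_borel, measurable) (rule nn_integral_cmult, measurable)
    finally show ?thesis .
  qed
  have 2: "slobodeckij_sq s (cbox 0 1) (\<lambda>x. c * D \<alpha> x) = ennreal ((norm c)\<^sup>2) * slobodeckij_sq s (cbox 0 1) (D \<alpha>)" for \<alpha> s
  proof -
    have *: "ennreal ((norm (c * D \<alpha> x - c * D \<alpha> y))\<^sup>2 / w) = ennreal ((norm c)\<^sup>2) * ennreal ((norm (D \<alpha> x - D \<alpha> y))\<^sup>2 / w)" if "w \<ge> 0" for x y w
      using that by (simp add: right_diff_distrib[symmetric] norm_mult power_mult_distrib ennreal_mult[symmetric])
    have "slobodeckij_sq s (cbox 0 1) (\<lambda>x. c * D \<alpha> x) =
      (\<integral>\<^sup>+x. \<integral>\<^sup>+y. ennreal ((norm c)\<^sup>2) * (ennreal ((norm (D \<alpha> x - D \<alpha> y))\<^sup>2 / norm (x - y) powr (real CARD('a) + 2 * s)) * indicator (cbox 0 1) y) \<partial>lborel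
       * indicator (cbox 0 1) x \<partial>lborel)"
      by (subst slobodeckij_sq_borel, measurable) (simp add: * mult.assoc)
    also have "\<dots> = (\<integral>\<^sup>+x. ennreal ((norm c)\<^sup>2) * (\<integral>\<^sup>+y. (ennreal ((norm (D \<alpha> x - D \<alpha> y))\<^sup>2 / norm (x - y) powr (real CARD('a) + 2 * s)) * indicator (cbox 0 1) y) \<partial>lborel
       * indicator (cbox 0 1) x) \<partial>lborel)"
      by (subst nn_integral_cmult, measurable) (simp add: mult.assoc)
    also have "\<dots> = ennreal ((norm c)\<^sup>2) * slobodeckij_sq s (cbox 0 1) (D \<alpha>)"
      by (subst slobodeckij_sq_borel, measurable) (rule nn_integral_cmult, measurable)
    finally show ?thesis .
  qed
  show ?thesis unfolding energy_def 1 2 by (simp add: sum_distrib_left[symmetric] distrib_left)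
qed

text \<open>A crude bound, uniform over \<alpha> and over the biases in [-L, L]; it serves as a
  majorant for integrability and leaves the rate untouched.\<close>

lemma neuron_abs_le:
  assumes "\<omega> \<in> sphere 0 1" "\<bar>b\<bar> \<le> L"
  shows "\<bar>neuron k \<omega> b \<alpha> x\<bar> \<le> fact k * (1 + norm x + L) ^ k"
proof -
  have "\<bar>\<omega> \<bullet> x - b\<bar> \<le> 1 + norm x + L"
    using Cauchy_Schwarz_ineq2[of \<omega> x] assms by simp
  then have "\<bar>relu_pow (k - mi_order \<alpha>) (\<omega> \<bullet> x - b)\<bar> \<le> (1 + norm x + L) ^ (k - mi_order \<alpha>)"
    by (auto simp: relu_pow_eq power_abs[symmetric] intro!: power_mono)
  also have "\<dots> \<le> (1 + norm x + L) ^ k" using assms by (intro power_increasing) auto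
  finally show ?thesis unfolding neuron_def abs_mult by (intro mult_mono abs_dcoef_le assms) auto
qed

lemma neuron_joint_measurable [measurable]:
  "(\<lambda>(b, x). neuron k \<omega> b \<alpha> x) \<in> borel_measurable (borel \<Otimes>\<^sub>M borel)"
  unfolding neuron_def by measurable

text \<open>One cell of the stratification: the interpolating part of the target is reproduced exactly and
  only the localised remainder is sampled.\<close>
lemma good_cell:
  fixes m H :: real
  assumes m: "0 \<le> m" "m < real k + 1/2" and H: "H \<ge> 1"
  obtains C :: real where "C > 0"
    "\<And>(\<omega>::real^'n::finite) \<beta> h \<rho> A. \<omega> \<in> sphere 0 1 \<Longrightarrow> 0 < h \<Longrightarrow> h \<le> H \<Longrightarrow> \<rho> \<in> borel_measurable borel \<Longrightarrow>
      (\<And>b. norm (\<rho> b) \<le> A) \<Longrightarrow>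
      good k m (k + 2) (\<lambda>\<alpha> x. LINT b|lborel. indicator {\<beta>..\<beta> + h} b * \<rho> b * of_real (neuron k \<omega> b \<alpha> x))
        (C * (A\<^sup>2 * h powr (2 * (real k - m) + 3)))"
proof -
  obtain C where C: "C > 0"
    "\<And>(\<omega>::real^'n) \<beta> h b. \<omega> \<in> sphere 0 1 \<Longrightarrow> 0 < h \<Longrightarrow> h \<le> H \<Longrightarrow> \<beta> \<le> b \<Longrightarrow> b \<le> \<beta> + h \<Longrightarrow>
      energy m (\<lambda>\<alpha> x. of_real (dcoef k \<omega> \<alpha> * kern k (k - mi_order \<alpha>) \<beta> h b (\<omega> \<bullet> x)))
        \<le> ennreal (C * h powr (2 * (real k - m) + 1))"
    by (rule kern_energy_bound[OF m H, where 'n='n]) (rule that, assumption+)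
  obtain Bl where Bl: "Bl \<ge> 0" "\<And>r y. r \<le> k \<Longrightarrow> 0 \<le> y \<Longrightarrow> y \<le> 1 \<Longrightarrow> \<bar>lagr k r y\<bar> \<le> Bl"
    by (rule lagr_bounded) (rule that, assumption+)
  show ?thesis
  proof (rule that[OF C(1)])
    fix \<omega> :: "real^'n" and \<beta> h A :: real and \<rho> :: "real \<Rightarrow> complex"
    assume \<omega>: "\<omega> \<in> sphere 0 1" and h: "0 < h" "h \<le> H" and \<rho> [measurable]: "\<rho> \<in> borel_measurable borel"
      and A: "\<And>b. norm (\<rho> b) \<le> A"
    have A0: "A \<ge> 0" using A[of 0] norm_ge_zero order_trans by blast
    let ?I = "{\<beta>..\<beta> + h}"
    define nd where "nd r = \<beta> + h * lnode k r" for r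
    define l where "l r b = lagr k r ((b - \<beta>) / h)" for r b
    have [measurable]: "l r \<in> borel_measurable borel" for r unfolding l_def by measurable
    define Y where "Y \<alpha> x = (LINT b|lborel. indicator ?I b * \<rho> b * of_real (neuron k \<omega> b \<alpha> x))" for \<alpha> x
    \<comment> \<open>The interpolating part integrates to a fixed combination of the
      \<open>k + 1\<close> node neurons; these are its coefficients.\<close>
    define J where "J r = (LINT b|lborel. indicator ?I b * (\<rho> b * of_real (l r b)))" for r
    \<comment> \<open>The factor \<open>h\<close> compensates the density \<open>1 / h\<close> of
      the uniform distribution on the cell, so that the mean is the full integral over the
      cell.\<close>
    define X where "X \<alpha> b x = indicator ?I b * of_real h * \<rho> b * of_real (neuron k \<omega> b \<alpha> x - (\<Sum>r\<le>k. l r b * neuron k \<omega> (nd r) \<alpha> x))" for \<alpha> b x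
    define L where "L = \<bar>\<beta>\<bar> + h"
    have bL: "\<bar>b\<bar> \<le> L" if "b \<in> ?I" for b using that h by (auto simp: L_def)
    have ndI: "nd r \<in> ?I" if "r \<le> k" for r
      using cell_node_bounds[OF diff_le_self[of k 0] h(1) _ _ that, of \<beta> \<beta>] h by (auto simp: nd_def)
    have l_le: "\<bar>l r b\<bar> \<le> Bl" if "b \<in> ?I" "r \<le> k" for r b
      unfolding l_def using that h by (intro Bl) auto
    have nb: "\<bar>neuron k \<omega> b \<alpha> x\<bar> \<le> fact k * (1 + norm x + L) ^ k" if "b \<in> ?I" for b \<alpha> x
      by (rule neuron_abs_le[OF \<omega> bL[OF that]])
    have int_I: "integrable lborel (\<lambda>b. indicator ?I b * g b)" if [measurable]: "g \<in> borel_measurable borel" and "\<And>b. b \<in> ?I \<Longrightarrow> norm (g b) \<le> M" for g :: "real \<Rightarrow> complex" and M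
    proof -
      have "integrable lborel (\<lambda>b. indicator ?I b *\<^sub>R g b)"
        by (rule integrableI_bounded_set_indicator[where B=M]) (use that in \<open>auto simp: emeasure_lborel_Icc_eq\<close>)
      moreover have "indicator ?I b *\<^sub>R g b = indicator ?I b * g b" for b by (simp add: indicator_def)
      ultimately show ?thesis by simp
    qed
    have XL: "X \<alpha> b x = indicator ?I b * of_real h * \<rho> b * of_real (dcoef k \<omega> \<alpha> * kern k (k - mi_order \<alpha>) \<beta> h b (\<omega> \<bullet> x))" for \<alpha> b x
      by (simp add: X_def neuron_def kern_def l_def nd_def right_diff_distrib sum_distrib_left mult_ac)
    define P where "P = density lborel (\<lambda>b. ennreal (indicator ?I b / h))"
    have P: "prob_space P"
    proof
      have "emeasure P (space P) = (\<integral>\<^sup>+b. ennreal (1 / h) * indicator ?I b \<partial>lborel)"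
        unfolding P_def by (subst emeasure_density) (auto intro!: nn_integral_cong simp: indicator_def)
      also have "\<dots> = 1" using h by (simp add: nn_integral_cmult_indicator ennreal_mult[symmetric])
      finally show "emeasure P (space P) = 1" .
    qed
    have EP: "(LINT b|P. X \<alpha> b x) = Y \<alpha> x - (\<Sum>r\<le>k. J r * of_real (neuron k \<omega> (nd r) \<alpha> x))" for \<alpha> x
    proof -
      have "(LINT b|P. X \<alpha> b x) = (LINT b|lborel. (indicator ?I b / h) *\<^sub>R X \<alpha> b x)"
        unfolding P_def using h by (subst integral_density) (auto simp: X_def)
      also have "\<dots> = (LINT b|lborel. indicator ?I b * (\<rho> b * of_real (neuron k \<omega> b \<alpha> x)) - (\<Sum>r\<le>k. (indicator ?I b * (\<rho> b * of_real (l r b))) * of_real (neuron k \<omega> (nd r) \<alpha> x)))"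
        using h by (intro Bochner_Integration.integral_cong)
          (auto simp: X_def indicator_def scaleR_conv_of_real right_diff_distrib sum_distrib_left mult_ac)
      also have "\<dots> = (LINT b|lborel. indicator ?I b * (\<rho> b * of_real (neuron k \<omega> b \<alpha> x))) - (\<Sum>r\<le>k. (LINT b|lborel. (indicator ?I b * (\<rho> b * of_real (l r b))) * of_real (neuron k \<omega> (nd r) \<alpha> x)))"
      proof -
        have "integrable lborel (\<lambda>b. indicator ?I b * (\<rho> b * of_real (neuron k \<omega> b \<alpha> x)))"
          by (rule int_I[of _ "A * (fact k * (1 + norm x + L) ^ k)"], measurable)
            (auto simp: norm_mult intro!: mult_mono A nb A0)
        moreover have "integrable lborel (\<lambda>b. (indicator ?I b * (\<rho> b * of_real (l r b))) * of_real (neuron k \<omega> (nd r) \<alpha> x))" if "r \<le> k" for r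
          by (intro integrable_mult_left int_I[of _ "A * Bl"], measurable)
            (auto simp: norm_mult intro!: mult_mono A l_le A0 that)
        ultimately show ?thesis
          by (subst Bochner_Integration.integral_diff Bochner_Integration.integral_sum; (auto)?)+
      qed
      also have "(\<Sum>r\<le>k. (LINT b|lborel. (indicator ?I b * (\<rho> b * of_real (l r b))) * of_real (neuron k \<omega> (nd r) \<alpha> x))) =
          (\<Sum>r\<le>k. J r * of_real (neuron k \<omega> (nd r) \<alpha> x))"
        by (simp only: integral_mult_left_zero J_def)
      finally show ?thesis by (simp add: Y_def mult.assoc)
    qed
    show "good k m (k + 2) (\<lambda>\<alpha> x. LINT b|lborel. indicator ?I b * \<rho> b * of_real (neuron k \<omega> b \<alpha> x))
        (C * (A\<^sup>2 * h powr (2 * (real k - m) + 3)))"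
      unfolding Y_def[symmetric]
    proof (rule good_random[OF P, where X=X and B="\<lambda>\<alpha> x. h * A * ((1 + real (Suc k) * Bl) * (fact k * (1 + norm x + L) ^ k))"])
      have sP: "sets (P \<Otimes>\<^sub>M (borel :: (real^'n) measure)) = sets (borel \<Otimes>\<^sub>M borel)"
        by (intro sets_pair_measure_cong) (auto simp: P_def)
      have "case_prod (X \<alpha>) \<in> borel_measurable (borel \<Otimes>\<^sub>M borel)" for \<alpha>
        unfolding X_def by measurable
      then show "case_prod (X \<alpha>) \<in> borel_measurable (P \<Otimes>\<^sub>M borel)" for \<alpha>
        using measurable_cong_sets[OF sP refl] by blast
      show "norm (X \<alpha> b x) \<le> h * A * ((1 + real (Suc k) * Bl) * (fact k * (1 + norm x + L) ^ k))" for \<alpha> b x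
      proof (cases "b \<in> ?I")
        case True
        let ?M = "fact k * (1 + norm x + L) ^ k :: real"
        have M0: "?M \<ge> 0" using h by (simp add: L_def)
        have "\<bar>\<Sum>r\<le>k. l r b * neuron k \<omega> (nd r) \<alpha> x\<bar> \<le> (\<Sum>r\<le>k. Bl * ?M)"
          by (intro order_trans[OF sum_abs] sum_mono)
            (auto simp only: abs_mult atMost_iff intro!: mult_mono l_le True nb ndI Bl(1))
        also have "\<dots> = real (Suc k) * Bl * ?M" by simp
        finally have "\<bar>neuron k \<omega> b \<alpha> x - (\<Sum>r\<le>k. l r b * neuron k \<omega> (nd r) \<alpha> x)\<bar> \<le> ?M + real (Suc k) * Bl * ?M"
          using nb[OF True, of \<alpha> x] by linarith
        also have "\<dots> = (1 + real (Suc k) * Bl) * ?M" by (simp add: algebra_simps)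
        finally have s: "\<bar>neuron k \<omega> b \<alpha> x - (\<Sum>r\<le>k. l r b * neuron k \<omega> (nd r) \<alpha> x)\<bar> \<le> (1 + real (Suc k) * Bl) * ?M" .
        have "norm (X \<alpha> b x) = h * norm (\<rho> b) * \<bar>neuron k \<omega> b \<alpha> x - (\<Sum>r\<le>k. l r b * neuron k \<omega> (nd r) \<alpha> x)\<bar>"
          unfolding X_def norm_mult norm_of_real using h True by simp
        also have "\<dots> \<le> h * A * ((1 + real (Suc k) * Bl) * ?M)"
          using h A0 by (intro mult_mono mult_left_mono A s) auto
        finally show ?thesis .
      next
        case False
        have "0 \<le> h * A * ((1 + real (Suc k) * Bl) * (fact k * (1 + norm x + L) ^ k))"
          using h A0 Bl(1) by (simp add: L_def)
        with False show ?thesis by (simp add: X_def)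
      qed
      show "Y \<alpha> \<in> borel_measurable borel" for \<alpha>
        unfolding Y_def by measurable
      show "(\<lambda>\<alpha> x. X \<alpha> b x + (Y \<alpha> x - (LINT b|P. X \<alpha> b x))) \<in> nets k (k + 2)" for b
      proof -
        \<comment> \<open>There are \<open>k + 1\<close> node neurons and one sampled neuron; the
          sample only modifies the coefficients at the nodes, which accounts for
          \<open>k + 2\<close> in total.\<close>
        let ?c = "indicator ?I b * of_real h * \<rho> b"
        have "(\<lambda>\<alpha> x. (\<Sum>r\<le>k. (J r - ?c * of_real (l r b)) * of_real (neuron k \<omega> (nd r) \<alpha> x)) + ?c * of_real (neuron k \<omega> b \<alpha> x)) \<in> nets k ((\<Sum>r\<le>k. 1) + 1)"
          by (intro nets_plus nets_sum nets_single \<omega>) auto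
        moreover have "X \<alpha> b x + (Y \<alpha> x - (LINT b|P. X \<alpha> b x)) = (\<Sum>r\<le>k. (J r - ?c * of_real (l r b)) * of_real (neuron k \<omega> (nd r) \<alpha> x)) + ?c * of_real (neuron k \<omega> b \<alpha> x)" for \<alpha> x
          unfolding EP by (simp add: X_def algebra_simps sum_subtractf sum_distrib_left)
        ultimately show ?thesis by simp
      qed
      show "energy m (\<lambda>\<alpha>. X \<alpha> b) \<le> ennreal (C * (A\<^sup>2 * h powr (2 * (real k - m) + 3)))" for b
      proof (cases "b \<in> ?I")
        case True
        have "(\<lambda>\<alpha>. X \<alpha> b) = (\<lambda>\<alpha> x. (of_real h * \<rho> b) * of_real (dcoef k \<omega> \<alpha> * kern k (k - mi_order \<alpha>) \<beta> h b (\<omega> \<bullet> x)))"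
          using True by (simp add: XL fun_eq_iff)
        then have "energy m (\<lambda>\<alpha>. X \<alpha> b) = ennreal ((norm (of_real h * \<rho> b))\<^sup>2) * energy m (\<lambda>\<alpha> x. of_real (dcoef k \<omega> \<alpha> * kern k (k - mi_order \<alpha>) \<beta> h b (\<omega> \<bullet> x)))"
          by (simp only:) (rule energy_cmult, measurable)
        also have "\<dots> \<le> ennreal ((h * A)\<^sup>2) * ennreal (C * h powr (2 * (real k - m) + 1))"
          using h A0 True by (intro mult_mono ennreal_leI power_mono C(2) \<omega>) (auto simp: norm_mult intro!: mult_left_mono A)
        also have "\<dots> = ennreal ((h * A)\<^sup>2 * (C * h powr (2 * (real k - m) + 1)))"
          by (simp add: ennreal_mult')
        \<comment> \<open>Squaring the factor \<open>h\<close> in \<open>X\<close> raises the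
          exponent from \<open>2 * (real k - m) + 1\<close> to
          \<open>2 * (real k - m) + 3\<close>.\<close>
        also have "(h * A)\<^sup>2 * (C * h powr (2 * (real k - m) + 1)) = C * (A\<^sup>2 * h powr (2 * (real k - m) + 3))"
        proof -
          have "h powr (2 * (real k - m) + 3) = h powr (2 * (real k - m) + 1) * h powr 2"
            by (simp add: powr_add[symmetric] add_ac)
          also have "h powr 2 = h\<^sup>2" using h by simp
          finally show ?thesis by (simp add: power_mult_distrib mult_ac)
        qed
        finally show ?thesis .
      next
        case False
        have "(\<lambda>\<alpha>. X \<alpha> b) = (\<lambda>\<alpha> x. 0 * 0)" using False by (simp add: X_def fun_eq_iff)
        moreover have "energy m (\<lambda>(\<alpha>::'n \<Rightarrow> nat) (x::real^'n). 0 * 0) = 0"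
          by (subst energy_cmult) auto
        ultimately show ?thesis by simp
      qed
      show "C * (A\<^sup>2 * h powr (2 * (real k - m) + 3)) \<ge> 0" using C(1) by simp
    qed
  qed
qed

text \<open>Importance sampling of the pair of index and bias, with probability proportional to
  \<open>A j\<close> on the product of \<open>T\<close> and [-L, L]. The ratio of coefficient to
  probability is then bounded by \<open>2 * L\<close> times the total mass, so \<open>N\<close>
  draws of weight \<open>1 / N\<close> have a total energy of order mass^2 / N.\<close>

lemma good_tail:
  fixes m L :: real
  assumes m: "0 \<le> m" "m < real k + 1/2" and L: "L > 0"
  obtains C :: real where "C > 0"
    "\<And>(\<omega> :: 'j::countable \<Rightarrow> real^'n::finite) A \<rho> T N M.
      (\<And>j. \<omega> j \<in> sphere 0 1) \<Longrightarrow> (\<And>j. \<rho> j \<in> borel_measurable borel) \<Longrightarrow> (\<And>j b. norm (\<rho> j b) \<le> A j) \<Longrightarrow>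
      (\<And>j b. \<bar>b\<bar> > L \<Longrightarrow> \<rho> j b = 0) \<Longrightarrow> integrable (count_space UNIV) (\<lambda>j. indicator T j * A j) \<Longrightarrow>
      (LINT j|count_space UNIV. indicator T j * A j) \<le> M \<Longrightarrow> 0 < N \<Longrightarrow>
      good k m N (\<lambda>\<alpha> x. LINT j|count_space UNIV. LINT b|lborel. indicator T j * \<rho> j b * of_real (neuron k (\<omega> j) b \<alpha> x))
        (C * (M\<^sup>2 / real N))"
proof -
  obtain C where C: "C > 0" "\<And>(\<omega>::real^'n) b. \<omega> \<in> sphere 0 1 \<Longrightarrow> \<bar>b\<bar> \<le> L \<Longrightarrow>
      energy m (\<lambda>\<alpha> x. of_real (dcoef k \<omega> \<alpha> * relu_pow (k - mi_order \<alpha>) (\<omega> \<bullet> x - b))) \<le> ennreal C"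
    by (rule neuron_energy_bound[OF m less_imp_le[OF L], where 'n='n]) (rule that, assumption+)
  show ?thesis
  proof (rule that[of "C * (2 * L)\<^sup>2"])
    show "C * (2 * L)\<^sup>2 > 0" using C(1) L by simp
    fix \<omega> :: "'j \<Rightarrow> real^'n" and A :: "'j \<Rightarrow> real" and \<rho> :: "'j \<Rightarrow> real \<Rightarrow> complex" and T :: "'j set" and N :: nat and M :: real
    assume \<omega>: "\<And>j. \<omega> j \<in> sphere 0 1" and \<rho> [measurable]: "\<And>j. \<rho> j \<in> borel_measurable borel" and A: "\<And>j b. norm (\<rho> j b) \<le> A j"
      and \<rho>L: "\<And>j b. \<bar>b\<bar> > L \<Longrightarrow> \<rho> j b = 0" and intA: "integrable (count_space UNIV) (\<lambda>j. indicator T j * A j)"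
      and M: "(LINT j|count_space UNIV. indicator T j * A j) \<le> M" and N: "0 < N"
    have A0: "A j \<ge> 0" for j using A[of j 0] norm_ge_zero order_trans by blast
    define mass where "mass = (LINT j|count_space UNIV. indicator T j * A j)"
    have mass0: "mass \<ge> 0" unfolding mass_def using A0 by (intro integral_nonneg_AE) auto
    define Y where "Y \<alpha> x = (LINT j|count_space UNIV. LINT b|lborel. indicator T j * \<rho> j b * of_real (neuron k (\<omega> j) b \<alpha> x))" for \<alpha> x
    have "good k m N Y (C * (2 * L)\<^sup>2 * (mass\<^sup>2 / real N))"
    \<comment> \<open>Without mass there is no probability density to draw from, but then the target
      is zero.\<close>
    proof (cases "mass = 0")
      case True
      have "AE j in count_space UNIV. indicator T j * A j = 0"
        using True integral_nonneg_eq_0_iff_AE[OF intA] A0 by (simp add: mass_def)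
      then have A_T: "indicator T j * A j = 0" for j by (simp add: AE_count_space)
      have z: "indicator T j * \<rho> j b = 0" for j b
      proof (cases "j \<in> T")
        case True
        then have "A j = 0" using A_T[of j] by simp
        then have "norm (\<rho> j b) \<le> 0" using A[of j b] by simp
        then show ?thesis by simp
      qed simp
      have "Y \<alpha> x = 0" for \<alpha> x unfolding Y_def z by simp
      then have "Y = (\<lambda>\<alpha> x. 0)" by (simp add: fun_eq_iff)
      then show ?thesis using good_zero[of k m N] True by simp
    next
      case False
      then have mp: "mass > 0" using mass0 by simp
      define \<Theta> where "\<Theta> = (count_space UNIV :: 'j measure) \<Otimes>\<^sub>M (lborel :: real measure)"
      interpret TH: pair_sigma_finite "count_space UNIV :: 'j measure" "lborel :: real measure"
        by (intro pair_sigma_finite.intro sigma_finite_measure_count_space_countable lborel.sigma_finite_measure_axioms) auto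
      define p where "p = (\<lambda>(j, b). indicator T j * indicator {-L..L} b * A j / (2 * L * mass))"
      \<comment> \<open>Where \<open>p\<close> vanishes, so does
        \<open>indicator T j * \<rho> j b\<close>, and the value 0 of \<open>c\<close> is the right
        one; the division by \<open>N\<close> is the share of a single draw.\<close>
      define c where "c = (\<lambda>(j, b). if p (j, b) = 0 then 0 else \<rho> j b / of_real (p (j, b) * real N))"
      have p0: "p \<theta> \<ge> 0" for \<theta> using A0 L mp by (auto simp: p_def split: prod.splits)
      have p_meas [measurable]: "p \<in> borel_measurable \<Theta>"
        unfolding p_def \<Theta>_def by (rule measurable_pair_measure_countable1) auto
      have c_meas [measurable]: "c \<in> borel_measurable \<Theta>"
      proof -
        have "(\<lambda>b. p (j, b)) \<in> borel_measurable borel" for j by (simp add: p_def)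
        then show ?thesis unfolding c_def \<Theta>_def by (intro measurable_pair_measure_countable1) auto
      qed
      have n_meas: "(\<lambda>(\<theta>, x). complex_of_real (neuron k (\<omega> (fst \<theta>)) (snd \<theta>) \<alpha> x)) \<in> borel_measurable (\<Theta> \<Otimes>\<^sub>M borel)" for \<alpha>
      proof -
        have "(\<lambda>q. complex_of_real (neuron k (\<omega> (fst (fst q))) (snd (fst q)) \<alpha> (snd q))) \<in> borel_measurable (\<Theta> \<Otimes>\<^sub>M borel)"
        proof (rule measurable_compose_countable[where f="\<lambda>j q. complex_of_real (neuron k (\<omega> j) (snd (fst q)) \<alpha> (snd q))" and g="\<lambda>q. fst (fst q)"])
          have "(\<lambda>q. (snd (fst q), snd q)) \<in> \<Theta> \<Otimes>\<^sub>M (borel::(real^'n) measure) \<rightarrow>\<^sub>M borel \<Otimes>\<^sub>M borel"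
            unfolding \<Theta>_def by measurable
          from measurable_compose[OF this neuron_joint_measurable]
          show "(\<lambda>q. complex_of_real (neuron k (\<omega> j) (snd (fst q)) \<alpha> (snd q))) \<in> borel_measurable (\<Theta> \<Otimes>\<^sub>M borel)" for j
            by simp
          show "(\<lambda>q. fst (fst q)) \<in> \<Theta> \<Otimes>\<^sub>M (borel::(real^'n) measure) \<rightarrow>\<^sub>M count_space UNIV"
            unfolding \<Theta>_def by measurable
        qed
        then show ?thesis by (simp add: case_prod_beta')
      qed
      define P where "P = density \<Theta> (\<lambda>\<theta>. ennreal (p \<theta>))"
      have P: "prob_space P"
      proof
        have "emeasure P (space P) = (\<integral>\<^sup>+\<theta>. ennreal (p \<theta>) \<partial>\<Theta>)"
          unfolding P_def by (subst emeasure_density) (auto intro!: nn_integral_cong simp: indicator_def)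
        also have "\<dots> = (\<integral>\<^sup>+j. \<integral>\<^sup>+b. ennreal (p (j, b)) \<partial>lborel \<partial>count_space UNIV)"
          using p_meas unfolding \<Theta>_def by (subst lborel.nn_integral_fst[symmetric]) auto
        also have "\<dots> = (\<integral>\<^sup>+j. ennreal (indicator T j * A j / mass) \<partial>count_space UNIV)"
        proof (intro nn_integral_cong)
          fix j :: 'j
          have "(\<integral>\<^sup>+b. ennreal (p (j, b)) \<partial>lborel) = (\<integral>\<^sup>+b. ennreal (indicator T j * A j / (2 * L * mass)) * indicator {-L..L} b \<partial>lborel)"
            by (intro nn_integral_cong) (auto simp: p_def indicator_def)
          also have "\<dots> = ennreal (indicator T j * A j / (2 * L * mass)) * ennreal (2 * L)"
            using L by (subst nn_integral_cmult_indicator) auto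
          also have "\<dots> = ennreal (indicator T j * A j / mass)"
            using L mp A0 by (subst ennreal_mult[symmetric]) auto
          finally show "(\<integral>\<^sup>+b. ennreal (p (j, b)) \<partial>lborel) = ennreal (indicator T j * A j / mass)" .
        qed
        also have "\<dots> = ennreal (LINT j|count_space UNIV. indicator T j * A j / mass)"
          using A0 mp intA by (intro nn_integral_eq_integral) auto
        also have "\<dots> = 1" using mp by (simp add: mass_def[symmetric])
        finally show "emeasure P (space P) = 1" .
      qed
      have pc: "p (j, b) *\<^sub>R c (j, b) = indicator T j * \<rho> j b / of_nat N" for j b
      proof (cases "p (j, b) = 0")
        case True
        then have "indicator T j * \<rho> j b = 0"
          using A[of j b] \<rho>L[of b j] L mp by (cases "\<bar>b\<bar> > L") (auto simp: p_def indicator_def split: if_splits)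
        with True show ?thesis by simp
      next
        case False
        then have "j \<in> T" by (auto simp: p_def indicator_def split: if_splits)
        with False N show ?thesis by (simp add: c_def scaleR_conv_of_real)
      qed
      have c_le: "norm (c (j, b)) \<le> 2 * L * mass / real N" for j b
      proof (cases "p (j, b) = 0")
        case False
        then have pe: "p (j, b) = A j / (2 * L * mass)" and Aj: "A j > 0" using A0[of j]
          by (auto simp: p_def indicator_def split: if_splits)
        have "norm (c (j, b)) = norm (\<rho> j b) / (p (j, b) * real N)"
          using False p0[of "(j, b)"] by (simp add: c_def norm_divide norm_mult)
        also have "\<dots> \<le> A j / (p (j, b) * real N)"
          using p0[of "(j, b)"] by (intro divide_right_mono A) auto
        also have "\<dots> = 2 * L * mass / real N" using Aj unfolding pe by (simp add: field_simps)
        finally show ?thesis .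
      qed (use L mass0 in \<open>simp add: c_def\<close>)
      have c_out: "\<bar>b\<bar> \<le> L" if "c (j, b) \<noteq> 0" for j b
        using that \<rho>L[of b j] by (auto simp: c_def not_le split: if_splits) (metis linorder_not_le)
      define X where "X \<alpha> \<theta> x = c \<theta> * of_real (neuron k (\<omega> (fst \<theta>)) (snd \<theta>) \<alpha> x)" for \<alpha> \<theta> x
      have sP: "sets (P \<Otimes>\<^sub>M (borel :: (real^'n) measure)) = sets (\<Theta> \<Otimes>\<^sub>M borel)"
        by (intro sets_pair_measure_cong) (auto simp: P_def)
      have X_meas: "case_prod (X \<alpha>) \<in> borel_measurable (\<Theta> \<Otimes>\<^sub>M borel)" for \<alpha>
      proof -
        have "(\<lambda>q. c (fst q) * (case q of (\<theta>, x) \<Rightarrow> complex_of_real (neuron k (\<omega> (fst \<theta>)) (snd \<theta>) \<alpha> x))) \<in> borel_measurable (\<Theta> \<Otimes>\<^sub>M borel)"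
          by (intro borel_measurable_times n_meas measurable_compose[OF measurable_fst c_meas])
        then show ?thesis by (simp add: X_def case_prod_beta')
      qed
      have X_le: "norm (X \<alpha> \<theta> x) \<le> 2 * L * mass / real N * (fact k * (1 + norm x + L) ^ k)" for \<alpha> \<theta> x
      proof (cases "c \<theta> = 0")
        case True
        then show ?thesis using L mass0 by (simp add: X_def)
      next
        case False
        obtain j b where th: "\<theta> = (j, b)" by fastforce
        have "norm (c (j, b)) * \<bar>neuron k (\<omega> j) b \<alpha> x\<bar> \<le> 2 * L * mass / real N * (fact k * (1 + norm x + L) ^ k)"
        proof (rule mult_mono)
          show "\<bar>neuron k (\<omega> j) b \<alpha> x\<bar> \<le> fact k * (1 + norm x + L) ^ k"
            by (rule neuron_abs_le[OF \<omega> c_out]) (use False th in simp)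
        qed (use c_le mass0 L in auto)
        then show ?thesis unfolding X_def th by (simp only: norm_mult norm_of_real fst_conv snd_conv)
      qed
      have EX: "(LINT \<theta>|P. X \<alpha> \<theta> x) = Y \<alpha> x / of_nat N" for \<alpha> x
      proof -
        interpret P: prob_space P by (rule P)
        have Xm: "(\<lambda>\<theta>. X \<alpha> \<theta> x) \<in> borel_measurable \<Theta>"
          using measurable_compose[OF _ X_meas[of \<alpha>], of "\<lambda>\<theta>. (\<theta>, x)" \<Theta>] by simp
        have "integrable P (\<lambda>\<theta>. X \<alpha> \<theta> x)"
        proof (rule P.integrable_const_bound)
          show "AE \<theta> in P. norm (X \<alpha> \<theta> x) \<le> 2 * L * mass / real N * (fact k * (1 + norm x + L) ^ k)"
            by (intro AE_I2 X_le)
          show "(\<lambda>\<theta>. X \<alpha> \<theta> x) \<in> borel_measurable P" using Xm by (simp add: P_def)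
        qed
        then have int: "integrable \<Theta> (\<lambda>\<theta>. p \<theta> *\<^sub>R X \<alpha> \<theta> x)"
          unfolding P_def using p0 Xm by (subst (asm) integrable_density) auto
        have "(LINT \<theta>|P. X \<alpha> \<theta> x) = (LINT \<theta>|\<Theta>. p \<theta> *\<^sub>R X \<alpha> \<theta> x)"
          unfolding P_def using p0 Xm by (subst integral_density) auto
        also have "\<dots> = (LINT j|count_space UNIV. LINT b|lborel. p (j, b) *\<^sub>R X \<alpha> (j, b) x)"
          using TH.integral_fst'[of "\<lambda>\<theta>. p \<theta> *\<^sub>R X \<alpha> \<theta> x"] int by (simp add: \<Theta>_def)
        also have "\<dots> = (LINT j|count_space UNIV. LINT b|lborel. indicator T j * \<rho> j b * of_real (neuron k (\<omega> j) b \<alpha> x) / of_nat N)"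
        proof -
          have "p (j, b) *\<^sub>R X \<alpha> (j, b) x = indicator T j * \<rho> j b * of_real (neuron k (\<omega> j) b \<alpha> x) / of_nat N" for j b
          proof -
            have "p (j, b) *\<^sub>R X \<alpha> (j, b) x = (p (j, b) *\<^sub>R c (j, b)) * of_real (neuron k (\<omega> j) b \<alpha> x)"
              by (simp add: X_def)
            then show ?thesis unfolding pc by simp
          qed
          then show ?thesis by simp
        qed
        also have "\<dots> = Y \<alpha> x / of_nat N" unfolding Y_def by simp
        finally show ?thesis .
      qed
      have Y_meas: "(\<lambda>x. Y \<alpha> x / of_nat N) \<in> borel_measurable borel" for \<alpha>
      proof -
        interpret P: prob_space P by (rule P)
        have XP: "case_prod (X \<alpha>) \<in> borel_measurable (P \<Otimes>\<^sub>M borel)"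
          using X_meas measurable_cong_sets[OF sP refl] by blast
        have "(\<lambda>(x, \<theta>). X \<alpha> \<theta> x) \<in> borel_measurable (borel \<Otimes>\<^sub>M P)"
          using measurable_compose[OF measurable_pair_swap' XP] by (simp add: case_prod_beta')
        then have "(\<lambda>x. LINT \<theta>|P. X \<alpha> \<theta> x) \<in> borel_measurable borel"
          by (rule P.borel_measurable_lebesgue_integral)
        then show ?thesis by (simp add: EX)
      qed
      have "good k m 1 (\<lambda>\<alpha> x. Y \<alpha> x / of_nat N) (C * (2 * L * mass / real N)\<^sup>2)"
      proof (rule good_random[OF P, where X=X])
        show "case_prod (X \<alpha>) \<in> borel_measurable (P \<Otimes>\<^sub>M borel)" for \<alpha>
          using X_meas measurable_cong_sets[OF sP refl] by blast
        show "norm (X \<alpha> \<theta> x) \<le> 2 * L * mass / real N * (fact k * (1 + norm x + L) ^ k)" for \<alpha> \<theta> x by (rule X_le)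
        show "(\<lambda>x. Y \<alpha> x / of_nat N) \<in> borel_measurable borel" for \<alpha> by (rule Y_meas)
        show "(\<lambda>\<alpha> x. X \<alpha> \<theta> x + (Y \<alpha> x / of_nat N - (LINT \<theta>|P. X \<alpha> \<theta> x))) \<in> nets k 1" for \<theta>
          unfolding EX unfolding X_def using nets_single[OF \<omega>[of "fst \<theta>"], of "c \<theta>" k "snd \<theta>"] by simp
        show "energy m (\<lambda>\<alpha>. X \<alpha> \<theta>) \<le> ennreal (C * (2 * L * mass / real N)\<^sup>2)" for \<theta>
        proof -
          obtain j b where th: "\<theta> = (j, b)" by fastforce
          have "energy m (\<lambda>\<alpha>. X \<alpha> \<theta>) = ennreal ((norm (c \<theta>))\<^sup>2) * energy m (\<lambda>\<alpha> x. of_real (neuron k (\<omega> j) b \<alpha> x))"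
            unfolding X_def th fst_conv snd_conv by (rule energy_cmult) measurable
          also have "\<dots> \<le> ennreal ((2 * L * mass / real N)\<^sup>2) * ennreal C"
          proof (cases "c \<theta> = 0")
            case False
            have "energy m (\<lambda>\<alpha> x. of_real (neuron k (\<omega> j) b \<alpha> x)) \<le> ennreal C"
              unfolding neuron_def using c_out[of j b] False th by (intro C(2) \<omega>) auto
            then show ?thesis using c_le[of j b] th by (intro mult_mono ennreal_leI power_mono) auto
          qed simp
          also have "\<dots> = ennreal (C * (2 * L * mass / real N)\<^sup>2)"
            by (simp only: mult.commute[of C] ennreal_mult'[OF zero_le_power2])
          finally show ?thesis .
        qed
        show "C * (2 * L * mass / real N)\<^sup>2 \<ge> 0" using C(1) by simp
      qed
      \<comment> \<open>The target is a sum of \<open>N\<close> copies of its \<open>N\<close>-th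
        part, each approximated by one neuron; additivity of \<open>good\<close> takes the place of
        \<open>N\<close> independent draws.\<close>
      then have "good k m (\<Sum>i<N. 1) (\<lambda>\<alpha> x. \<Sum>i<N. Y \<alpha> x / of_nat N) (\<Sum>i<N. C * (2 * L * mass / real N)\<^sup>2)"
        by (intro good_sum) auto
      moreover have "(\<Sum>i<N. C * (2 * L * mass / real N)\<^sup>2) = C * (2 * L)\<^sup>2 * (mass\<^sup>2 / real N)"
        using N by (simp add: power_mult_distrib power_divide power2_eq_square field_simps)
      ultimately show ?thesis using N by simp
    qed
    moreover have "C * (2 * L)\<^sup>2 * (mass\<^sup>2 / real N) \<le> C * (2 * L)\<^sup>2 * (M\<^sup>2 / real N)"
      using M mass0 C(1) by (intro mult_left_mono divide_right_mono power_mono) (auto simp: mass_def)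
    ultimately show "good k m N (\<lambda>\<alpha> x. LINT j|count_space UNIV. LINT b|lborel. indicator T j * \<rho> j b * of_real (neuron k (\<omega> j) b \<alpha> x))
        (C * (2 * L)\<^sup>2 * (M\<^sup>2 / real N))"
      unfolding Y_def[symmetric] by (rule good_mono[OF _ order_refl])
  qed
qed

section \<open>Distribution of the neurons over the directions\<close>

lemma sum_le_integral_count_space:
  fixes f :: "'j \<Rightarrow> real"
  assumes "integrable (count_space UNIV) f" "\<And>j. f j \<ge> 0" "finite F"
  shows "(\<Sum>j\<in>F. f j) \<le> (LINT j|count_space UNIV. f j)"
proof -
  have "finite {j. indicator F j * f j \<noteq> 0}"
    by (rule finite_subset[OF _ assms(3)]) (auto simp: indicator_def)
  then have "(LINT j|count_space UNIV. indicator F j * f j) = (\<Sum>j | indicator F j * f j \<noteq> 0. indicator F j * f j)"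
    by (subst lebesgue_integral_count_space_finite_support) auto
  also have "\<dots> = (\<Sum>j\<in>F. f j)"
    using assms(3) by (intro sum.mono_neutral_cong_left) (auto simp: indicator_def)
  finally have "(\<Sum>j\<in>F. f j) = (LINT j|count_space UNIV. indicator F j * f j)" ..
  also have "\<dots> \<le> (LINT j|count_space UNIV. f j)"
  proof (rule integral_mono)
    show "integrable (count_space UNIV) (\<lambda>j. indicator F j * f j)"
      by (rule Bochner_Integration.integrable_bound[OF assms(1)]) (auto simp: indicator_def)
    show "indicator F j * f j \<le> f j" for j using assms(2)[of j] by (simp add: indicator_def)
  qed (rule assms(1))
  finally show ?thesis .
qed

text \<open>Neighbouring closed cells overlap only in an end point, which has measure zero.\<close>

lemma integral_split_cells:
  fixes g :: "real \<Rightarrow> complex"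
  assumes g: "integrable lborel g" and h: "h \<ge> 0"
  shows "(LINT b|lborel. indicator {a..a + real n * h} b * g b) =
    (\<Sum>i<n. LINT b|lborel. indicator {a + real i * h..a + real i * h + h} b * g b)"
proof (induction n)
  case 0
  have "(LINT b|lborel. indicator {a..a + real 0 * h} b * g b) = (LINT b|(lborel :: real measure). (0::complex))"
  proof (rule integral_cong_AE)
    show "AE b in lborel. indicator {a..a + real 0 * h} b * g b = 0"
      using AE_lborel_singleton[of a] by eventually_elim (auto simp: indicator_def)
  qed (use borel_measurable_integrable[OF g] in auto)
  then show ?case by simp
next
  case (Suc n)
  have int: "integrable lborel (\<lambda>b. indicator {l..u} b * g b)" for l u
    by (rule Bochner_Integration.integrable_bound[OF g])
      (use borel_measurable_integrable[OF g] in \<open>auto simp: indicator_def\<close>)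
  let ?c = "a + real n * h"
  have e: "a + real (Suc n) * h = ?c + h" by (simp add: algebra_simps)
  have "(LINT b|lborel. indicator {a..a + real (Suc n) * h} b * g b) =
      (LINT b|lborel. indicator {a..?c} b * g b + indicator {?c..?c + h} b * g b)"
    unfolding e
  proof (rule integral_cong_AE)
    have ac: "a \<le> ?c" using h by simp
    show "AE b in lborel. indicator {a..?c + h} b * g b = indicator {a..?c} b * g b + indicator {?c..?c + h} b * g b"
      using AE_lborel_singleton[of ?c]
    proof eventually_elim
      case (elim b)
      show ?case
      proof (cases "b < ?c")
        case True
        then show ?thesis using h by (simp add: indicator_def)
      next
        case False
        with elim ac have "a \<le> b" "?c < b" by linarith+
        then show ?thesis by (simp add: indicator_def)
      qed
    qed
  qed (use borel_measurable_integrable[OF g] in auto)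
  also have "\<dots> = (LINT b|lborel. indicator {a..?c} b * g b) + (LINT b|lborel. indicator {?c..?c + h} b * g b)"
    by (rule Bochner_Integration.integral_add[OF int int])
  finally show ?case using Suc by simp
qed

text \<open>The finitely many ridge functions with \<open>\<kappa> j \<ge> 1 / t\<close> are stratified, the \<open>j\<close>-th one into about
  \<open>t * (\<kappa> j + A j * \<kappa> j powr (1/2 - q) / B)\<close> cells; the others are sampled as a whole.\<close>
lemma good_superposition:
  fixes m L K :: real
  assumes m: "0 \<le> m" "m < real k + 1/2" and L: "L > 0" and K: "K \<ge> 0"
  defines "q \<equiv> real k + 1 - m"
  obtains C :: real where "C > 0"
    "\<And>(\<omega> :: 'j::countable \<Rightarrow> real^'n::finite) A \<rho> \<kappa> B t.
      (\<And>j. \<omega> j \<in> sphere 0 1) \<Longrightarrow> (\<And>j. \<rho> j \<in> borel_measurable borel) \<Longrightarrow> (\<And>j b. norm (\<rho> j b) \<le> A j) \<Longrightarrow>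
      (\<And>j b. \<bar>b\<bar> > L \<Longrightarrow> \<rho> j b = 0) \<Longrightarrow> (\<And>j. \<kappa> j > 0) \<Longrightarrow>
      integrable (count_space UNIV) \<kappa> \<Longrightarrow> (LINT j|count_space UNIV. \<kappa> j) \<le> K \<Longrightarrow>
      integrable (count_space UNIV) (\<lambda>j. A j * \<kappa> j powr (1/2 - q)) \<Longrightarrow>
      (LINT j|count_space UNIV. A j * \<kappa> j powr (1/2 - q)) \<le> B \<Longrightarrow> t > 0 \<Longrightarrow>
      \<exists>N. real N \<le> (2 * (real k + 2) * (1 + K) + 1) * t + 1 \<and>
        good k m N (\<lambda>\<alpha> x. LINT j|count_space UNIV. LINT b|lborel. \<rho> j b * of_real (neuron k (\<omega> j) b \<alpha> x))
          (C * (B\<^sup>2 * t powr (- (2 * q))))"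
proof -
  \<comment> \<open>This is m < k + 1/2; it makes the exponents q - 1/2 and 2 q - 1 positive, so
    that the corresponding powers are monotone.\<close>
  have q: "q > 1/2" using m by (simp add: q_def)
  obtain C1 :: real where C1: "C1 > 0"
    "\<And>(\<omega>::real^'n) \<beta> h \<rho> A. \<omega> \<in> sphere 0 1 \<Longrightarrow> 0 < h \<Longrightarrow> h \<le> max 1 (2 * L) \<Longrightarrow> \<rho> \<in> borel_measurable borel \<Longrightarrow>
      (\<And>b. norm (\<rho> b) \<le> A) \<Longrightarrow>
      good k m (k + 2) (\<lambda>\<alpha> x. LINT b|lborel. indicator {\<beta>..\<beta> + h} b * \<rho> b * of_real (neuron k \<omega> b \<alpha> x))
        (C1 * (A\<^sup>2 * h powr (2 * (real k - m) + 3)))"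
  proof (rule good_cell[OF m, of "max 1 (2 * L)", where 'n='n], goal_cases)
    case (2 C)
    show ?case by (rule 2(1)[OF 2(2)]) (rule 2(3))
  qed simp
  obtain C2 :: real where C2: "C2 > 0"
    "\<And>(\<omega> :: 'j \<Rightarrow> real^'n) A \<rho> T N M.
      (\<And>j. \<omega> j \<in> sphere 0 1) \<Longrightarrow> (\<And>j. \<rho> j \<in> borel_measurable borel) \<Longrightarrow> (\<And>j b. norm (\<rho> j b) \<le> A j) \<Longrightarrow>
      (\<And>j b. \<bar>b\<bar> > L \<Longrightarrow> \<rho> j b = 0) \<Longrightarrow> integrable (count_space UNIV) (\<lambda>j. indicator T j * A j) \<Longrightarrow>
      (LINT j|count_space UNIV. indicator T j * A j) \<le> M \<Longrightarrow> 0 < N \<Longrightarrow>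
      good k m N (\<lambda>\<alpha> x. LINT j|count_space UNIV. LINT b|lborel. indicator T j * \<rho> j b * of_real (neuron k (\<omega> j) b \<alpha> x))
        (C2 * (M\<^sup>2 / real N))"
  proof (rule good_tail[OF m L, where 'n='n and 'j='j], goal_cases)
    case (1 C)
    show ?case by (rule 1(1)[OF 1(2)]) (rule 1(3))
  qed
  define C where "C = C1 * (2 * L) powr (2 * q + 1) + C2"
  show ?thesis
  proof (rule that[of C])
    show "C > 0" using C1(1) C2(1) by (auto simp: C_def intro!: add_nonneg_pos)
    fix \<omega> :: "'j \<Rightarrow> real^'n" and A \<kappa> :: "'j \<Rightarrow> real" and \<rho> :: "'j \<Rightarrow> real \<Rightarrow> complex" and B t :: real
    assume \<omega>: "\<And>j. \<omega> j \<in> sphere 0 1" and \<rho> [measurable]: "\<And>j. \<rho> j \<in> borel_measurable borel" and A: "\<And>j b. norm (\<rho> j b) \<le> A j"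
      and \<rho>L: "\<And>j b. \<bar>b\<bar> > L \<Longrightarrow> \<rho> j b = 0" and \<kappa>: "\<And>j. \<kappa> j > 0"
      and \<kappa>_int: "integrable (count_space UNIV) \<kappa>" and \<kappa>K: "(LINT j|count_space UNIV. \<kappa> j) \<le> K"
      and B_int: "integrable (count_space UNIV) (\<lambda>j. A j * \<kappa> j powr (1/2 - q))"
      and BB: "(LINT j|count_space UNIV. A j * \<kappa> j powr (1/2 - q)) \<le> B" and t: "t > 0"
    have A0: "A j \<ge> 0" for j using A[of j 0] norm_ge_zero order_trans by blast
    define Bj where "Bj j = A j * \<kappa> j powr (1/2 - q)" for j
    have Bj0: "Bj j \<ge> 0" for j using A0 by (simp add: Bj_def)
    have ABj: "A j = Bj j * \<kappa> j powr (q - 1/2)" for j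
      using \<kappa>[of j] by (simp add: Bj_def mult.assoc powr_add[symmetric])
    have sumB: "(\<Sum>j\<in>F. Bj j) \<le> B" if "finite F" for F
      using sum_le_integral_count_space[OF B_int _ that] BB A0 by (simp add: Bj_def)
    have sumK: "(\<Sum>j\<in>F. \<kappa> j) \<le> K" if "finite F" for F
      using sum_le_integral_count_space[OF \<kappa>_int less_imp_le[OF \<kappa>] that] \<kappa>K by simp
    have B0: "B \<ge> 0" using sumB[of "{}"] by simp
    \<comment> \<open>The directions heavy enough for a cell of their own; summability of \<kappa>
      bounds their number by \<open>K * t\<close>.\<close>
    define F where "F = {j. \<kappa> j \<ge> 1 / t}"
    have "card G \<le> nat \<lfloor>K * t\<rfloor>" if "G \<subseteq> F" "finite G" for G
    proof -
      have "real (card G) * (1 / t) \<le> (\<Sum>j\<in>G. \<kappa> j)"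
        using that by (intro sum_bounded_below) (auto simp: F_def)
      also have "\<dots> \<le> K" by (rule sumK[OF that(2)])
      finally show ?thesis using t by (simp add: field_simps le_nat_floor)
    qed
    then have F: "finite F" using finite_if_finite_subsets_card_bdd[of F "nat \<lfloor>K * t\<rfloor>"] by blast
    \<comment> \<open>The first part distributes one unit of cells in proportion to the share of
      \<open>j\<close> in \<open>B\<close>, the second ensures at least one cell per direction in
      \<open>F\<close>. If \<open>B = 0\<close>, division by zero yields 0 and only the second part
      remains.\<close>
    define w where "w j = Bj j / B + \<kappa> j" for j
    have w\<kappa>: "\<kappa> j \<le> w j" for j using Bj0 B0 by (simp add: w_def)
    have w0: "w j > 0" for j using w\<kappa>[of j] \<kappa>[of j] by linarith
    define nj where "nj j = nat \<lceil>t * w j\<rceil>" for j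
    have nj: "t * w j \<le> real (nj j)" "real (nj j) \<le> 2 * (t * w j)" "0 < nj j" if "j \<in> F" for j
    proof -
      have "1 \<le> t * \<kappa> j" using that t by (simp add: F_def field_simps)
      also have "\<dots> \<le> t * w j" using t w\<kappa> by simp
      finally have 1: "1 \<le> t * w j" .
      then have "real (nj j) = of_int \<lceil>t * w j\<rceil>" unfolding nj_def by simp
      moreover have "t * w j \<le> of_int \<lceil>t * w j\<rceil>" "of_int \<lceil>t * w j\<rceil> \<le> t * w j + 1" by linarith+
      ultimately have "t * w j \<le> real (nj j)" "real (nj j) \<le> t * w j + 1" by simp_all
      then show "t * w j \<le> real (nj j)" "real (nj j) \<le> 2 * (t * w j)" "0 < nj j" using 1 by linarith+
    qed
    define hj where "hj j = 2 * L / real (nj j)" for j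
    define N0 where "N0 = nat \<lceil>t\<rceil>"
    have N0: "t \<le> real N0" "real N0 \<le> t + 1" "0 < N0"
      using t by (auto simp: N0_def)
    define N where "N = (\<Sum>j\<in>F. \<Sum>i<nj j. k + 2) + N0"
    \<comment> \<open>There are \<open>k + 2\<close> neurons per cell, a factor 2 from rounding up
      numbers that are at least 1, and a total weight of at most \<open>1 + K\<close>; the tail
      takes another \<open>t + 1\<close>.\<close>
    have Nle: "real N \<le> (2 * (real k + 2) * (1 + K) + 1) * t + 1"
    proof -
      have "(\<Sum>j\<in>F. Bj j / B) \<le> 1"
      proof (cases "B = 0")
        case False
        then show ?thesis using sumB[OF F] B0 by (simp add: sum_divide_distrib[symmetric])
      qed simp
      then have ws: "(\<Sum>j\<in>F. w j) \<le> 1 + K" using sumK[OF F] by (simp add: w_def sum.distrib)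
      have "real N = (\<Sum>j\<in>F. real (nj j) * (real k + 2)) + real N0" by (simp add: N_def distrib_left mult.commute add.commute)
      also have "\<dots> \<le> (\<Sum>j\<in>F. 2 * (t * w j) * (real k + 2)) + (t + 1)"
        by (intro add_mono sum_mono mult_right_mono nj N0) auto
      also have "(\<Sum>j\<in>F. 2 * (t * w j) * (real k + 2)) = (\<Sum>j\<in>F. 2 * t * (real k + 2) * w j)"
        by (intro sum.cong) (auto simp: mult_ac)
      also have "\<dots> = 2 * t * (real k + 2) * (\<Sum>j\<in>F. w j)" by (rule sum_distrib_left[symmetric])
      also have "\<dots> \<le> 2 * t * (real k + 2) * (1 + K)" using t by (intro mult_left_mono ws) auto
      finally show ?thesis by (simp add: algebra_simps)
    qed
    define g where "g j \<alpha> x = (LINT b|lborel. \<rho> j b * of_real (neuron k (\<omega> j) b \<alpha> x))" for j \<alpha> x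
    have \<rho>n_int: "integrable lborel (\<lambda>b. \<rho> j b * of_real (neuron k (\<omega> j) b \<alpha> x))" for j \<alpha> x
    proof -
      have "integrable lborel (\<lambda>b. indicator {-L..L} b *\<^sub>R (\<rho> j b * of_real (neuron k (\<omega> j) b \<alpha> x)))"
        by (rule integrableI_bounded_set_indicator[where B="A j * (fact k * (1 + norm x + L) ^ k)"])
          (auto simp: emeasure_lborel_Icc_eq norm_mult intro!: AE_I2 mult_mono A A0 neuron_abs_le \<omega>)
      moreover have "indicator {-L..L} b *\<^sub>R (\<rho> j b * of_real (neuron k (\<omega> j) b \<alpha> x)) = \<rho> j b * of_real (neuron k (\<omega> j) b \<alpha> x)" for b
        using \<rho>L[of b j] by (cases "\<bar>b\<bar> > L") (auto simp: indicator_def)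
      ultimately show ?thesis by simp
    qed
    have g_le: "norm (g j \<alpha> x) \<le> A j * (2 * L * (fact k * (1 + norm x + L) ^ k))" for j \<alpha> x
    proof -
      have "norm (g j \<alpha> x) \<le> (LINT b|lborel. norm (\<rho> j b * of_real (neuron k (\<omega> j) b \<alpha> x)))"
        unfolding g_def by (rule integral_norm_bound)
      also have "\<dots> \<le> (LINT b|lborel. indicator {-L..L} b *\<^sub>R (A j * (fact k * (1 + norm x + L) ^ k)))"
      proof (rule integral_mono)
        show "norm (\<rho> j b * of_real (neuron k (\<omega> j) b \<alpha> x)) \<le> indicator {-L..L} b *\<^sub>R (A j * (fact k * (1 + norm x + L) ^ k))" for b
        proof (cases "\<bar>b\<bar> > L")
          case True
          have "0 \<le> indicator {-L..L} b * (A j * (fact k * (1 + norm x + L) ^ k))"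
            using A0 L by (intro mult_nonneg_nonneg zero_le_power add_nonneg_nonneg) auto
          then show ?thesis using \<rho>L[OF True, of j] by simp
        next
          case False
          have "norm (\<rho> j b) * \<bar>neuron k (\<omega> j) b \<alpha> x\<bar> \<le> A j * (fact k * (1 + norm x + L) ^ k)"
            by (intro mult_mono A A0 neuron_abs_le \<omega>) (use False in auto)
          then show ?thesis using False by (auto simp: norm_mult indicator_def)
        qed
      qed (use \<rho>n_int in \<open>auto simp: emeasure_lborel_Icc_eq intro: integrable_norm\<close>)
      also have "\<dots> = A j * (2 * L * (fact k * (1 + norm x + L) ^ k))" using L by simp
      finally show ?thesis .
    qed
    define Yc where "Yc j i \<alpha> x = (LINT b|lborel. indicator {- L + real i * hj j..- L + real i * hj j + hj j} b * \<rho> j b * of_real (neuron k (\<omega> j) b \<alpha> x))" for j i \<alpha> x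
    have g_cells: "g j \<alpha> x = (\<Sum>i<nj j. Yc j i \<alpha> x)" if j: "j \<in> F" for j \<alpha> x
    proof -
      have e: "- L + real (nj j) * hj j = L" using nj(3)[OF j] by (simp add: hj_def)
      have "g j \<alpha> x = (LINT b|lborel. indicator {-L..- L + real (nj j) * hj j} b * (\<rho> j b * of_real (neuron k (\<omega> j) b \<alpha> x)))"
        unfolding g_def e
      proof (rule Bochner_Integration.integral_cong[OF refl])
        show "\<rho> j b * of_real (neuron k (\<omega> j) b \<alpha> x) = indicator {-L..L} b * (\<rho> j b * of_real (neuron k (\<omega> j) b \<alpha> x))" for b
          using \<rho>L[of b j] by (cases "\<bar>b\<bar> > L") (auto simp: indicator_def)
      qed
      also have "\<dots> = (\<Sum>i<nj j. Yc j i \<alpha> x)"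
        using L by (subst integral_split_cells[OF \<rho>n_int]) (auto simp: Yc_def hj_def mult.assoc)
      finally show ?thesis .
    qed
    define Yt where "Yt \<alpha> x = (LINT j|count_space UNIV. LINT b|lborel. indicator (- F) j * \<rho> j b * of_real (neuron k (\<omega> j) b \<alpha> x))" for \<alpha> x
    \<comment> \<open>Off \<open>F\<close> the weight is below \<open>1 / t\<close>, and the
      exponent q - 1/2 is positive; this bounds the mass of the tail by
      \<open>B * t powr (1/2 - q)\<close>.\<close>
    have AT: "A j \<le> Bj j * t powr (1/2 - q)" if "j \<notin> F" for j
    proof -
      have "\<kappa> j \<le> 1 / t" using that by (simp add: F_def)
      then have "\<kappa> j powr (q - 1/2) \<le> (1 / t) powr (q - 1/2)" using q \<kappa>[of j] by (intro powr_mono2) auto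
      also have "\<dots> = t powr (1/2 - q)" using t by (simp add: powr_divide powr_minus_divide[symmetric])
      finally show ?thesis unfolding ABj[of j] using Bj0 by (intro mult_left_mono)
    qed
    have Bt_int: "integrable (count_space UNIV) (\<lambda>j. Bj j * t powr (1/2 - q))"
      using B_int by (simp add: Bj_def)
    have T_int: "integrable (count_space UNIV) (\<lambda>j. indicator (- F) j * A j)"
      by (rule Bochner_Integration.integrable_bound[OF Bt_int]) (use AT A0 Bj0 in \<open>auto simp: indicator_def\<close>)
    have "(LINT j|count_space UNIV. indicator (- F) j * A j) \<le> (LINT j|count_space UNIV. Bj j * t powr (1/2 - q))"
      by (rule integral_mono[OF T_int Bt_int]) (use AT Bj0 in \<open>auto simp: indicator_def\<close>)
    also have "\<dots> \<le> B * t powr (1/2 - q)" using BB by (simp add: Bj_def mult_right_mono)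
    finally have T_le: "(LINT j|count_space UNIV. indicator (- F) j * A j) \<le> B * t powr (1/2 - q)" .
    have tail: "good k m N0 Yt (C2 * ((B * t powr (1/2 - q))\<^sup>2 / real N0))"
      unfolding Yt_def by (rule C2(2)[OF \<omega> \<rho> A \<rho>L T_int T_le N0(3)])
    have cell: "good k m (k + 2) (Yc j i) (C1 * ((A j)\<^sup>2 * hj j powr (2 * q + 1)))" if j: "j \<in> F" for j i
    proof -
      have e: "2 * (real k - m) + 3 = 2 * q + 1" by (simp add: q_def)
      have "hj j \<le> 2 * L / 1" unfolding hj_def using L nj(3)[OF j] by (intro divide_left_mono) auto
      then have "hj j \<le> max 1 (2 * L)" by simp
      moreover have "0 < hj j" using L nj(3)[OF j] by (simp add: hj_def)
      ultimately show ?thesis unfolding Yc_def e[symmetric] by (intro C1(2) \<omega> \<rho> A)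
    qed
    have main: "good k m (\<Sum>j\<in>F. \<Sum>i<nj j. k + 2) (\<lambda>\<alpha> x. \<Sum>j\<in>F. \<Sum>i<nj j. Yc j i \<alpha> x) (\<Sum>j\<in>F. \<Sum>i<nj j. C1 * ((A j)\<^sup>2 * hj j powr (2 * q + 1)))"
      by (intro good_sum F cell) auto
    have Y_eq: "(LINT j|count_space UNIV. LINT b|lborel. \<rho> j b * of_real (neuron k (\<omega> j) b \<alpha> x)) = (\<Sum>j\<in>F. \<Sum>i<nj j. Yc j i \<alpha> x) + Yt \<alpha> x" for \<alpha> x
    proof -
      let ?M = "2 * L * (fact k * (1 + norm x + L) ^ k)"
      have M0: "?M \<ge> 0" using L by simp
      have i1: "integrable (count_space UNIV) (\<lambda>j. indicator (- F) j * g j \<alpha> x)"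
      proof (rule Bochner_Integration.integrable_bound[OF integrable_mult_left[OF T_int, of ?M]])
        show "AE j in count_space UNIV. norm (indicator (- F) j * g j \<alpha> x) \<le> norm (indicator (- F) j * A j * ?M)"
        proof (rule AE_I2)
          fix j
          show "norm (indicator (- F) j * g j \<alpha> x) \<le> norm (indicator (- F) j * A j * ?M)"
          proof (cases "j \<in> F")
            case False
            have "norm (g j \<alpha> x) \<le> A j * ?M" by (rule g_le)
            also have "\<dots> \<le> \<bar>A j * ?M\<bar>" by (rule abs_ge_self)
            finally show ?thesis using False by simp
          qed simp
        qed
      qed simp
      have fs: "finite {j. indicator F j * g j \<alpha> x \<noteq> 0}"
        by (rule finite_subset[OF _ F]) (auto simp: indicator_def)
      have i2: "integrable (count_space UNIV) (\<lambda>j. indicator F j * g j \<alpha> x)"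
      proof (rule Bochner_Integration.integrable_bound)
        show "integrable (count_space UNIV) (\<lambda>j. (\<Sum>j\<in>F. norm (g j \<alpha> x)) * indicator F j)"
          using F by (intro integrable_mult_right integrable_real_indicator) (auto simp: ennreal_of_nat_eq_real_of_nat)
        show "AE j in count_space UNIV. norm (indicator F j * g j \<alpha> x) \<le> norm ((\<Sum>j\<in>F. norm (g j \<alpha> x)) * indicator F j)"
        proof (rule AE_I2)
          fix j
          have "0 \<le> (\<Sum>j\<in>F. norm (g j \<alpha> x))" by (intro sum_nonneg) auto
          then show "norm (indicator F j * g j \<alpha> x) \<le> norm ((\<Sum>j\<in>F. norm (g j \<alpha> x)) * indicator F j)"
            using member_le_sum[of j F "\<lambda>j. norm (g j \<alpha> x)"] F by (cases "j \<in> F") auto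
        qed
      qed simp
      have "(LINT j|count_space UNIV. g j \<alpha> x) = (LINT j|count_space UNIV. indicator F j * g j \<alpha> x + indicator (- F) j * g j \<alpha> x)"
        by (intro Bochner_Integration.integral_cong) (auto simp: indicator_def)
      also have "\<dots> = (LINT j|count_space UNIV. indicator F j * g j \<alpha> x) + (LINT j|count_space UNIV. indicator (- F) j * g j \<alpha> x)"
        by (rule Bochner_Integration.integral_add[OF i2 i1])
      also have "(LINT j|count_space UNIV. indicator F j * g j \<alpha> x) = (\<Sum>j | indicator F j * g j \<alpha> x \<noteq> 0. indicator F j * g j \<alpha> x)"
        using fs by (subst lebesgue_integral_count_space_finite_support) auto
      also have "\<dots> = (\<Sum>j\<in>F. g j \<alpha> x)"
        using F by (intro sum.mono_neutral_cong_left) (auto simp: indicator_def)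
      also have "\<dots> = (\<Sum>j\<in>F. \<Sum>i<nj j. Yc j i \<alpha> x)" by (intro sum.cong g_cells) auto
      also have "(LINT j|count_space UNIV. indicator (- F) j * g j \<alpha> x) = Yt \<alpha> x"
        unfolding Yt_def g_def by (simp add: mult.assoc)
      finally show ?thesis unfolding g_def .
    qed
    have fin: "(\<Sum>j\<in>F. \<Sum>i<nj j. C1 * ((A j)\<^sup>2 * hj j powr (2 * q + 1))) + C2 * ((B * t powr (1/2 - q))\<^sup>2 / real N0)
        \<le> C * (B\<^sup>2 * t powr (- (2 * q)))"
    proof -
      \<comment> \<open>The \<open>nj j\<close> cells of length \<open>2 * L / nj j\<close> together
        cost (A j)^2 (nj j)^(-2 q) up to constants, and the number of cells is at least
        \<open>t * w j\<close>.\<close>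
      have cell_le: "(\<Sum>i<nj j. C1 * ((A j)\<^sup>2 * hj j powr (2 * q + 1))) \<le> C1 * (2 * L) powr (2 * q + 1) * (t powr (- (2 * q)) * (Bj j * B))"
        if j: "j \<in> F" for j
      proof -
        let ?n = "real (nj j)"
        have n: "?n > 0" using nj(3)[OF j] by simp
        have tw: "t * w j > 0" using t w0 by simp
        have "(\<Sum>i<nj j. C1 * ((A j)\<^sup>2 * hj j powr (2 * q + 1))) = C1 * (A j)\<^sup>2 * (?n * hj j powr (2 * q + 1))" by simp
        also have "?n * hj j powr (2 * q + 1) = (2 * L) powr (2 * q + 1) * ?n powr (- (2 * q))"
        proof -
          have "?n powr (2 * q + 1) = ?n powr (2 * q) * ?n" using n by (simp add: powr_add)
          then show ?thesis using L n unfolding hj_def by (simp add: powr_divide powr_minus field_simps)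
        qed
        also have "C1 * (A j)\<^sup>2 * ((2 * L) powr (2 * q + 1) * ?n powr (- (2 * q))) \<le> C1 * (A j)\<^sup>2 * ((2 * L) powr (2 * q + 1) * (t * w j) powr (- (2 * q)))"
          using C1(1) tw nj(1)[OF j] q by (intro mult_left_mono powr_mono2') auto
        also have "\<dots> = C1 * (2 * L) powr (2 * q + 1) * (t powr (- (2 * q)) * ((A j)\<^sup>2 * w j powr (- (2 * q))))"
          using t w0[of j] by (simp add: powr_mult mult_ac)
        also have "\<dots> \<le> C1 * (2 * L) powr (2 * q + 1) * (t powr (- (2 * q)) * (Bj j * B))"
        proof (intro mult_left_mono)
          \<comment> \<open>Bounding \<kappa> by \<open>w\<close> lets the powers of
            \<open>w\<close> collapse to 1 / w; the share \<open>Bj j / B\<close> contained in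
            \<open>w\<close> then leaves \<open>Bj j * B\<close>, which sums over j to at most
            B^2.\<close>
          have "(A j)\<^sup>2 = (Bj j)\<^sup>2 * \<kappa> j powr (2 * q - 1)"
            unfolding ABj[of j] power_mult_distrib using \<kappa>[of j] by (simp add: power2_eq_square[of "_ powr _"] powr_add[symmetric])
          also have "\<dots> \<le> (Bj j)\<^sup>2 * w j powr (2 * q - 1)"
            using q \<kappa>[of j] w\<kappa>[of j] by (intro mult_left_mono powr_mono2) auto
          finally have "(A j)\<^sup>2 * w j powr (- (2 * q)) \<le> (Bj j)\<^sup>2 * w j powr (2 * q - 1) * w j powr (- (2 * q))"
            by (rule mult_right_mono) simp
          also have "\<dots> = (Bj j)\<^sup>2 / w j"
          proof -
            have "w j powr (2 * q - 1) * w j powr (- (2 * q)) = w j powr (- 1)"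
              by (simp add: powr_add[symmetric])
            also have "\<dots> = 1 / w j" using w0[of j] by (simp add: powr_minus_divide)
            finally show ?thesis by (simp add: mult.assoc)
          qed
          also have "\<dots> \<le> Bj j * B"
          proof (cases "Bj j = 0")
            case False
            then have bp: "Bj j > 0" using Bj0[of j] by simp
            then have Bp: "B > 0" using sumB[of "{j}"] by simp
            have "Bj j / B \<le> w j" using \<kappa>[of j] by (simp add: w_def)
            then have "Bj j \<le> w j * B" using Bp by (simp add: field_simps)
            then have "Bj j * Bj j \<le> Bj j * (w j * B)" using bp by (intro mult_left_mono) auto
            then show ?thesis using w0[of j] by (simp add: power2_eq_square pos_divide_le_eq mult_ac)
          qed simp
          finally show "(A j)\<^sup>2 * w j powr (- (2 * q)) \<le> Bj j * B" .
        qed (use C1(1) in auto)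
        finally show ?thesis .
      qed
      define D where "D = C1 * (2 * L) powr (2 * q + 1) * t powr (- (2 * q)) * B"
      have D0: "D \<ge> 0" using C1(1) B0 by (simp add: D_def)
      have "(\<Sum>i<nj j. C1 * ((A j)\<^sup>2 * hj j powr (2 * q + 1))) \<le> D * Bj j" if "j \<in> F" for j
        using cell_le[OF that] by (simp only: D_def mult.assoc mult.commute mult.left_commute)
      then have "(\<Sum>j\<in>F. \<Sum>i<nj j. C1 * ((A j)\<^sup>2 * hj j powr (2 * q + 1))) \<le> (\<Sum>j\<in>F. D * Bj j)"
        by (rule sum_mono)
      moreover have "(\<Sum>j\<in>F. D * Bj j) = D * (\<Sum>j\<in>F. Bj j)" by (rule sum_distrib_left[symmetric])
      moreover have "D * (\<Sum>j\<in>F. Bj j) \<le> D * B" by (rule mult_left_mono[OF sumB[OF F] D0])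
      moreover have "D * B = C1 * (2 * L) powr (2 * q + 1) * (B\<^sup>2 * t powr (- (2 * q)))"
        unfolding D_def power2_eq_square by (simp only: mult.assoc mult.commute mult.left_commute)
      ultimately have p1: "(\<Sum>j\<in>F. \<Sum>i<nj j. C1 * ((A j)\<^sup>2 * hj j powr (2 * q + 1))) \<le> C1 * (2 * L) powr (2 * q + 1) * (B\<^sup>2 * t powr (- (2 * q)))"
        by linarith
      have "(B * t powr (1/2 - q))\<^sup>2 / real N0 \<le> (B * t powr (1/2 - q))\<^sup>2 / t"
        by (rule divide_left_mono) (use N0 t in auto)
      \<comment> \<open>The half power of \<open>t\<close> by which the mass of the tail is too
        large is regained from the factor \<open>1 / t\<close> of plain sampling, after
        squaring.\<close>
      moreover have "(B * t powr (1/2 - q))\<^sup>2 / t = B\<^sup>2 * t powr (- (2 * q))"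
      proof -
        have "(t powr (1/2 - q))\<^sup>2 = t powr (1 - 2 * q)"
          unfolding power2_eq_square powr_add[symmetric] by (rule arg_cong[where f="\<lambda>z. t powr z"]) linarith
        moreover have "t powr (1 - 2 * q) / t = t powr (- (2 * q))"
          using powr_diff[of t "1 - 2 * q" 1] t by simp
        ultimately show ?thesis by (simp only: power_mult_distrib times_divide_eq_right[symmetric])
      qed
      ultimately have "(B * t powr (1/2 - q))\<^sup>2 / real N0 \<le> B\<^sup>2 * t powr (- (2 * q))" by (rule order_trans[OF _ eq_refl])
      then have p2: "C2 * ((B * t powr (1/2 - q))\<^sup>2 / real N0) \<le> C2 * (B\<^sup>2 * t powr (- (2 * q)))"
        by (rule mult_left_mono) (use C2(1) in simp)
      show ?thesis unfolding C_def distrib_right by (rule add_mono[OF p1 p2])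
    qed
    have good: "good k m N (\<lambda>\<alpha> x. LINT j|count_space UNIV. LINT b|lborel. \<rho> j b * of_real (neuron k (\<omega> j) b \<alpha> x))
          (C * (B\<^sup>2 * t powr (- (2 * q))))"
      using good_mono[OF good_plus[OF main tail] order_refl fin] unfolding Y_eq[symmetric] N_def[symmetric] .
    show "\<exists>N. real N \<le> (2 * (real k + 2) * (1 + K) + 1) * t + 1 \<and>
        good k m N (\<lambda>\<alpha> x. LINT j|count_space UNIV. LINT b|lborel. \<rho> j b * of_real (neuron k (\<omega> j) b \<alpha> x))
          (C * (B\<^sup>2 * t powr (- (2 * q))))"
      by (intro exI[of _ N] conjI good Nle)
  qed
qed

section \<open>Weak derivatives of networks\<close>

lemma test_function_differentiable:
  "\<phi> \<in> test_functions U \<Longrightarrow> \<phi> differentiable (at x)"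
proof -
  assume "\<phi> \<in> test_functions U"
  then have "partial_derivs [] \<phi> differentiable (at x)" unfolding test_functions_def by blast
  then show ?thesis by (simp add: partial_derivs_def)
qed

lemma test_function_continuous: "\<phi> \<in> test_functions U \<Longrightarrow> continuous_on S \<phi>"
  by (intro continuous_at_imp_continuous_on ballI differentiable_imp_continuous_within test_function_differentiable)

lemma test_function_has_derivative:
  "\<phi> \<in> test_functions U \<Longrightarrow> (\<phi> has_derivative frechet_derivative \<phi> (at x)) (at x)"
  using test_function_differentiable frechet_derivative_works by blast

lemma partial_deriv_outside:
  assumes "closed K" "\<And>x. x \<notin> K \<Longrightarrow> \<phi> x = 0" "x \<notin> K"
  shows "partial_deriv i \<phi> x = 0"
proof -
  have "((\<lambda>_. 0) has_derivative (\<lambda>_. 0::real)) (at x)" by simp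
  then have "(\<phi> has_derivative (\<lambda>_. 0)) (at x)"
    by (rule has_derivative_transform_within_open[of _ _ _ _ "- K"]) (use assms in auto)
  from frechet_derivative_at[OF this] show ?thesis by (simp add: partial_deriv_def fun_eq_iff)
qed

lemma partial_deriv_test_function:
  assumes "\<phi> \<in> test_functions U"
  shows "partial_deriv i \<phi> \<in> test_functions U"
proof -
  obtain K where K: "compact K" "K \<subseteq> U" "\<And>x. x \<notin> K \<Longrightarrow> \<phi> x = 0"
    using assms unfolding test_functions_def by blast
  have "partial_derivs is (partial_deriv i \<phi>) = partial_derivs (is @ [i]) \<phi>" for "is"
    by (simp add: partial_derivs_def)
  moreover have "partial_deriv i \<phi> x = 0" if "x \<notin> K" for x
    by (rule partial_deriv_outside[OF compact_imp_closed[OF K(1)] K(3) that])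
  ultimately show ?thesis
    using assms K(1,2) unfolding test_functions_def by auto
qed

lemma partial_derivs_test_function:
  "\<phi> \<in> test_functions U \<Longrightarrow> partial_derivs is \<phi> \<in> test_functions U"
  unfolding partial_derivs_def by (induction "is") (auto intro: partial_deriv_test_function)

lemma test_function_line_derivative:
  assumes "\<phi> \<in> test_functions U"
  shows "((\<lambda>t. \<phi> (x + t *\<^sub>R axis i 1)) has_real_derivative partial_deriv i \<phi> (x + t *\<^sub>R axis i 1)) (at t)"
proof -
  have 1: "((\<lambda>t. x + t *\<^sub>R axis i 1) has_derivative (\<lambda>h. h *\<^sub>R axis i 1)) (at t)"
    by (auto intro!: derivative_eq_intros)
  have 2: "((\<lambda>t. \<phi> (x + t *\<^sub>R axis i 1)) has_derivative (\<lambda>h. frechet_derivative \<phi> (at (x + t *\<^sub>R axis i 1)) (h *\<^sub>R axis i 1))) (at t)"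
    by (rule has_derivative_compose[OF 1 test_function_has_derivative[OF assms]])
  have "linear (frechet_derivative \<phi> (at (x + t *\<^sub>R axis i 1)))"
    by (rule linear_frechet_derivative[OF test_function_differentiable[OF assms]])
  then have "(\<lambda>h. frechet_derivative \<phi> (at (x + t *\<^sub>R axis i 1)) (h *\<^sub>R axis i 1)) = (\<lambda>h. partial_deriv i \<phi> (x + t *\<^sub>R axis i 1) * h)"
    by (simp add: linear_scale partial_deriv_def fun_eq_iff mult.commute)
  with 2 show ?thesis by (simp add: has_field_derivative_def)
qed

lemma test_function_bounded:
  assumes "\<phi> \<in> test_functions U"
  obtains M R where "M \<ge> 0" "R \<ge> 0" "\<And>x. \<bar>\<phi> x\<bar> \<le> M" "\<And>x. norm x > R \<Longrightarrow> \<phi> x = 0"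
proof -
  obtain K where K: "compact K" "K \<subseteq> U" "\<And>x. x \<notin> K \<Longrightarrow> \<phi> x = 0"
    using assms unfolding test_functions_def by blast
  have "compact (\<phi> ` K)" by (intro compact_continuous_image test_function_continuous[OF assms] K)
  then obtain M where M: "\<And>x. x \<in> K \<Longrightarrow> \<bar>\<phi> x\<bar> \<le> M"
    by (meson compact_imp_bounded bounded_real imageI)
  obtain R where R: "\<And>x. x \<in> K \<Longrightarrow> norm x \<le> R"
    using compact_imp_bounded[OF K(1)] by (auto simp: bounded_iff)
  have "\<bar>\<phi> x\<bar> \<le> max 0 M" for x using M[of x] K(3)[of x] by (cases "x \<in> K") auto
  moreover have "\<phi> x = 0" if "norm x > max 0 R" for x using K(3)[of x] R[of x] that by force
  ultimately show ?thesis using that[of "max 0 M" "max 0 R"] by auto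
qed

lemma test_function_measurable: "\<phi> \<in> test_functions U \<Longrightarrow> \<phi> \<in> borel_measurable borel"
  by (rule borel_measurable_continuous_onI[OF test_function_continuous])

lemma test_function_Lipschitz:
  assumes "\<phi> \<in> test_functions U" and M: "\<And>x. \<bar>partial_deriv i \<phi> x\<bar> \<le> M" and h: "h > 0"
  shows "\<bar>\<phi> (x + h *\<^sub>R axis i 1) - \<phi> x\<bar> \<le> M * h"
proof -
  obtain z where "\<phi> (x + h *\<^sub>R axis i 1) - \<phi> (x + 0 *\<^sub>R axis i 1) = (h - 0) * partial_deriv i \<phi> (x + z *\<^sub>R axis i 1)"
    using MVT2[OF h, of "\<lambda>t. \<phi> (x + t *\<^sub>R axis i 1)" "\<lambda>t. partial_deriv i \<phi> (x + t *\<^sub>R axis i 1)"]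
      test_function_line_derivative[OF assms(1)] by blast
  then show ?thesis using mult_left_mono[OF M, of h] h by (simp add: abs_mult mult.commute)
qed

section \<open>Integration by parts for Lipschitz functions\<close>

lemma integrable_locally_bounded_test_function:
  fixes g :: "real^'n \<Rightarrow> complex"
  assumes g: "g \<in> borel_measurable borel" and gb: "\<And>x. norm x \<le> R \<Longrightarrow> norm (g x) \<le> B"
    and \<phi>: "\<phi> \<in> borel_measurable borel" "\<And>x. \<bar>\<phi> x\<bar> \<le> M" "\<And>x. norm x > R \<Longrightarrow> \<phi> x = 0"
  shows "integrable lborel (\<lambda>x. g x * of_real (\<phi> x))"
proof -
  have [measurable]: "g \<in> borel_measurable borel" "\<phi> \<in> borel_measurable borel" by (rule g, rule \<phi>(1))
  have "integrable lborel (\<lambda>x. indicator (cball 0 R) x *\<^sub>R (g x * of_real (\<phi> x)))"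
  proof (rule integrableI_bounded_set_indicator[where B="B * M"])
    show "emeasure lborel (cball (0::real^'n) R) < \<infinity>" by (rule emeasure_bounded_finite[OF bounded_cball])
    show "AE x in lborel. x \<in> cball 0 R \<longrightarrow> norm (g x * of_real (\<phi> x)) \<le> B * M"
    proof (intro AE_I2 impI)
      fix x :: "real^'n" assume "x \<in> cball 0 R"
      then have "norm (g x) \<le> B" by (intro gb) auto
      then show "norm (g x * of_real (\<phi> x)) \<le> B * M" unfolding norm_mult norm_of_real
        using order_trans[OF norm_ge_zero] by (intro mult_mono \<phi>(2)) auto
    qed
  qed auto
  moreover have "indicator (cball 0 R) x *\<^sub>R (g x * of_real (\<phi> x)) = g x * of_real (\<phi> x)" for x
    using \<phi>(3)[of x] by (auto simp: indicator_def not_le)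
  ultimately show ?thesis by simp
qed

text \<open>Translation invariance of the measure moves the difference quotient from the test
  function to \<open>g\<close>; dominated convergence on both sides then gives the identity. The
  local Lipschitz bound along the axis provides the majorant, so convergence of the quotients almost
  everywhere suffices.\<close>

lemma integration_by_parts_difference_quotients:
  fixes g :: "real^'n \<Rightarrow> complex"
  assumes \<phi>: "\<phi> \<in> test_functions U"
    and g [measurable]: "g \<in> borel_measurable borel" and g' [measurable]: "g' \<in> borel_measurable borel"
    and lim: "AE x in lborel. (\<lambda>n. (g (x - (1 / real (Suc n)) *\<^sub>R axis i 1) - g x) / of_real (1 / real (Suc n))) \<longlonglongrightarrow> - g' x"
    and gb: "\<And>R. \<exists>B. \<forall>x. norm x \<le> R \<longrightarrow> norm (g x) \<le> B"
    and gL: "\<And>R. \<exists>B. \<forall>x h. norm x \<le> R \<longrightarrow> 0 < h \<longrightarrow> h \<le> 1 \<longrightarrow> norm (g (x - h *\<^sub>R axis i 1) - g x) \<le> B * h"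
  shows "(LINT x|lborel. g x * of_real (partial_deriv i \<phi> x)) = - (LINT x|lborel. g' x * of_real (\<phi> x))"
proof -
  let ?e = "axis i 1 :: real^'n" and ?h = "\<lambda>n. 1 / real (Suc n)"
  let ?D = "partial_deriv i \<phi>"
  obtain M R where M: "M \<ge> 0" "R \<ge> 0" "\<And>x. \<bar>\<phi> x\<bar> \<le> M" "\<And>x. norm x > R \<Longrightarrow> \<phi> x = 0"
    using test_function_bounded[OF \<phi>] by blast
  obtain M' where M': "M' \<ge> 0" "\<And>x. \<bar>?D x\<bar> \<le> M'"
    using test_function_bounded[OF partial_deriv_test_function[OF \<phi>, of i]] by metis
  have [measurable]: "\<phi> \<in> borel_measurable borel" "?D \<in> borel_measurable borel"
    by (rule test_function_measurable[OF \<phi>], rule test_function_measurable[OF partial_deriv_test_function[OF \<phi>]])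
  obtain B where B: "\<And>x. norm x \<le> R + 1 \<Longrightarrow> norm (g x) \<le> B" using gb by blast
  obtain B' where B': "\<And>x h. norm x \<le> R \<Longrightarrow> 0 < h \<Longrightarrow> h \<le> 1 \<Longrightarrow> norm (g (x - h *\<^sub>R ?e) - g x) \<le> B' * h" using gL by blast
  have B0: "B \<ge> 0" using B[of 0] M(2) by (metis add_nonneg_nonneg norm_ge_zero norm_zero order_trans zero_le_one)
  \<comment> \<open>A shift by at most 1 enlarges the support of the test function to radius
    \<open>R + 1\<close>, which is why \<open>g\<close> is bounded on that ball.\<close>
  have out: "\<phi> (x + h *\<^sub>R ?e) = 0" if "norm x > R + 1" "0 < h" "h \<le> 1" for x h
  proof (rule M(4))
    have "norm x \<le> norm (x + h *\<^sub>R ?e) + norm (h *\<^sub>R ?e)" using norm_triangle_ineq4[of "x + h *\<^sub>R ?e" "h *\<^sub>R ?e"] by simp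
    also have "norm (h *\<^sub>R ?e) \<le> 1" using that by (simp add: norm_axis_1)
    finally show "norm (x + h *\<^sub>R ?e) > R" using that(1) by linarith
  qed
  have h01: "0 < ?h n" "?h n \<le> 1" for n by auto
  define p where "p n x = (\<phi> (x + ?h n *\<^sub>R ?e) - \<phi> x) / ?h n" for n x
  define q where "q n x = (g (x - ?h n *\<^sub>R ?e) - g x) / of_real (?h n)" for n x
  have eq: "(LINT x|lborel. g x * of_real (p n x)) = (LINT x|lborel. q n x * of_real (\<phi> x))" for n
  proof -
    let ?s = "?h n *\<^sub>R ?e"
    have i1: "integrable lborel (\<lambda>x. g x * of_real (\<phi> x))"
      by (rule integrable_locally_bounded_test_function[OF g, of "R + 1" B \<phi> M]) (use B M in auto)
    have i2: "integrable lborel (\<lambda>x. g x * of_real (\<phi> (x + ?s)))"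
      by (rule integrable_locally_bounded_test_function[OF g, of "R + 1" B _ M]) (use B M out[OF _ h01] in auto)
    have tr: "(LINT x|lborel. f x) = (LINT x|lborel. f (x - ?s))" if [measurable]: "f \<in> borel_measurable borel" for f :: "real^'n \<Rightarrow> complex"
    proof -
      have "(LINT x|lborel. f x) = (LINT x|distr lborel borel ((+) (- ?s)). f x)" by (simp only: lborel_distr_plus)
      also have "\<dots> = (LINT x|lborel. f (x - ?s))" by (subst integral_distr) auto
      finally show ?thesis .
    qed
    have i3: "integrable lborel (\<lambda>x. g (x - ?s) * of_real (\<phi> x))"
    proof -
      have "integrable (distr lborel borel ((+) (- ?s))) (\<lambda>x. g x * of_real (\<phi> (x + ?s)))" using i2 by (simp only: lborel_distr_plus)
      then show ?thesis by (subst (asm) integrable_distr_eq) auto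
    qed
    have "(LINT x|lborel. g x * of_real (p n x)) = (LINT x|lborel. (g x * of_real (\<phi> (x + ?s)) - g x * of_real (\<phi> x)) / of_real (?h n))"
      by (intro Bochner_Integration.integral_cong) (auto simp: p_def right_diff_distrib diff_divide_distrib)
    also have "\<dots> = ((LINT x|lborel. g x * of_real (\<phi> (x + ?s))) - (LINT x|lborel. g x * of_real (\<phi> x))) / of_real (?h n)"
      using i1 i2 by simp
    also have "(LINT x|lborel. g x * of_real (\<phi> (x + ?s))) = (LINT x|lborel. g (x - ?s) * of_real (\<phi> x))"
      by (subst tr) auto
    also have "((LINT x|lborel. g (x - ?s) * of_real (\<phi> x)) - (LINT x|lborel. g x * of_real (\<phi> x))) / of_real (?h n)
       = (LINT x|lborel. (g (x - ?s) * of_real (\<phi> x) - g x * of_real (\<phi> x)) / of_real (?h n))"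
      using i1 i3 by simp
    also have "\<dots> = (LINT x|lborel. q n x * of_real (\<phi> x))"
      by (intro Bochner_Integration.integral_cong) (auto simp: q_def left_diff_distrib diff_divide_distrib)
    finally show ?thesis .
  qed
  have dom: "integrable lborel (\<lambda>x. C * indicator (cball (0::real^'n) r) x :: real)" for C r
    by (intro integrable_mult_right integrable_real_indicator emeasure_bounded_finite bounded_cball) auto
  have h_lim: "(\<lambda>n. ?h n) \<longlonglongrightarrow> 0" using LIMSEQ_inverse_real_of_nat by (simp add: inverse_eq_divide)
  have L1: "(\<lambda>n. LINT x|lborel. g x * of_real (p n x)) \<longlonglongrightarrow> (LINT x|lborel. g x * of_real (?D x))"
  proof (rule integral_dominated_convergence[OF _ _ dom[of "B * M'" "R + 1"]])
    show "AE x in lborel. (\<lambda>n. g x * of_real (p n x)) \<longlonglongrightarrow> g x * of_real (?D x)"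
    proof (intro AE_I2 tendsto_intros)
      fix x
      have "((\<lambda>t. \<phi> (x + t *\<^sub>R ?e)) has_real_derivative ?D x) (at 0)"
        using test_function_line_derivative[OF \<phi>, of x i 0] by simp
      then have "((\<lambda>t. (\<phi> (x + t *\<^sub>R ?e) - \<phi> x) / t) \<longlongrightarrow> ?D x) (at 0)"
        by (simp add: has_field_derivative_iff)
      moreover have "filterlim ?h (at 0) sequentially"
        using h_lim by (auto simp: filterlim_at)
      ultimately show "(\<lambda>n. p n x) \<longlonglongrightarrow> ?D x"
        unfolding p_def by (rule filterlim_compose)
    qed
    show "AE x in lborel. norm (g x * of_real (p n x)) \<le> B * M' * indicator (cball 0 (R + 1)) x" for n
    proof (rule AE_I2)
      fix x :: "real^'n"
      show "norm (g x * of_real (p n x)) \<le> B * M' * indicator (cball 0 (R + 1)) x"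
      proof (cases "norm x \<le> R + 1")
        case True
        have "\<phi> (x + ?h n *\<^sub>R ?e) - \<phi> x = p n x * ?h n" by (simp add: p_def)
        then have "\<bar>p n x\<bar> * ?h n \<le> M' * ?h n"
          using test_function_Lipschitz[OF \<phi> M'(2) h01(1)[of n], of x] by (simp only: abs_mult abs_of_pos[OF h01(1)])
        then have "\<bar>p n x\<bar> \<le> M'" using h01(1)[of n] by (rule mult_right_le_imp_le)
        then have "norm (g x * of_real (p n x)) \<le> B * M'" unfolding norm_mult norm_of_real
          using B[OF True] B0 by (intro mult_mono) auto
        then show ?thesis using True by simp
      next
        case False
        then have "p n x = 0" using out[OF _ h01, of x n] M(4)[of x] by (simp add: p_def)
        then show ?thesis using B0 M'(1) by simp
      qed
    qed
  qed (simp_all add: p_def)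
  have L2: "(\<lambda>n. LINT x|lborel. q n x * of_real (\<phi> x)) \<longlonglongrightarrow> (LINT x|lborel. (- g' x) * of_real (\<phi> x))"
  proof (rule integral_dominated_convergence[OF _ _ dom[of "B' * M" R]])
    show "AE x in lborel. (\<lambda>n. q n x * of_real (\<phi> x)) \<longlonglongrightarrow> (- g' x) * of_real (\<phi> x)"
      using lim unfolding q_def by eventually_elim (intro tendsto_intros)
    show "AE x in lborel. norm (q n x * of_real (\<phi> x)) \<le> B' * M * indicator (cball 0 R) x" for n
    proof (rule AE_I2)
      fix x :: "real^'n"
      show "norm (q n x * of_real (\<phi> x)) \<le> B' * M * indicator (cball 0 R) x"
      proof (cases "norm x \<le> R")
        case True
        have "norm (q n x) \<le> B'" using B'[OF True h01, of n]
          by (simp only: q_def norm_divide norm_of_real abs_of_pos[OF h01(1)] pos_divide_le_eq[OF h01(1)])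
        then have "norm (q n x) * \<bar>\<phi> x\<bar> \<le> B' * M" using order_trans[OF norm_ge_zero] by (intro mult_mono M) auto
        then show ?thesis using True by (simp add: norm_mult)
      next
        case False
        then show ?thesis using M(4)[of x] by simp
      qed
    qed
  qed (simp_all add: q_def)
  have "(LINT x|lborel. g x * of_real (?D x)) = (LINT x|lborel. (- g' x) * of_real (\<phi> x))"
    using LIMSEQ_unique[OF L1] L2 by (simp only: eq)
  then show ?thesis by simp
qed

lemma AE_not_on_hyperplane:
  fixes \<omega> :: "real^'n"
  assumes "\<omega> \<noteq> 0"
  shows "AE x in lborel. \<omega> \<bullet> x \<noteq> b"
proof -
  have "negligible {x. \<omega> \<bullet> x = b}" using assms by (intro negligible_hyperplane) auto
  then have "{x. \<omega> \<bullet> x = b} \<in> null_sets lebesgue" by (simp add: negligible_iff_null_sets)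
  then have "AE x in lebesgue. x \<notin> {x. \<omega> \<bullet> x = b}" by (rule AE_not_in)
  then show ?thesis by (simp add: AE_completion_iff)
qed

text \<open>Below order \<open>k\<close> the formal derivative is a truncated power of positive
  exponent, locally Lipschitz and differentiable off the hyperplane
  \<open>\<omega> \<bullet> x = b\<close>, a null set. On the hyperplane differentiability can fail
  when the next derivative is a step function.\<close>

lemma neuron_integration_by_parts:
  fixes \<omega> :: "real^'n::finite"
  assumes \<phi>: "\<phi> \<in> test_functions U" and \<omega>: "\<omega> \<in> sphere 0 1" and \<beta>: "mi_order \<beta> < k"
  shows "(LINT x|lborel. complex_of_real (neuron k \<omega> b \<beta> x) * of_real (partial_deriv i \<phi> x)) =
    - (LINT x|lborel. complex_of_real (neuron k \<omega> b (\<beta>(i := Suc (\<beta> i))) x) * of_real (\<phi> x))"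
proof (rule integration_by_parts_difference_quotients[OF \<phi>])
  let ?\<beta>' = "\<beta>(i := Suc (\<beta> i))"
  obtain p where p: "k - mi_order \<beta> = Suc p" using \<beta> by (metis Suc_diff_Suc)
  have "(\<Sum>j\<in>UNIV. ?\<beta>' j) = (\<Sum>j\<in>UNIV. \<beta> j + (if j = i then 1 else 0))" by (intro sum.cong) auto
  then have ord: "mi_order ?\<beta>' = Suc (mi_order \<beta>)" by (simp add: mi_order_def sum.distrib)
  then have p': "k - mi_order ?\<beta>' = p" using p by simp
  have "(\<Prod>j\<in>UNIV. (\<omega> $ j) ^ ?\<beta>' j) = (\<Prod>j\<in>UNIV. (\<omega> $ j) ^ \<beta> j * (if j = i then \<omega> $ j else 1))" by (intro prod.cong) auto
  also have "\<dots> = (\<Prod>j\<in>UNIV. (\<omega> $ j) ^ \<beta> j) * \<omega> $ i" by (simp add: prod.distrib)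
  finally have prod: "(\<Prod>j\<in>UNIV. (\<omega> $ j) ^ ?\<beta>' j) = (\<Prod>j\<in>UNIV. (\<omega> $ j) ^ \<beta> j) * \<omega> $ i" .
  have coef: "dcoef k \<omega> ?\<beta>' = dcoef k \<omega> \<beta> * (real (Suc p) * \<omega> $ i)"
    unfolding dcoef_def prod p p' by (simp add: field_simps del: of_nat_Suc)
  have N: "neuron k \<omega> b \<beta> x = dcoef k \<omega> \<beta> * relu_pow (Suc p) (\<omega> \<bullet> x - b)" for x by (simp add: neuron_def p)
  have N': "neuron k \<omega> b ?\<beta>' x = dcoef k \<omega> \<beta> * (\<omega> $ i * (real (Suc p) * relu_pow p (\<omega> \<bullet> x - b)))" for x
    by (simp add: neuron_def p' coef mult_ac del: of_nat_Suc)
  show "(\<lambda>x. complex_of_real (neuron k \<omega> b \<beta> x)) \<in> borel_measurable borel" by measurable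
  show "(\<lambda>x. complex_of_real (neuron k \<omega> b ?\<beta>' x)) \<in> borel_measurable borel" by measurable
  show "\<exists>B. \<forall>x. norm x \<le> R \<longrightarrow> norm (complex_of_real (neuron k \<omega> b \<beta> x)) \<le> B" for R
  proof (intro exI[of _ "fact k * (1 + R + \<bar>b\<bar>) ^ k"] allI impI)
    fix x :: "real^'n" assume "norm x \<le> R"
    then have "fact k * (1 + norm x + \<bar>b\<bar>) ^ k \<le> fact k * (1 + R + \<bar>b\<bar>) ^ k"
      by (intro mult_left_mono power_mono) auto
    with neuron_abs_le[OF \<omega> order_refl, of k b \<beta> x]
    show "norm (complex_of_real (neuron k \<omega> b \<beta> x)) \<le> fact k * (1 + R + \<bar>b\<bar>) ^ k" unfolding norm_of_real by linarith
  qed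
  show "\<exists>B. \<forall>x h. norm x \<le> R \<longrightarrow> 0 < h \<longrightarrow> h \<le> 1 \<longrightarrow> norm (complex_of_real (neuron k \<omega> b \<beta> (x - h *\<^sub>R axis i 1)) - of_real (neuron k \<omega> b \<beta> x)) \<le> B * h" for R
  proof (intro exI[of _ "fact k * (real (Suc p) * (2 + R + \<bar>b\<bar>) ^ p)"] allI impI)
    fix x :: "real^'n" and h :: real assume x: "norm x \<le> R" and h: "0 < h" "h \<le> 1"
    have ip: "\<omega> \<bullet> (x - h *\<^sub>R axis i 1) = \<omega> \<bullet> x - h * \<omega> $ i" by (simp add: inner_diff_right inner_axis)
    have wi: "\<bar>\<omega> $ i\<bar> \<le> 1" using component_le_norm_cart[of \<omega> i] \<omega> by simp
    have wx: "\<bar>\<omega> \<bullet> x\<bar> \<le> R" using Cauchy_Schwarz_ineq2[of \<omega> x] \<omega> x by simp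
    have hw: "\<bar>h * \<omega> $ i\<bar> \<le> h" using h mult_left_mono[OF wi, of h] by (simp add: abs_mult)
    have "\<bar>relu_pow (Suc p) (\<omega> \<bullet> x - h * \<omega> $ i - b) - relu_pow (Suc p) (\<omega> \<bullet> x - b)\<bar>
      \<le> real (Suc p) * (2 + R + \<bar>b\<bar>) ^ p * \<bar>(\<omega> \<bullet> x - h * \<omega> $ i - b) - (\<omega> \<bullet> x - b)\<bar>"
      using wx hw h by (intro relu_pow_Lipschitz) linarith+
    also have "\<dots> \<le> real (Suc p) * (2 + R + \<bar>b\<bar>) ^ p * h"
      using hw order_trans[OF norm_ge_zero x] by (intro mult_left_mono) auto
    finally have r: "\<bar>relu_pow (Suc p) (\<omega> \<bullet> x - h * \<omega> $ i - b) - relu_pow (Suc p) (\<omega> \<bullet> x - b)\<bar> \<le> real (Suc p) * (2 + R + \<bar>b\<bar>) ^ p * h" .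
    have "norm (complex_of_real (neuron k \<omega> b \<beta> (x - h *\<^sub>R axis i 1)) - of_real (neuron k \<omega> b \<beta> x)) =
       \<bar>dcoef k \<omega> \<beta>\<bar> * \<bar>relu_pow (Suc p) (\<omega> \<bullet> x - h * \<omega> $ i - b) - relu_pow (Suc p) (\<omega> \<bullet> x - b)\<bar>"
      unfolding of_real_diff[symmetric] norm_of_real N ip right_diff_distrib[symmetric] abs_mult ..
    also have "\<dots> \<le> fact k * (real (Suc p) * (2 + R + \<bar>b\<bar>) ^ p * h)"
      by (intro mult_mono abs_dcoef_le[OF \<omega>] r) auto
    finally show "norm (complex_of_real (neuron k \<omega> b \<beta> (x - h *\<^sub>R axis i 1)) - of_real (neuron k \<omega> b \<beta> x)) \<le> fact k * (real (Suc p) * (2 + R + \<bar>b\<bar>) ^ p) * h"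
      by (simp only: mult.assoc)
  qed
  have "\<omega> \<noteq> 0" using \<omega> by auto
  from AE_not_on_hyperplane[OF this, of b]
  show "AE x in lborel. (\<lambda>n. (complex_of_real (neuron k \<omega> b \<beta> (x - (1 / real (Suc n)) *\<^sub>R axis i 1)) - of_real (neuron k \<omega> b \<beta> x)) / of_real (1 / real (Suc n)))
      \<longlonglongrightarrow> - of_real (neuron k \<omega> b ?\<beta>' x)"
  proof eventually_elim
    case (elim x)
    let ?f = "\<lambda>t. dcoef k \<omega> \<beta> * relu_pow (Suc p) (\<omega> \<bullet> x - t * \<omega> $ i - b)"
    have "(?f has_real_derivative dcoef k \<omega> \<beta> * (real (Suc p) * relu_pow p (\<omega> \<bullet> x - 0 * \<omega> $ i - b) * (- \<omega> $ i))) (at 0)"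
      by (intro DERIV_cmult DERIV_chain'[OF _ relu_pow_has_derivative]) (use elim in \<open>auto intro!: derivative_eq_intros\<close>)
    then have "((\<lambda>t. (?f t - ?f 0) / t) \<longlongrightarrow> - neuron k \<omega> b ?\<beta>' x) (at 0)"
      unfolding N' by (simp add: has_field_derivative_iff mult_ac del: of_nat_Suc)
    moreover have "filterlim (\<lambda>n. 1 / real (Suc n)) (at 0) sequentially"
      using LIMSEQ_inverse_real_of_nat by (auto simp: filterlim_at inverse_eq_divide)
    ultimately have "(\<lambda>n. (?f (1 / real (Suc n)) - ?f 0) / (1 / real (Suc n))) \<longlonglongrightarrow> - neuron k \<omega> b ?\<beta>' x"
      by (rule filterlim_compose)
    then have lim: "(\<lambda>n. complex_of_real ((?f (1 / real (Suc n)) - ?f 0) / (1 / real (Suc n)))) \<longlonglongrightarrow> of_real (- neuron k \<omega> b ?\<beta>' x)"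
      by (rule tendsto_of_real)
    have eqn: "complex_of_real ((?f (1 / real (Suc n)) - ?f 0) / (1 / real (Suc n))) =
       (complex_of_real (neuron k \<omega> b \<beta> (x - (1 / real (Suc n)) *\<^sub>R axis i 1)) - of_real (neuron k \<omega> b \<beta> x)) / of_real (1 / real (Suc n))" for n
      unfolding of_real_divide of_real_diff N by (simp add: inner_diff_right inner_axis)
    show ?case using lim unfolding eqn of_real_minus .
  qed
qed

text \<open>A form of weak differentiability that is stable under sums and integrals: Borel
  representatives, local bounds, and integrals over the whole space. Lists record an order of
  differentiation, and \<open>count_list\<close> recovers the multi-index. The identity is demanded
  up to order \<open>k\<close>, the range in which a neuron has functions as weak
  derivatives.\<close>

definition wd_family :: "nat \<Rightarrow> (real^'n) set \<Rightarrow> (('n::finite \<Rightarrow> nat) \<Rightarrow> real^'n \<Rightarrow> complex) \<Rightarrow> bool" where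
  "wd_family k U D \<longleftrightarrow> (\<forall>\<alpha>. D \<alpha> \<in> borel_measurable borel) \<and>
     (\<forall>\<alpha> R. \<exists>B. \<forall>x. norm x \<le> R \<longrightarrow> norm (D \<alpha> x) \<le> B) \<and>
     (\<forall>\<phi>\<in>test_functions U. \<forall>is. length is \<le> k \<longrightarrow>
        (LINT x|lborel. D (\<lambda>_. 0) x * of_real (partial_derivs is \<phi> x)) =
        (-1) ^ length is * (LINT x|lborel. D (count_list is) x * of_real (\<phi> x)))"

lemma wd_family_integrable:
  assumes "wd_family k U D" "\<phi> \<in> test_functions U"
  shows "integrable lborel (\<lambda>x. D \<alpha> x * of_real (\<phi> x))"
proof -
  obtain M R where M: "\<And>x. \<bar>\<phi> x\<bar> \<le> M" "\<And>x. norm x > R \<Longrightarrow> \<phi> x = 0"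
    using test_function_bounded[OF assms(2)] by metis
  obtain B where "\<And>x. norm x \<le> R \<Longrightarrow> norm (D \<alpha> x) \<le> B"
    using assms(1) unfolding wd_family_def by blast
  moreover have "D \<alpha> \<in> borel_measurable borel" using assms(1) unfolding wd_family_def by blast
  ultimately show ?thesis
    using M test_function_measurable[OF assms(2)] by (intro integrable_locally_bounded_test_function) auto
qed

lemma wd_family_add_cmult:
  assumes 1: "wd_family k U D" and 2: "wd_family k U D'"
  shows "wd_family k U (\<lambda>\<alpha> x. D \<alpha> x + c * D' \<alpha> x)"
  unfolding wd_family_def
proof (intro conjI allI ballI impI)
  have [measurable]: "\<And>\<alpha>. D \<alpha> \<in> borel_measurable borel" "\<And>\<alpha>. D' \<alpha> \<in> borel_measurable borel"
    using 1 2 unfolding wd_family_def by blast+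
  show "(\<lambda>x. D \<alpha> x + c * D' \<alpha> x) \<in> borel_measurable borel" for \<alpha> by measurable
  show "\<exists>B. \<forall>x. norm x \<le> R \<longrightarrow> norm (D \<alpha> x + c * D' \<alpha> x) \<le> B" for \<alpha> R
  proof -
    obtain B B' where "\<And>x. norm x \<le> R \<Longrightarrow> norm (D \<alpha> x) \<le> B" "\<And>x. norm x \<le> R \<Longrightarrow> norm (D' \<alpha> x) \<le> B'"
      using 1 2 unfolding wd_family_def by metis
    then have "norm (D \<alpha> x + c * D' \<alpha> x) \<le> B + norm c * B'" if "norm x \<le> R" for x
      using that by (intro order_trans[OF norm_triangle_ineq] add_mono) (auto simp: norm_mult intro!: mult_left_mono)
    then show ?thesis by blast
  qed
  fix \<phi> and "is" :: "'a list" assume \<phi>: "\<phi> \<in> test_functions U" and l: "length is \<le> k"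
  note \<phi>' = partial_derivs_test_function[OF \<phi>, of "is"]
  have int: "(LINT x|lborel. (D \<alpha> x + c * D' \<alpha> x) * of_real (\<psi> x)) = (LINT x|lborel. D \<alpha> x * of_real (\<psi> x)) + c * (LINT x|lborel. D' \<alpha> x * of_real (\<psi> x))"
    if \<psi>: "\<psi> \<in> test_functions U" for \<psi> \<alpha>
    using wd_family_integrable[OF 1 \<psi>, of \<alpha>] wd_family_integrable[OF 2 \<psi>, of \<alpha>] by (simp add: distrib_right mult.assoc)
  show "(LINT x|lborel. (D (\<lambda>_. 0) x + c * D' (\<lambda>_. 0) x) * of_real (partial_derivs is \<phi> x)) =
        (-1) ^ length is * (LINT x|lborel. (D (count_list is) x + c * D' (count_list is) x) * of_real (\<phi> x))"
    unfolding int[OF \<phi>'] int[OF \<phi>] using 1 2 \<phi> l unfolding wd_family_def by (simp add: distrib_left mult.left_commute)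
qed

text \<open>An arbitrary initial multi-index \<beta> makes the induction work: the outermost
  derivative moves from the test function to the neuron and raises one entry of \<beta>.\<close>

lemma neuron_weak_derivatives:
  assumes \<omega>: "\<omega> \<in> sphere 0 1" and \<phi>: "\<phi> \<in> test_functions U"
  shows "mi_order \<beta> + length is \<le> k \<Longrightarrow>
    (LINT x|lborel. complex_of_real (neuron k \<omega> b \<beta> x) * of_real (partial_derivs is \<phi> x)) =
    (-1) ^ length is * (LINT x|lborel. complex_of_real (neuron k \<omega> b (\<lambda>i. \<beta> i + count_list is i) x) * of_real (\<phi> x))"
proof (induction "is" arbitrary: \<beta>)
  case Nil
  then show ?case by (simp add: partial_derivs_def)
next
  case (Cons i "is")
  let ?\<beta>' = "\<beta>(i := Suc (\<beta> i))"
  have "(\<Sum>j\<in>UNIV. ?\<beta>' j) = (\<Sum>j\<in>UNIV. \<beta> j + (if j = i then 1 else 0))" by (intro sum.cong) auto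
  then have ord: "mi_order ?\<beta>' = Suc (mi_order \<beta>)" by (simp add: mi_order_def sum.distrib)
  have "partial_derivs (i # is) \<phi> = partial_deriv i (partial_derivs is \<phi>)" by (simp add: partial_derivs_def)
  then have "(LINT x|lborel. complex_of_real (neuron k \<omega> b \<beta> x) * of_real (partial_derivs (i # is) \<phi> x)) =
     - (LINT x|lborel. complex_of_real (neuron k \<omega> b ?\<beta>' x) * of_real (partial_derivs is \<phi> x))"
    using neuron_integration_by_parts[OF partial_derivs_test_function[OF \<phi>] \<omega>, of \<beta> k b i "is"] Cons.prems by simp
  also have "\<dots> = - ((-1) ^ length is * (LINT x|lborel. complex_of_real (neuron k \<omega> b (\<lambda>j. ?\<beta>' j + count_list is j) x) * of_real (\<phi> x)))"
  proof -
    have prem: "mi_order ?\<beta>' + length is \<le> k" using ord Cons.prems by simp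
    show ?thesis by (simp only: Cons.IH[OF prem])
  qed
  also have "(\<lambda>j. ?\<beta>' j + count_list is j) = (\<lambda>j. \<beta> j + count_list (i # is) j)" by (auto simp: fun_eq_iff)
  finally show ?case by simp
qed

lemma wd_family_neuron:
  assumes \<omega>: "\<omega> \<in> sphere 0 1"
  shows "wd_family k U (\<lambda>\<alpha> x. complex_of_real (neuron k \<omega> b \<alpha> x))"
  unfolding wd_family_def
proof (intro conjI allI ballI impI)
  show "\<exists>B. \<forall>x. norm x \<le> R \<longrightarrow> norm (complex_of_real (neuron k \<omega> b \<alpha> x)) \<le> B" for \<alpha> R
  proof (intro exI[of _ "fact k * (1 + R + \<bar>b\<bar>) ^ k"] allI impI)
    fix x :: "real^'a" assume "norm x \<le> R"
    then have "fact k * (1 + norm x + \<bar>b\<bar>) ^ k \<le> fact k * (1 + R + \<bar>b\<bar>) ^ k"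
      by (intro mult_left_mono power_mono) auto
    with neuron_abs_le[OF \<omega> order_refl, of k b \<alpha> x]
    show "norm (complex_of_real (neuron k \<omega> b \<alpha> x)) \<le> fact k * (1 + R + \<bar>b\<bar>) ^ k" unfolding norm_of_real by linarith
  qed
  fix \<phi> and "is" :: "'a list" assume "\<phi> \<in> test_functions U" "length is \<le> k"
  then show "(LINT x|lborel. complex_of_real (neuron k \<omega> b (\<lambda>_. 0) x) * of_real (partial_derivs is \<phi> x)) =
        (-1) ^ length is * (LINT x|lborel. complex_of_real (neuron k \<omega> b (count_list is) x) * of_real (\<phi> x))"
    using neuron_weak_derivatives[OF \<omega>, of \<phi> U "\<lambda>_. 0" "is" k b] by (simp add: mi_order_def)
qed simp

lemma wd_family_nets: "v \<in> nets k N \<Longrightarrow> wd_family k U v"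
proof (induction rule: nets_induct)
  case (zero N)
  show ?case by (auto simp: wd_family_def)
next
  case (add u N \<omega> a b)
  show ?case by (rule wd_family_add_cmult[OF add(3) wd_family_neuron[OF add(2)]])
qed

section \<open>Weak derivatives of superpositions\<close>

lemma neuron_theta_measurable:
  fixes \<omega> :: "'j::countable \<Rightarrow> real^'n::finite"
  shows "(\<lambda>q. complex_of_real (neuron k (\<omega> (fst (fst q))) (snd (fst q)) \<alpha> (snd q)))
     \<in> borel_measurable ((count_space UNIV \<Otimes>\<^sub>M borel) \<Otimes>\<^sub>M borel)"
proof (rule measurable_compose_countable[where f="\<lambda>j q. complex_of_real (neuron k (\<omega> j) (snd (fst q)) \<alpha> (snd q))" and g="\<lambda>q. fst (fst q)"])
  have "(\<lambda>q. (snd (fst q), snd q)) \<in> ((count_space UNIV :: 'j measure) \<Otimes>\<^sub>M borel) \<Otimes>\<^sub>M (borel::(real^'n) measure) \<rightarrow>\<^sub>M borel \<Otimes>\<^sub>M borel"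
    by measurable
  from measurable_compose[OF this neuron_joint_measurable]
  show "(\<lambda>q. complex_of_real (neuron k (\<omega> j) (snd (fst q)) \<alpha> (snd q))) \<in> borel_measurable ((count_space UNIV \<Otimes>\<^sub>M borel) \<Otimes>\<^sub>M borel)" for j
    by simp
  show "(\<lambda>q. fst (fst q)) \<in> ((count_space UNIV :: 'j measure) \<Otimes>\<^sub>M borel) \<Otimes>\<^sub>M (borel::(real^'n) measure) \<rightarrow>\<^sub>M count_space UNIV"
    by measurable
qed

text \<open>Fubini exchanges the superposition with the integral against a test function, after
  which the identity for single neurons applies for each index and bias. Summability of
  \<open>A\<close> and the bounded range of biases give the majorant.\<close>

lemma wd_family_superposition:
  fixes \<omega> :: "'j::countable \<Rightarrow> real^'n::finite"
  assumes \<omega>: "\<And>j. \<omega> j \<in> sphere 0 1" and \<rho> [measurable]: "\<And>j. \<rho> j \<in> borel_measurable borel" and A: "\<And>j b. norm (\<rho> j b) \<le> A j"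
    and \<rho>L: "\<And>j b. \<bar>b\<bar> > L \<Longrightarrow> \<rho> j b = 0" and A_int: "integrable (count_space UNIV) A" and L: "L > 0"
  shows "wd_family k U (\<lambda>\<alpha> x. LINT j|count_space UNIV. LINT b|lborel. \<rho> j b * of_real (neuron k (\<omega> j) b \<alpha> x))"
proof -
  define \<Theta> where "\<Theta> = (count_space UNIV :: 'j measure) \<Otimes>\<^sub>M (lborel :: real measure)"
  interpret TH: pair_sigma_finite "count_space UNIV :: 'j measure" "lborel :: real measure"
    by (intro pair_sigma_finite.intro sigma_finite_measure_count_space_countable lborel.sigma_finite_measure_axioms) auto
  have sfT: "sigma_finite_measure \<Theta>" unfolding \<Theta>_def by (rule TH.P.sigma_finite_measure_axioms | unfold_locales)
  interpret TX: pair_sigma_finite \<Theta> "lborel :: (real^'n) measure"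
    by (intro pair_sigma_finite.intro sfT lborel.sigma_finite_measure_axioms)
  have A0: "A j \<ge> 0" for j using A[of j 0] norm_ge_zero order_trans by blast
  define r where "r \<theta> = \<rho> (fst \<theta>) (snd \<theta>)" for \<theta>
  \<comment> \<open>Setting the neuron to 0 for biases beyond \<open>L\<close> changes nothing in
    the products, as the density vanishes there, and yields a bound uniform in the bias.\<close>
  define n where "n \<alpha> \<theta> x = (if \<bar>snd \<theta>\<bar> > L then 0 else complex_of_real (neuron k (\<omega> (fst \<theta>)) (snd \<theta>) \<alpha> x))" for \<alpha> \<theta> x
  have sT: "sets \<Theta> = sets (count_space UNIV \<Otimes>\<^sub>M borel)"
    unfolding \<Theta>_def by (intro sets_pair_measure_cong) auto
  have sTX: "sets (\<Theta> \<Otimes>\<^sub>M (lborel :: (real^'n) measure)) = sets ((count_space UNIV \<Otimes>\<^sub>M borel) \<Otimes>\<^sub>M borel)"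
    by (intro sets_pair_measure_cong sT) auto
  have r_meas: "r \<in> borel_measurable \<Theta>"
    unfolding measurable_cong_sets[OF sT refl] r_def
    by (rule measurable_pair_measure_countable1) auto
  have n_meas: "(\<lambda>q. n \<alpha> (fst q) (snd q)) \<in> borel_measurable (\<Theta> \<Otimes>\<^sub>M lborel)" for \<alpha>
  proof -
    have [measurable]: "(\<lambda>q. complex_of_real (neuron k (\<omega> (fst (fst q))) (snd (fst q)) \<alpha> (snd q)))
      \<in> borel_measurable ((count_space UNIV \<Otimes>\<^sub>M borel) \<Otimes>\<^sub>M borel)" by (rule neuron_theta_measurable)
    show ?thesis unfolding measurable_cong_sets[OF sTX refl] n_def by measurable
  qed
  have n_le: "norm (n \<alpha> \<theta> x) \<le> fact k * (1 + norm x + L) ^ k" for \<alpha> \<theta> x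
    using neuron_abs_le[OF \<omega>[of "fst \<theta>"], of "snd \<theta>" L k \<alpha> x] L by (auto simp: n_def)
  have r_int: "integrable \<Theta> r"
  proof -
    have le: "norm (\<rho> j b) \<le> A j * indicator {-L..L} b" for j b
      using A[of j b] \<rho>L[of b j] by (cases "\<bar>b\<bar> > L") (auto simp: indicator_def)
    have ji: "integrable lborel (\<lambda>b. A j * indicator {-L..L} b)" for j
      by (intro integrable_mult_right integrable_real_indicator) (auto simp: emeasure_lborel_Icc_eq)
    have "integrable ((count_space UNIV :: 'j measure) \<Otimes>\<^sub>M (lborel :: real measure)) r"
    proof (rule TH.Fubini_integrable)
      show "r \<in> borel_measurable ((count_space UNIV :: 'j measure) \<Otimes>\<^sub>M (lborel :: real measure))"
        using r_meas by (simp add: \<Theta>_def)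
      show "AE j in count_space UNIV. integrable lborel (\<lambda>b. r (j, b))"
      proof (rule AE_I2)
        fix j show "integrable lborel (\<lambda>b. r (j, b))"
          by (rule Bochner_Integration.integrable_bound[OF ji[of j]])
            (use le A0 in \<open>auto simp: r_def abs_mult intro!: order_trans[OF le]\<close>)
      qed
      show "integrable (count_space UNIV) (\<lambda>j. LINT b|lborel. norm (r (j, b)))"
      proof (rule Bochner_Integration.integrable_bound[OF integrable_mult_left[OF A_int, of "2 * L"]])
        show "AE j in count_space UNIV. norm (LINT b|lborel. norm (r (j, b))) \<le> norm (A j * (2 * L))"
        proof (rule AE_I2)
          fix j
          have "(LINT b|lborel. norm (r (j, b))) \<le> (LINT b|lborel. A j * indicator {-L..L} b)"
            by (rule integral_mono'[OF ji]) (use le A0 in \<open>auto simp: r_def\<close>)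
          also have "\<dots> = A j * (2 * L)" using L by simp
          finally show "norm (LINT b|lborel. norm (r (j, b))) \<le> norm (A j * (2 * L))"
            using A0[of j] L by simp
        qed
      qed simp
    qed
    then show ?thesis by (simp add: \<Theta>_def)
  qed
  have nx_meas: "(\<lambda>\<theta>. n \<alpha> \<theta> x) \<in> borel_measurable \<Theta>" for \<alpha> x
    using measurable_compose[OF _ n_meas[of \<alpha>], of "\<lambda>\<theta>. (\<theta>, x)" \<Theta>] by simp
  have rn_int: "integrable \<Theta> (\<lambda>\<theta>. r \<theta> * n \<alpha> \<theta> x)" for \<alpha> x
  proof (rule Bochner_Integration.integrable_bound[OF integrable_mult_left[OF integrable_norm[OF r_int], of "fact k * (1 + norm x + L) ^ k"]])
    show "AE \<theta> in \<Theta>. norm (r \<theta> * n \<alpha> \<theta> x) \<le> norm (norm (r \<theta>) * (fact k * (1 + norm x + L) ^ k))"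
      using n_le[of \<alpha> _ x] L by (intro AE_I2) (simp add: norm_mult mult_left_mono)
    show "(\<lambda>\<theta>. r \<theta> * n \<alpha> \<theta> x) \<in> borel_measurable \<Theta>" by (intro borel_measurable_times r_meas nx_meas)
  qed
  have D: "(LINT j|count_space UNIV. LINT b|lborel. \<rho> j b * of_real (neuron k (\<omega> j) b \<alpha> x)) = (LINT \<theta>|\<Theta>. r \<theta> * n \<alpha> \<theta> x)" for \<alpha> x
  proof -
    have "\<rho> j b * of_real (neuron k (\<omega> j) b \<alpha> x) = r (j, b) * n \<alpha> (j, b) x" for j b
      using \<rho>L[of b j] by (simp add: r_def n_def)
    then show ?thesis using TH.integral_fst'[of "\<lambda>\<theta>. r \<theta> * n \<alpha> \<theta> x"] rn_int[of \<alpha> x] by (simp add: \<Theta>_def)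
  qed
  define D where "D \<alpha> x = (LINT \<theta>|\<Theta>. r \<theta> * n \<alpha> \<theta> x)" for \<alpha> x
  have D_meas: "D \<alpha> \<in> borel_measurable borel" for \<alpha>
  proof -
    have "(\<lambda>q. r (fst q) * n \<alpha> (fst q) (snd q)) \<in> borel_measurable (\<Theta> \<Otimes>\<^sub>M lborel)"
      by (intro borel_measurable_times n_meas measurable_compose[OF measurable_fst r_meas])
    from measurable_compose[OF measurable_pair_swap' this]
    have "(\<lambda>(x, \<theta>). r \<theta> * n \<alpha> \<theta> x) \<in> borel_measurable (lborel \<Otimes>\<^sub>M \<Theta>)" by (simp add: case_prod_beta')
    from sigma_finite_measure.borel_measurable_lebesgue_integral[OF sfT this] show ?thesis by (simp add: D_def[abs_def])
  qed
  have pair: "(LINT x|lborel. D \<alpha> x * of_real (\<psi> x)) = (LINT \<theta>|\<Theta>. r \<theta> * (LINT x|lborel. n \<alpha> \<theta> x * of_real (\<psi> x)))"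
    if \<psi>: "\<psi> \<in> test_functions U" for \<psi> \<alpha>
  proof -
    obtain M R where M: "M \<ge> 0" "R \<ge> 0" "\<And>x. \<bar>\<psi> x\<bar> \<le> M" "\<And>x. norm x > R \<Longrightarrow> \<psi> x = 0"
      using test_function_bounded[OF \<psi>] by blast
    let ?C = "fact k * (1 + R + L) ^ k * M"
    let ?f = "\<lambda>q. r (fst q) * n \<alpha> (fst q) (snd q) * of_real (\<psi> (snd q))"
    have f_le: "norm (?f (\<theta>, x)) \<le> norm (r \<theta>) * (?C * indicator (cball 0 R) x)" for \<theta> x
    proof (cases "norm x \<le> R")
      case True
      have "norm (n \<alpha> \<theta> x) \<le> fact k * (1 + norm x + L) ^ k" by (rule n_le)
      also have "\<dots> \<le> fact k * (1 + R + L) ^ k" using True L by (intro mult_left_mono power_mono) auto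
      finally have "norm (n \<alpha> \<theta> x) * \<bar>\<psi> x\<bar> \<le> ?C" using M L by (intro mult_mono) auto
      then have "norm (r \<theta>) * (norm (n \<alpha> \<theta> x) * \<bar>\<psi> x\<bar>) \<le> norm (r \<theta>) * ?C" by (rule mult_left_mono) simp
      then show ?thesis using True by (simp add: norm_mult mult.assoc)
    next
      case False
      then show ?thesis using M(4)[of x] by simp
    qed
    have f_meas: "?f \<in> borel_measurable (\<Theta> \<Otimes>\<^sub>M lborel)"
    proof -
      have "\<psi> \<in> borel_measurable borel" by (rule test_function_measurable[OF \<psi>])
      then have "(\<lambda>q. complex_of_real (\<psi> (snd q))) \<in> borel_measurable (\<Theta> \<Otimes>\<^sub>M lborel)" by measurable
      then show ?thesis by (intro borel_measurable_times n_meas measurable_compose[OF measurable_fst r_meas])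
    qed
    have ci: "integrable lborel (\<lambda>x::real^'n. ?C * indicator (cball 0 R) x)"
      by (intro integrable_mult_right integrable_real_indicator emeasure_bounded_finite bounded_cball) auto
    have f_int: "integrable (\<Theta> \<Otimes>\<^sub>M lborel) ?f"
    proof (rule TX.Fubini_integrable[OF f_meas])
      have fx_meas: "(\<lambda>x. ?f (\<theta>, x)) \<in> borel_measurable lborel" if "\<theta> \<in> space \<Theta>" for \<theta>
        using measurable_compose[OF measurable_Pair1'[OF that] f_meas] by simp
      have fx: "integrable lborel (\<lambda>x. ?f (\<theta>, x))" if "\<theta> \<in> space \<Theta>" for \<theta>
        by (rule Bochner_Integration.integrable_bound[OF integrable_mult_right[OF ci, of "norm (r \<theta>)"] fx_meas[OF that]])
          (intro AE_I2 order_trans[OF f_le], simp)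
      then show "AE \<theta> in \<Theta>. integrable lborel (\<lambda>x. ?f (\<theta>, x))" by (rule AE_I2)
      show "integrable \<Theta> (\<lambda>\<theta>. LINT x|lborel. norm (?f (\<theta>, x)))"
      proof (rule Bochner_Integration.integrable_bound[OF integrable_mult_left[OF integrable_norm[OF r_int], of "LINT x|lborel. ?C * indicator (cball (0::real^'n) R) x"]])
        show "(\<lambda>\<theta>. LINT x|lborel. norm (?f (\<theta>, x))) \<in> borel_measurable \<Theta>"
          using f_meas by (intro lborel.borel_measurable_lebesgue_integral) (simp add: case_prod_beta')
        show "AE \<theta> in \<Theta>. norm (LINT x|lborel. norm (?f (\<theta>, x))) \<le> norm (norm (r \<theta>) * (LINT x|lborel. ?C * indicator (cball (0::real^'n) R) x))"
        proof (rule AE_I2)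
          fix \<theta> assume "\<theta> \<in> space \<Theta>"
          have "(LINT x|lborel. norm (?f (\<theta>, x))) \<le> (LINT x|lborel. norm (r \<theta>) * (?C * indicator (cball (0::real^'n) R) x))"
            by (rule integral_mono[OF integrable_norm[OF fx[OF \<open>\<theta> \<in> space \<Theta>\<close>]] integrable_mult_right[OF ci] f_le])
          also have "\<dots> = norm (r \<theta>) * (LINT x|lborel. ?C * indicator (cball (0::real^'n) R) x)" by (rule integral_mult_right_zero)
          finally show "norm (LINT x|lborel. norm (?f (\<theta>, x))) \<le> norm (norm (r \<theta>) * (LINT x|lborel. ?C * indicator (cball (0::real^'n) R) x))"
            unfolding real_norm_def by (subst abs_of_nonneg) (auto intro: order_trans[OF _ abs_ge_self])
        qed
      qed
    qed
    have "(LINT x|lborel. D \<alpha> x * of_real (\<psi> x)) = (LINT x|lborel. LINT \<theta>|\<Theta>. ?f (\<theta>, x))"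
      unfolding D_def by simp
    also have "\<dots> = (LINT \<theta>|\<Theta>. LINT x|lborel. ?f (\<theta>, x))"
      using TX.Fubini_integral[of "\<lambda>\<theta> x. ?f (\<theta>, x)"] f_int by (simp add: case_prod_beta')
    also have "\<dots> = (LINT \<theta>|\<Theta>. r \<theta> * (LINT x|lborel. n \<alpha> \<theta> x * of_real (\<psi> x)))"
      by (simp add: mult.assoc)
    finally show ?thesis .
  qed
  show ?thesis unfolding D D_def[symmetric] wd_family_def
  proof (intro conjI allI ballI impI D_meas)
    show "\<exists>B. \<forall>x. norm x \<le> R \<longrightarrow> norm (D \<alpha> x) \<le> B" for \<alpha> R
    proof (intro exI allI impI)
      fix x :: "real^'n" assume x: "norm x \<le> R"
      have "norm (D \<alpha> x) \<le> (LINT \<theta>|\<Theta>. norm (r \<theta> * n \<alpha> \<theta> x))" unfolding D_def by (rule integral_norm_bound)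
      also have "\<dots> \<le> (LINT \<theta>|\<Theta>. norm (r \<theta>) * (fact k * (1 + R + L) ^ k))"
      proof (rule integral_mono[OF integrable_norm[OF rn_int] integrable_mult_left[OF integrable_norm[OF r_int]]])
        fix \<theta>
        have "norm (n \<alpha> \<theta> x) \<le> fact k * (1 + norm x + L) ^ k" by (rule n_le)
        also have "\<dots> \<le> fact k * (1 + R + L) ^ k" using x L by (intro mult_left_mono power_mono) auto
        finally show "norm (r \<theta> * n \<alpha> \<theta> x) \<le> norm (r \<theta>) * (fact k * (1 + R + L) ^ k)"
          by (simp add: norm_mult mult_left_mono)
      qed
      finally show "norm (D \<alpha> x) \<le> (LINT \<theta>|\<Theta>. norm (r \<theta>) * (fact k * (1 + R + L) ^ k))" .
    qed
    fix \<phi> and "is" :: "'n list" assume \<phi>: "\<phi> \<in> test_functions U" and l: "length is \<le> k"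
    have "(LINT x|lborel. n (\<lambda>_. 0) \<theta> x * of_real (partial_derivs is \<phi> x)) = (-1) ^ length is * (LINT x|lborel. n (count_list is) \<theta> x * of_real (\<phi> x))" for \<theta>
      using neuron_weak_derivatives[OF \<omega>[of "fst \<theta>"] \<phi>, of "\<lambda>_. 0" "is" k "snd \<theta>"] l
      by (cases "L < \<bar>snd \<theta>\<bar>") (simp_all add: n_def mi_order_def)
    then have "r \<theta> * (LINT x|lborel. n (\<lambda>_. 0) \<theta> x * of_real (partial_derivs is \<phi> x)) = (-1) ^ length is * (r \<theta> * (LINT x|lborel. n (count_list is) \<theta> x * of_real (\<phi> x)))" for \<theta>
      by (simp only: mult.left_commute)
    then show "(LINT x|lborel. D (\<lambda>_. 0) x * of_real (partial_derivs is \<phi> x)) = (-1) ^ length is * (LINT x|lborel. D (count_list is) x * of_real (\<phi> x))"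
      unfolding pair[OF \<phi>] pair[OF partial_derivs_test_function[OF \<phi>]] by (simp only: integral_mult_right_zero)
  qed
qed

section \<open>Passage to the Sobolev norm\<close>

lemma integral_lebesgue_on_test:
  fixes g :: "real^'n \<Rightarrow> complex"
  assumes \<phi>: "\<phi> \<in> test_functions U" and g: "g \<in> borel_measurable borel" and U: "U \<in> sets lebesgue"
  shows "(LINT x|lebesgue_on U. g x * of_real (\<phi> x)) = (LINT x|lborel. g x * of_real (\<phi> x))"
proof -
  have out: "\<phi> x = 0" if "x \<notin> U" for x using \<phi> that unfolding test_functions_def by blast
  have [measurable]: "g \<in> borel_measurable borel" "\<phi> \<in> borel_measurable borel" using g test_function_measurable[OF \<phi>] by auto
  have "(LINT x|lebesgue_on U. g x * of_real (\<phi> x)) = (LINT x|lebesgue. indicator U x *\<^sub>R (g x * of_real (\<phi> x)))"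
    using U by (subst integral_restrict_space) auto
  also have "\<dots> = (LINT x|lebesgue. g x * of_real (\<phi> x))"
    by (intro Bochner_Integration.integral_cong) (auto simp: indicator_def out)
  also have "\<dots> = (LINT x|lborel. g x * of_real (\<phi> x))"
    by (intro integral_completion) measurable
  finally show ?thesis .
qed

text \<open>The family \<open>D\<close> is one of those over which the Sobolev norm takes its
  infimum. Since \<open>u\<close> is known only up to null sets of the cube, its measurability and
  local integrability have to be inherited from \<open>D\<close>.\<close>

lemma wd_family_sobolev_norm_le:
  assumes m: "0 \<le> m" "m < real k + 1/2"
    and D: "wd_family k (interior (cbox 0 1)) D"
    and u: "AE x in lebesgue_on (cbox 0 1). u x = D (\<lambda>_. 0) x"
  shows "sobolev_norm m (cbox 0 1) (u :: real^'n::finite \<Rightarrow> complex) \<le> ennreal_sqrt (energy m D)"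
proof -
  let ?\<Omega> = "cbox 0 1 :: (real^'n) set" and ?U = "interior (cbox 0 1 :: (real^'n) set)"
  let ?j = "nat \<lfloor>m\<rfloor>"
  have jk: "?j \<le> k" by (rule sobolev_order_facts[OF m])
  have Dm: "D \<alpha> \<in> borel_measurable borel" and Db: "\<exists>B. \<forall>x. norm x \<le> R \<longrightarrow> norm (D \<alpha> x) \<le> B" for \<alpha> R
    using D unfolding wd_family_def by blast+
  have U: "?U \<in> sets lebesgue" by simp
  have sub: "AE x in lebesgue_on S. u x = D (\<lambda>_. 0) x" if "S \<subseteq> ?\<Omega>" "S \<in> sets lebesgue" for S
  proof -
    have "AE x in lebesgue. x \<in> ?\<Omega> \<longrightarrow> u x = D (\<lambda>_. 0) x"
      using u by (subst (asm) AE_restrict_space_iff) auto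
    then have "AE x in lebesgue. x \<in> S \<longrightarrow> u x = D (\<lambda>_. 0) x"
      by (rule eventually_mono) (use that(1) in blast)
    then show ?thesis using that(2) by (subst AE_restrict_space_iff) auto
  qed
  have int_K: "integrable (lebesgue_on K) (D \<alpha>)" if K: "compact K" for K \<alpha>
  proof -
    obtain R where R: "\<And>x. x \<in> K \<Longrightarrow> norm x \<le> R" using compact_imp_bounded[OF K] by (auto simp: bounded_iff)
    obtain B where B: "\<And>x. norm x \<le> R \<Longrightarrow> norm (D \<alpha> x) \<le> B" using Db by blast
    have "K \<in> lmeasurable" by (rule lmeasurable_compact[OF K])
    then interpret finite_measure "lebesgue_on K"
      by (intro finite_measure_lebesgue_on)
    have "D \<alpha> \<in> borel_measurable lebesgue" using Dm[of \<alpha>] by (intro measurable_completion) simp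
    then have "D \<alpha> \<in> borel_measurable (lebesgue_on K)" by (rule measurable_restrict_space1)
    then show ?thesis by (rule integrable_const_bound[where B=B, rotated]) (use R B in \<open>auto intro!: AE_I2\<close>)
  qed
  have loc_D: "locally_integrable ?U (D \<alpha>)" for \<alpha>
    unfolding locally_integrable_def using int_K by blast
  have u_meas: "u \<in> borel_measurable (lebesgue_on S)" if S: "S \<subseteq> ?\<Omega>" "S \<in> sets lebesgue" for S
  proof -
    \<comment> \<open>Outside the cube \<open>u\<close> is arbitrary, so it is replaced there by
      \<open>D\<close>; the result agrees with \<open>D\<close> almost everywhere on the whole
      space, and completeness of the measure makes it measurable.\<close>
    define v where "v x = (if x \<in> ?\<Omega> then u x else D (\<lambda>_. 0) x)" for x
    have "AE x in lebesgue. x \<in> ?\<Omega> \<longrightarrow> u x = D (\<lambda>_. 0) x"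
      using u by (subst (asm) AE_restrict_space_iff) auto
    then have "AE x in lebesgue. D (\<lambda>_. 0) x = v x"
      by (rule eventually_mono) (auto simp: v_def)
    moreover have "D (\<lambda>_. 0) \<in> borel_measurable lebesgue" using Dm by (intro measurable_completion) simp
    ultimately have "v \<in> borel_measurable lebesgue" by (rule borel_measurable_AE[rotated])
    then have "v \<in> borel_measurable (lebesgue_on S)" by (rule measurable_restrict_space1)
    moreover have "v x = u x" if "x \<in> space (lebesgue_on S)" for x
      using that S(1) by (auto simp: v_def)
    ultimately show ?thesis by (subst measurable_cong[where g=v]) auto
  qed
  have loc_u: "locally_integrable ?U u"
    unfolding locally_integrable_def
  proof (intro allI impI)
    fix K assume K: "compact K \<and> K \<subseteq> ?U"
    have KO: "K \<subseteq> ?\<Omega>" using K interior_subset by blast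
    have Kl: "K \<in> sets lebesgue" using lmeasurable_compact K by blast
    show "integrable (lebesgue_on K) u"
      by (rule integrable_cong_AE_imp[OF int_K u_meas[OF KO Kl]]) (use K sub[OF KO Kl] in auto)
  qed
  have "D \<in> weak_derivative_families ?j ?\<Omega> u"
    unfolding weak_derivative_families_def weak_derivative_def
  proof (intro CollectI allI impI conjI ballI loc_u loc_D)
    fix \<alpha> \<phi> and "is" :: "'n list"
    assume \<alpha>: "mi_order \<alpha> \<le> ?j" and \<phi>: "\<phi> \<in> test_functions ?U" and c: "\<forall>i. count_list is i = \<alpha> i"
    have \<alpha>_eq: "\<alpha> = count_list is" by (rule ext) (rule c[rule_format, symmetric])
    have ord: "mi_order \<alpha> = length is" unfolding mi_order_def \<alpha>_eq by (rule sum_count_set) auto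
    have "(LINT x|lebesgue_on ?U. u x * of_real (partial_derivs is \<phi> x)) = (LINT x|lebesgue_on ?U. D (\<lambda>_. 0) x * of_real (partial_derivs is \<phi> x))"
    proof -
      have AE: "AE x in lebesgue_on ?U. u x = D (\<lambda>_. 0) x" by (rule sub[OF interior_subset U])
      have dm: "D (\<lambda>_. 0) \<in> borel_measurable (lebesgue_on ?U)"
        using Dm by (intro measurable_restrict_space1 measurable_completion) simp
      have um: "u \<in> borel_measurable (lebesgue_on ?U)" by (rule u_meas[OF interior_subset U])
      have pm: "partial_derivs is \<phi> \<in> borel_measurable (lebesgue_on ?U)"
        using test_function_measurable[OF partial_derivs_test_function[OF \<phi>]] by (intro measurable_restrict_space1 measurable_completion) simp
      show ?thesis
        by (rule integral_cong_AE) (use AE um dm pm in auto)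
    qed
    also have "\<dots> = (LINT x|lborel. D (\<lambda>_. 0) x * of_real (partial_derivs is \<phi> x))"
      by (rule integral_lebesgue_on_test[OF partial_derivs_test_function[OF \<phi>] Dm U])
    also have "\<dots> = (-1) ^ length is * (LINT x|lborel. D (count_list is) x * of_real (\<phi> x))"
      using D \<phi> \<alpha> ord jk unfolding wd_family_def by simp
    also have "(LINT x|lborel. D (count_list is) x * of_real (\<phi> x)) = (LINT x|lebesgue_on ?U. D \<alpha> x * of_real (\<phi> x))"
      unfolding \<alpha>_eq by (rule integral_lebesgue_on_test[OF \<phi> Dm U, symmetric])
    finally show "(LINT x|lebesgue_on ?U. u x * of_real (partial_derivs is \<phi> x)) = (-1) ^ mi_order \<alpha> * (LINT x|lebesgue_on ?U. D \<alpha> x * of_real (\<phi> x))"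
      by (simp only: ord)
  qed
  then show ?thesis
    unfolding sobolev_norm_def Let_def energy_def by (rule INF_lower)
qed

section \<open>Fourier inversion\<close>

text \<open>The Lebesgue measure is the image of a product measure over the basis, which reduces
  integrals of product functions to one dimension.\<close>

lemma integral_lborel_prod_Basis:
  fixes f :: "'a::euclidean_space \<Rightarrow> real \<Rightarrow> complex"
  assumes f: "\<And>b. b \<in> Basis \<Longrightarrow> integrable lborel (f b)"
  shows "integrable lborel (\<lambda>x::'a. \<Prod>b\<in>Basis. f b (x \<bullet> b))" (is ?A)
    and "(LINT x|(lborel :: ('a) measure). (\<Prod>b\<in>Basis. f b (x \<bullet> b))) = (\<Prod>b\<in>Basis. (LINT t|lborel. f b t))" (is ?B)
proof -
  interpret product_sigma_finite "\<lambda>_::'a. lborel :: real measure" ..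
  let ?T = "\<lambda>g::'a \<Rightarrow> real. \<Sum>b\<in>Basis. g b *\<^sub>R b"
  let ?P = "\<Pi>\<^sub>M b\<in>(Basis::'a set). (lborel::real measure)"
  have T: "?T \<in> ?P \<rightarrow>\<^sub>M borel" by measurable
  have [measurable]: "(\<lambda>x::'a. \<Prod>b\<in>Basis. f b (x \<bullet> b)) \<in> borel_measurable borel"
  proof (rule borel_measurable_prod)
    fix b :: 'a assume "b \<in> Basis"
    then have [measurable]: "f b \<in> borel_measurable borel" using borel_measurable_integrable[OF f] by simp
    show "(\<lambda>x. f b (x \<bullet> b)) \<in> borel_measurable borel" by measurable
  qed
  have e: "(\<Prod>b\<in>Basis. f b (?T g \<bullet> b)) = (\<Prod>b\<in>Basis. f b (g b))" for g :: "'a \<Rightarrow> real"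
    by (intro prod.cong) (auto simp: inner_sum_left inner_Basis if_distrib cong: if_cong)
  have "integrable ?P (\<lambda>g. \<Prod>b\<in>Basis. f b (g b))" by (intro product_integrable_prod f) auto
  then show ?A
    by (subst lborel_eq, subst integrable_distr_eq[OF T]) (auto simp: e)
  show ?B
    by (subst lborel_eq, subst integral_distr[OF T])
      (auto simp: e intro!: product_integral_prod f)
qed

lemma integral_lborel_prod_cart:
  fixes f :: "'n::finite \<Rightarrow> real \<Rightarrow> complex"
  assumes f: "\<And>i. integrable lborel (f i)"
  shows "integrable lborel (\<lambda>x::real^'n. \<Prod>i\<in>UNIV. f i (x $ i))" (is ?A)
    and "(LINT x|(lborel :: (real^'n) measure). (\<Prod>i\<in>UNIV. f i (x $ i))) = (\<Prod>i\<in>UNIV. (LINT t|lborel. f i t))" (is ?B)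
proof -
  have re: "(\<Prod>b\<in>(Basis::(real^'n) set). h b) = (\<Prod>i\<in>UNIV. h (axis i 1))" for h :: "real^'n \<Rightarrow> complex"
  proof -
    have B: "(Basis::(real^'n) set) = range (\<lambda>i. axis i 1)" by (auto simp: Basis_vec_def)
    have inj: "inj (\<lambda>i::'n. axis i (1::real))" by (auto simp: inj_def axis_eq_axis)
    show ?thesis unfolding B prod.reindex[OF inj] by (simp add: o_def)
  qed
  have ai: "axis_index (axis i (1::real)) = i" for i :: 'n
    by (simp add: axis_index_axis)
  note L = integral_lborel_prod_Basis[where 'a="real^'n" and f="\<lambda>b. f (axis_index b)", OF f]
  show ?A using L(1) by (simp add: re ai inner_axis)
  show ?B using L(2) by (simp add: re ai inner_axis)
qed

section \<open>The Gaussian and its Fourier transform\<close>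

definition gauss :: "real^'n::finite \<Rightarrow> real" where
  "gauss z = (\<Prod>i\<in>UNIV. std_normal_density (z $ i))"

lemma gauss_pos: "gauss z > 0"
  unfolding gauss_def by (intro prod_pos) (auto simp: normal_density_def)

lemma gauss_continuous: "continuous_on UNIV (gauss :: real^'n::finite \<Rightarrow> real)"
  unfolding gauss_def normal_density_def by (intro continuous_intros) auto

lemma gauss_measurable [measurable]: "gauss \<in> borel_measurable borel"
  by (rule borel_measurable_continuous_onI[OF gauss_continuous])

lemma gauss_le_0: "gauss (z::real^'n::finite) \<le> gauss (0::real^'n::finite)"
  unfolding gauss_def by (intro linordered_semidom_class.prod_mono) (auto simp: normal_density_def intro!: divide_right_mono)

text \<open>This identity cancels the factor (2 pi)^d that arises from rescaling the frequency in
  the inversion formula.\<close>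

lemma gauss_0_sq: "gauss (0::real^'n::finite) ^ 2 * (2 * pi) ^ CARD('n) = 1"
proof -
  have "std_normal_density 0 ^ 2 * (2 * pi) = 1" by (simp add: normal_density_def power_divide)
  then have "(std_normal_density 0 ^ 2 * (2 * pi)) ^ CARD('n) = 1" by simp
  then show ?thesis by (simp add: gauss_def power_mult_distrib power_mult[symmetric] mult.commute)
qed

text \<open>Everything factorises over the coordinates. In one dimension the transform is the
  characteristic function exp(-t^2/2) of the standard normal distribution, which is the density
  divided by its value at 0.\<close>

lemma gauss_integrable: "integrable lborel (gauss :: real^'n::finite \<Rightarrow> real)"
  and gauss_integral: "(LINT z|(lborel :: (real^'n) measure). gauss z) = 1"
  and gauss_fourier: "(LINT z|(lborel :: (real^'n) measure). of_real (gauss z) * exp (\<i> * of_real (z \<bullet> \<tau>))) = of_real (gauss \<tau> / gauss (0::real^'n))"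
proof -
  have i1: "integrable lborel (\<lambda>t. of_real (std_normal_density t) :: complex)" by simp
  note L1 = integral_lborel_prod_cart[where f="\<lambda>i::'n. \<lambda>t. of_real (std_normal_density t) :: complex", OF i1]
  show g: "integrable lborel (gauss :: real^'n \<Rightarrow> real)"
    using L1(1) by (simp add: gauss_def[abs_def] of_real_prod[symmetric] complex_of_real_integrable_eq del: of_real_prod)
  have "complex_of_real (LINT z|(lborel :: (real^'n) measure). gauss z) = 1"
    using L1(2) by (simp add: gauss_def[abs_def] of_real_prod[symmetric] integral_complex_of_real del: of_real_prod)
  then show "(LINT z|(lborel :: (real^'n) measure). gauss z) = 1" by simp
  let ?f = "\<lambda>i::'n. \<lambda>t. of_real (std_normal_density t) * exp (\<i> * of_real (t * \<tau> $ i)) :: complex"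
  have i2: "integrable lborel (?f i)" for i
    by (rule Bochner_Integration.integrable_bound[OF i1]) (auto simp: norm_mult)
  have v: "(LINT t|lborel. ?f i t) = of_real (std_normal_density (\<tau> $ i) / std_normal_density 0)" for i
  proof -
    have "(LINT t|lborel. ?f i t) = char std_normal_distribution (\<tau> $ i)"
      unfolding char_def by (subst integral_density) (auto simp: scaleR_conv_of_real mult_ac)
    also have "\<dots> = of_real (exp (- (\<tau> $ i)\<^sup>2 / 2))" by (simp add: char_std_normal_distribution)
    finally show ?thesis by (simp add: normal_density_def)
  qed
  have p: "of_real (gauss z) * exp (\<i> * of_real (z \<bullet> \<tau>)) = (\<Prod>i\<in>UNIV. ?f i (z $ i))" for z :: "real^'n"
    by (simp add: gauss_def prod.distrib inner_vec_def sum_distrib_left exp_sum)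
  show "(LINT z|(lborel :: (real^'n) measure). of_real (gauss z) * exp (\<i> * of_real (z \<bullet> \<tau>))) = of_real (gauss \<tau> / gauss (0::real^'n))"
    unfolding p integral_lborel_prod_cart(2)[OF i2] v by (simp add: gauss_def prod_dividef)
qed

lemma integral_lborel_affine:
  fixes f :: "real^'n::finite \<Rightarrow> complex"
  assumes f [measurable]: "f \<in> borel_measurable borel" and c: "c \<noteq> 0"
  shows "(LINT x|lborel. f x) = of_real (\<bar>c\<bar> ^ CARD('n)) * (LINT x|lborel. f (t + c *\<^sub>R x))"
proof -
  have T: "(\<lambda>x::real^'n. t + c *\<^sub>R x) \<in> lborel \<rightarrow>\<^sub>M borel" by measurable
  have "(LINT x|lborel. f x) = (LINT x|density (distr lborel borel (\<lambda>x. t + c *\<^sub>R x)) (\<lambda>_. ennreal (\<bar>c\<bar> ^ CARD('n))). f x)"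
    by (subst lborel_affine[OF c, of t]) (simp add: ennreal_power)
  also have "\<dots> = (LINT x|distr lborel borel (\<lambda>x. t + c *\<^sub>R x). (\<bar>c\<bar> ^ CARD('n)) *\<^sub>R f x)"
    by (rule integral_density) auto
  also have "\<dots> = of_real (\<bar>c\<bar> ^ CARD('n)) * (LINT x|lborel. f (t + c *\<^sub>R x))"
    by (subst integral_distr[OF T]) (auto simp: scaleR_conv_of_real)
  finally show ?thesis .
qed

lemma integrable_lborel_affine:
  fixes f :: "real^'n::finite \<Rightarrow> 'b::{banach, second_countable_topology}"
  assumes f: "integrable lborel f" and c: "c \<noteq> 0"
  shows "integrable lborel (\<lambda>x. f (t + c *\<^sub>R x))"
proof -
  have [measurable]: "f \<in> borel_measurable borel" using borel_measurable_integrable[OF f] by simp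
  have T: "(\<lambda>x::real^'n. t + c *\<^sub>R x) \<in> lborel \<rightarrow>\<^sub>M borel" by measurable
  have "integrable (density (distr lborel borel (\<lambda>x. t + c *\<^sub>R x)) (\<lambda>_. ennreal (\<bar>c\<bar> ^ CARD('n)))) f"
    using f by (subst (asm) lborel_affine[OF c, of t]) (simp add: ennreal_power)
  then have "integrable (distr lborel borel (\<lambda>x. t + c *\<^sub>R x)) (\<lambda>x. (\<bar>c\<bar> ^ CARD('n)) *\<^sub>R f x)"
    by (subst (asm) integrable_density) auto
  then have "integrable lborel (\<lambda>x. (\<bar>c\<bar> ^ CARD('n)) *\<^sub>R f (t + c *\<^sub>R x))"
    by (subst (asm) integrable_distr_eq[OF T]) auto
  then have "integrable lborel (\<lambda>x. (1 / \<bar>c\<bar> ^ CARD('n)) *\<^sub>R ((\<bar>c\<bar> ^ CARD('n)) *\<^sub>R f (t + c *\<^sub>R x)))"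
    by (rule integrable_scaleR_right)
  moreover have "(1 / \<bar>c\<bar> ^ CARD('n)) *\<^sub>R ((\<bar>c\<bar> ^ CARD('n)) *\<^sub>R f (t + c *\<^sub>R x)) = f (t + c *\<^sub>R x)" for x
    using c by simp
  ultimately show ?thesis by (simp only:)
qed

text \<open>The multiplier \<open>gauss ((2 * pi * \<epsilon>) *\<^sub>R \<xi>) / gauss 0\<close>
  tends to 1 as \<epsilon> tends to 0, and its Fourier integral is the Gaussian probability density
  of width \<epsilon>. The substitution z = 2 pi \<epsilon> \<xi> reduces this to the unscaled
  formula.\<close>

lemma gauss_dilated_fourier:
  assumes \<epsilon>: "\<epsilon> > 0"
  shows "integrable lborel (\<lambda>\<xi>::real^'n::finite. gauss ((2 * pi * \<epsilon>) *\<^sub>R \<xi>) / gauss (0::real^'n))" (is ?A)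
    and "(LINT \<xi>|(lborel :: (real^'n) measure). of_real (gauss ((2 * pi * \<epsilon>) *\<^sub>R \<xi>) / gauss (0::real^'n)) * exp (2 * of_real pi * \<i> * of_real (\<xi> \<bullet> v)))
      = of_real (gauss ((1 / \<epsilon>) *\<^sub>R v) / \<epsilon> ^ CARD('n))" (is ?B)
proof -
  let ?c = "2 * pi * \<epsilon>"
  have c: "?c > 0" using \<epsilon> by simp
  have "?c \<noteq> 0" using \<epsilon> by simp
  from integrable_lborel_affine[OF gauss_integrable this, of 0]
  show ?A by (intro Bochner_Integration.integrable_divide) simp
  let ?g0 = "gauss (0::real^'n)"
  let ?h = "\<lambda>z::real^'n. of_real (gauss z) * exp (\<i> * of_real (z \<bullet> ((1 / \<epsilon>) *\<^sub>R v)))"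
  have "(LINT z|lborel. ?h z) = of_real (\<bar>?c\<bar> ^ CARD('n)) * (LINT \<xi>|lborel. ?h (0 + ?c *\<^sub>R \<xi>))"
    using c by (intro integral_lborel_affine) auto
  also have "(LINT \<xi>|lborel. ?h (0 + ?c *\<^sub>R \<xi>)) = (LINT \<xi>|(lborel :: (real^'n) measure). of_real ?g0 * (of_real (gauss (?c *\<^sub>R \<xi>) / ?g0) * exp (2 * of_real pi * \<i> * of_real (\<xi> \<bullet> v))))"
    using \<epsilon> gauss_pos[of "0::real^'n"] by (intro Bochner_Integration.integral_cong) (auto simp: mult_ac)
  also have "\<dots> = of_real ?g0 * (LINT \<xi>|(lborel :: (real^'n) measure). of_real (gauss (?c *\<^sub>R \<xi>) / ?g0) * exp (2 * of_real pi * \<i> * of_real (\<xi> \<bullet> v)))"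
    by (rule integral_mult_right_zero)
  finally have "of_real (gauss ((1 / \<epsilon>) *\<^sub>R v) / ?g0) = of_real (\<bar>?c\<bar> ^ CARD('n)) * (of_real ?g0 * (LINT \<xi>|(lborel :: (real^'n) measure). of_real (gauss (?c *\<^sub>R \<xi>) / ?g0) * exp (2 * of_real pi * \<i> * of_real (\<xi> \<bullet> v))))"
    unfolding gauss_fourier .
  moreover have "of_real (gauss ((1 / \<epsilon>) *\<^sub>R v) / ?g0) = of_real (\<bar>?c\<bar> ^ CARD('n)) * (of_real ?g0 * (of_real (gauss ((1 / \<epsilon>) *\<^sub>R v) / \<epsilon> ^ CARD('n)) :: complex))"
  proof -
    have e: "(2 * pi) ^ CARD('n) = 1 / ?g0 ^ 2" using gauss_0_sq[where 'n='n] gauss_pos[of "0::real^'n"] by (simp add: field_simps)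
    have "gauss ((1 / \<epsilon>) *\<^sub>R v) / ?g0 = \<bar>?c\<bar> ^ CARD('n) * (?g0 * (gauss ((1 / \<epsilon>) *\<^sub>R v) / \<epsilon> ^ CARD('n)))"
    proof -
      have "\<bar>?c\<bar> ^ CARD('n) = (2 * pi) ^ CARD('n) * \<epsilon> ^ CARD('n)" using \<epsilon> by (simp add: power_mult_distrib abs_mult)
      then show ?thesis unfolding e using \<epsilon> gauss_pos[of "0::real^'n"] by (simp add: power2_eq_square)
    qed
    then show ?thesis by (simp only: of_real_mult[symmetric])
  qed
  moreover have "of_real (\<bar>?c\<bar> ^ CARD('n)) * of_real ?g0 \<noteq> (0::complex)" using c gauss_pos[of "0::real^'n"] by auto
  ultimately show ?B by (metis (no_types, lifting) mult.assoc mult_left_cancel)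
qed

text \<open>The kernel of the inverse transform; the forward transform uses it at
  \<open>- y\<close>.\<close>

definition fourier_kernel :: "real^'n::finite \<Rightarrow> real^'n \<Rightarrow> complex" where
  "fourier_kernel \<xi> x = exp (2 * of_real pi * \<i> * of_real (\<xi> \<bullet> x))"

lemma norm_fourier_kernel [simp]: "norm (fourier_kernel \<xi> x) = 1"
  by (simp add: fourier_kernel_def)

lemma fourier_kernel_measurable [measurable]:
  "f \<in> borel_measurable M \<Longrightarrow> g \<in> borel_measurable M \<Longrightarrow> (\<lambda>x. fourier_kernel (f x) (g x)) \<in> borel_measurable M"
  unfolding fourier_kernel_def by measurable

lemma fourier_kernel_diff: "fourier_kernel \<xi> (x - y) = fourier_kernel \<xi> x * fourier_kernel \<xi> (- y)"
  by (simp add: fourier_kernel_def exp_add[symmetric] inner_diff_right algebra_simps)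

text \<open>Product measurability and Fubini are at hand for Borel functions, whereas an extension
  is only Lebesgue measurable. Changing it on a null set leaves the transform untouched, which is
  thereby seen to be Borel measurable.\<close>

lemma fourier_borel_version:
  assumes f: "integrable lebesgue (fe :: real^'n::finite \<Rightarrow> complex)"
  obtains g where "integrable lborel g" "AE x in lebesgue. fe x = g x"
    "\<And>\<xi>. fourier fe \<xi> = (LINT y|lborel. g y * fourier_kernel \<xi> (- y))"
    "fourier fe \<in> borel_measurable borel"
proof -
  have fm: "fe \<in> borel_measurable (completion lborel)" using f by (rule borel_measurable_integrable)
  obtain a where a: "a \<in> borel_measurable lborel" "AE x in lborel. Re (fe x) = a x"
    using completion_ex_borel_measurable_real[of "\<lambda>x. Re (fe x)" lborel] fm by auto
  obtain b where b: "b \<in> borel_measurable lborel" "AE x in lborel. Im (fe x) = b x"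
    using completion_ex_borel_measurable_real[of "\<lambda>x. Im (fe x)" lborel] fm by auto
  define g where "g x = Complex (a x) (b x)" for x
  have [measurable]: "g \<in> borel_measurable borel"
    using a(1) b(1) unfolding g_def by (intro borel_measurable_complex_iff[THEN iffD2]) simp
  have "AE x in lborel. fe x = g x"
    using a(2) b(2) by eventually_elim (auto simp: g_def complex_eq_iff)
  then have AE: "AE x in lebesgue. fe x = g x" by (rule AE_completion)
  have gl: "g \<in> borel_measurable lebesgue" by (rule measurable_completion) simp
  have "integrable lebesgue g" by (rule integrable_cong_AE_imp[OF f gl]) (use AE in \<open>auto elim: eventually_mono\<close>)
  then have gi: "integrable lborel g" by (subst (asm) integrable_completion) auto
  have k: "fourier fe \<xi> = (LINT y|lborel. g y * fourier_kernel \<xi> (- y))" for \<xi>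
  proof -
    have e: "exp (- (2 * of_real pi * \<i> * of_real (\<xi> \<bullet> x))) = fourier_kernel \<xi> (- x)" for x
      by (simp add: fourier_kernel_def)
    have kl: "(\<lambda>x. fourier_kernel \<xi> (- x)) \<in> borel_measurable lebesgue" by (rule measurable_completion) measurable
    have "fourier fe \<xi> = (LINT y|lebesgue. g y * fourier_kernel \<xi> (- y))"
      unfolding fourier_def e
      by (rule integral_cong_AE) (use AE fm gl kl in \<open>auto elim: eventually_mono\<close>)
    also have "\<dots> = (LINT y|lborel. g y * fourier_kernel \<xi> (- y))"
      by (rule integral_completion) measurable
    finally show ?thesis .
  qed
  have "fourier fe \<in> borel_measurable borel"
    unfolding k[abs_def] by measurable
  with gi AE k show ?thesis by (rule that)
qed

text \<open>The product of the two integrable functions is a majorant on the product space, as the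
  kernel has modulus at most 1.\<close>

lemma lborel_Fubini_mult:
  fixes f :: "'a::euclidean_space \<Rightarrow> complex" and h :: "'b::euclidean_space \<Rightarrow> complex" and K :: "'a \<Rightarrow> 'b \<Rightarrow> complex"
  assumes f: "integrable lborel f" and h: "integrable lborel h"
    and K: "(\<lambda>z. K (fst z) (snd z)) \<in> borel_measurable (lborel \<Otimes>\<^sub>M lborel)" and K1: "\<And>x y. norm (K x y) \<le> 1"
  shows "(LINT x|lborel. LINT y|lborel. f x * h y * K x y) = (LINT y|lborel. LINT x|lborel. f x * h y * K x y)"
proof -
  have [measurable]: "f \<in> borel_measurable borel" "h \<in> borel_measurable borel"
    using borel_measurable_integrable[OF f] borel_measurable_integrable[OF h] by auto
  have Km: "(\<lambda>y. K x y) \<in> borel_measurable lborel" for x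
    using measurable_compose[OF measurable_Pair1'[of x lborel lborel] K] by simp
  have m: "(\<lambda>z. f (fst z) * h (snd z) * K (fst z) (snd z)) \<in> borel_measurable (lborel \<Otimes>\<^sub>M lborel)"
    by (intro borel_measurable_times K) measurable
  have b: "norm (f x * h y * K x y) \<le> norm (f x) * norm (h y)" for x y
    using mult_left_mono[OF K1[of x y], of "norm (f x) * norm (h y)"] by (simp add: norm_mult)
  have i: "integrable lborel (\<lambda>y. f x * h y * K x y)" for x
    by (rule Bochner_Integration.integrable_bound[where f="\<lambda>y. norm (f x) * norm (h y)"])
      (use h Km b in \<open>auto simp: integrable_norm\<close>)
  have "integrable (lborel \<Otimes>\<^sub>M lborel) (\<lambda>z. f (fst z) * h (snd z) * K (fst z) (snd z))"
  proof (rule lborel_pair.Fubini_integrable)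
    show "integrable lborel (\<lambda>x. LINT y|lborel. norm (f (fst (x, y)) * h (snd (x, y)) * K (fst (x, y)) (snd (x, y))))"
    proof (rule Bochner_Integration.integrable_bound[where f="\<lambda>x. norm (f x) * (LINT y|lborel. norm (h y))"])
      show "(\<lambda>x. LINT y|lborel. norm (f (fst (x, y)) * h (snd (x, y)) * K (fst (x, y)) (snd (x, y)))) \<in> borel_measurable lborel"
        using m by (intro lborel.borel_measurable_lebesgue_integral) (auto simp: case_prod_beta)
      show "AE x in lborel. norm (LINT y|lborel. norm (f (fst (x, y)) * h (snd (x, y)) * K (fst (x, y)) (snd (x, y))))
          \<le> norm (norm (f x) * (LINT y|lborel. norm (h y)))"
      proof (rule AE_I2)
        fix x
        have "(LINT y|lborel. norm (f x * h y * K x y)) \<le> (LINT y|lborel. norm (f x) * norm (h y))"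
          by (intro integral_mono integrable_norm i b) (use h in \<open>auto simp: integrable_norm\<close>)
        then show "norm (LINT y|lborel. norm (f (fst (x, y)) * h (snd (x, y)) * K (fst (x, y)) (snd (x, y))))
          \<le> norm (norm (f x) * (LINT y|lborel. norm (h y)))"
          by simp
      qed
    qed (use f in \<open>auto simp: integrable_norm\<close>)
  qed (use m i in auto)
  then have "integrable (lborel \<Otimes>\<^sub>M lborel) (\<lambda>(x, y). f x * h y * K x y)"
    by (simp add: case_prod_beta')
  from lborel_pair.Fubini_integral[OF this] show ?thesis by (rule sym)
qed

text \<open>Boxes are stable under intersection and generate the Borel sets, so vanishing of the
  integrals extends from boxes to all Borel sets. Restricting to the bounded boxes
  \<open>Q n\<close> supplies the integrability that \<open>h\<close> may lack globally.\<close>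

lemma AE_zero_if_box_integrals_zero:
  fixes h :: "'a::euclidean_space \<Rightarrow> complex"
  assumes i: "\<And>a b. integrable lborel (\<lambda>x. indicator (box a b) x *\<^sub>R h x)"
    and z: "\<And>a b. (LINT x|lborel. indicator (box a b) x *\<^sub>R h x) = 0"
  shows "AE x in lborel. h x = 0"
proof -
  define Q where "Q n = box (- real n *\<^sub>R One) (real n *\<^sub>R One :: 'a)" for n :: nat
  have Qi: "integrable lborel (\<lambda>x. indicator (Q n) x *\<^sub>R h x)" for n unfolding Q_def by (rule i)
  have "AE x in lborel. indicator (Q n) x *\<^sub>R h x = 0" for n
  proof (rule sigma_finite_measure.density_zero[OF lborel.sigma_finite_measure_axioms Qi])
    fix A :: "'a set" assume "A \<in> sets lborel"
    moreover have "sets (lborel :: 'a measure) = sigma_sets UNIV (range (\<lambda>(a, b). box a b))"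
      by (simp add: borel_eq_box)
    ultimately have A: "A \<in> sigma_sets UNIV (range (\<lambda>(a, b). box a b :: 'a set))" by simp
    have Int: "Int_stable (range (\<lambda>(a, b). box a b :: 'a set))"
    proof (rule Int_stableI)
      fix S T :: "'a set" assume "S \<in> range (\<lambda>(a, b). box a b)" "T \<in> range (\<lambda>(a, b). box a b)"
      then obtain a b c d where "S = box a b" "T = box c d" by auto
      then show "S \<inter> T \<in> range (\<lambda>(a, b). box a b)" by (auto simp: box_Int_box)
    qed
    have subset_Pow: "range (\<lambda>(a, b). box a b :: 'a set) \<subseteq> Pow UNIV" by simp
    show "set_lebesgue_integral lborel A (\<lambda>x. indicator (Q n) x *\<^sub>R h x) = 0"
      using Int subset_Pow A
    proof (induction rule: sigma_sets_induct_disjoint)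
      case (basic A)
      then obtain a b where A: "A = box a b" by auto
      obtain c d where cd: "A \<inter> Q n = box c d" unfolding A Q_def box_Int_box by blast
      have "set_lebesgue_integral lborel A (\<lambda>x. indicator (Q n) x *\<^sub>R h x) = (LINT x|lborel. indicator (box c d) x *\<^sub>R h x)"
        unfolding set_lebesgue_integral_def cd[symmetric]
        by (intro Bochner_Integration.integral_cong) (auto simp: indicator_def)
      then show ?case by (simp add: z)
    next
      case empty
      show ?case by (simp add: set_lebesgue_integral_def)
    next
      case (compl A)
      have m: "A \<in> sets lborel" using compl(1) by (simp add: borel_eq_box)
      have "set_lebesgue_integral lborel (UNIV - A) (\<lambda>x. indicator (Q n) x *\<^sub>R h x) =
          (LINT x|lborel. indicator (Q n) x *\<^sub>R h x - indicator A x *\<^sub>R (indicator (Q n) x *\<^sub>R h x))"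
        unfolding set_lebesgue_integral_def by (intro Bochner_Integration.integral_cong) (auto simp: indicator_def)
      also have "\<dots> = (LINT x|lborel. indicator (Q n) x *\<^sub>R h x) - (LINT x|lborel. indicator A x *\<^sub>R (indicator (Q n) x *\<^sub>R h x))"
        by (intro Bochner_Integration.integral_diff Qi integrable_mult_indicator m)
      also have "\<dots> = 0" using compl(2) z by (simp add: set_lebesgue_integral_def Q_def)
      finally show ?case .
    next
      case (union A)
      have m: "A i \<in> sets lborel" for i using union(2) by (auto simp: borel_eq_box)
      have "set_lebesgue_integral lborel (\<Union>i. A i) (\<lambda>x. indicator (Q n) x *\<^sub>R h x) = (\<Sum>i. set_lebesgue_integral lborel (A i) (\<lambda>x. indicator (Q n) x *\<^sub>R h x))"
      proof (rule lebesgue_integral_countable_add)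
        show "set_integrable lborel (\<Union>i. A i) (\<lambda>x. indicator (Q n) x *\<^sub>R h x)"
          unfolding set_integrable_def using m by (intro integrable_mult_indicator Qi sets.countable_UN) auto
        show "\<And>i j. i \<noteq> j \<Longrightarrow> A i \<inter> A j = {}" using union(1) by (auto simp: disjoint_family_on_def)
      qed (rule m)
      then show ?case using union(3) by simp
    qed
  qed
  then have "AE x in lborel. \<forall>n. indicator (Q n) x *\<^sub>R h x = 0" by (subst AE_all_countable) blast
  then show ?thesis
  proof (eventually_elim)
    case (elim x)
    obtain n :: nat where n: "norm x < real n" using reals_Archimedean2 by blast
    have "x \<in> Q n" unfolding Q_def mem_box
    proof
      fix i :: 'a assume i: "i \<in> Basis"
      have "\<bar>x \<bullet> i\<bar> < real n" using Basis_le_norm[OF i, of x] n by simp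
      then show "- real n *\<^sub>R One \<bullet> i < x \<bullet> i \<and> x \<bullet> i < real n *\<^sub>R One \<bullet> i" using i by (simp add: abs_less_iff)
    qed
    then show ?case using elim[rule_format, of n] by simp
  qed
qed

text \<open>Without the Gaussian factor the double integral over y and \<xi> need not converge
  absolutely; with it Fubini applies, and the inversion integral becomes the convolution of
  \<open>g\<close> with a Gaussian density of width \<epsilon>.\<close>

lemma gauss_mollified:
  fixes g :: "real^'n::finite \<Rightarrow> complex"
  assumes g: "integrable lborel g" and \<epsilon>: "\<epsilon> > 0"
  shows "(LINT \<xi>|lborel. (LINT y|lborel. g y * fourier_kernel \<xi> (- y)) * of_real (gauss ((2 * pi * \<epsilon>) *\<^sub>R \<xi>) / gauss (0::real^'n)) * fourier_kernel \<xi> x)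
    = (LINT y|lborel. g y * of_real (gauss ((1 / \<epsilon>) *\<^sub>R (x - y)) / \<epsilon> ^ CARD('n)))"
proof -
  let ?\<theta> = "\<lambda>\<xi>::real^'n. complex_of_real (gauss ((2 * pi * \<epsilon>) *\<^sub>R \<xi>) / gauss (0::real^'n))"
  have \<theta>: "integrable lborel ?\<theta>"
    using gauss_dilated_fourier(1)[OF \<epsilon>, where 'n='n] unfolding complex_of_real_integrable_eq .
  have "(LINT \<xi>|lborel. (LINT y|lborel. g y * fourier_kernel \<xi> (- y)) * ?\<theta> \<xi> * fourier_kernel \<xi> x)
      = (LINT \<xi>|lborel. LINT y|lborel. ?\<theta> \<xi> * g y * fourier_kernel \<xi> (x - y))"
  proof (rule Bochner_Integration.integral_cong[OF refl])
    fix \<xi> :: "real^'n"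
    have "(LINT y|lborel. g y * fourier_kernel \<xi> (- y)) * ?\<theta> \<xi> * fourier_kernel \<xi> x
        = (?\<theta> \<xi> * fourier_kernel \<xi> x) * (LINT y|lborel. g y * fourier_kernel \<xi> (- y))" by (simp add: mult_ac)
    also have "\<dots> = (LINT y|lborel. (?\<theta> \<xi> * fourier_kernel \<xi> x) * (g y * fourier_kernel \<xi> (- y)))"
      by (rule integral_mult_right_zero[symmetric])
    also have "\<dots> = (LINT y|lborel. ?\<theta> \<xi> * g y * fourier_kernel \<xi> (x - y))"
      by (intro Bochner_Integration.integral_cong) (auto simp: fourier_kernel_diff mult_ac)
    finally show "(LINT y|lborel. g y * fourier_kernel \<xi> (- y)) * ?\<theta> \<xi> * fourier_kernel \<xi> x = (LINT y|lborel. ?\<theta> \<xi> * g y * fourier_kernel \<xi> (x - y))" .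
  qed
  also have "\<dots> = (LINT y|lborel. LINT \<xi>|lborel. ?\<theta> \<xi> * g y * fourier_kernel \<xi> (x - y))"
    by (rule lborel_Fubini_mult[OF \<theta> g]) auto
  also have "\<dots> = (LINT y|lborel. g y * of_real (gauss ((1 / \<epsilon>) *\<^sub>R (x - y)) / \<epsilon> ^ CARD('n)))"
  proof (rule Bochner_Integration.integral_cong[OF refl])
    fix y
    have "(LINT \<xi>|lborel. ?\<theta> \<xi> * g y * fourier_kernel \<xi> (x - y)) = (LINT \<xi>|lborel. g y * (?\<theta> \<xi> * fourier_kernel \<xi> (x - y)))"
      by (intro Bochner_Integration.integral_cong) (auto simp: mult_ac)
    also have "\<dots> = g y * (LINT \<xi>|lborel. ?\<theta> \<xi> * fourier_kernel \<xi> (x - y))" by (rule integral_mult_right_zero)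
    also have "\<dots> = g y * of_real (gauss ((1 / \<epsilon>) *\<^sub>R (x - y)) / \<epsilon> ^ CARD('n))"
      unfolding fourier_kernel_def gauss_dilated_fourier(2)[OF \<epsilon>] ..
    finally show "(LINT \<xi>|lborel. ?\<theta> \<xi> * g y * fourier_kernel \<xi> (x - y)) = g y * of_real (gauss ((1 / \<epsilon>) *\<^sub>R (x - y)) / \<epsilon> ^ CARD('n))" .
  qed
  finally show ?thesis .
qed

text \<open>Integration over a box moves the convolution from \<open>g\<close> to the indicator of
  the box. The limit of small \<epsilon> then concerns the mollified indicator, which converges
  pointwise off the boundary, instead of a mollified integrable function.\<close>

lemma box_gauss_mollified:
  fixes g :: "real^'n::finite \<Rightarrow> complex"
  assumes g: "integrable lborel g" and \<epsilon>: "\<epsilon> > 0"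
  shows "(LINT x|lborel. indicator (box a b) x * (LINT y|lborel. g y * of_real (gauss ((1 / \<epsilon>) *\<^sub>R (x - y)) / \<epsilon> ^ CARD('n))))
    = (LINT y|lborel. g y * of_real (LINT z|lborel. indicator (box a b) (y + \<epsilon> *\<^sub>R z) * gauss z))"
proof -
  let ?M = "gauss (0::real^'n) / \<epsilon> ^ CARD('n)"
  have M: "?M > 0" using \<epsilon> gauss_pos[of "0::real^'n"] by simp
  let ?\<phi> = "\<lambda>v::real^'n. complex_of_real (gauss ((1 / \<epsilon>) *\<^sub>R v) / \<epsilon> ^ CARD('n))"
  \<comment> \<open>The Gaussian divided by its maximum, hence of modulus at most 1, as the Fubini
    lemma for bounded kernels requires.\<close>
  define K where "K x y = ?\<phi> (x - y) / of_real ?M" for x y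
  have K1: "norm (K x y) \<le> 1" for x y
    using \<epsilon> gauss_pos[of "0::real^'n"] gauss_pos[of "(1 / \<epsilon>) *\<^sub>R (x - y)"] gauss_le_0[of "(1 / \<epsilon>) *\<^sub>R (x - y)"]
    by (simp add: K_def norm_divide norm_mult)
  have K\<phi>: "of_real ?M * K x y = ?\<phi> (x - y)" for x y
    unfolding K_def using M by (simp only: nonzero_mult_div_cancel_left times_divide_eq_right of_real_eq_0_iff less_imp_neq[OF M, symmetric] not_False_eq_True)
  have ind: "integrable lborel (\<lambda>x. of_real ?M * indicator (box a b) x :: complex)"
  proof (rule integrable_mult_right)
    have "integrable lborel (\<lambda>x. indicator (box a b) x :: real)"
      by (intro integrable_real_indicator) (auto simp: emeasure_lborel_box_finite[unfolded infinity_ennreal_def])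
    then show "integrable lborel (\<lambda>x. indicator (box a b) x :: complex)"
      by (rule Bochner_Integration.integrable_bound) (auto simp: indicator_def)
  qed
  have "(LINT x|lborel. indicator (box a b) x * (LINT y|lborel. g y * ?\<phi> (x - y)))
      = (LINT x|lborel. LINT y|lborel. of_real ?M * indicator (box a b) x * g y * K x y)"
    by (intro Bochner_Integration.integral_cong refl, subst integral_mult_right_zero[symmetric])
      (intro Bochner_Integration.integral_cong refl, simp only: K\<phi>[symmetric] mult_ac)
  also have "\<dots> = (LINT y|lborel. LINT x|lborel. of_real ?M * indicator (box a b) x * g y * K x y)"
    by (rule lborel_Fubini_mult[OF ind g _ K1]) (simp add: K_def)
  also have "\<dots> = (LINT y|lborel. g y * of_real (LINT z|lborel. indicator (box a b) (y + \<epsilon> *\<^sub>R z) * gauss z))"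
  proof (rule Bochner_Integration.integral_cong[OF refl])
    fix y
    have "(LINT x|lborel. of_real ?M * indicator (box a b) x * g y * K x y) = (LINT x|lborel. g y * (indicator (box a b) x * ?\<phi> (x - y)))"
      by (intro Bochner_Integration.integral_cong refl) (simp only: K\<phi>[symmetric] mult_ac)
    also have "\<dots> = g y * (LINT x|lborel. indicator (box a b) x * ?\<phi> (x - y))" by (rule integral_mult_right_zero)
    also have "(LINT x|lborel. indicator (box a b) x * ?\<phi> (x - y)) = of_real (\<bar>\<epsilon>\<bar> ^ CARD('n)) * (LINT z|lborel. indicator (box a b) (y + \<epsilon> *\<^sub>R z) * ?\<phi> (y + \<epsilon> *\<^sub>R z - y))"
      using \<epsilon> by (intro integral_lborel_affine) auto
    also have "\<dots> = (LINT z|lborel. of_real (\<bar>\<epsilon>\<bar> ^ CARD('n)) * (indicator (box a b) (y + \<epsilon> *\<^sub>R z) * ?\<phi> (y + \<epsilon> *\<^sub>R z - y)))"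
      by (rule integral_mult_right_zero[symmetric])
    also have "\<dots> = (LINT z|lborel. complex_of_real (indicator (box a b) (y + \<epsilon> *\<^sub>R z) * gauss z))"
      using \<epsilon> by (intro Bochner_Integration.integral_cong refl) (auto simp: indicator_def)
    also have "\<dots> = of_real (LINT z|lborel. indicator (box a b) (y + \<epsilon> *\<^sub>R z) * gauss z)"
      by (rule integral_complex_of_real)
    finally show "(LINT x|lborel. of_real ?M * indicator (box a b) x * g y * K x y) = g y * of_real (LINT z|lborel. indicator (box a b) (y + \<epsilon> *\<^sub>R z) * gauss z)" .
  qed
  finally show ?thesis .
qed

lemma AE_lborel_not_box_frontier:
  "AE x in (lborel :: 'a::euclidean_space measure). x \<in> box a b \<or> x \<notin> cbox a b"
proof -
  have "negligible (cbox a b - box a b :: 'a set)" by (rule negligible_frontier_interval)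
  then have "cbox a b - box a b \<in> null_sets (lborel :: 'a measure)"
    by (simp add: negligible_iff_null_sets null_sets_completion_iff)
  then have "AE x in lborel. x \<notin> cbox a b - box a b" by (rule AE_not_in)
  then show ?thesis by eventually_elim auto
qed

text \<open>As the width tends to 0, the left side converges by domination with |h|, and the right
  side because the mollified indicator converges off the boundary of the box, a null set.\<close>

lemma fourier_inversion_box:
  fixes g :: "real^'n::finite \<Rightarrow> complex"
  assumes g: "integrable lborel g" and h: "integrable lborel h"
    and hg: "\<And>\<xi>. h \<xi> = (LINT y|lborel. g y * fourier_kernel \<xi> (- y))"
  shows "(LINT x|lborel. indicator (box a b) x * (LINT \<xi>|lborel. h \<xi> * fourier_kernel \<xi> x)) = (LINT x|lborel. indicator (box a b) x * g x)"
proof -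
  have [measurable]: "g \<in> borel_measurable borel" "h \<in> borel_measurable borel"
    using borel_measurable_integrable[OF g] borel_measurable_integrable[OF h] by auto
  define e where "e n = inverse (real (Suc n))" for n
  have e0: "e n > 0" for n by (simp add: e_def)
  have elim: "e \<longlonglongrightarrow> 0" unfolding e_def by (rule LIMSEQ_inverse_real_of_nat)
  let ?g0 = "gauss (0::real^'n)"
  define G where "G n x = (LINT \<xi>|lborel. h \<xi> * of_real (gauss ((2 * pi * e n) *\<^sub>R \<xi>) / ?g0) * fourier_kernel \<xi> x)" for n x
  have h_le: "norm (h \<xi> * of_real (gauss ((2 * pi * e n) *\<^sub>R \<xi>) / ?g0) * fourier_kernel \<xi> x) \<le> norm (h \<xi>)" for n \<xi> x
  proof -
    have "gauss ((2 * pi * e n) *\<^sub>R \<xi>) / ?g0 \<le> 1" "0 \<le> gauss ((2 * pi * e n) *\<^sub>R \<xi>) / ?g0"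
      using gauss_le_0[of "(2 * pi * e n) *\<^sub>R \<xi>"] gauss_pos[of "0::real^'n"] gauss_pos[of "(2 * pi * e n) *\<^sub>R \<xi>"] by simp_all
    then have "norm (h \<xi>) * \<bar>gauss ((2 * pi * e n) *\<^sub>R \<xi>) / ?g0\<bar> \<le> norm (h \<xi>) * 1" by (intro mult_left_mono) auto
    then show ?thesis by (simp only: norm_mult norm_fourier_kernel norm_of_real mult_1_right)
  qed
  have G_le: "norm (G n x) \<le> (LINT \<xi>|lborel. norm (h \<xi>))" for n x
  proof -
    have "norm (G n x) \<le> (LINT \<xi>|lborel. norm (h \<xi> * of_real (gauss ((2 * pi * e n) *\<^sub>R \<xi>) / ?g0) * fourier_kernel \<xi> x))"
      unfolding G_def by (rule integral_norm_bound)
    also have "\<dots> \<le> (LINT \<xi>|lborel. norm (h \<xi>))"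
      by (rule integral_mono_AE') (use h h_le in auto)
    finally show ?thesis .
  qed
  have G_lim: "(\<lambda>n. G n x) \<longlonglongrightarrow> (LINT \<xi>|lborel. h \<xi> * fourier_kernel \<xi> x)" for x
    unfolding G_def
  proof (rule integral_dominated_convergence[where w="\<lambda>\<xi>. norm (h \<xi>)"])
    show "AE \<xi> in lborel. (\<lambda>n. h \<xi> * of_real (gauss ((2 * pi * e n) *\<^sub>R \<xi>) / ?g0) * fourier_kernel \<xi> x) \<longlonglongrightarrow> h \<xi> * fourier_kernel \<xi> x"
    proof (rule AE_I2)
      fix \<xi> :: "real^'n"
      have "(\<lambda>n. (2 * pi * e n) *\<^sub>R \<xi>) \<longlonglongrightarrow> (2 * pi * 0) *\<^sub>R \<xi>" by (intro tendsto_intros elim)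
      then have "(\<lambda>n. gauss ((2 * pi * e n) *\<^sub>R \<xi>)) \<longlonglongrightarrow> ?g0"
        using continuous_on_tendsto_compose[OF gauss_continuous, of "\<lambda>n. (2 * pi * e n) *\<^sub>R \<xi>" "0" sequentially] by simp
      then have "(\<lambda>n. h \<xi> * of_real (gauss ((2 * pi * e n) *\<^sub>R \<xi>) / ?g0) * fourier_kernel \<xi> x) \<longlonglongrightarrow> h \<xi> * of_real (?g0 / ?g0) * fourier_kernel \<xi> x"
        using gauss_pos[of "0::real^'n"] by (intro tendsto_intros) auto
      then show "(\<lambda>n. h \<xi> * of_real (gauss ((2 * pi * e n) *\<^sub>R \<xi>) / ?g0) * fourier_kernel \<xi> x) \<longlonglongrightarrow> h \<xi> * fourier_kernel \<xi> x"
        using gauss_pos[of "0::real^'n"] by simp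
    qed
    show "AE \<xi> in lborel. norm (h \<xi> * of_real (gauss ((2 * pi * e n) *\<^sub>R \<xi>) / ?g0) * fourier_kernel \<xi> x) \<le> norm (h \<xi>)" for n
      by (intro AE_I2 h_le)
  qed (use h in auto)
  have Gm [measurable]: "G n \<in> borel_measurable borel" for n unfolding G_def by measurable
  have ind: "integrable lborel (\<lambda>x. indicator (box a b) x * (LINT \<xi>|lborel. norm (h \<xi>)) :: real)"
    by (intro integrable_mult_left integrable_real_indicator) (auto simp: emeasure_lborel_box_finite[unfolded infinity_ennreal_def])
  have lim1: "(\<lambda>n. LINT x|lborel. indicator (box a b) x * G n x) \<longlonglongrightarrow> (LINT x|lborel. indicator (box a b) x * (LINT \<xi>|lborel. h \<xi> * fourier_kernel \<xi> x))"
  proof (rule integral_dominated_convergence[OF _ _ ind])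
    show "AE x in lborel. (\<lambda>n. indicator (box a b) x * G n x) \<longlonglongrightarrow> indicator (box a b) x * (LINT \<xi>|lborel. h \<xi> * fourier_kernel \<xi> x)"
      by (intro AE_I2 tendsto_intros G_lim)
    show "AE x in lborel. norm (indicator (box a b) x * G n x) \<le> indicator (box a b) x * (LINT \<xi>|lborel. norm (h \<xi>))" for n
      using G_le by (intro AE_I2) (auto simp: indicator_def)
  qed measurable
  define P where "P n y = (LINT z|lborel. indicator (box a b) (y + e n *\<^sub>R z) * gauss (z::real^'n))" for n y
  have GP: "(LINT x|lborel. indicator (box a b) x * G n x) = (LINT y|lborel. g y * of_real (P n y))" for n
    unfolding G_def P_def hg gauss_mollified[OF g e0] by (rule box_gauss_mollified[OF g e0])
  have P01: "\<bar>P n y\<bar> \<le> 1" for n y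
  proof -
    have "\<bar>P n y\<bar> \<le> (LINT z|lborel. \<bar>indicator (box a b) (y + e n *\<^sub>R z) * gauss (z::real^'n)\<bar>)"
      unfolding P_def by (rule integral_abs_bound)
    also have "\<dots> \<le> (LINT z|lborel. gauss (z::real^'n))"
      by (rule integral_mono_AE'[OF gauss_integrable]) (auto simp: indicator_def gauss_pos less_imp_le)
    finally show ?thesis by (simp add: gauss_integral)
  qed
  have P_lim: "(\<lambda>n. P n y) \<longlonglongrightarrow> indicator (box a b) y" if y: "y \<in> box a b \<or> y \<notin> cbox a b" for y
  proof -
    have "(\<lambda>n. P n y) \<longlonglongrightarrow> (LINT z|lborel. indicator (box a b) y * gauss (z::real^'n))"
      unfolding P_def
    proof (rule integral_dominated_convergence[OF _ _ gauss_integrable])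
      show "AE z in lborel. (\<lambda>n. indicator (box a b) (y + e n *\<^sub>R z) * gauss z) \<longlonglongrightarrow> indicator (box a b) y * gauss z"
      proof (rule AE_I2)
        fix z :: "real^'n"
        have lim: "(\<lambda>n. y + e n *\<^sub>R z) \<longlonglongrightarrow> y + 0 *\<^sub>R z" by (intro tendsto_intros elim)
        have "\<forall>\<^sub>F n in sequentially. indicator (box a b) (y + e n *\<^sub>R z) = (indicator (box a b) y :: real)"
          using y
        proof
          assume y: "y \<in> box a b"
          have "\<forall>\<^sub>F n in sequentially. y + e n *\<^sub>R z \<in> box a b"
            by (rule topological_tendstoD[OF lim]) (use y in auto)
          then show ?thesis by eventually_elim (use y in auto)
        next
          assume y: "y \<notin> cbox a b"
          have "\<forall>\<^sub>F n in sequentially. y + e n *\<^sub>R z \<in> - cbox a b"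
            by (rule topological_tendstoD[OF lim]) (use y in \<open>auto simp: open_Compl\<close>)
          then show ?thesis by eventually_elim (use y box_subset_cbox[of a b] in \<open>auto simp: indicator_def\<close>)
        qed
        then have "\<forall>\<^sub>F n in sequentially. indicator (box a b) y * gauss z = indicator (box a b) (y + e n *\<^sub>R z) * gauss z"
          by eventually_elim simp
        then show "(\<lambda>n. indicator (box a b) (y + e n *\<^sub>R z) * gauss z) \<longlonglongrightarrow> indicator (box a b) y * gauss z"
          by (rule Lim_transform_eventually[OF tendsto_const])
      qed
      show "AE z in lborel. norm (indicator (box a b) (y + e n *\<^sub>R z) * gauss z) \<le> gauss z" for n
        by (intro AE_I2) (auto simp: indicator_def gauss_pos less_imp_le)
    qed measurable
    then show ?thesis by (simp add: gauss_integral)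
  qed
  have Pm [measurable]: "P n \<in> borel_measurable borel" for n unfolding P_def by measurable
  have "(\<lambda>n. LINT y|lborel. g y * of_real (P n y)) \<longlonglongrightarrow> (LINT y|lborel. indicator (box a b) y * g y)"
  proof (rule integral_dominated_convergence[where w="\<lambda>y. norm (g y)"])
    show "AE y in lborel. (\<lambda>n. g y * of_real (P n y)) \<longlonglongrightarrow> indicator (box a b) y * g y"
      using AE_lborel_not_box_frontier[of a b]
    proof eventually_elim
      case (elim y)
      have "(\<lambda>n. g y * of_real (P n y)) \<longlonglongrightarrow> g y * of_real (indicator (box a b) y)"
        by (intro tendsto_intros P_lim elim)
      then show ?case by (cases "y \<in> box a b") simp_all
    qed
    show "AE y in lborel. norm (g y * of_real (P n y)) \<le> norm (g y)" for n
      using P01 by (intro AE_I2) (auto simp: norm_mult mult_left_le)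
  qed (use g in auto)
  with lim1 show ?thesis unfolding GP by (rule LIMSEQ_unique)
qed

text \<open>A Borel version of \<open>fe\<close> and the inversion integral have equal integrals
  over all boxes; the latter is bounded, so the difference is integrable on boxes and vanishes
  almost everywhere.\<close>

lemma fourier_inversion_AE:
  fixes fe :: "real^'n::finite \<Rightarrow> complex"
  assumes f: "integrable lebesgue fe" and h: "integrable lborel (fourier fe)"
  shows "AE x in lebesgue. fe x = (LINT \<xi>|lborel. fourier fe \<xi> * fourier_kernel \<xi> x)"
proof -
  obtain g where g: "integrable lborel g" and AE: "AE x in lebesgue. fe x = g x"
    and hg: "\<And>\<xi>. fourier fe \<xi> = (LINT y|lborel. g y * fourier_kernel \<xi> (- y))"
    using fourier_borel_version[OF f] by metis
  have [measurable]: "g \<in> borel_measurable borel" "fourier fe \<in> borel_measurable borel"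
    using borel_measurable_integrable[OF g] borel_measurable_integrable[OF h] by auto
  define F where "F x = (LINT \<xi>|lborel. fourier fe \<xi> * fourier_kernel \<xi> x)" for x
  have [measurable]: "F \<in> borel_measurable borel" unfolding F_def by measurable
  have Fb: "norm (F x) \<le> (LINT \<xi>|lborel. norm (fourier fe \<xi>))" for x
    unfolding F_def by (rule order_trans[OF integral_norm_bound]) (simp add: norm_mult)
  have gi: "integrable lborel (\<lambda>x. indicator (box a b) x *\<^sub>R g x)" for a b
    by (intro integrable_mult_indicator g) simp
  have Fi: "integrable lborel (\<lambda>x. indicator (box a b) x *\<^sub>R F x)" for a b
    by (rule integrableI_bounded_set_indicator[where B="LINT \<xi>|lborel. norm (fourier fe \<xi>)"])
      (auto simp: emeasure_lborel_box_finite[unfolded infinity_ennreal_def] Fb)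
  have "AE x in lborel. g x - F x = 0"
  proof (rule AE_zero_if_box_integrals_zero)
    fix a b
    show "integrable lborel (\<lambda>x. indicator (box a b) x *\<^sub>R (g x - F x))"
      unfolding scaleR_diff_right by (intro Bochner_Integration.integrable_diff gi Fi)
    have "(LINT x|lborel. indicator (box a b) x *\<^sub>R (g x - F x)) = (LINT x|lborel. indicator (box a b) x *\<^sub>R g x) - (LINT x|lborel. indicator (box a b) x *\<^sub>R F x)"
      unfolding scaleR_diff_right by (intro Bochner_Integration.integral_diff gi Fi)
    also have "(LINT x|lborel. indicator (box a b) x *\<^sub>R g x) = (LINT x|lborel. indicator (box a b) x * g x)"
      by (intro Bochner_Integration.integral_cong) (auto simp: indicator_def)
    also have "\<dots> = (LINT x|lborel. indicator (box a b) x * F x)"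
      unfolding F_def by (rule fourier_inversion_box[OF g h hg, symmetric])
    also have "\<dots> = (LINT x|lborel. indicator (box a b) x *\<^sub>R F x)"
      by (intro Bochner_Integration.integral_cong) (auto simp: indicator_def)
    finally show "(LINT x|lborel. indicator (box a b) x *\<^sub>R (g x - F x)) = 0" by simp
  qed
  then have "AE x in lebesgue. g x - F x = 0" by (rule AE_completion)
  with AE show ?thesis unfolding F_def[symmetric] by eventually_elim simp
qed

section \<open>Expansion over a lattice of frequencies\<close>

lemma integrable_count_int_powr:
  assumes p: "p > 1"
  shows "integrable (count_space UNIV) (\<lambda>j::int. (1 + \<bar>real_of_int j\<bar>) powr (-p))"
proof -
  let ?g = "\<lambda>j::int. (1 + \<bar>real_of_int j\<bar>) powr (-p)"
  have "summable (\<lambda>n. real (Suc n) powr (-p))"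
    using p by (subst summable_Suc_iff) (simp add: summable_real_powr_iff)
  then have "summable (\<lambda>n. (1 + real n) powr (-p))" by (simp add: add.commute)
  then have nat: "Infinite_Set_Sum.abs_summable_on (\<lambda>n::nat. (1 + real n) powr (-p)) UNIV"
    by (simp add: abs_summable_on_nat_iff')
  have 1: "Infinite_Set_Sum.abs_summable_on ?g (range int)"
    by (subst Infinite_Set_Sum.abs_summable_on_reindex_iff[symmetric]) (use nat in auto)
  have 2: "Infinite_Set_Sum.abs_summable_on ?g (range (\<lambda>n. - int n))"
    by (subst Infinite_Set_Sum.abs_summable_on_reindex_iff[symmetric]) (use nat in \<open>auto simp: inj_def\<close>)
  have "j \<in> range int \<union> range (\<lambda>n. - int n)" for j :: int
    by (cases j rule: int_cases2) auto
  then have "(UNIV::int set) = range int \<union> range (\<lambda>n. - int n)" by blast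
  with Infinite_Set_Sum.abs_summable_on_union[OF 1 2] show ?thesis
    by (simp add: Infinite_Set_Sum.abs_summable_on_def)
qed

lemma integral_count_space_prod:
  fixes f :: "'n::finite \<Rightarrow> int \<Rightarrow> 'c::{real_normed_field,banach,second_countable_topology}"
  assumes f: "\<And>i. integrable (count_space UNIV) (f i)"
  shows "integrable (count_space UNIV) (\<lambda>l::'n \<Rightarrow> int. \<Prod>i\<in>UNIV. f i (l i))" (is ?A)
    and "(LINT l|count_space UNIV. (\<Prod>i\<in>UNIV. f i (l i))) = (\<Prod>i\<in>UNIV. (LINT j|count_space UNIV. f i j))" (is ?B)
proof -
  have P: "PiE UNIV (\<lambda>_::'n. UNIV::int set) = UNIV" by (auto simp: PiE_UNIV_domain)
  have s: "Infinite_Set_Sum.abs_summable_on (f i) UNIV" for i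
    using f by (simp add: Infinite_Set_Sum.abs_summable_on_def)
  show ?A using abs_summable_on_prod_PiE[of "UNIV::'n set" "\<lambda>_. UNIV::int set" f] s
    by (simp add: P Infinite_Set_Sum.abs_summable_on_def)
  show ?B using infsetsum_prod_PiE[of "UNIV::'n set" "\<lambda>_. UNIV::int set" f] s
    by (simp add: P infsetsum_def)
qed

text \<open>The frequencies of the expansion with period 2 in every coordinate, indexed by integer
  vectors.\<close>

definition freq :: "('n \<Rightarrow> int) \<Rightarrow> real^'n::finite" where
  "freq l = vec_lambda (\<lambda>i. of_int (l i) / 2)"

text \<open>The exponent is shared evenly by the d coordinates: with p = e / d > 1 the weight is
  bounded by a product of summable one-dimensional weights.\<close>

lemma freq_weight_integrable:
  assumes e: "e > real CARD('n::finite)"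
  shows "integrable (count_space UNIV) (\<lambda>l::'n \<Rightarrow> int. (1 + norm (freq l :: real^'n)) powr (-e))"
proof -
  define p where "p = e / real CARD('n)"
  have p: "p > 1" using e by (simp add: p_def)
  have i: "integrable (count_space UNIV) (\<lambda>j::int. 2 powr p * (1 + \<bar>real_of_int j\<bar>) powr (-p))"
    by (intro integrable_mult_right integrable_count_int_powr p)
  show ?thesis
  proof (rule Bochner_Integration.integrable_bound[OF integral_count_space_prod(1)[where 'n='n, OF i]])
    show "AE l in count_space UNIV. norm ((1 + norm (freq l :: real^'n)) powr (-e)) \<le> norm (\<Prod>i\<in>UNIV. 2 powr p * (1 + \<bar>real_of_int (l i)\<bar>) powr (-p))"
    proof (rule AE_I2)
      fix l :: "'n \<Rightarrow> int"
      let ?r = "1 + norm (freq l :: real^'n)"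
      have r: "?r > 0" by (simp add: add_pos_nonneg)
      have "?r powr (-e) = (?r powr (-p)) ^ CARD('n)"
        using r by (simp add: p_def powr_powr powr_realpow[symmetric])
      also have "\<dots> = (\<Prod>i\<in>(UNIV::'n set). ?r powr (-p))" by simp
      also have "\<dots> \<le> (\<Prod>i\<in>UNIV. 2 powr p * (1 + \<bar>real_of_int (l i)\<bar>) powr (-p))"
      proof (rule linordered_semidom_class.prod_mono, rule conjI)
        fix i
        have "\<bar>(freq l :: real^'n) $ i\<bar> \<le> norm (freq l :: real^'n)" by (rule component_le_norm_cart)
        then have "(1 + \<bar>real_of_int (l i)\<bar>) / 2 \<le> ?r" by (simp add: freq_def)
        then have "?r powr (-p) \<le> ((1 + \<bar>real_of_int (l i)\<bar>) / 2) powr (-p)"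
          using p by (intro powr_mono2') auto
        also have "\<dots> = 2 powr p * (1 + \<bar>real_of_int (l i)\<bar>) powr (-p)"
          by (simp add: powr_divide powr_minus field_simps)
        finally show "?r powr (-p) \<le> 2 powr p * (1 + \<bar>real_of_int (l i)\<bar>) powr (-p)" .
      qed simp
      finally show "norm (?r powr (-e)) \<le> norm (\<Prod>i\<in>UNIV. 2 powr p * (1 + \<bar>real_of_int (l i)\<bar>) powr (-p))" by simp
    qed
  qed simp
qed

text \<open>The majorant \<open>W\<close> is summable for each x with sum at most the integrable
  \<open>V x\<close>; this gives absolute convergence on the product space, from which all four
  conclusions follow.\<close>

lemma lborel_count_Fubini:
  fixes F :: "'a::euclidean_space \<Rightarrow> 'j::countable \<Rightarrow> 'b::{banach, second_countable_topology}"
  assumes F: "\<And>j. (\<lambda>x. F x j) \<in> borel_measurable borel"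
    and FW: "\<And>x j. norm (F x j) \<le> W x j"
    and W: "\<And>x. integrable (count_space UNIV) (W x)"
    and WV: "\<And>x. (LINT j|count_space UNIV. W x j) \<le> V x" and V: "integrable lborel V"
  shows "integrable lborel (\<lambda>x. F x j)"
    and "integrable (count_space UNIV) (\<lambda>j. LINT x|lborel. F x j)"
    and "(LINT x|lborel. LINT j|count_space UNIV. F x j) = (LINT j|count_space UNIV. LINT x|lborel. F x j)"
    and "integrable lborel (\<lambda>x. LINT j|count_space UNIV. F x j)"
proof -
  interpret P: pair_sigma_finite "lborel :: 'a measure" "count_space (UNIV :: 'j set)"
    by (intro pair_sigma_finite.intro lborel.sigma_finite_measure_axioms sigma_finite_measure_count_space)
  have W0: "0 \<le> W x j" for x j using FW[of x j] norm_ge_zero order_trans by blast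
  have V0: "0 \<le> V x" for x
    using order_trans[OF integral_nonneg_AE WV[of x]] W0 by simp
  have "(\<lambda>z. F (snd z) (fst z)) \<in> borel_measurable (count_space UNIV \<Otimes>\<^sub>M lborel)"
    using F by (intro measurable_pair_measure_countable1) auto
  from measurable_pair_swap[OF this]
  have m: "case_prod F \<in> borel_measurable (lborel \<Otimes>\<^sub>M count_space UNIV)" by (simp add: case_prod_beta')
  have Fj: "integrable (count_space UNIV) (\<lambda>j. F x j)" for x
    by (rule Bochner_Integration.integrable_bound[OF W[of x]]) (use FW W0 in auto)
  have le: "(LINT j|count_space UNIV. norm (F x j)) \<le> V x" for x
    by (rule order_trans[OF integral_mono WV]) (use Fj W FW in auto)
  have mn: "case_prod (\<lambda>x j. norm (F x j)) \<in> borel_measurable (lborel \<Otimes>\<^sub>M count_space UNIV)"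
    using measurable_compose[OF m borel_measurable_norm] by (simp add: case_prod_beta')
  have int: "integrable (lborel \<Otimes>\<^sub>M count_space UNIV) (case_prod F)"
  proof (rule P.Fubini_integrable[OF m])
    show "integrable lborel (\<lambda>x. LINT j|count_space UNIV. norm (case_prod F (x, j)))"
    proof (rule Bochner_Integration.integrable_bound[OF V])
      show "(\<lambda>x. LINT j|count_space UNIV. norm (case_prod F (x, j))) \<in> borel_measurable lborel"
        using P.M2.borel_measurable_lebesgue_integral[OF mn] by simp
      show "AE x in lborel. norm (LINT j|count_space UNIV. norm (case_prod F (x, j))) \<le> norm (V x)"
        using le V0 by (intro AE_I2) simp
    qed
  qed (use Fj in simp)
  show "integrable lborel (\<lambda>x. F x j)"
  proof (rule Bochner_Integration.integrable_bound[OF V])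
    have "W x j \<le> V x" for x
      using order_trans[OF sum_le_integral_count_space[OF W[of x] W0, of "{j}"] WV[of x]] by simp
    then show "AE x in lborel. norm (F x j) \<le> norm (V x)"
      using FW V0 by (intro AE_I2) (auto intro: order_trans)
  qed (use F in simp)
  show "integrable (count_space UNIV) (\<lambda>j. LINT x|lborel. F x j)" by (rule P.integrable_snd[OF int])
  show "(LINT x|lborel. LINT j|count_space UNIV. F x j) = (LINT j|count_space UNIV. LINT x|lborel. F x j)"
    by (rule P.Fubini_integral[OF int, symmetric])
  show "integrable lborel (\<lambda>x. LINT j|count_space UNIV. F x j)" by (rule P.integrable_fst[OF int])
qed

text \<open>A Peetre-type inequality: 1 + |freq l| is at most (1 + |\<eta>|) times the product over
  i of 1 + |\<eta>_i - l_i / 2|. Raised to the power \<open>s\<close>, that product is absorbed by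
  the decay of order \<open>N\<close>, and N \<ge> s + 2 leaves the summable inverse
  squares.\<close>

lemma freq_weight_le:
  fixes \<eta> :: "real^'n::finite"
  assumes s: "s \<ge> 0" and N: "real N \<ge> s + 2"
  shows "(1 + norm (freq l :: real^'n)) powr s * (\<Prod>i\<in>UNIV. 1 / (1 + \<bar>\<eta> $ i - of_int (l i) / 2\<bar>) ^ N)
    \<le> (1 + norm \<eta>) powr s * (\<Prod>i\<in>UNIV. 1 / (1 + \<bar>\<eta> $ i - of_int (l i) / 2\<bar>)\<^sup>2)"
proof -
  let ?u = "\<lambda>i. \<bar>\<eta> $ i - of_int (l i) / 2\<bar>"
  have prod_ge: "1 + (\<Sum>i\<in>I. ?u i) \<le> (\<Prod>i\<in>I. 1 + ?u i)" if "finite I" for I :: "'n set"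
    using that
  proof induction
    case (insert j I)
    have "1 + (\<Sum>i\<in>insert j I. ?u i) \<le> (1 + ?u j) * (1 + (\<Sum>i\<in>I. ?u i))"
      using insert by (simp add: algebra_simps sum_nonneg mult_nonneg_nonneg)
    also have "\<dots> \<le> (1 + ?u j) * (\<Prod>i\<in>I. 1 + ?u i)" by (intro mult_left_mono insert) auto
    finally show ?case using insert by simp
  qed simp
  have "norm (freq l :: real^'n) \<le> norm \<eta> + norm (\<eta> - freq l)"
    using norm_triangle_sub[of "freq l" \<eta>] by (simp add: norm_minus_commute)
  also have "norm (\<eta> - freq l) \<le> (\<Sum>i\<in>UNIV. ?u i)"
    using norm_le_l1_cart[of "\<eta> - freq l"] by (simp add: freq_def)
  finally have "1 + norm (freq l :: real^'n) \<le> 1 + norm \<eta> + (\<Sum>i\<in>UNIV. ?u i)" by simp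
  also have "\<dots> \<le> (1 + norm \<eta>) * (1 + (\<Sum>i\<in>UNIV. ?u i))"
    by (simp add: algebra_simps sum_nonneg mult_nonneg_nonneg)
  also have "\<dots> \<le> (1 + norm \<eta>) * (\<Prod>i\<in>UNIV. 1 + ?u i)" by (intro mult_left_mono prod_ge) auto
  finally have "(1 + norm (freq l :: real^'n)) powr s \<le> ((1 + norm \<eta>) * (\<Prod>i\<in>UNIV. 1 + ?u i)) powr s"
    using s by (intro powr_mono2) auto
  also have "\<dots> = (1 + norm \<eta>) powr s * (\<Prod>i\<in>UNIV. (1 + ?u i) powr s)"
  proof -
    have "(\<Prod>i\<in>I. 1 + ?u i) powr s = (\<Prod>i\<in>I. (1 + ?u i) powr s)" if "finite I" for I :: "'n set"
      using that by induction (auto simp: powr_mult prod_nonneg)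
    then show ?thesis by (simp add: powr_mult prod_nonneg)
  qed
  finally have 1: "(1 + norm (freq l :: real^'n)) powr s \<le> (1 + norm \<eta>) powr s * (\<Prod>i\<in>UNIV. (1 + ?u i) powr s)" .
  have "(1 + norm (freq l :: real^'n)) powr s * (\<Prod>i\<in>UNIV. 1 / (1 + ?u i) ^ N)
      \<le> (1 + norm \<eta>) powr s * (\<Prod>i\<in>UNIV. (1 + ?u i) powr s) * (\<Prod>i\<in>UNIV. 1 / (1 + ?u i) ^ N)"
    by (intro mult_right_mono 1 prod_nonneg) auto
  also have "\<dots> = (1 + norm \<eta>) powr s * (\<Prod>i\<in>UNIV. (1 + ?u i) powr s * (1 / (1 + ?u i) ^ N))"
    by (simp only: prod.distrib mult.assoc)
  also have "\<dots> \<le> (1 + norm \<eta>) powr s * (\<Prod>i\<in>UNIV. 1 / (1 + ?u i)\<^sup>2)"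
  proof (rule mult_left_mono, rule linordered_semidom_class.prod_mono, rule conjI)
    fix i
    have p: "1 + ?u i > 0" by (simp add: add_pos_nonneg)
    have "(1 + ?u i) powr s * (1 / (1 + ?u i) ^ N) = (1 + ?u i) powr (s - real N)"
      using p by (simp add: powr_diff powr_realpow)
    also have "\<dots> \<le> (1 + ?u i) powr (- 2)" using N by (intro powr_mono) auto
    also have "\<dots> = 1 / (1 + ?u i)\<^sup>2" using p by (simp add: powr_minus_divide powr_numeral)
    finally show "(1 + ?u i) powr s * (1 / (1 + ?u i) ^ N) \<le> 1 / (1 + ?u i)\<^sup>2" .
  qed auto
  finally show ?thesis .
qed

lemma fourier_kernel_prod:
  "fourier_kernel \<eta> x = (\<Prod>i\<in>UNIV. exp (2 * of_real pi * \<i> * of_real (\<eta> $ i * x $ i)))"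
  unfolding fourier_kernel_def inner_vec_def by (simp add: sum_distrib_left exp_sum)

text \<open>An exponential of any frequency \<eta> is expanded over the lattice by the product of
  the one-dimensional expansions; integrating its coefficients against \<open>h\<close> gives
  \<open>a\<close>. By \<open>freq_weight_le\<close> the weighted sum of |a| is at most a multiple,
  independent of \<open>h\<close>, of the weighted integral of |h|.\<close>

lemma lattice_expansion:
  fixes s :: real
  assumes s: "s \<ge> 0"
  obtains K :: real where "K > 0"
    "\<And>(h :: real^'n::finite \<Rightarrow> complex) I. h \<in> borel_measurable borel \<Longrightarrow>
       integrable lborel (\<lambda>\<eta>. (1 + norm \<eta>) powr s * norm (h \<eta>)) \<Longrightarrow>
       (LINT \<eta>|lborel. (1 + norm \<eta>) powr s * norm (h \<eta>)) \<le> I \<Longrightarrow>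
       \<exists>a. integrable (count_space UNIV) (\<lambda>l. norm (a l) * (1 + norm (freq l :: real^'n)) powr s) \<and>
         (LINT l|count_space UNIV. norm (a l) * (1 + norm (freq l :: real^'n)) powr s) \<le> K * I \<and>
         (\<forall>x\<in>cbox 0 1. (LINT l|count_space UNIV. a l * fourier_kernel (freq l) x) = (LINT \<eta>|lborel. h \<eta> * fourier_kernel \<eta> x))"
proof -
  \<comment> \<open>Decay of order at least s + 2 is requested: \<open>s\<close> of it pays for the
    weight, the remaining 2 for the summation.\<close>
  define N where "N = nat \<lceil>s\<rceil> + 2"
  have N: "real N \<ge> s + 2" "N \<ge> 2" unfolding N_def by linarith+
  obtain C :: real and c :: "int \<Rightarrow> real \<Rightarrow> complex" where C: "C > 0"
    and cm [measurable]: "\<And>l. c l \<in> borel_measurable borel"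
    and cb: "\<And>l t. norm (c l t) \<le> C / (1 + \<bar>t - of_int l / 2\<bar>) ^ N"
    and cexp: "\<And>t x. 0 \<le> x \<Longrightarrow> x \<le> 1 \<Longrightarrow>
      (LINT l|count_space UNIV. c l t * exp (of_real pi * \<i> * of_int l * of_real x)) = exp (2 * of_real pi * \<i> * of_real (t * x))"
    by (rule exp_lattice_expansion[OF N(2)]) (rule that, assumption+)
  obtain S where S: "S > 0"
    and Si: "\<And>t::real. integrable (count_space UNIV) (\<lambda>l::int. 1 / (1 + \<bar>t - of_int l / 2\<bar>)\<^sup>2)"
    and Sb: "\<And>t::real. (LINT l|count_space UNIV. 1 / (1 + \<bar>t - of_int (l::int) / 2\<bar>)\<^sup>2) \<le> S"
    by (rule int_shifted_inverse_square) (rule that, assumption+)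
  let ?P = "\<lambda>(\<eta>::real^'n) (l::'n \<Rightarrow> int). \<Prod>i\<in>UNIV. 1 / (1 + \<bar>\<eta> $ i - of_int (l i) / 2\<bar>)\<^sup>2"
  have Pi: "integrable (count_space UNIV) (?P \<eta>)" for \<eta>
    by (rule integral_count_space_prod(1)) (rule Si)
  have Pb: "(LINT l|count_space UNIV. ?P \<eta> l) \<le> S ^ CARD('n)" for \<eta>
  proof -
    have "(LINT l|count_space UNIV. ?P \<eta> l) = (\<Prod>i\<in>UNIV. (LINT j|count_space UNIV. 1 / (1 + \<bar>\<eta> $ i - of_int (j::int) / 2\<bar>)\<^sup>2))"
      by (rule integral_count_space_prod(2)) (rule Si)
    also have "\<dots> \<le> (\<Prod>i\<in>(UNIV::'n set). S)"
      by (intro linordered_semidom_class.prod_mono conjI Sb integral_nonneg_AE) auto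
    finally show ?thesis by simp
  qed
  define cc where "cc \<eta> l = (\<Prod>i\<in>UNIV. c (l i) (\<eta> $ i))" for \<eta> :: "real^'n" and l
  have ccm [measurable]: "(\<lambda>\<eta>. cc \<eta> l) \<in> borel_measurable borel" for l
    unfolding cc_def by measurable
  have ccN: "norm (cc \<eta> l) \<le> C ^ CARD('n) * (\<Prod>i\<in>UNIV. 1 / (1 + \<bar>\<eta> $ i - of_int (l i) / 2\<bar>) ^ N)" for \<eta> l
  proof -
    have "norm (cc \<eta> l) = (\<Prod>i\<in>UNIV. norm (c (l i) (\<eta> $ i)))" by (simp add: cc_def prod_norm)
    also have "\<dots> \<le> (\<Prod>i\<in>UNIV. C * (1 / (1 + \<bar>\<eta> $ i - of_int (l i) / 2\<bar>) ^ N))"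
      using cb by (intro linordered_semidom_class.prod_mono conjI) auto
    also have "\<dots> = C ^ CARD('n) * (\<Prod>i\<in>UNIV. 1 / (1 + \<bar>\<eta> $ i - of_int (l i) / 2\<bar>) ^ N)"
      by (simp only: prod.distrib prod_constant)
    finally show ?thesis .
  qed
  have ccs: "norm (cc \<eta> l) * (1 + norm (freq l :: real^'n)) powr s \<le> C ^ CARD('n) * (1 + norm \<eta>) powr s * ?P \<eta> l" for \<eta> l
  proof -
    have "norm (cc \<eta> l) * (1 + norm (freq l :: real^'n)) powr s
        \<le> C ^ CARD('n) * (\<Prod>i\<in>UNIV. 1 / (1 + \<bar>\<eta> $ i - of_int (l i) / 2\<bar>) ^ N) * (1 + norm (freq l :: real^'n)) powr s"
      by (intro mult_right_mono ccN) auto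
    also have "\<dots> = C ^ CARD('n) * ((1 + norm (freq l :: real^'n)) powr s * (\<Prod>i\<in>UNIV. 1 / (1 + \<bar>\<eta> $ i - of_int (l i) / 2\<bar>) ^ N))"
      by (simp only: mult.assoc mult.commute mult.left_commute)
    also have "\<dots> \<le> C ^ CARD('n) * ((1 + norm \<eta>) powr s * ?P \<eta> l)"
      using C by (intro mult_left_mono freq_weight_le s N) auto
    finally show ?thesis by (simp only: mult.assoc)
  qed
  have w1: "1 \<le> (1 + norm v) powr s" for v :: "real^'n" using s by (intro ge_one_powr_ge_zero) auto
  have ccP: "norm (cc \<eta> l) \<le> C ^ CARD('n) * (1 + norm \<eta>) powr s * ?P \<eta> l" for \<eta> l
    using order_trans[OF mult_left_mono[OF w1[of "freq l"], of "norm (cc \<eta> l)"] ccs] by simp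
  have cc_exp: "(LINT l|count_space UNIV. cc \<eta> l * fourier_kernel (freq l) x) = fourier_kernel \<eta> x" if x: "x \<in> cbox 0 1" for \<eta> x
  proof -
    have x01: "0 \<le> x $ i" "x $ i \<le> 1" for i using x by (auto simp: mem_box_cart)
    let ?f = "\<lambda>i j. c j (\<eta> $ i) * exp (of_real pi * \<i> * of_int j * of_real (x $ i))"
    have fi: "integrable (count_space UNIV) (?f i)" for i
    proof (rule Bochner_Integration.integrable_bound)
      show "integrable (count_space UNIV) (\<lambda>j::int. C * (1 / (1 + \<bar>\<eta> $ i - of_int j / 2\<bar>)\<^sup>2))"
        by (intro integrable_mult_right Si)
      show "AE j in count_space UNIV. norm (?f i j) \<le> norm (C * (1 / (1 + \<bar>\<eta> $ i - of_int j / 2\<bar>)\<^sup>2))"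
      proof (rule AE_I2)
        fix j
        have e: "norm (exp (of_real pi * \<i> * of_int j * of_real (x $ i))) = 1" by simp
        have "norm (?f i j) = norm (c j (\<eta> $ i))" unfolding norm_mult e by simp
        also have "\<dots> \<le> C / (1 + \<bar>\<eta> $ i - of_int j / 2\<bar>) ^ N" by (rule cb)
        also have "\<dots> \<le> C / (1 + \<bar>\<eta> $ i - of_int j / 2\<bar>)\<^sup>2"
          using C N(2) by (intro divide_left_mono power_increasing mult_pos_pos zero_less_power) (auto simp: add_pos_nonneg)
        finally show "norm (?f i j) \<le> norm (C * (1 / (1 + \<bar>\<eta> $ i - of_int j / 2\<bar>)\<^sup>2))" using C by simp
      qed
    qed simp
    have "(LINT l|count_space UNIV. cc \<eta> l * fourier_kernel (freq l) x) = (LINT l|count_space UNIV. (\<Prod>i\<in>UNIV. ?f i (l i)))"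
    proof (rule Bochner_Integration.integral_cong[OF refl])
      fix l
      have "fourier_kernel (freq l) x = (\<Prod>i\<in>UNIV. exp (of_real pi * \<i> * of_int (l i) * of_real (x $ i)))"
        unfolding fourier_kernel_prod by (intro prod.cong refl arg_cong[where f=exp]) (simp add: freq_def)
      then show "cc \<eta> l * fourier_kernel (freq l) x = (\<Prod>i\<in>UNIV. ?f i (l i))"
        unfolding cc_def prod.distrib by simp
    qed
    also have "\<dots> = (\<Prod>i\<in>UNIV. (LINT j|count_space UNIV. ?f i j))" by (rule integral_count_space_prod(2)[OF fi])
    also have "\<dots> = (\<Prod>i\<in>UNIV. exp (2 * of_real pi * \<i> * of_real (\<eta> $ i * x $ i)))"
      by (intro prod.cong refl cexp x01)
    also have "\<dots> = fourier_kernel \<eta> x"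
      by (rule fourier_kernel_prod[symmetric])
    finally show ?thesis .
  qed
  define K where "K = C ^ CARD('n) * S ^ CARD('n)"
  show ?thesis
  proof (rule that[of K])
    show "K > 0" using C S by (simp add: K_def)
    fix h :: "real^'n \<Rightarrow> complex" and I :: real
    assume hm [measurable]: "h \<in> borel_measurable borel" and hi: "integrable lborel (\<lambda>\<eta>. (1 + norm \<eta>) powr s * norm (h \<eta>))"
      and hI: "(LINT \<eta>|lborel. (1 + norm \<eta>) powr s * norm (h \<eta>)) \<le> I"
    define W where "W \<eta> l = norm (h \<eta>) * (C ^ CARD('n) * (1 + norm \<eta>) powr s * ?P \<eta> l)" for \<eta> l
    define V where "V \<eta> = K * ((1 + norm \<eta>) powr s * norm (h \<eta>))" for \<eta>
    have W_eq: "W \<eta> = (\<lambda>l. (norm (h \<eta>) * (C ^ CARD('n) * (1 + norm \<eta>) powr s)) * ?P \<eta> l)" for \<eta>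
      by (simp add: W_def fun_eq_iff mult.assoc)
    have Wi: "integrable (count_space UNIV) (W \<eta>)" for \<eta> unfolding W_eq by (intro integrable_mult_right Pi)
    have WV: "(LINT l|count_space UNIV. W \<eta> l) \<le> V \<eta>" for \<eta>
    proof -
      have "(LINT l|count_space UNIV. W \<eta> l) = (norm (h \<eta>) * (C ^ CARD('n) * (1 + norm \<eta>) powr s)) * (LINT l|count_space UNIV. ?P \<eta> l)"
        unfolding W_eq by (rule integral_mult_right_zero)
      also have "\<dots> \<le> (norm (h \<eta>) * (C ^ CARD('n) * (1 + norm \<eta>) powr s)) * S ^ CARD('n)"
        using C by (intro mult_left_mono Pb) auto
      finally show ?thesis by (simp only: V_def K_def mult.assoc mult.commute mult.left_commute)
    qed
    have Vi: "integrable lborel V" unfolding V_def by (intro integrable_mult_right hi)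
    define a where "a l = (LINT \<eta>|lborel. h \<eta> * cc \<eta> l)" for l
    let ?F = "\<lambda>x \<eta> l. h \<eta> * (cc \<eta> l * fourier_kernel (freq l) x)"
    have F1: "norm (?F x \<eta> l) \<le> W \<eta> l" for x \<eta> l
      using mult_left_mono[OF ccP[of \<eta> l], of "norm (h \<eta>)"] by (simp add: norm_mult W_def)
    note F = lborel_count_Fubini[of "?F x" W V for x, OF _ F1 Wi WV Vi]
    let ?G = "\<lambda>\<eta> l. norm (h \<eta>) * (norm (cc \<eta> l) * (1 + norm (freq l :: real^'n)) powr s)"
    have G1: "norm (?G \<eta> l) \<le> W \<eta> l" for \<eta> l
      using mult_left_mono[OF ccs[of \<eta> l], of "norm (h \<eta>)"] by (simp add: norm_mult W_def)
    have Gm: "(\<lambda>\<eta>. ?G \<eta> l) \<in> borel_measurable borel" for l by measurable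
    note G = lborel_count_Fubini[of ?G W V, OF Gm G1 Wi WV Vi]
    have aG: "norm (a l) * (1 + norm (freq l :: real^'n)) powr s \<le> (LINT \<eta>|lborel. ?G \<eta> l)" for l
    proof -
      have "norm (a l) \<le> (LINT \<eta>|lborel. norm (h \<eta>) * norm (cc \<eta> l))"
        unfolding a_def by (rule order_trans[OF integral_norm_bound]) (simp add: norm_mult)
      then have "norm (a l) * (1 + norm (freq l :: real^'n)) powr s \<le> (LINT \<eta>|lborel. norm (h \<eta>) * norm (cc \<eta> l)) * (1 + norm (freq l :: real^'n)) powr s"
        by (rule mult_right_mono) simp
      also have "\<dots> = (LINT \<eta>|lborel. norm (h \<eta>) * norm (cc \<eta> l) * (1 + norm (freq l :: real^'n)) powr s)"
        by (rule integral_mult_left_zero[symmetric])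
      finally show ?thesis by (simp only: mult.assoc)
    qed
    have ai: "integrable (count_space UNIV) (\<lambda>l. norm (a l) * (1 + norm (freq l :: real^'n)) powr s)"
    proof (rule Bochner_Integration.integrable_bound[OF G(2)])
      show "AE l in count_space UNIV. norm (norm (a l) * (1 + norm (freq l :: real^'n)) powr s) \<le> norm (LINT \<eta>|lborel. ?G \<eta> l)"
      proof (rule AE_I2)
        fix l
        have "0 \<le> norm (a l) * (1 + norm (freq l :: real^'n)) powr s" by simp
        then show "norm (norm (a l) * (1 + norm (freq l :: real^'n)) powr s) \<le> norm (LINT \<eta>|lborel. ?G \<eta> l)"
          using aG[of l] unfolding real_norm_def by linarith
      qed
    qed simp
    have "(LINT l|count_space UNIV. norm (a l) * (1 + norm (freq l :: real^'n)) powr s) \<le> (LINT l|count_space UNIV. LINT \<eta>|lborel. ?G \<eta> l)"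
      by (rule integral_mono[OF ai G(2) aG])
    also have "\<dots> = (LINT \<eta>|lborel. LINT l|count_space UNIV. ?G \<eta> l)" by (rule G(3)[symmetric])
    also have "\<dots> \<le> (LINT \<eta>|lborel. V \<eta>)"
    proof (rule integral_mono[OF G(4) Vi])
      fix \<eta>
      have G0: "?G \<eta> l \<le> W \<eta> l" for l using G1[of \<eta> l] unfolding real_norm_def by (rule order_trans[OF abs_ge_self])
      have "integrable (count_space UNIV) (?G \<eta>)"
        by (rule Bochner_Integration.integrable_bound[OF Wi[of \<eta>]])
          (simp, intro AE_I2 order_trans[OF G1], unfold real_norm_def, rule abs_ge_self)
      from integral_mono[OF this Wi[of \<eta>] G0] WV[of \<eta>] show "(LINT l|count_space UNIV. ?G \<eta> l) \<le> V \<eta>"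
        by (rule order_trans)
    qed
    also have "\<dots> = K * (LINT \<eta>|lborel. (1 + norm \<eta>) powr s * norm (h \<eta>))" unfolding V_def by (rule integral_mult_right_zero)
    also have "\<dots> \<le> K * I" using C S by (intro mult_left_mono hI) (auto simp: K_def)
    finally have aK: "(LINT l|count_space UNIV. norm (a l) * (1 + norm (freq l :: real^'n)) powr s) \<le> K * I" .
    have aF: "(LINT l|count_space UNIV. a l * fourier_kernel (freq l) x) = (LINT \<eta>|lborel. h \<eta> * fourier_kernel \<eta> x)" if x: "x \<in> cbox 0 1" for x
    proof -
      have Fm: "(\<lambda>\<eta>. ?F x \<eta> l) \<in> borel_measurable borel" for l by measurable
      have "(LINT l|count_space UNIV. a l * fourier_kernel (freq l) x) = (LINT l|count_space UNIV. LINT \<eta>|lborel. ?F x \<eta> l)"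
        unfolding a_def by (intro Bochner_Integration.integral_cong refl) (subst integral_mult_left_zero[symmetric], simp add: mult.assoc)
      also have "\<dots> = (LINT \<eta>|lborel. LINT l|count_space UNIV. ?F x \<eta> l)" by (rule F(3)[OF Fm, symmetric])
      also have "\<dots> = (LINT \<eta>|lborel. h \<eta> * fourier_kernel \<eta> x)"
        by (intro Bochner_Integration.integral_cong refl) (subst integral_mult_right_zero, simp add: cc_exp[OF x])
      finally show ?thesis .
    qed
    show "\<exists>a. integrable (count_space UNIV) (\<lambda>l. norm (a l) * (1 + norm (freq l :: real^'n)) powr s) \<and>
         (LINT l|count_space UNIV. norm (a l) * (1 + norm (freq l :: real^'n)) powr s) \<le> K * I \<and>
         (\<forall>x\<in>cbox 0 1. (LINT l|count_space UNIV. a l * fourier_kernel (freq l) x) = (LINT \<eta>|lborel. h \<eta> * fourier_kernel \<eta> x))"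
      by (intro exI[of _ a] conjI ballI ai aK aF)
  qed
qed

section \<open>Approximation of Barron functions\<close>

lemma ennreal_sqrt_le:
  assumes "x \<le> ennreal y" "0 \<le> y"
  shows "ennreal_sqrt x \<le> ennreal (sqrt y)"
proof -
  have "x \<noteq> top" using assms(1) by (auto simp: top_unique)
  moreover have "enn2real x \<le> y" using assms by (intro enn2real_leI)
  ultimately show ?thesis by (simp add: ennreal_sqrt_def ennreal_leI)
qed

lemma energy_zero: "energy m (\<lambda>\<alpha> x. 0) = 0"
  by (simp add: energy_def L2_norm_sq_def slobodeckij_sq_def)

lemma neuron_zero: "neuron k \<omega> b (\<lambda>_. 0) x = relu_pow k (\<omega> \<bullet> x - b)"
  by (simp add: neuron_def dcoef_def mi_order_def)

text \<open>Stated for one fixed extension and its weighted integral; as the constant depends on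
  neither, the infimum over extensions can be taken afterwards.\<close>

lemma barron_approximation:
  fixes m s :: real and k :: nat
  assumes m: "0 \<le> m" "m < real k + 1/2"
    and s: "s > (real CARD('n::finite) + 1) * (real k - m + 1/2) + m + 1/2"
  obtains C :: real where "C > 0"
    "\<And>(fe :: real^'n \<Rightarrow> complex) f n. integrable lebesgue fe \<Longrightarrow> AE x in lebesgue_on (cbox 0 1). fe x = f x \<Longrightarrow>
      integrable lborel (\<lambda>\<eta>. (1 + norm \<eta>) powr s * norm (fourier fe \<eta>)) \<Longrightarrow> n \<ge> 2 \<Longrightarrow>
      \<exists>v\<in>shallow_nets k n. sobolev_norm m (cbox 0 1) (\<lambda>x. f x - v x) \<le>
        ennreal (C * (LINT \<eta>|lborel. (1 + norm \<eta>) powr s * norm (fourier fe \<eta>)) * (real n powr (m - (real k + 1)) * ln (real n)))"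
proof -
  define q where "q = real k + 1 - m"
  have q: "q > 1/2" using m by (simp add: q_def)
  \<comment> \<open>The hypothesis on \<open>s\<close> rewritten: with q = k + 1 - m, the number (d
    + 1)(k - m + 1/2) + m + 1/2 equals d (q - 1/2) + k + 1.\<close>
  have s1: "s - real (Suc k) > real CARD('n) * (q - 1/2)"
    using s by (simp add: q_def algebra_simps add_divide_distrib)
  then have sk: "s > real (Suc k)" using q by (smt (verit) mult_nonneg_nonneg of_nat_0_le_iff)
  then have s0: "s \<ge> 0" by linarith
  \<comment> \<open>The largest exponent of the weights \<kappa> for which A \<kappa>^(1/2 - q) is
    still controlled by the Barron weight of order \<open>s\<close>.\<close>
  define e where "e = (s - real (Suc k)) / (q - 1/2)"
  have e: "e > real CARD('n)" using s1 q by (simp add: e_def pos_less_divide_eq)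
  have eq: "e * (q - 1/2) = s - real (Suc k)" using q by (simp add: e_def)
  define \<kappa> where "\<kappa> l = (1 + norm (freq l :: real^'n)) powr (-e)" for l
  have \<kappa>i: "integrable (count_space UNIV) \<kappa>" unfolding \<kappa>_def by (rule freq_weight_integrable[OF e])
  have r0: "1 + norm (freq l :: real^'n) > 0" for l by (simp add: add_pos_nonneg)
  have \<kappa>0: "\<kappa> l > 0" for l using r0[of l] by (simp add: \<kappa>_def)
  define K0 where "K0 = (LINT l|count_space UNIV. \<kappa> l)"
  have K0: "K0 \<ge> 0" unfolding K0_def by (intro integral_nonneg_AE AE_I2 less_imp_le \<kappa>0)
  \<comment> \<open>A bound for \<open>\<bar>\<omega> \<bullet> x\<bar>\<close> on the cube; the
    ridge functions are represented by neurons on this range only.\<close>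
  define R where "R = real CARD('n)"
  have R: "R > 0" by (simp add: R_def)
  obtain L Cr :: real where L: "L \<ge> R" and Cr: "Cr > 0"
    and ridge: "\<And>\<tau>. \<tau> \<ge> 0 \<Longrightarrow> \<exists>\<rho>\<in>borel_measurable borel.
       (\<forall>b. norm (\<rho> b) \<le> Cr * (1 + \<tau>) ^ Suc k) \<and> (\<forall>b. \<bar>b\<bar> > L \<longrightarrow> \<rho> b = 0) \<and>
       (\<forall>t. \<bar>t\<bar> \<le> R \<longrightarrow> (LINT b|lborel. \<rho> b * complex_of_real (relu_pow k (t - b))) =
          exp (2 * of_real pi * \<i> * of_real (\<tau> * t)))"
  proof (rule ridge_representation[OF R, of k], goal_cases)
    case (1 L C)
    show ?case by (rule 1(1)[OF 1(2) 1(3)]) (rule 1(4))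
  qed
  have L0: "L > 0" using L R by linarith
  define P where "P \<tau> \<rho> \<longleftrightarrow> \<rho> \<in> borel_measurable borel \<and> (\<forall>b. norm (\<rho> b) \<le> Cr * (1 + \<tau>) ^ Suc k) \<and> (\<forall>b. \<bar>b\<bar> > L \<longrightarrow> \<rho> b = 0) \<and>
       (\<forall>t. \<bar>t\<bar> \<le> R \<longrightarrow> (LINT b|lborel. \<rho> b * complex_of_real (relu_pow k (t - b))) =
          exp (2 * of_real pi * \<i> * of_real (\<tau> * t)))" for \<tau> :: real and \<rho> :: "real \<Rightarrow> complex"
  have "\<forall>\<tau>. \<exists>\<rho>. \<tau> \<ge> 0 \<longrightarrow> P \<tau> \<rho>"
    using ridge unfolding P_def Bex_def by blast
  from choice[OF this] obtain r where rP: "\<forall>\<tau>. \<tau> \<ge> 0 \<longrightarrow> P \<tau> (r \<tau>)" ..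
  have r: "r \<tau> \<in> borel_measurable borel" and r_le: "norm (r \<tau> b) \<le> Cr * (1 + \<tau>) ^ Suc k"
    and rL: "\<bar>b\<bar> > L \<Longrightarrow> r \<tau> b = 0"
    and r_exp: "\<bar>t\<bar> \<le> R \<Longrightarrow> (LINT b|lborel. r \<tau> b * complex_of_real (relu_pow k (t - b))) =
          exp (2 * of_real pi * \<i> * of_real (\<tau> * t))" if "\<tau> \<ge> 0" for \<tau> b t
    using rP that unfolding P_def by blast+
  obtain C1 :: real where C1: "C1 > 0"
    and superposition: "\<And>(\<omega> :: ('n \<Rightarrow> int) \<Rightarrow> real^'n) A \<rho> \<kappa> B t.
      (\<And>j. \<omega> j \<in> sphere 0 1) \<Longrightarrow> (\<And>j. \<rho> j \<in> borel_measurable borel) \<Longrightarrow> (\<And>j b. norm (\<rho> j b) \<le> A j) \<Longrightarrow>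
      (\<And>j b. \<bar>b\<bar> > L \<Longrightarrow> \<rho> j b = 0) \<Longrightarrow> (\<And>j. \<kappa> j > 0) \<Longrightarrow>
      integrable (count_space UNIV) \<kappa> \<Longrightarrow> (LINT j|count_space UNIV. \<kappa> j) \<le> K0 \<Longrightarrow>
      integrable (count_space UNIV) (\<lambda>j. A j * \<kappa> j powr (1/2 - q)) \<Longrightarrow>
      (LINT j|count_space UNIV. A j * \<kappa> j powr (1/2 - q)) \<le> B \<Longrightarrow> t > 0 \<Longrightarrow>
      \<exists>N. real N \<le> (2 * (real k + 2) * (1 + K0) + 1) * t + 1 \<and>
        good k m N (\<lambda>\<alpha> x. LINT j|count_space UNIV. LINT b|lborel. \<rho> j b * of_real (neuron k (\<omega> j) b \<alpha> x))
          (C1 * (B\<^sup>2 * t powr (- (2 * q))))"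
  proof (rule good_superposition[OF m L0 K0, where 'n='n and 'j="'n \<Rightarrow> int"], goal_cases)
    case (1 C)
    show ?case by (rule 1(1)[OF 1(2)]) (rule 1(3)[folded q_def])
  qed
  obtain K :: real where K: "K > 0"
    and lattice: "\<And>(h :: real^'n \<Rightarrow> complex) I. h \<in> borel_measurable borel \<Longrightarrow>
       integrable lborel (\<lambda>\<eta>. (1 + norm \<eta>) powr s * norm (h \<eta>)) \<Longrightarrow>
       (LINT \<eta>|lborel. (1 + norm \<eta>) powr s * norm (h \<eta>)) \<le> I \<Longrightarrow>
       \<exists>a. integrable (count_space UNIV) (\<lambda>l. norm (a l) * (1 + norm (freq l :: real^'n)) powr s) \<and>
         (LINT l|count_space UNIV. norm (a l) * (1 + norm (freq l :: real^'n)) powr s) \<le> K * I \<and>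
         (\<forall>x\<in>cbox 0 1. (LINT l|count_space UNIV. a l * fourier_kernel (freq l) x) = (LINT \<eta>|lborel. h \<eta> * fourier_kernel \<eta> x))"
  proof (rule lattice_expansion[OF s0, where 'n='n], goal_cases)
    case (1 K)
    show ?case by (rule 1(1)[OF 1(2)]) (rule 1(3))
  qed
  obtain \<omega>0 :: "real^'n" where \<omega>0: "\<omega>0 \<in> sphere 0 1" using sphere_nonempty by blast
  define \<tau> where "\<tau> l = norm (freq l :: real^'n)" for l
  \<comment> \<open>The frequency 0 has no direction; any unit vector serves, because its modulus
    \<tau> is 0.\<close>
  define \<omega> where "\<omega> l = (if freq l = (0 :: real^'n) then \<omega>0 else freq l /\<^sub>R \<tau> l)" for l
  have \<tau>0: "\<tau> l \<ge> 0" for l by (simp add: \<tau>_def)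
  have \<omega>: "\<omega> l \<in> sphere 0 1" for l using \<omega>0 by (simp add: \<omega>_def \<tau>_def)
  have \<tau>\<omega>: "\<tau> l *\<^sub>R \<omega> l = freq l" for l by (simp add: \<omega>_def \<tau>_def)
  define D where "D = 2 * (real k + 2) * (1 + K0) + 1"
  have D: "D > 0" using K0 by (simp add: D_def add_nonneg_pos)
  \<comment> \<open>\<open>ln 2\<close> bounds \<open>ln (real n)\<close> from below for n \<ge> 2,
    so dividing by it pays for the logarithm in the claim; the power of \<open>2 * D\<close> comes
    from the choice of \<open>t\<close> below.\<close>
  define C where "C = sqrt C1 * (Cr * K) * (2 * D) powr q / ln 2"
  show ?thesis
  proof (rule that[of C])
    show "C > 0" using C1 Cr K D by (simp add: C_def)
    fix fe f :: "real^'n \<Rightarrow> complex" and n :: nat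
    assume fe: "integrable lebesgue fe" and fef: "AE x in lebesgue_on (cbox 0 1). fe x = f x"
      and hi: "integrable lborel (\<lambda>\<eta>. (1 + norm \<eta>) powr s * norm (fourier fe \<eta>))" and n: "n \<ge> 2"
    define I where "I = (LINT \<eta>|lborel. (1 + norm \<eta>) powr s * norm (fourier fe \<eta>))"
    have I0: "I \<ge> 0" unfolding I_def by (intro integral_nonneg_AE AE_I2) auto
    have hm [measurable]: "fourier fe \<in> borel_measurable borel" using fourier_borel_version[OF fe] by blast
    have hint: "integrable lborel (fourier fe)"
    proof (rule Bochner_Integration.integrable_bound[OF hi])
      show "AE \<eta> in lborel. norm (fourier fe \<eta>) \<le> norm ((1 + norm \<eta>) powr s * norm (fourier fe \<eta>))"
      proof (rule AE_I2)
        fix \<eta> :: "real^'n"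
        have "1 \<le> (1 + norm \<eta>) powr s" using s0 by (intro ge_one_powr_ge_zero) auto
        then show "norm (fourier fe \<eta>) \<le> norm ((1 + norm \<eta>) powr s * norm (fourier fe \<eta>))"
          using mult_right_mono[of 1 "(1 + norm \<eta>) powr s" "norm (fourier fe \<eta>)"] by simp
      qed
    qed simp
    obtain a where a: "integrable (count_space UNIV) (\<lambda>l. norm (a l) * (1 + norm (freq l :: real^'n)) powr s) \<and>
         (LINT l|count_space UNIV. norm (a l) * (1 + norm (freq l :: real^'n)) powr s) \<le> K * I \<and>
         (\<forall>x\<in>cbox 0 1. (LINT l|count_space UNIV. a l * fourier_kernel (freq l) x) = (LINT \<eta>|lborel. fourier fe \<eta> * fourier_kernel \<eta> x))"
      using lattice[OF hm hi order_refl, folded I_def] by (elim exE) (rule that)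
    note ai = a[THEN conjunct1] and aK = a[THEN conjunct2, THEN conjunct1] and ax = a[THEN conjunct2, THEN conjunct2, rule_format]
    define \<rho> where "\<rho> l b = a l * r (\<tau> l) b" for l b
    define A where "A l = norm (a l) * (Cr * (1 + \<tau> l) ^ Suc k)" for l
    have \<rho>m: "\<rho> l \<in> borel_measurable borel" for l
      unfolding \<rho>_def using r[OF \<tau>0[of l]] by simp
    have \<rho>A: "norm (\<rho> l b) \<le> A l" for l b
      unfolding \<rho>_def A_def norm_mult by (intro mult_left_mono r_le \<tau>0) auto
    have \<rho>L: "\<rho> l b = 0" if "\<bar>b\<bar> > L" for l b unfolding \<rho>_def using rL[OF \<tau>0 that] by simp
    have Ar: "A l = Cr * (norm (a l) * (1 + \<tau> l) powr real (Suc k))" for l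
      using r0[of l] by (simp only: A_def \<tau>_def powr_realpow mult.assoc mult.commute mult.left_commute)
    \<comment> \<open>By the choice of \<open>e\<close> the powers of the frequency, k + 1 from the
      density and the rest from the weight, add up to exactly \<open>s\<close>.\<close>
    have A\<kappa>: "A l * \<kappa> l powr (1/2 - q) = Cr * (norm (a l) * (1 + norm (freq l :: real^'n)) powr s)" for l
    proof -
      have "\<kappa> l powr (1/2 - q) = (1 + \<tau> l) powr (- e * (1/2 - q))" by (simp add: \<kappa>_def \<tau>_def powr_powr)
      also have "- e * (1/2 - q) = s - real (Suc k)" using eq by (simp add: algebra_simps)
      finally have "A l * \<kappa> l powr (1/2 - q) = Cr * (norm (a l) * ((1 + \<tau> l) powr real (Suc k) * (1 + \<tau> l) powr (s - real (Suc k))))"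
        unfolding Ar by (simp only: mult.assoc)
      then show ?thesis unfolding powr_add[symmetric] by (simp add: \<tau>_def)
    qed
    have A\<kappa>i: "integrable (count_space UNIV) (\<lambda>l. A l * \<kappa> l powr (1/2 - q))"
      unfolding A\<kappa> by (intro integrable_mult_right ai)
    have A\<kappa>B: "(LINT l|count_space UNIV. A l * \<kappa> l powr (1/2 - q)) \<le> Cr * (K * I)"
    proof -
      have "(LINT l|count_space UNIV. A l * \<kappa> l powr (1/2 - q)) = Cr * (LINT l|count_space UNIV. norm (a l) * (1 + norm (freq l :: real^'n)) powr s)"
        unfolding A\<kappa> by (rule integral_mult_right_zero)
      also have "\<dots> \<le> Cr * (K * I)" using Cr by (intro mult_left_mono aK) auto
      finally show ?thesis .
    qed
    have Ai: "integrable (count_space UNIV) A"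
    proof (rule Bochner_Integration.integrable_bound[OF integrable_mult_right[OF ai, of Cr]])
      show "AE l in count_space UNIV. norm (A l) \<le> norm (Cr * (norm (a l) * (1 + norm (freq l :: real^'n)) powr s))"
      proof (rule AE_I2)
        fix l
        have "(1 + \<tau> l) powr real (Suc k) \<le> (1 + \<tau> l) powr s" using sk \<tau>0[of l] by (intro powr_mono) auto
        then have "A l \<le> Cr * (norm (a l) * (1 + \<tau> l) powr s)"
          unfolding Ar using Cr by (intro mult_left_mono) auto
        moreover have "0 \<le> A l" unfolding Ar using Cr by simp
        ultimately show "norm (A l) \<le> norm (Cr * (norm (a l) * (1 + norm (freq l :: real^'n)) powr s))"
          by (simp add: \<tau>_def)
      qed
    qed simp
    define F where "F \<alpha> x = (LINT l|count_space UNIV. LINT b|lborel. \<rho> l b * of_real (neuron k (\<omega> l) b \<alpha> x))" for \<alpha> x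
    have F0: "F (\<lambda>_. 0) x = (LINT \<eta>|lborel. fourier fe \<eta> * fourier_kernel \<eta> x)" if x: "x \<in> cbox 0 1" for x
    proof -
      have "F (\<lambda>_. 0) x = (LINT l|count_space UNIV. a l * fourier_kernel (freq l) x)"
        unfolding F_def
      proof (rule Bochner_Integration.integral_cong[OF refl])
        fix l
        have "\<bar>\<omega> l \<bullet> x\<bar> \<le> norm (\<omega> l) * norm x" by (rule Cauchy_Schwarz_ineq2)
        also have "\<dots> \<le> R" using \<omega>[of l] norm_le_sqrt_card_cube[OF x] by (simp add: R_def)
        finally have t: "\<bar>\<omega> l \<bullet> x\<bar> \<le> R" .
        have "(LINT b|lborel. \<rho> l b * of_real (neuron k (\<omega> l) b (\<lambda>_. 0) x)) = (LINT b|lborel. a l * (r (\<tau> l) b * of_real (relu_pow k (\<omega> l \<bullet> x - b))))"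
          unfolding \<rho>_def neuron_zero by (simp only: mult.assoc)
        also have "\<dots> = a l * (LINT b|lborel. r (\<tau> l) b * of_real (relu_pow k (\<omega> l \<bullet> x - b)))" by (rule integral_mult_right_zero)
        also have "\<dots> = a l * exp (2 * of_real pi * \<i> * of_real (\<tau> l * (\<omega> l \<bullet> x)))" by (simp only: r_exp[OF \<tau>0 t])
        also have "\<tau> l * (\<omega> l \<bullet> x) = freq l \<bullet> x" unfolding inner_scaleR_left[symmetric] \<tau>\<omega> ..
        finally show "(LINT b|lborel. \<rho> l b * of_real (neuron k (\<omega> l) b (\<lambda>_. 0) x)) = a l * fourier_kernel (freq l) x"
          by (simp only: fourier_kernel_def)
      qed
      then show ?thesis using ax[OF x] by simp
    qed
    have "AE x in lebesgue. fe x = (LINT \<eta>|lborel. fourier fe \<eta> * fourier_kernel \<eta> x)" by (rule fourier_inversion_AE[OF fe hint])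
    moreover have "AE x in lebesgue. x \<in> cbox 0 1 \<longrightarrow> fe x = f x"
      using fef by (subst (asm) AE_restrict_space_iff) auto
    ultimately have "AE x in lebesgue. x \<in> cbox 0 1 \<longrightarrow> f x = F (\<lambda>_. 0) x"
      by eventually_elim (auto simp: F0)
    then have fF: "AE x in lebesgue_on (cbox 0 1). f x = F (\<lambda>_. 0) x"
      by (subst AE_restrict_space_iff) auto
    \<comment> \<open>Then \<open>D * t + 1\<close> is n / 2 + 1, which is at most \<open>n\<close>
      because n \<ge> 2.\<close>
    define t where "t = real n / (2 * D)"
    have t: "t > 0" using n D by (simp add: t_def)
    define B where "B = Cr * (K * I)"
    have B0: "B \<ge> 0" using Cr K I0 by (simp add: B_def)
    have \<kappa>K: "(LINT l|count_space UNIV. \<kappa> l) \<le> K0" by (simp add: K0_def)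
    have "\<exists>N. real N \<le> D * t + 1 \<and> good k m N F (C1 * (B\<^sup>2 * t powr (- (2 * q))))"
      unfolding D_def B_def F_def[abs_def]
      by (rule superposition[where \<omega>=\<omega> and \<rho>=\<rho> and A=A and \<kappa>=\<kappa>])
        (rule \<omega> \<rho>m \<rho>A \<rho>L \<kappa>0 \<kappa>i \<kappa>K A\<kappa>i A\<kappa>B t | assumption)+
    then obtain N where N: "real N \<le> D * t + 1 \<and> good k m N F (C1 * (B\<^sup>2 * t powr (- (2 * q))))" ..
    note goodN = N[THEN conjunct2]
    have "D * t = real n / 2" using D by (simp add: t_def)
    with N[THEN conjunct1] n have "N \<le> n" by linarith
    then have goodn: "good k m n F (C1 * (B\<^sup>2 * t powr (- (2 * q))))" by (rule good_mono[OF goodN _ order_refl])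
    \<comment> \<open>No error precedes the approximation of the whole target, so the accumulated
      error \<open>S\<close> is 0.\<close>
    obtain v where v: "v \<in> nets k n" and en: "energy m (\<lambda>\<alpha> x. 0 + F \<alpha> x - v \<alpha> x) \<le> energy m ((\<lambda>\<alpha> x. 0) :: ('n \<Rightarrow> nat) \<Rightarrow> real^'n \<Rightarrow> complex) + ennreal (C1 * (B\<^sup>2 * t powr (- (2 * q))))"
      by (rule goodD[OF goodn, where S="\<lambda>\<alpha> x. 0"]) (simp, rule that, assumption+)
    have wd: "wd_family k (interior (cbox 0 1)) (\<lambda>\<alpha> x. F \<alpha> x + (- 1) * v \<alpha> x)"
    proof (rule wd_family_add_cmult[OF _ wd_family_nets[OF v]])
      show "wd_family k (interior (cbox 0 1)) F"
        unfolding F_def[abs_def]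
        by (rule wd_family_superposition[where A=A and L=L]) (rule \<omega> \<rho>m \<rho>A \<rho>L Ai L0 | assumption)+
    qed
    have AEv: "AE x in lebesgue_on (cbox 0 1). f x - v (\<lambda>_. 0) x = F (\<lambda>_. 0) x + (- 1) * v (\<lambda>_. 0) x"
      using fF by eventually_elim simp
    have "sobolev_norm m (cbox 0 1) (\<lambda>x. f x - v (\<lambda>_. 0) x) \<le> ennreal_sqrt (energy m (\<lambda>\<alpha> x. F \<alpha> x + (- 1) * v \<alpha> x))"
      by (rule wd_family_sobolev_norm_le[OF m wd AEv])
    also have "\<dots> \<le> ennreal (sqrt (C1 * (B\<^sup>2 * t powr (- (2 * q)))))"
      by (rule ennreal_sqrt_le) (use en C1 in \<open>simp_all add: energy_zero\<close>)
    also have "\<dots> \<le> ennreal (C * I * (real n powr (m - (real k + 1)) * ln (real n)))"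
    proof (rule ennreal_leI)
      have "t powr (- (2 * q)) = (t powr (- q))\<^sup>2" by (simp add: power2_eq_square powr_add[symmetric])
      then have "sqrt (C1 * (B\<^sup>2 * t powr (- (2 * q)))) = sqrt C1 * (B * t powr (- q))"
        using B0 by (simp add: real_sqrt_mult)
      also have "t powr (- q) = (2 * D) powr q * real n powr (m - (real k + 1))"
      proof -
        have "t powr (- q) = real n powr (- q) / (2 * D) powr (- q)"
          unfolding t_def by (rule powr_divide)
        also have "\<dots> = (2 * D) powr q * real n powr (- q)" by (simp only: powr_minus divide_inverse inverse_inverse_eq mult.commute)
        finally show ?thesis by (simp add: q_def)
      qed
      also have "sqrt C1 * (B * ((2 * D) powr q * real n powr (m - (real k + 1)))) = C * I * (real n powr (m - (real k + 1)) * ln 2)"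
        by (simp add: C_def B_def)
      also have "\<dots> \<le> C * I * (real n powr (m - (real k + 1)) * ln (real n))"
        using \<open>C > 0\<close> I0 n by (intro mult_left_mono) auto
      finally show "sqrt (C1 * (B\<^sup>2 * t powr (- (2 * q)))) \<le> C * I * (real n powr (m - (real k + 1)) * ln (real n))" .
    qed
    finally show "\<exists>v\<in>shallow_nets k n. sobolev_norm m (cbox 0 1) (\<lambda>x. f x - v x) \<le>
        ennreal (C * (LINT \<eta>|lborel. (1 + norm \<eta>) powr s * norm (fourier fe \<eta>)) * (real n powr (m - (real k + 1)) * ln (real n)))"
      unfolding I_def using nets_shallow[OF v] by (intro bexI)
  qed
qed

theorem theorem4:
  fixes k :: nat and m s :: real
  assumes "0 \<le> m" and "m < real k + 1/2"
    and "s > (real CARD('n::finite) + 1) * (real k - m + 1/2) + m + 1/2"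
  shows "\<exists>C::real. C > 0 \<and>
    (\<forall>f \<in> barron_space s (cbox 0 1 :: (real^'n) set). \<forall>n::nat. n \<ge> 2 \<longrightarrow>
      (INF fn\<in>shallow_nets k n. sobolev_norm m (cbox 0 1) (\<lambda>x. f x - fn x))
        \<le> ennreal C * barron_norm s (cbox 0 1) f
            * ennreal (real n powr (m - (real k + 1)) * ln (real n)))"
proof -
  obtain C :: real where C: "C > 0"
    and approx: "\<And>(fe :: real^'n \<Rightarrow> complex) f n. integrable lebesgue fe \<Longrightarrow> AE x in lebesgue_on (cbox 0 1). fe x = f x \<Longrightarrow>
      integrable lborel (\<lambda>\<eta>. (1 + norm \<eta>) powr s * norm (fourier fe \<eta>)) \<Longrightarrow> n \<ge> 2 \<Longrightarrow>
      \<exists>v\<in>shallow_nets k n. sobolev_norm m (cbox 0 1) (\<lambda>x. f x - v x) \<le>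
        ennreal (C * (LINT \<eta>|lborel. (1 + norm \<eta>) powr s * norm (fourier fe \<eta>)) * (real n powr (m - (real k + 1)) * ln (real n)))"
  proof (rule barron_approximation[OF assms], goal_cases)
    case (1 C)
    show ?case by (rule 1(1)[OF 1(2)]) (rule 1(3))
  qed
  show ?thesis
  proof (intro exI[of _ C] conjI C ballI allI impI)
    fix f :: "real^'n \<Rightarrow> complex" and n :: nat
    assume n: "n \<ge> 2"
    define w where "w = real n powr (m - (real k + 1)) * ln (real n)"
    have w: "w > 0" using n by (simp add: w_def)
    let ?inf = "INF fn\<in>shallow_nets k n. sobolev_norm m (cbox 0 1) (\<lambda>x. f x - fn x)"
    define c where "c = ennreal (C * w)"
    have c: "c \<noteq> 0" "c \<noteq> top" using C w by (simp_all add: c_def)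
    \<comment> \<open>Dividing by a constant that is neither 0 nor infinite turns the claim into a
      lower bound valid for every extension, and hence for the infimum over them.\<close>
    have "?inf / c \<le> barron_norm s (cbox 0 1) f"
      unfolding barron_norm_def
    proof (rule INF_greatest)
      fix fe assume "fe \<in> extensions (cbox 0 1) f"
      then have fe: "integrable lebesgue fe" "AE x in lebesgue_on (cbox 0 1). fe x = f x"
        by (auto simp: extensions_def)
      have [measurable]: "fourier fe \<in> borel_measurable borel" using fourier_borel_version[OF fe(1)] by blast
      let ?J = "\<integral>\<^sup>+\<xi>. ennreal ((1 + norm \<xi>) powr s * norm (fourier fe \<xi>)) \<partial>lebesgue"
      have J: "?J = (\<integral>\<^sup>+\<xi>. ennreal ((1 + norm \<xi>) powr s * norm (fourier fe \<xi>)) \<partial>lborel)"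
        by (rule nn_integral_completion) measurable
      show "?inf / c \<le> ?J"
      \<comment> \<open>An infinite integral satisfies the bound trivially; a finite one makes the
        weighted transform integrable, so that the approximation result applies to this
        extension.\<close>
      proof (cases "?J = top")
        case False
        have hi: "integrable lborel (\<lambda>\<xi>. (1 + norm \<xi>) powr s * norm (fourier fe \<xi>))"
          using False by (intro integrableI_nonneg) (auto simp: J less_top)
        obtain v where v: "v \<in> shallow_nets k n"
          "sobolev_norm m (cbox 0 1) (\<lambda>x. f x - v x) \<le> ennreal (C * (LINT \<eta>|lborel. (1 + norm \<eta>) powr s * norm (fourier fe \<eta>)) * w)"
          using approx[OF fe hi n] unfolding w_def by blast
        have "?inf \<le> sobolev_norm m (cbox 0 1) (\<lambda>x. f x - v x)" by (rule INF_lower[OF v(1)])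
        also note v(2)
        also have "ennreal (C * (LINT \<eta>|lborel. (1 + norm \<eta>) powr s * norm (fourier fe \<eta>)) * w) = ennreal (LINT \<eta>|lborel. (1 + norm \<eta>) powr s * norm (fourier fe \<eta>)) * c"
          unfolding c_def using C w by (subst ennreal_mult[symmetric]) (auto simp: mult_ac intro!: integral_nonneg_AE)
        also have "ennreal (LINT \<eta>|lborel. (1 + norm \<eta>) powr s * norm (fourier fe \<eta>)) = ?J"
          unfolding J by (rule nn_integral_eq_integral[symmetric, OF hi]) auto
        finally have "?inf / c \<le> ?J * c / c" by (rule divide_right_mono_ennreal)
        then show ?thesis using c by (simp add: ennreal_mult_divide_eq)
      qed simp
    qed
    then have "?inf / c * c \<le> barron_norm s (cbox 0 1) f * c" by (rule mult_right_mono) simp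
    moreover have "?inf / c * c = ?inf" using c by (simp add: ennreal_divide_times ennreal_divide_self less_top)
    moreover have "barron_norm s (cbox 0 1) f * c = ennreal C * barron_norm s (cbox 0 1) f * ennreal w"
      unfolding c_def using C w by (simp add: ennreal_mult mult_ac)
    ultimately show "?inf \<le> ennreal C * barron_norm s (cbox 0 1) f * ennreal (real n powr (m - (real k + 1)) * ln (real n))"
      unfolding w_def by simp
  qed
qed

end
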